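(* Let the data of the game satisfy the integrability assumptions listed in the context and let $t\in[0,T)$ be given. Suppose that: (a) for $i=1,2$ the convexity condition $$\mathbb{E}\Big\{\int_t^T\Big[\langle Q^iX_i,X_i\rangle+2\langle S^i_iX_i,u_i\rangle+\langle R^i_{ii}u_i,u_i\rangle\Big]ds+\langle G^iX_i(T),X_i(T)\rangle\Big\}\geq 0,\qquad\forall\,u_i(\cdot)\in\mathcal{U}_i[t,T],$$ holds, where $X_i(\cdot)$ solves $dX_i=(AX_i+B_iu_i)ds+(CX_i+D_iu_i)dW$ on $[t,T]$, $X_i(t)=0$; (b) the Riccati equation $$\begin{cases}\dot{\mathbf\Pi}+\mathbf\Pi A+\mathbf A^\top\mathbf\Pi+\mathbf C^\top\mathbf\Pi C+\mathbf Q\mathbf I_n\\ \ -\big(\mathbf\Pi B+\mathbf C^\top\mathbf\Pi D+\mathbf S^\top\mathbf I_m\big)\big[\mathbf J^\top(\mathbf R\mathbf I_m+\mathbf D^\top\mathbf\Pi D)\big]^{-1}\mathbf J^\top\big(\mathbf B^\top\mathbf\Pi+\mathbf D^\top\mathbf\Pi C+\mathbf S\mathbf I_n\big)=0,\quad s\in[t,T],\\ \mathbf\Pi(T)=\mathbf G\mathbf I_n\end{cases}$$ admits a solution $\mathbf\Pi(\cdot)\in C([t,T];\mathbb{R}^{2n\times n})$ (in particular the $m\times m$ matrix $\mathbf J^\top(\mathbf R\mathbf I_m+\mathbf D^\top\mathbf\Pi D)$ is invertible for a.e. $s\in[t,T]$). Let $(\boldsymbol\eta(\cdot),\boldsymbol\zeta(\cdot))$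 be the adapted solution to the $\mathbb{R}^{2n}$-valued BSDE $$\begin{cases} d\boldsymbol\eta=-\Big\{\big(\mathbf A^\top-\mathbf K\mathbf J^\top\mathbf B^\top\big)\boldsymbol\eta+\big(\mathbf C^\top-\mathbf K\mathbf J^\top\mathbf D^\top\big)\boldsymbol\zeta+\big(\mathbf C^\top-\mathbf K\mathbf J^\top\mathbf D^\top\big)\mathbf\Pi\sigma\\ \qquad\quad+\mathbf\Pi b+\mathbf q-\mathbf K\mathbf J^\top\boldsymbol\rho\Big\}ds+\boldsymbol\zeta\,dW,\quad s\in[t,T],\\ \boldsymbol\eta(T)=\mathbf g,\end{cases}$$ where $\mathbf K=\big(\mathbf\Pi B+\mathbf C^\top\mathbf\Pi D+\mathbf S^\top\mathbf I_m\big)\big[\mathbf J^\top(\mathbf R\mathbf I_m+\mathbf D^\top\mathbf\Pi D)\big]^{-1}$. Put $$\Theta=-\big[\mathbf J^\top(\mathbf R\mathbf I_m+\mathbf D^\top\mathbf\Pi D)\big]^{-1}\mathbf J^\top\big(\mathbf B^\top\mathbf\Pi+\mathbf D^\top\mathbf\Pi C+\mathbf S\mathbf I_n\big),$$ $$v=-\big[\mathbf J^\top(\mathbf R\mathbf I_m+\mathbf D^\top\mathbf\Pi D)\big]^{-1}\mathbf J^\top\big(\mathbf B^\top\boldsymbol\eta+\mathbf D^\top\boldsymbol\zeta+\mathbf D^\top\mathbf\Pi\sigma+\boldsymbol\rho\big),$$ where it is understood that $\Theta\in L^2(t,T;\mathbb{R}^{m\times n})$ and $v\in L^2_{\mathbb{F}}(t,T;\mathbb{R}^m)$.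 For an arbitrary initial state $x\in\mathbb{R}^n$ let $X(\cdot)$ be the solution to $$\begin{cases} dX=\big[(A+B\Theta)X+Bv+b\big]ds+\big[(C+D\Theta)X+Dv+\sigma\big]dW,\quad s\in[t,T],\\ X(t)=x.\end{cases}$$ Then the process $u(\cdot)=\Theta(\cdot)X(\cdot)+v(\cdot)$ is an open-loop Nash equilibrium of Problem (SDG) for $(t,x)$.
   Context: Let $T>0$ and let $(\Omega,\mathcal{F},\mathbb{F},\mathbb{P})$ be a complete filtered probability space carrying a standard one-dimensional Brownian motion $W$, with $\mathbb{F}=\{\mathcal{F}_t\}_{t\ge0}$ the natural filtration of $W$ augmented by all $\mathbb{P}$-null sets. $\mathbb{S}^k$ is the set of symmetric $k\times k$ real matrices. For a Euclidean space $\mathbb{H}$: $L^p(t,T;\mathbb{H})$ and $C([t,T];\mathbb{H})$ are the usual spaces of deterministic functions; $L^2_{\mathcal{F}_T}(\Omega;\mathbb{H})$ is the space of square-integrable $\mathcal{F}_T$-measurable random variables; $L^2_{\mathbb{F}}(t,T;\mathbb{H})$ is the space of $\mathbb{F}$-progressively measurable $\varphi$ with $\mathbb{E}\int_t^T|\varphi|^2ds<\infty$; $L^2_{\mathbb{F}}(\Omega;C([t,T];\mathbb{H}))$ is the space of continuous adapted $\varphi$ with $\mathbb{E}\sup_{[t,T]}|\varphi|^2<\infty$; $L^2_{\mathbb{F}}(\Omega;L^1(t,T;\mathbb{H}))$ is the space of progressively measurable $\varphi$ with $\mathbb{E}(\int_t^T|\varphi|ds)^2<\infty$. The adapted solution of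 a BSDE on $[t,T]$ is a pair in $L^2_{\mathbb{F}}(\Omega;C)\times L^2_{\mathbb{F}}$ satisfying it. The time variable $s$ is suppressed. Game data. $m=m_1+m_2$; $B=(B_1,B_2)$, $D=(D_1,D_2)$ with $B_i,D_i$ having $m_i$ columns; for $i=1,2$, $$S^i=\begin{pmatrix} S^i_1 \\ S^i_2 \end{pmatrix},\quad R^i=\begin{pmatrix} R^i_{11} & R^i_{12} \\ R^i_{21} & R^i_{22} \end{pmatrix},\quad \rho^i=\begin{pmatrix} \rho^i_1 \\ \rho^i_2 \end{pmatrix},\quad u=\begin{pmatrix} u_1 \\ u_2 \end{pmatrix},$$ where the row subscript $j$ denotes the block of $m_j$ rows. Integrability assumptions: $A\in L^1(0,T;\mathbb{R}^{n\times n})$, $B\in L^2(0,T;\mathbb{R}^{n\times m})$, $b\in L^2_{\mathbb{F}}(\Omega;L^1(0,T;\mathbb{R}^n))$, $C\in L^2(0,T;\mathbb{R}^{n\times n})$, $D\in L^\infty(0,T;\mathbb{R}^{n\times m})$, $\sigma\in L^2_{\mathbb{F}}(0,T;\mathbb{R}^n)$; and for $i=1,2$: $Q^i\in L^1(0,T;\mathbb{S}^n)$, $S^i\in L^2(0,T;\mathbb{R}^{m\times n})$, $R^i\in L^\infty(0,T;\mathbb{S}^m)$, $q^i\in L^2_{\mathbb{F}}(\Omega;L^1(0,T;\mathbb{R}^n))$, $\rho^i\in L^2_{\mathbb{F}}(0,T;\mathbb{R}^m)$, $g^i\in L^2_{\mathcal{F}_T}(\Omega;\mathbb{R}^n)$,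 $G^i\in\mathbb{S}^n$. Compact notation: $\mathbf A=\mathrm{diag}(A,A)$, $\mathbf B=\mathrm{diag}(B,B)$, $\mathbf C=\mathrm{diag}(C,C)$, $\mathbf D=\mathrm{diag}(D,D)$, $\mathbf Q=\mathrm{diag}(Q^1,Q^2)$, $\mathbf S=\mathrm{diag}(S^1,S^2)$, $\mathbf R=\mathrm{diag}(R^1,R^2)$, $\mathbf G=\mathrm{diag}(G^1,G^2)$ (block diagonal), $\mathbf q=\begin{pmatrix} q^1 \\ q^2 \end{pmatrix}$, $\boldsymbol\rho=\begin{pmatrix} \rho^1 \\ \rho^2 \end{pmatrix}$, $\mathbf g=\begin{pmatrix} g^1 \\ g^2 \end{pmatrix}$, $$\mathbf J=\begin{pmatrix} I_{m_1} & 0_{m_1\times m_2} \\ 0_{m_2\times m_1} & 0_{m_2\times m_2} \\ 0_{m_1\times m_1} & 0_{m_1\times m_2} \\ 0_{m_2\times m_1} & I_{m_2} \end{pmatrix}\in\mathbb{R}^{2m\times m},\qquad\mathbf I_k=\begin{pmatrix} I_k \\ I_k \end{pmatrix}\in\mathbb{R}^{2k\times k}.$$ Problem (SDG). $\mathcal{U}_i[t,T]=L^2_{\mathbb{F}}(t,T;\mathbb{R}^{m_i})$. The state solves $$dX=(AX+Bu+b)ds+(CX+Du+\sigma)dW,\quad s\in[t,T],\qquad X(t)=x,$$ and the cost of Player $i$ is $$J^i(t,x;u_1,u_2)=\mathbb{E}\Big\{\langle G^iX(T),X(T)\rangle+2\langle g^i,X(T)\rangle+\int_t^T\big[\langle Q^iX,X\rangle+2\langle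 S^iX,u\rangle+\langle R^iu,u\rangle+2\langle q^i,X\rangle+2\langle\rho^i,u\rangle\big]ds\Big\}.$$ A pair $(u_1^*,u_2^* )\in\mathcal{U}_1[t,T]\times\mathcal{U}_2[t,T]$ is an open-loop Nash equilibrium for $(t,x)$ if $J^1(t,x;u_1^*,u_2^* )\le J^1(t,x;u_1,u_2^* )$ for all $u_1\in\mathcal{U}_1[t,T]$ and $J^2(t,x;u_1^*,u_2^* )\le J^2(t,x;u_1^*,u_2)$ for all $u_2\in\mathcal{U}_2[t,T]$. *)

theory Defs
  imports "HOL-Probability.Probability"
begin

section \<open>Brownian motion and its augmented natural filtration\<close>

definition aug_filtration ::
  "'w measure \<Rightarrow> (real \<Rightarrow> 'w \<Rightarrow> real) \<Rightarrow> real \<Rightarrow> 'w measure" where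
  "aug_filtration M W t = sigma (space M)
     ({W s -` E \<inter> space M | s E. s \<in> {0..t} \<and> E \<in> sets borel} \<union> null_sets M)"

definition brownian_motion ::
  "'w measure \<Rightarrow> (real \<Rightarrow> 'w measure) \<Rightarrow> (real \<Rightarrow> 'w \<Rightarrow> real) \<Rightarrow> bool" where
  "brownian_motion M F W \<longleftrightarrow>
     (\<forall>t\<ge>0. W t \<in> borel_measurable M \<and> W t \<in> borel_measurable (F t)) \<and>
     (AE \<omega> in M. W 0 \<omega> = 0) \<and>
     (AE \<omega> in M. continuous_on {0..} (\<lambda>t. W t \<omega>)) \<and>
     (\<forall>s t. 0 \<le> s \<and> s < t \<longrightarrow>
        distributed M lborel (\<lambda>\<omega>. W t \<omega> - W s \<omega>) (\<lambda>x. ennreal (normal_density 0 (sqrt (t - s)) x)) \<and>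
        prob_space.indep_set M (sets (F s))
          {(\<lambda>\<omega>. W t \<omega> - W s \<omega>) -` E \<inter> space M | E. E \<in> sets borel})"


section \<open>Function and process spaces\<close>

text \<open>
  Elements of all these spaces are represented by functions, not by classes modulo null sets.
  Time functions are represented by Borel functions; every class modulo null sets contains one.
\<close>

definition Lp :: "nat \<Rightarrow> real \<Rightarrow> real \<Rightarrow> (real \<Rightarrow> 'h::euclidean_space) set" where
  "Lp p a b = {f. set_borel_measurable lborel {a..b} f \<and>
                  set_integrable lborel {a..b} (\<lambda>s. norm (f s) ^ p)}"

definition Linf :: "real \<Rightarrow> real \<Rightarrow> (real \<Rightarrow> 'h::euclidean_space) set" where
  "Linf a b = {f. set_borel_measurable lborel {a..b} f \<and>
                  (\<exists>c. AE s in lborel. s \<in> {a..b} \<longrightarrow> norm (f s) \<le> c)}"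

definition prog_measurable ::
  "(real \<Rightarrow> 'w measure) \<Rightarrow> real \<Rightarrow> real \<Rightarrow> (real \<Rightarrow> 'w \<Rightarrow> 'h::euclidean_space) \<Rightarrow> bool" where
  "prog_measurable F a b \<phi> \<longleftrightarrow>
     (\<forall>s\<in>{a..b}. (\<lambda>(r, \<omega>). \<phi> r \<omega>) \<in> borel_measurable (restrict_space borel {a..s} \<Otimes>\<^sub>M F s))"

definition L2F ::
  "'w measure \<Rightarrow> (real \<Rightarrow> 'w measure) \<Rightarrow> real \<Rightarrow> real \<Rightarrow> (real \<Rightarrow> 'w \<Rightarrow> 'h::euclidean_space) set" where
  "L2F M F a b = {\<phi>. prog_measurable F a b \<phi> \<and>
     (\<integral>\<^sup>+\<omega>. (\<integral>\<^sup>+s\<in>{a..b}. ennreal ((norm (\<phi> s \<omega>))\<^sup>2) \<partial>lborel) \<partial>M) < \<infinity>}"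

definition L2F_C ::
  "'w measure \<Rightarrow> (real \<Rightarrow> 'w measure) \<Rightarrow> real \<Rightarrow> real \<Rightarrow> (real \<Rightarrow> 'w \<Rightarrow> 'h::euclidean_space) set" where
  "L2F_C M F a b = {\<phi>. (\<forall>s\<in>{a..b}. \<phi> s \<in> borel_measurable (F s)) \<and>
     (\<forall>\<omega>\<in>space M. continuous_on {a..b} (\<lambda>s. \<phi> s \<omega>)) \<and>
     (\<integral>\<^sup>+\<omega>. (SUP s\<in>{a..b}. ennreal ((norm (\<phi> s \<omega>))\<^sup>2)) \<partial>M) < \<infinity>}"

definition L2F_L1 ::
  "'w measure \<Rightarrow> (real \<Rightarrow> 'w measure) \<Rightarrow> real \<Rightarrow> real \<Rightarrow> (real \<Rightarrow> 'w \<Rightarrow> 'h::euclidean_space) set" where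
  "L2F_L1 M F a b = {\<phi>. prog_measurable F a b \<phi> \<and>
     (\<integral>\<^sup>+\<omega>. (\<integral>\<^sup>+s\<in>{a..b}. ennreal (norm (\<phi> s \<omega>)) \<partial>lborel)\<^sup>2 \<partial>M) < \<infinity>}"

definition L2_FT :: "'w measure \<Rightarrow> 'w measure \<Rightarrow> ('w \<Rightarrow> 'h::euclidean_space) set" where
  "L2_FT M FT = {\<xi>. \<xi> \<in> borel_measurable FT \<and> integrable M (\<lambda>\<omega>. (norm (\<xi> \<omega>))\<^sup>2)}"


section \<open>Ito integral and stochastic differentials\<close>

text \<open>
  A simple integrand on \<open>[a,b]\<close> is given by a grid \<open>p 0 \<le> \<dots> \<le> p k\<close> in \<open>[a,b]\<close> and bounded
  \<open>F (p i)\<close>-measurable values \<open>\<xi> i\<close> on \<open>(p i, p (i + 1)]\<close>.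
\<close>

definition simple_data ::
  "'w measure \<Rightarrow> (real \<Rightarrow> 'w measure) \<Rightarrow> real \<Rightarrow> real \<Rightarrow>
   nat \<Rightarrow> (nat \<Rightarrow> real) \<Rightarrow> (nat \<Rightarrow> 'w \<Rightarrow> 'h::euclidean_space) \<Rightarrow> bool" where
  "simple_data M F a b k p \<xi> \<longleftrightarrow>
     a \<le> p 0 \<and> p k \<le> b \<and> (\<forall>i<k. p i \<le> p (Suc i)) \<and>
     (\<forall>i<k. \<xi> i \<in> borel_measurable (F (p i)) \<and> bounded (\<xi> i ` space M))"

definition simple_process ::
  "nat \<Rightarrow> (nat \<Rightarrow> real) \<Rightarrow> (nat \<Rightarrow> 'w \<Rightarrow> 'h::euclidean_space) \<Rightarrow> real \<Rightarrow> 'w \<Rightarrow> 'h" where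
  "simple_process k p \<xi> s \<omega> = (\<Sum>i<k. indicator {p i<..p (Suc i)} s *\<^sub>R \<xi> i \<omega>)"

definition simple_integral ::
  "(real \<Rightarrow> 'w \<Rightarrow> real) \<Rightarrow> nat \<Rightarrow> (nat \<Rightarrow> real) \<Rightarrow> (nat \<Rightarrow> 'w \<Rightarrow> 'h::euclidean_space) \<Rightarrow>
   real \<Rightarrow> 'w \<Rightarrow> 'h" where
  "simple_integral W k p \<xi> s \<omega> =
     (\<Sum>i<k. (W (min s (p (Suc i))) \<omega> - W (min s (p i)) \<omega>) *\<^sub>R \<xi> i \<omega>)"

text \<open>
  \<open>I\<close> is a continuous adapted version of the process \<open>s \<mapsto> \<integral>\<^bsub>a\<^esub>\<^bsup>s\<^esup> \<phi> dW\<close> on \<open>[a,b]\<close>, the integral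
  being the mean-square limit of the integrals of simple processes that approximate \<open>\<phi>\<close>.
  It is determined by \<open>\<phi>\<close> up to indistinguishability.
\<close>

definition is_ito_integral ::
  "'w measure \<Rightarrow> (real \<Rightarrow> 'w measure) \<Rightarrow> (real \<Rightarrow> 'w \<Rightarrow> real) \<Rightarrow> real \<Rightarrow> real \<Rightarrow>
   (real \<Rightarrow> 'w \<Rightarrow> 'h::euclidean_space) \<Rightarrow> (real \<Rightarrow> 'w \<Rightarrow> 'h) \<Rightarrow> bool" where
  "is_ito_integral M F W a b \<phi> I \<longleftrightarrow>
     \<phi> \<in> L2F M F a b \<and>
     (\<forall>s\<in>{a..b}. I s \<in> borel_measurable (F s)) \<and>
     (\<forall>\<omega>\<in>space M. continuous_on {a..b} (\<lambda>s. I s \<omega>)) \<and>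
     (\<exists>k p \<xi>. (\<forall>n. simple_data M F a b (k n) (p n) (\<xi> n)) \<and>
        (\<lambda>n. \<integral>\<^sup>+\<omega>. (\<integral>\<^sup>+s\<in>{a..b}.
            ennreal ((norm (simple_process (k n) (p n) (\<xi> n) s \<omega> - \<phi> s \<omega>))\<^sup>2) \<partial>lborel) \<partial>M)
          \<longlonglongrightarrow> 0 \<and>
        (\<forall>s\<in>{a..b}. (\<lambda>n. \<integral>\<^sup>+\<omega>.
            ennreal ((norm (simple_integral W (k n) (p n) (\<xi> n) s \<omega> - I s \<omega>))\<^sup>2) \<partial>M)
          \<longlonglongrightarrow> 0))"

text \<open>\<open>dX = \<alpha> ds + \<beta> dW\<close> on \<open>[a,b]\<close>.\<close>

definition has_ito_differential ::
  "'w measure \<Rightarrow> (real \<Rightarrow> 'w measure) \<Rightarrow> (real \<Rightarrow> 'w \<Rightarrow> real) \<Rightarrow> real \<Rightarrow> real \<Rightarrow>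
   (real \<Rightarrow> 'w \<Rightarrow> 'h::euclidean_space) \<Rightarrow> (real \<Rightarrow> 'w \<Rightarrow> 'h) \<Rightarrow> (real \<Rightarrow> 'w \<Rightarrow> 'h) \<Rightarrow> bool" where
  "has_ito_differential M F W a b X \<alpha> \<beta> \<longleftrightarrow>
     (AE \<omega> in M. set_integrable lborel {a..b} (\<lambda>s. \<alpha> s \<omega>)) \<and>
     (\<exists>I. is_ito_integral M F W a b \<beta> I \<and>
        (AE \<omega> in M. \<forall>s\<in>{a..b}. X s \<omega> = X a \<omega> + (LINT r:{a..s}|lborel. \<alpha> r \<omega>) + I s \<omega>))"


section \<open>Block matrices\<close>

text \<open>
  A matrix with \<open>p + q\<close> rows has row index type \<open>'p + 'q\<close>, \<open>Inl\<close> indexing the upper rows; likewise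
  for columns.  Since a matrix is a vector of rows, \<open>vstack\<close>, \<open>upper\<close> and \<open>lower\<close> serve both for
  vectors and for the row blocks of matrices.
\<close>

definition vstack :: "'e^'p::finite \<Rightarrow> 'e^'q::finite \<Rightarrow> 'e^('p + 'q)" where
  "vstack x y = (\<chi> i. case i of Inl j \<Rightarrow> x $ j | Inr j \<Rightarrow> y $ j)"

definition upper :: "'e^('p::finite + 'q::finite) \<Rightarrow> 'e^'p" where
  "upper x = (\<chi> i. x $ Inl i)"

definition lower :: "'e^('p::finite + 'q::finite) \<Rightarrow> 'e^'q" where
  "lower x = (\<chi> i. x $ Inr i)"

definition left_cols :: "'e^('p::finite + 'q::finite)^'r::finite \<Rightarrow> 'e^'p^'r" where
  "left_cols N = (\<chi> i. upper (N $ i))"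

definition right_cols :: "'e^('p::finite + 'q::finite)^'r::finite \<Rightarrow> 'e^'q^'r" where
  "right_cols N = (\<chi> i. lower (N $ i))"

definition block_diag ::
  "real^'p::finite^'r::finite \<Rightarrow> real^'q::finite^'s::finite \<Rightarrow> real^('p + 'q)^('r + 's)" where
  "block_diag N P = vstack (\<chi> i. vstack (N $ i) 0) (\<chi> i. vstack 0 (P $ i))"

definition II :: "real^'k::finite^('k + 'k)" where
  "II = vstack (mat 1) (mat 1)"

definition JJ :: "real^('m1::finite + 'm2::finite)^(('m1 + 'm2) + ('m1 + 'm2))" where
  "JJ = vstack (block_diag (mat 1) 0) (block_diag 0 (mat 1))"


section \<open>The game\<close>

datatype player = P1 | P2

record ('w, 'n::finite, 'm1::finite, 'm2::finite) game =
  Ac :: "real \<Rightarrow> real^'n^'n"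
  Bc :: "real \<Rightarrow> real^('m1 + 'm2)^'n"
  bc :: "real \<Rightarrow> 'w \<Rightarrow> real^'n"
  Cc :: "real \<Rightarrow> real^'n^'n"
  Dc :: "real \<Rightarrow> real^('m1 + 'm2)^'n"
  sigc :: "real \<Rightarrow> 'w \<Rightarrow> real^'n"
  Qc :: "player \<Rightarrow> real \<Rightarrow> real^'n^'n"
  Sc :: "player \<Rightarrow> real \<Rightarrow> real^'n^('m1 + 'm2)"
  Rc :: "player \<Rightarrow> real \<Rightarrow> real^('m1 + 'm2)^('m1 + 'm2)"
  qc :: "player \<Rightarrow> real \<Rightarrow> 'w \<Rightarrow> real^'n"
  rhoc :: "player \<Rightarrow> real \<Rightarrow> 'w \<Rightarrow> real^('m1 + 'm2)"
  gc :: "player \<Rightarrow> 'w \<Rightarrow> real^'n"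
  Gc :: "player \<Rightarrow> real^'n^'n"

definition game_integrability ::
  "'w measure \<Rightarrow> (real \<Rightarrow> 'w measure) \<Rightarrow> real \<Rightarrow>
   ('w, 'n::finite, 'm1::finite, 'm2::finite) game \<Rightarrow> bool" where
  "game_integrability M F T \<G> \<longleftrightarrow>
     Ac \<G> \<in> Lp 1 0 T \<and> Bc \<G> \<in> Lp 2 0 T \<and> bc \<G> \<in> L2F_L1 M F 0 T \<and>
     Cc \<G> \<in> Lp 2 0 T \<and> Dc \<G> \<in> Linf 0 T \<and> sigc \<G> \<in> L2F M F 0 T \<and>
     (\<forall>i. Qc \<G> i \<in> Lp 1 0 T \<and> (AE s in lborel. s \<in> {0..T} \<longrightarrow> transpose (Qc \<G> i s) = Qc \<G> i s) \<and>
          Sc \<G> i \<in> Lp 2 0 T \<and>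
          Rc \<G> i \<in> Linf 0 T \<and> (AE s in lborel. s \<in> {0..T} \<longrightarrow> transpose (Rc \<G> i s) = Rc \<G> i s) \<and>
          qc \<G> i \<in> L2F_L1 M F 0 T \<and> rhoc \<G> i \<in> L2F M F 0 T \<and>
          gc \<G> i \<in> L2_FT M (F T) \<and> transpose (Gc \<G> i) = Gc \<G> i)"

definition is_state ::
  "'w measure \<Rightarrow> (real \<Rightarrow> 'w measure) \<Rightarrow> (real \<Rightarrow> 'w \<Rightarrow> real) \<Rightarrow> real \<Rightarrow>
   ('w, 'n::finite, 'm1::finite, 'm2::finite) game \<Rightarrow> real \<Rightarrow> real^'n \<Rightarrow>
   (real \<Rightarrow> 'w \<Rightarrow> real^('m1 + 'm2)) \<Rightarrow> (real \<Rightarrow> 'w \<Rightarrow> real^'n) \<Rightarrow> bool" where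
  "is_state M F W T \<G> t x u X \<longleftrightarrow>
     X \<in> L2F_C M F t T \<and> (AE \<omega> in M. X t \<omega> = x) \<and>
     has_ito_differential M F W t T X
       (\<lambda>s \<omega>. Ac \<G> s *v X s \<omega> + Bc \<G> s *v u s \<omega> + bc \<G> s \<omega>)
       (\<lambda>s \<omega>. Cc \<G> s *v X s \<omega> + Dc \<G> s *v u s \<omega> + sigc \<G> s \<omega>)"

text \<open>The cost of player \<open>i\<close>, evaluated along the state process \<open>X\<close> belonging to the control \<open>u\<close>.\<close>

definition cost ::
  "'w measure \<Rightarrow> real \<Rightarrow> ('w, 'n::finite, 'm1::finite, 'm2::finite) game \<Rightarrow> player \<Rightarrow> real \<Rightarrow>
   (real \<Rightarrow> 'w \<Rightarrow> real^('m1 + 'm2)) \<Rightarrow> (real \<Rightarrow> 'w \<Rightarrow> real^'n) \<Rightarrow> real" where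
  "cost M T \<G> i t u X =
     (LINT \<omega>|M. (Gc \<G> i *v X T \<omega>) \<bullet> X T \<omega> + 2 * (gc \<G> i \<omega> \<bullet> X T \<omega>)
       + (LINT s:{t..T}|lborel.
            (Qc \<G> i s *v X s \<omega>) \<bullet> X s \<omega> + 2 * ((Sc \<G> i s *v X s \<omega>) \<bullet> u s \<omega>)
          + (Rc \<G> i s *v u s \<omega>) \<bullet> u s \<omega>
          + 2 * (qc \<G> i s \<omega> \<bullet> X s \<omega>) + 2 * (rhoc \<G> i s \<omega> \<bullet> u s \<omega>)))"

definition joint ::
  "(real \<Rightarrow> 'w \<Rightarrow> real^'m1::finite) \<Rightarrow> (real \<Rightarrow> 'w \<Rightarrow> real^'m2::finite) \<Rightarrow>
   real \<Rightarrow> 'w \<Rightarrow> real^('m1 + 'm2)" where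
  "joint u1 u2 = (\<lambda>s \<omega>. vstack (u1 s \<omega>) (u2 s \<omega>))"

text \<open>
  The state process of an admissible control pair exists and is unique up to indistinguishability, so
  \<open>J\<^sup>i(t,x;u\<^sub>1,u\<^sub>2)\<close> is the common value of \<open>cost\<close> along all its versions \<open>X\<close>.
\<close>

definition open_loop_nash ::
  "'w measure \<Rightarrow> (real \<Rightarrow> 'w measure) \<Rightarrow> (real \<Rightarrow> 'w \<Rightarrow> real) \<Rightarrow> real \<Rightarrow>
   ('w, 'n::finite, 'm1::finite, 'm2::finite) game \<Rightarrow> real \<Rightarrow> real^'n \<Rightarrow>
   (real \<Rightarrow> 'w \<Rightarrow> real^'m1) \<Rightarrow> (real \<Rightarrow> 'w \<Rightarrow> real^'m2) \<Rightarrow> bool" where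
  "open_loop_nash M F W T \<G> t x u1 u2 \<longleftrightarrow>
     u1 \<in> L2F M F t T \<and> u2 \<in> L2F M F t T \<and>
     (\<exists>X. is_state M F W T \<G> t x (joint u1 u2) X) \<and>
     (\<forall>X. is_state M F W T \<G> t x (joint u1 u2) X \<longrightarrow>
        (\<forall>v1\<in>L2F M F t T. \<forall>Y. is_state M F W T \<G> t x (joint v1 u2) Y \<longrightarrow>
           cost M T \<G> P1 t (joint u1 u2) X \<le> cost M T \<G> P1 t (joint v1 u2) Y) \<and>
        (\<forall>v2\<in>L2F M F t T. \<forall>Y. is_state M F W T \<G> t x (joint u1 v2) Y \<longrightarrow>
           cost M T \<G> P2 t (joint u1 u2) X \<le> cost M T \<G> P2 t (joint u1 v2) Y))"

text \<open>
  The convexity condition, for either player: \<open>B\<close>, \<open>D\<close> are the player's control columns, and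
  \<open>Q\<close>, \<open>S\<close>, \<open>R\<close>, \<open>G\<close> the player's own weights, with \<open>S\<close>, \<open>R\<close> restricted to the own control block.
\<close>

definition convexity_condition ::
  "'w measure \<Rightarrow> (real \<Rightarrow> 'w measure) \<Rightarrow> (real \<Rightarrow> 'w \<Rightarrow> real) \<Rightarrow> real \<Rightarrow> real \<Rightarrow>
   (real \<Rightarrow> real^'n::finite^'n) \<Rightarrow> (real \<Rightarrow> real^'k::finite^'n) \<Rightarrow>
   (real \<Rightarrow> real^'n^'n) \<Rightarrow> (real \<Rightarrow> real^'k^'n) \<Rightarrow>
   (real \<Rightarrow> real^'n^'n) \<Rightarrow> (real \<Rightarrow> real^'n^'k) \<Rightarrow> (real \<Rightarrow> real^'k^'k) \<Rightarrow> real^'n^'n \<Rightarrow> bool" where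
  "convexity_condition M F W t T A B C D Q S R G \<longleftrightarrow>
     (\<forall>u\<in>L2F M F t T. \<forall>X\<in>L2F_C M F t T.
        (AE \<omega> in M. X t \<omega> = 0) \<and>
        has_ito_differential M F W t T X
          (\<lambda>s \<omega>. A s *v X s \<omega> + B s *v u s \<omega>) (\<lambda>s \<omega>. C s *v X s \<omega> + D s *v u s \<omega>) \<longrightarrow>
        0 \<le> (LINT \<omega>|M.
               (LINT s:{t..T}|lborel.
                  (Q s *v X s \<omega>) \<bullet> X s \<omega> + 2 * ((S s *v X s \<omega>) \<bullet> u s \<omega>) + (R s *v u s \<omega>) \<bullet> u s \<omega>)
               + (G *v X T \<omega>) \<bullet> X T \<omega>))"


section \<open>The compact notation and the Riccati equation\<close>

definition AA where "AA \<G> s = block_diag (Ac \<G> s) (Ac \<G> s)"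
definition BB where "BB \<G> s = block_diag (Bc \<G> s) (Bc \<G> s)"
definition CC where "CC \<G> s = block_diag (Cc \<G> s) (Cc \<G> s)"
definition DD where "DD \<G> s = block_diag (Dc \<G> s) (Dc \<G> s)"
definition QQ where "QQ \<G> s = block_diag (Qc \<G> P1 s) (Qc \<G> P2 s)"
definition SS where "SS \<G> s = block_diag (Sc \<G> P1 s) (Sc \<G> P2 s)"
definition RR where "RR \<G> s = block_diag (Rc \<G> P1 s) (Rc \<G> P2 s)"
definition GG where "GG \<G> = block_diag (Gc \<G> P1) (Gc \<G> P2)"
definition qq where "qq \<G> s \<omega> = vstack (qc \<G> P1 s \<omega>) (qc \<G> P2 s \<omega>)"
definition rr where "rr \<G> s \<omega> = vstack (rhoc \<G> P1 s \<omega>) (rhoc \<G> P2 s \<omega>)"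
definition gg where "gg \<G> \<omega> = vstack (gc \<G> P1 \<omega>) (gc \<G> P2 \<omega>)"

definition weight ::
  "('w, 'n::finite, 'm1::finite, 'm2::finite) game \<Rightarrow> (real \<Rightarrow> real^'n^('n + 'n)) \<Rightarrow>
   real \<Rightarrow> real^('m1 + 'm2)^('m1 + 'm2)" where
  "weight \<G> P s = transpose JJ ** (RR \<G> s ** II + transpose (DD \<G> s) ** P s ** Dc \<G> s)"

definition left_factor ::
  "('w, 'n::finite, 'm1::finite, 'm2::finite) game \<Rightarrow> (real \<Rightarrow> real^'n^('n + 'n)) \<Rightarrow>
   real \<Rightarrow> real^('m1 + 'm2)^('n + 'n)" where
  "left_factor \<G> P s =
     P s ** Bc \<G> s + transpose (CC \<G> s) ** P s ** Dc \<G> s + transpose (SS \<G> s) ** II"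

definition right_factor ::
  "('w, 'n::finite, 'm1::finite, 'm2::finite) game \<Rightarrow> (real \<Rightarrow> real^'n^('n + 'n)) \<Rightarrow>
   real \<Rightarrow> real^'n^('m1 + 'm2)" where
  "right_factor \<G> P s = transpose JJ **
     (transpose (BB \<G> s) ** P s + transpose (DD \<G> s) ** P s ** Cc \<G> s + SS \<G> s ** II)"

definition KK ::
  "('w, 'n::finite, 'm1::finite, 'm2::finite) game \<Rightarrow> (real \<Rightarrow> real^'n^('n + 'n)) \<Rightarrow>
   real \<Rightarrow> real^('m1 + 'm2)^('n + 'n)" where
  "KK \<G> P s = left_factor \<G> P s ** matrix_inv (weight \<G> P s)"

text \<open>The Riccati equation reads \<open>dP/ds + riccati_rhs \<G> P = 0\<close>, \<open>P(T) = GG \<G> ** II\<close>.\<close>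

definition riccati_rhs ::
  "('w, 'n::finite, 'm1::finite, 'm2::finite) game \<Rightarrow> (real \<Rightarrow> real^'n^('n + 'n)) \<Rightarrow>
   real \<Rightarrow> real^'n^('n + 'n)" where
  "riccati_rhs \<G> P s =
     P s ** Ac \<G> s + transpose (AA \<G> s) ** P s + transpose (CC \<G> s) ** P s ** Cc \<G> s + QQ \<G> s ** II
     - left_factor \<G> P s ** matrix_inv (weight \<G> P s) ** right_factor \<G> P s"

text \<open>
  The coefficients are merely integrable in time, so solutions are meant in the Caratheodory sense,
  i.e. for the integrated equation.
\<close>

definition riccati_solution ::
  "('w, 'n::finite, 'm1::finite, 'm2::finite) game \<Rightarrow> real \<Rightarrow> real \<Rightarrow>
   (real \<Rightarrow> real^'n^('n + 'n)) \<Rightarrow> bool" where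
  "riccati_solution \<G> t T P \<longleftrightarrow>
     continuous_on {t..T} P \<and>
     (AE s in lborel. s \<in> {t..T} \<longrightarrow> invertible (weight \<G> P s)) \<and>
     set_integrable lborel {t..T} (riccati_rhs \<G> P) \<and>
     (\<forall>s\<in>{t..T}. P s = GG \<G> ** II + (LINT r:{s..T}|lborel. riccati_rhs \<G> P r))"

definition Theta ::
  "('w, 'n::finite, 'm1::finite, 'm2::finite) game \<Rightarrow> (real \<Rightarrow> real^'n^('n + 'n)) \<Rightarrow>
   real \<Rightarrow> real^'n^('m1 + 'm2)" where
  "Theta \<G> P s = - (matrix_inv (weight \<G> P s) ** right_factor \<G> P s)"

definition vff ::
  "('w, 'n::finite, 'm1::finite, 'm2::finite) game \<Rightarrow> (real \<Rightarrow> real^'n^('n + 'n)) \<Rightarrow>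
   (real \<Rightarrow> 'w \<Rightarrow> real^('n + 'n)) \<Rightarrow> (real \<Rightarrow> 'w \<Rightarrow> real^('n + 'n)) \<Rightarrow>
   real \<Rightarrow> 'w \<Rightarrow> real^('m1 + 'm2)" where
  "vff \<G> P \<eta> \<zeta> s \<omega> = - (matrix_inv (weight \<G> P s) *v (transpose JJ *v
     (transpose (BB \<G> s) *v \<eta> s \<omega> + transpose (DD \<G> s) *v \<zeta> s \<omega>
      + transpose (DD \<G> s) *v (P s *v sigc \<G> s \<omega>) + rr \<G> s \<omega>)))"

text \<open>The BSDE reads \<open>d\<eta> = - bsde_driver \<G> P \<eta> \<zeta> ds + \<zeta> dW\<close>.\<close>

definition bsde_driver ::
  "('w, 'n::finite, 'm1::finite, 'm2::finite) game \<Rightarrow> (real \<Rightarrow> real^'n^('n + 'n)) \<Rightarrow>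
   (real \<Rightarrow> 'w \<Rightarrow> real^('n + 'n)) \<Rightarrow> (real \<Rightarrow> 'w \<Rightarrow> real^('n + 'n)) \<Rightarrow>
   real \<Rightarrow> 'w \<Rightarrow> real^('n + 'n)" where
  "bsde_driver \<G> P \<eta> \<zeta> s \<omega> =
     (let KJ = KK \<G> P s ** transpose JJ;
          AB = transpose (AA \<G> s) - KJ ** transpose (BB \<G> s);
          CD = transpose (CC \<G> s) - KJ ** transpose (DD \<G> s)
      in AB *v \<eta> s \<omega> + CD *v \<zeta> s \<omega> + CD *v (P s *v sigc \<G> s \<omega>)
         + P s *v bc \<G> s \<omega> + qq \<G> s \<omega> - KJ *v rr \<G> s \<omega>)"

definition bsde_solution ::
  "'w measure \<Rightarrow> (real \<Rightarrow> 'w measure) \<Rightarrow> (real \<Rightarrow> 'w \<Rightarrow> real) \<Rightarrow> real \<Rightarrow> real \<Rightarrow>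
   ('w, 'n::finite, 'm1::finite, 'm2::finite) game \<Rightarrow> (real \<Rightarrow> real^'n^('n + 'n)) \<Rightarrow>
   (real \<Rightarrow> 'w \<Rightarrow> real^('n + 'n)) \<Rightarrow> (real \<Rightarrow> 'w \<Rightarrow> real^('n + 'n)) \<Rightarrow> bool" where
  "bsde_solution M F W t T \<G> P \<eta> \<zeta> \<longleftrightarrow>
     \<eta> \<in> L2F_C M F t T \<and> \<zeta> \<in> L2F M F t T \<and>
     (AE \<omega> in M. \<eta> T \<omega> = gg \<G> \<omega>) \<and>
     has_ito_differential M F W t T \<eta> (\<lambda>s \<omega>. - bsde_driver \<G> P \<eta> \<zeta> s \<omega>) \<zeta>"

end

theory Submission
  imports Defs
begin

text \<open>Fix the control of one player and let the other deviate.  The game being linear-quadratic, the cost of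
the deviating player along \<open>u + w\<close> is the cost along \<open>u\<close>, plus a quadratic form in the variation \<open>(N, w)\<close>
of state and control, plus twice a linear form in \<open>(N, w)\<close>.  The quadratic form is the one that the
convexity condition declares nonnegative, because \<open>N\<close> starts at zero and solves
\<open>dN = (A N + B w) ds + (C N + D w) dW\<close>; so everything depends on the linear form being zero.

To evaluate the linear form, one passes to the adjoint process \<open>Y = \<Pi> X + \<eta>\<close>, where \<open>\<Pi>\<close> is the Riccati
solution (\<open>P\<close> in the formal text), with diffusion coefficient
\<open>Z = \<Pi> (C X + D u + \<sigma>) + \<zeta>\<close>.  The Riccati equation and the backward equation are made so that
\<open>dY = - (A\<^sup>T Y + C\<^sup>T Z + Q X + S\<^sup>T u + q) ds + Z dW\<close>, \<open>Y(T) = G X(T) + g\<close>, blockwise for each player.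
The expected product rule for \<open>\<langle>Y, N\<rangle>\<close> then turns the linear form into the integral of \<open>\<langle>H, w\<rangle>\<close> with
\<open>H = B\<^sup>T Y + D\<^sup>T Z + S X + R u + \<rho>\<close> (\<open>adjoint_identity\<close>, \<open>player_optimality\<close>).  The feedback \<open>u = \<Theta> X + v\<close> solves
exactly \<open>J\<^sup>T H = 0\<close> for the stacked \<open>H\<close> of both players (\<open>stationarity\<close>): the residual of each player vanishes
in the components that this player controls, and these are the only nonzero components of \<open>w\<close>.

The analytic core is the product rule for Ito processes in expectation (\<open>product_expectation\<close>).  Write
\<open>x = V + I\<close> and \<open>y = U + K\<close> with absolutely continuous \<open>V\<close>, \<open>U\<close> and Ito integrals \<open>I\<close>, \<open>K\<close>.  The product \<open>V U\<close>
is treated path by path with Fubini's theorem, \<open>I K\<close> by the Ito isometry, and the mixed products by the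
martingale property, by which \<open>K(s)\<close> may be replaced by \<open>K(r)\<close> against the drift at time \<open>r\<close>.  Since \<open>\<Pi>\<close> is
deterministic and absolutely continuous, the three-fold product \<open>\<langle>\<Pi> X, N\<rangle>\<close> reduces to this rule and to
integration by parts for the function \<open>s \<mapsto> E[x(s) y(s)]\<close>.

An equilibrium is judged on all versions of the state process.  Two versions differ by a solution of the
homogeneous equation with zero initial value, whose second moment satisfies a Gronwall inequality with
integrable kernel; hence it vanishes and all versions have the same cost (\<open>linear_sde_unique\<close>).\<close>

section \<open>Absolutely continuous functions of time\<close>

text \<open>The coefficients of the game are only integrable in time, so derivatives are replaced by densities:
  \<open>f\<close> is absolutely continuous on \<open>[a,b]\<close> with density \<open>f'\<close>.\<close>

definition primitive_on :: "real \<Rightarrow> real \<Rightarrow> (real \<Rightarrow> real) \<Rightarrow> (real \<Rightarrow> real) \<Rightarrow> bool" where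
  "primitive_on a b f f' \<longleftrightarrow> set_integrable lborel {a..b} f' \<and>
     (\<forall>s\<in>{a..b}. f s = f a + (LINT r:{a..s}|lborel. f' r))"

lemma integrable_pair_mult:
  fixes f :: "'a \<Rightarrow> real" and g :: "'b \<Rightarrow> real"
  assumes "sigma_finite_measure M" "sigma_finite_measure N"
    and f: "integrable M f" and g: "integrable N g"
  shows "integrable (M \<Otimes>\<^sub>M N) (\<lambda>(x, y). f x * g y)"
proof -
  interpret pair_sigma_finite M N using assms by (simp add: pair_sigma_finite_def)
  have [measurable]: "f \<in> borel_measurable M" "g \<in> borel_measurable N" using f g by auto
  show ?thesis
  proof (rule Fubini_integrable)
    show "integrable M (\<lambda>x. \<integral>y. norm (case (x, y) of (x, y) \<Rightarrow> f x * g y) \<partial>N)"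
      using f by (simp add: abs_mult)
    show "AE x in M. integrable N (\<lambda>y. case (x, y) of (x, y) \<Rightarrow> f x * g y)"
      using g by simp
  qed measurable
qed

text \<open>The two iterated integrals are the integrals of \<open>F s * G r\<close> over the two triangles into which the
  diagonal, a null set, cuts the square.\<close>

lemma integral_triangles:
  fixes F G :: "real \<Rightarrow> real"
  assumes F: "integrable lborel F" and G: "integrable lborel G"
  shows "integrable lborel (\<lambda>s. F s * (\<integral>r. indicator {..s} r * G r \<partial>lborel))"
    and "(\<integral>s. F s * (\<integral>r. indicator {..s} r * G r \<partial>lborel) \<partial>lborel) +
         (\<integral>s. G s * (\<integral>r. indicator {..s} r * F r \<partial>lborel) \<partial>lborel) =
         (\<integral>s. F s \<partial>lborel) * (\<integral>s. G s \<partial>lborel)"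
proof -
  have [measurable]: "F \<in> borel_measurable borel" "G \<in> borel_measurable borel" using F G by auto
  have FG: "integrable (lborel \<Otimes>\<^sub>M lborel) (\<lambda>(s, r). F s * G r)"
    by (rule integrable_pair_mult[OF sigma_finite_lborel sigma_finite_lborel F G])
  have i1: "integrable (lborel \<Otimes>\<^sub>M lborel) (\<lambda>(s, r). F s * (indicator {..s} r * G r))"
    by (rule Bochner_Integration.integrable_bound[OF FG])
       (auto simp: indicator_def split: if_splits)
  have i2: "integrable (lborel \<Otimes>\<^sub>M lborel) (\<lambda>(s, r). F s * (indicator {s..} r * G r))"
    by (rule Bochner_Integration.integrable_bound[OF FG])
       (auto simp: indicator_def split: if_splits)
  show "integrable lborel (\<lambda>s. F s * (\<integral>r. indicator {..s} r * G r \<partial>lborel))"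
    using lborel_pair.integrable_fst[OF i1] by simp
  have j2: "integrable lborel (\<lambda>s. F s * (\<integral>r. indicator {s..} r * G r \<partial>lborel))"
    using lborel_pair.integrable_fst[OF i2] by simp
  have "(\<integral>s. G s * (\<integral>r. indicator {..s} r * F r \<partial>lborel) \<partial>lborel)
      = (\<integral>s. (\<integral>r. F r * (indicator {r..} s * G s) \<partial>lborel) \<partial>lborel)"
    by (auto simp: indicator_def mult.commute mult.left_commute intro!: Bochner_Integration.integral_cong
        simp flip: Bochner_Integration.integral_mult_right_zero)
  also have "\<dots> = (\<integral>r. (\<integral>s. F r * (indicator {r..} s * G s) \<partial>lborel) \<partial>lborel)"
    by (rule lborel_pair.Fubini_integral[OF i2])
  finally have "(\<integral>s. F s * (\<integral>r. indicator {..s} r * G r \<partial>lborel) \<partial>lborel) +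
         (\<integral>s. G s * (\<integral>r. indicator {..s} r * F r \<partial>lborel) \<partial>lborel) =
      (\<integral>s. F s * (\<integral>r. indicator {..s} r * G r \<partial>lborel) + F s * (\<integral>r. indicator {s..} r * G r \<partial>lborel) \<partial>lborel)"
    using lborel_pair.integrable_fst[OF i1] j2
    by (subst Bochner_Integration.integral_add) simp_all
  also have "\<dots> = (\<integral>s. F s * (\<integral>r. G r \<partial>lborel) \<partial>lborel)"
  proof (rule Bochner_Integration.integral_cong[OF refl])
    fix s
    have "(\<integral>r. indicator {..s} r * G r \<partial>lborel) + (\<integral>r. indicator {s..} r * G r \<partial>lborel)
       = (\<integral>r. indicator {..s} r * G r + indicator {s..} r * G r \<partial>lborel)"
      by (subst Bochner_Integration.integral_add)
         (use integrable_mult_indicator[OF _ G] in auto)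
    also have "\<dots> = (\<integral>r. G r \<partial>lborel)"
    proof (rule integral_cong_AE)
      have "AE r in lborel. r \<noteq> s" by (rule AE_lborel_singleton)
      then show "AE r in lborel. indicator {..s} r * G r + indicator {s..} r * G r = G r"
        by eventually_elim (auto simp: indicator_def)
    qed measurable
    finally show "F s * (\<integral>r. indicator {..s} r * G r \<partial>lborel) + F s * (\<integral>r. indicator {s..} r * G r \<partial>lborel)
        = F s * (\<integral>r. G r \<partial>lborel)"
      by (simp flip: distrib_left)
  qed
  finally show "(\<integral>s. F s * (\<integral>r. indicator {..s} r * G r \<partial>lborel) \<partial>lborel) +
         (\<integral>s. G s * (\<integral>r. indicator {..s} r * F r \<partial>lborel) \<partial>lborel) =
         (\<integral>s. F s \<partial>lborel) * (\<integral>s. G s \<partial>lborel)" by simp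
qed

lemma primitive_onD:
  assumes "primitive_on a b f f'"
  shows "set_integrable lborel {a..b} f'"
    and "s \<in> {a..b} \<Longrightarrow> f s = f a + (LINT r:{a..s}|lborel. f' r)"
  using assms unfolding primitive_on_def by blast+

lemma primitive_on_subinterval:
  assumes "primitive_on a b f f'" "c \<le> b"
  shows "primitive_on a c f f'"
  unfolding primitive_on_def
proof (intro conjI ballI)
  show "set_integrable lborel {a..c} f'"
    by (rule set_integrable_subset[OF primitive_onD(1)[OF assms(1)]]) (use assms(2) in auto)
  fix s assume "s \<in> {a..c}"
  with assms(2) have "s \<in> {a..b}" by simp
  then show "f s = f a + (LINT r:{a..s}|lborel. f' r)" by (rule primitive_onD(2)[OF assms(1)])
qed

text \<open>Integration by parts: after inserting the integrals that represent \<open>f\<close> and \<open>g\<close>, the double integrals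
  on the right cover the square and give the product of the two total increments.\<close>

lemma primitive_on_mult_end:
  assumes "a \<le> b" and f: "primitive_on a b f f'" and g: "primitive_on a b g g'"
  shows "set_integrable lborel {a..b} (\<lambda>s. f' s * g s + f s * g' s)"
    and "f b * g b = f a * g a + (LINT s:{a..b}|lborel. f' s * g s + f s * g' s)"
proof -
  define F where "F = (\<lambda>s. indicator {a..b} s * f' s)"
  define G where "G = (\<lambda>s. indicator {a..b} s * g' s)"
  have F: "integrable lborel F" and G: "integrable lborel G"
    using primitive_onD(1)[OF f] primitive_onD(1)[OF g] by (simp_all add: set_integrable_def F_def G_def)
  have fe: "f s = f a + (\<integral>r. indicator {..s} r * F r \<partial>lborel)" if "s \<in> {a..b}" for s
  proof -
    have "(LINT r:{a..s}|lborel. f' r) = (\<integral>r. indicator {..s} r * F r \<partial>lborel)"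
      using that unfolding set_lebesgue_integral_def F_def
      by (intro Bochner_Integration.integral_cong) (auto simp: indicator_def)
    then show ?thesis using primitive_onD(2)[OF f that] by simp
  qed
  have ge: "g s = g a + (\<integral>r. indicator {..s} r * G r \<partial>lborel)" if "s \<in> {a..b}" for s
  proof -
    have "(LINT r:{a..s}|lborel. g' r) = (\<integral>r. indicator {..s} r * G r \<partial>lborel)"
      using that unfolding set_lebesgue_integral_def G_def
      by (intro Bochner_Integration.integral_cong) (auto simp: indicator_def)
    then show ?thesis using primitive_onD(2)[OF g that] by simp
  qed
  have fb: "f b = f a + (\<integral>s. F s \<partial>lborel)"
  proof -
    have "(\<integral>r. indicator {..b} r * F r \<partial>lborel) = (\<integral>s. F s \<partial>lborel)"
      by (intro Bochner_Integration.integral_cong) (auto simp: indicator_def F_def)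
    then show ?thesis using fe[of b] \<open>a \<le> b\<close> by simp
  qed
  have gb: "g b = g a + (\<integral>s. G s \<partial>lborel)"
  proof -
    have "(\<integral>r. indicator {..b} r * G r \<partial>lborel) = (\<integral>s. G s \<partial>lborel)"
      by (intro Bochner_Integration.integral_cong) (auto simp: indicator_def G_def)
    then show ?thesis using ge[of b] \<open>a \<le> b\<close> by simp
  qed
  note TF = integral_triangles[OF F G] and TG = integral_triangles[OF G F]
  have eq: "indicator {a..b} s *\<^sub>R (f' s * g s + f s * g' s) =
      F s * g a + F s * (\<integral>r. indicator {..s} r * G r \<partial>lborel) +
      (G s * f a + G s * (\<integral>r. indicator {..s} r * F r \<partial>lborel))" for s
  proof (cases "s \<in> {a..b}")
    case True
    from fe[OF True] ge[OF True] show ?thesis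
      using True by (simp add: F_def G_def algebra_simps)
  qed (simp add: F_def G_def)
  show "set_integrable lborel {a..b} (\<lambda>s. f' s * g s + f s * g' s)"
    unfolding set_integrable_def eq using F G TF(1) TG(1) by simp
  have "(LINT s:{a..b}|lborel. f' s * g s + f s * g' s) =
     (\<integral>s. F s \<partial>lborel) * g a + (\<integral>s. G s \<partial>lborel) * f a +
     ((\<integral>s. F s * (\<integral>r. indicator {..s} r * G r \<partial>lborel) \<partial>lborel) +
         (\<integral>s. G s * (\<integral>r. indicator {..s} r * F r \<partial>lborel) \<partial>lborel))"
    unfolding set_lebesgue_integral_def eq using F G TF(1) TG(1) by simp
  also have "\<dots> = (\<integral>s. F s \<partial>lborel) * g a + (\<integral>s. G s \<partial>lborel) * f a +
     (\<integral>s. F s \<partial>lborel) * (\<integral>s. G s \<partial>lborel)" using TF(2) by simp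
  finally show "f b * g b = f a * g a + (LINT s:{a..b}|lborel. f' s * g s + f s * g' s)"
    unfolding fb gb by (simp add: algebra_simps)
qed

lemma primitive_on_mult:
  assumes "a \<le> b" "primitive_on a b f f'" "primitive_on a b g g'"
  shows "primitive_on a b (\<lambda>s. f s * g s) (\<lambda>s. f' s * g s + f s * g' s)"
  unfolding primitive_on_def
proof (intro conjI ballI)
  fix s assume "s \<in> {a..b}"
  then show "f s * g s = f a * g a + (LINT r:{a..s}|lborel. f' r * g r + f r * g' r)"
    by (intro primitive_on_mult_end(2) primitive_on_subinterval[OF assms(2)]
        primitive_on_subinterval[OF assms(3)]) auto
qed (rule primitive_on_mult_end(1)[OF assms])

lemma primitive_on_power:
  assumes "a \<le> b" and k: "primitive_on a b \<kappa> k"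
  shows "primitive_on a b (\<lambda>s. \<kappa> s ^ Suc n) (\<lambda>s. real (Suc n) * (k s * \<kappa> s ^ n))"
proof (induction n)
  case 0
  then show ?case using k by simp
next
  case (Suc n)
  have "k s * \<kappa> s ^ Suc n + \<kappa> s * (real (Suc n) * (k s * \<kappa> s ^ n)) =
     real (Suc (Suc n)) * (k s * \<kappa> s ^ Suc n)" for s
    by (simp add: algebra_simps)
  with primitive_on_mult[OF \<open>a \<le> b\<close> k Suc] show ?case by simp
qed

text \<open>Inserting the inequality into itself \<open>n\<close> times bounds \<open>\<phi>\<close> by \<open>K \<kappa>\<^sup>n / n!\<close>, where \<open>\<kappa>\<close> is the primitive of
  the kernel; these bounds tend to zero.\<close>

lemma gronwall_zero:
  fixes \<phi> k :: "real \<Rightarrow> real"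
  assumes k: "set_integrable lborel {a..b} k" and k0: "\<And>s. s \<in> {a..b} \<Longrightarrow> 0 \<le> k s"
    and \<phi>m: "set_borel_measurable lborel {a..b} \<phi>"
    and \<phi>M: "\<And>s. s \<in> {a..b} \<Longrightarrow> \<phi> s \<le> K"  and \<phi>0: "\<And>s. s \<in> {a..b} \<Longrightarrow> 0 \<le> \<phi> s"
    and ineq: "\<And>s. s \<in> {a..b} \<Longrightarrow> \<phi> s \<le> (LINT r:{a..s}|lborel. k r * \<phi> r)"
    and s: "s \<in> {a..b}"
  shows "\<phi> s = 0"
proof -
  define \<kappa> where "\<kappa> s = (LINT r:{a..s}|lborel. k r)" for s
  have "a \<le> b" using s by simp
  have \<kappa>a: "\<kappa> a = 0" 
    using set_integral_at_point[OF set_integrable_subset[OF k, of "{a}"]] s by (simp add: \<kappa>_def)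
  have pk: "primitive_on a b \<kappa> k" unfolding primitive_on_def using k \<kappa>a \<kappa>_def by auto
  have pp: "primitive_on a b (\<lambda>s. \<kappa> s ^ Suc n) (\<lambda>s. real (Suc n) * (k s * \<kappa> s ^ n))" for n
    by (rule primitive_on_power[OF \<open>a \<le> b\<close> pk])
  have ikn: "set_integrable lborel {a..b} (\<lambda>s. k s * \<kappa> s ^ n)" for n
    using primitive_onD(1)[OF pp[of n]] by (simp del: of_nat_Suc)
  have kn: "(LINT r:{a..s}|lborel. k r * \<kappa> r ^ n) = \<kappa> s ^ Suc n / real (Suc n)" if "s \<in> {a..b}" for n s
    using primitive_onD(2)[OF pp[of n] that] \<kappa>a by (simp del: of_nat_Suc)
  have K0: "0 \<le> K" using \<phi>M[OF s] \<phi>0[OF s] by simp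
  have ik\<phi>: "set_integrable lborel {a..b} (\<lambda>s. k s * \<phi> s)"
  proof (rule set_integrable_bound[of _ _ "\<lambda>s. K * k s"])
    show "set_borel_measurable lborel {a..b} (\<lambda>s. k s * \<phi> s)"
    proof -
      have "(\<lambda>x. indicator {a..b} x *\<^sub>R (k x * \<phi> x)) =
        (\<lambda>x. (indicator {a..b} x *\<^sub>R k x) * (indicator {a..b} x *\<^sub>R \<phi> x))"
        by (auto simp: indicator_def)
      moreover have "\<dots> \<in> borel_measurable lborel"
        using k \<phi>m unfolding set_integrable_def set_borel_measurable_def
        by (intro borel_measurable_times) auto
      ultimately show ?thesis unfolding set_borel_measurable_def by simp
    qed
    show "AE x in lborel. x \<in> {a..b} \<longrightarrow> norm (k x * \<phi> x) \<le> norm (K * k x)"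
      using \<phi>M \<phi>0 k0 K0 by (auto simp: abs_mult mult.commute intro!: AE_I2 mult_right_mono)
  qed (use k in auto)
  have bound: "\<phi> s \<le> K * (\<kappa> s ^ n / fact n)" if "s \<in> {a..b}" for n s
    using that
  proof (induction n arbitrary: s)
    case 0
    then show ?case using \<phi>M by simp
  next
    case (Suc n)
    have "\<phi> s \<le> (LINT r:{a..s}|lborel. k r * \<phi> r)" by (rule ineq[OF Suc.prems])
    also have "\<dots> \<le> (LINT r:{a..s}|lborel. (K / fact n) * (k r * \<kappa> r ^ n))"
    proof (rule set_integral_mono)
      show "set_integrable lborel {a..s} (\<lambda>r. k r * \<phi> r)"
        by (rule set_integrable_subset[OF ik\<phi>]) (use Suc.prems in auto)
      show "set_integrable lborel {a..s} (\<lambda>r. (K / fact n) * (k r * \<kappa> r ^ n))"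
        by (intro set_integrable_mult_right set_integrable_subset[OF ikn]) (use Suc.prems in auto)
      fix r assume "r \<in> {a..s}"
      then have r: "r \<in> {a..b}" using Suc.prems by auto
      have "k r * \<phi> r \<le> k r * (K * (\<kappa> r ^ n / fact n))"
        by (rule mult_left_mono[OF Suc.IH[OF r] k0[OF r]])
      then show "k r * \<phi> r \<le> (K / fact n) * (k r * \<kappa> r ^ n)" by (simp add: field_simps)
    qed
    also have "\<dots> = (K / fact n) * (\<kappa> s ^ Suc n / real (Suc n))"
      using kn[OF Suc.prems] by simp
    also have "\<dots> = K * (\<kappa> s ^ Suc n / fact (Suc n))" by (simp add: field_simps)
    finally show ?case .
  qed
  have "(\<lambda>n. K * (\<kappa> s ^ n / fact n)) \<longlonglongrightarrow> K * 0"
    by (intro tendsto_intros) (use summable_LIMSEQ_zero[OF summable_exp[of "\<kappa> s"]] in \<open>simp add: field_simps\<close>)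
  then have "\<phi> s \<le> 0" using bound[OF s] by (intro LIMSEQ_le_const[of _ 0]) auto
  then show ?thesis using \<phi>0[OF s] by simp
qed

section \<open>Processes on a time interval\<close>

text \<open>Lebesgue measure on \<open>[a,b]\<close> as a measure of its own: a progressively measurable process is then
  plainly measurable for the product of this measure with \<open>M\<close>, and Fubini's theorem applies to it.\<close>

definition leb_on :: "real \<Rightarrow> real \<Rightarrow> real measure" where
  "leb_on a b = restrict_space lborel {a..b}"

lemma space_leb_on [simp]: "space (leb_on a b) = {a..b}"
  by (simp add: leb_on_def space_restrict_space)

lemma finite_measure_leb_on: "finite_measure (leb_on a b)"
  by (rule finite_measureI)
    (auto simp: leb_on_def space_restrict_space emeasure_restrict_space emeasure_lborel_Icc_eq)

lemma sigma_finite_leb_on: "sigma_finite_measure (leb_on a b)"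
  using finite_measure_leb_on by (rule finite_measure.axioms)

lemma set_lebesgue_integral_leb_on: 
  fixes f :: "real \<Rightarrow> 'h::euclidean_space"
  shows "(LINT s:{a..b}|lborel. f s) = (LINT s|leb_on a b. f s)"
  by (simp add: leb_on_def integral_restrict_space set_lebesgue_integral_def)

lemma set_integrable_leb_on: 
  fixes f :: "real \<Rightarrow> 'h::euclidean_space"
  shows "set_integrable lborel {a..b} f \<longleftrightarrow> integrable (leb_on a b) f"
  by (simp add: leb_on_def integrable_restrict_space set_integrable_def)

lemma set_borel_measurable_leb_on:
  fixes f :: "real \<Rightarrow> 'h::euclidean_space"
  shows "set_borel_measurable lborel {a..b} f \<longleftrightarrow> f \<in> borel_measurable (leb_on a b)"
  unfolding leb_on_def set_borel_measurable_def
  by (subst borel_measurable_restrict_space_iff) auto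

lemma nn_set_integral_leb_on: "(\<integral>\<^sup>+s\<in>{a..b}. f s \<partial>lborel) = (\<integral>\<^sup>+s. f s \<partial>leb_on a b)"
  unfolding leb_on_def by (subst nn_integral_restrict_space) auto

lemma AE_leb_on: "(AE s in leb_on a b. P s) \<longleftrightarrow> (AE s in lborel. s \<in> {a..b} \<longrightarrow> P s)"
  unfolding leb_on_def by (subst AE_restrict_space_iff) auto

lemma sets_leb_on: "sets (leb_on a b) = sets (restrict_space borel {a..b})"
  by (simp add: leb_on_def sets_restrict_space)

lemma measurable_leb_on_mono:
  assumes "k \<in> borel_measurable (leb_on a b)" "{c..d} \<subseteq> {a..b}"
  shows "k \<in> borel_measurable (leb_on c d)"
  using assms unfolding leb_on_def by (rule measurable_restrict_mono)

subsection \<open>Matrix actions\<close>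

lemma bounded_bilinear_matrix_vector: "bounded_bilinear ((*v) :: real^'n::finite^'m::finite \<Rightarrow> _)"
  unfolding bilinear_conv_bounded_bilinear[symmetric] bilinear_def
  by (auto simp: linear_iff matrix_vector_right_distrib matrix_vector_mult_add_rdistrib
      scaleR_matrix_vector_assoc matrix_vector_mult_scaleR)

lemma borel_measurable_matrix_vector [measurable (raw)]:
  fixes A :: "'a \<Rightarrow> real^'n::finite^'m::finite"
  assumes "A \<in> borel_measurable N" "x \<in> borel_measurable N"
  shows "(\<lambda>z. A z *v x z) \<in> borel_measurable N"
proof (rule borel_measurable_continuous_Pair[OF assms])
  show "continuous_on UNIV (\<lambda>x. fst x *v (snd x) :: real^'m)"
    by (intro bounded_bilinear.continuous_on[OF bounded_bilinear_matrix_vector] continuous_intros)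
qed

lemma norm_matrix_vector_le:
  fixes A :: "real^'n::finite^'m::finite"
  shows "norm (A *v x) \<le> norm A * norm x"
proof -
  have "norm (A *v x) = L2_set (\<lambda>i. \<bar>A $ i \<bullet> x\<bar>) UNIV"
    by (simp add: norm_vec_def matrix_vector_mult_def inner_vec_def)
  also have "\<dots> \<le> L2_set (\<lambda>i. norm (A $ i) * norm x) UNIV"
    by (rule L2_set_mono) (auto simp: Cauchy_Schwarz_ineq2)
  also have "\<dots> = norm A * norm x"
    by (simp add: L2_set_left_distrib norm_vec_def)
  finally show ?thesis .
qed

lemma norm_transpose: "norm (transpose A) = norm (A :: real^'n::finite^'m::finite)"
proof -
  have "(norm (transpose A))\<^sup>2 = (norm A)\<^sup>2"
    unfolding power2_norm_eq_inner inner_vec_def transpose_def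
    by (simp add: sum.swap[of _ "UNIV::'n set"])
  then show ?thesis by (simp add: power2_eq_iff_nonneg)
qed

lemma borel_measurable_transpose [measurable (raw)]:
  fixes A :: "'a \<Rightarrow> real^'n::finite^'m::finite"
  assumes "A \<in> borel_measurable N"
  shows "(\<lambda>z. transpose (A z)) \<in> borel_measurable N"
proof -
  have "linear (transpose :: real^'n^'m \<Rightarrow> _)"
    by (auto simp: linear_iff transpose_def vec_eq_iff)
  then have "continuous_on UNIV (transpose :: real^'n^'m \<Rightarrow> _)"
    by (rule linear_continuous_on_compose[OF continuous_on_id, simplified])
  from borel_measurable_continuous_on[OF this assms] show ?thesis .
qed

subsection \<open>The filtration\<close>

text \<open>The interval \<open>[a,b]\<close> is fixed together with the Brownian motion: intermediate times \<open>s\<close> enter by restricting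
  integrals to \<open>{a..s}\<close>, so that all processes live on the same product space.\<close>

locale brownian_space = prob_space M for M :: "'w measure" +
  fixes F :: "real \<Rightarrow> 'w measure" and W :: "real \<Rightarrow> 'w \<Rightarrow> real" and a b :: real
  assumes filtration: "F = aug_filtration M W"
    and brownian: "brownian_motion M F W"
    and a_nonneg: "0 \<le> a" and a_le_b: "a \<le> b"
begin

lemma aug_generator:
  "{W s -` E \<inter> space M | s E. s \<in> {0..t} \<and> E \<in> sets borel} \<union> null_sets M \<subseteq> Pow (space M)"
  using sets.sets_into_space by (auto simp: null_sets_def)

lemma space_F [simp]: "space (F s) = space M"
  unfolding filtration aug_filtration_def by (rule space_measure_of[OF aug_generator])

lemma sets_F_M: "sets (F s) \<subseteq> sets M"
proof -
  have "W r -` E \<inter> space M \<in> sets M" if "0 \<le> r" "E \<in> sets borel" for r E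
    using brownian that unfolding brownian_motion_def by (auto intro: measurable_sets)
  then show ?thesis
    unfolding filtration aug_filtration_def sets_measure_of[OF aug_generator]
    by (intro sets.sigma_sets_subset) (auto simp: null_sets_def)
qed

lemma sets_F_mono: "r \<le> s \<Longrightarrow> sets (F r) \<subseteq> sets (F s)"
  unfolding filtration aug_filtration_def sets_measure_of[OF aug_generator]
  by (rule sigma_sets_mono') fastforce

lemma measurable_F_M: "f \<in> measurable (F s) N \<Longrightarrow> f \<in> measurable M N"
  using measurable_mono[OF order_refl refl sets_F_M[of s], of N] by auto

lemma measurable_F_mono: "f \<in> measurable (F r) N \<Longrightarrow> r \<le> s \<Longrightarrow> f \<in> measurable (F s) N"
  using measurable_mono[OF order_refl refl sets_F_mono[of r s], of N] by auto

lemma W_F: "0 \<le> s \<Longrightarrow> W s \<in> borel_measurable (F s)"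
  using brownian unfolding brownian_motion_def by blast

lemma W_M: "0 \<le> s \<Longrightarrow> W s \<in> borel_measurable M"
  using brownian unfolding brownian_motion_def by blast

abbreviation L :: "real measure" where "L \<equiv> leb_on a b"

abbreviation LM :: "(real \<times> 'w) measure" where "LM \<equiv> L \<Otimes>\<^sub>M M"

lemma pair_sf: "pair_sigma_finite L M"
  using sigma_finite_leb_on sigma_finite_measure_axioms by (simp add: pair_sigma_finite_def)

subsection \<open>Progressive measurability\<close>

lemma prog_joint:
  assumes "prog_measurable F a b \<phi>"
  shows "(\<lambda>(r, \<omega>). \<phi> r \<omega>) \<in> borel_measurable LM"
proof -
  have 1: "(\<lambda>(r, \<omega>). \<phi> r \<omega>) \<in> borel_measurable (restrict_space borel {a..b} \<Otimes>\<^sub>M F b)"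
    using assms a_le_b unfolding prog_measurable_def by auto
  have 2: "(\<lambda>z. z) \<in> measurable LM (restrict_space borel {a..b} \<Otimes>\<^sub>M F b)"
  proof (rule measurable_pair)
    show "fst \<circ> (\<lambda>z. z) \<in> measurable LM (restrict_space borel {a..b})"
      using measurable_fst[of L M] measurable_cong_sets[OF refl sets_leb_on[of a b], of LM]
      by (simp add: comp_def)
    show "snd \<circ> (\<lambda>z. z) \<in> measurable LM (F b)"
      using measurable_compose[OF measurable_snd[of L M] measurable_F_M[OF measurable_ident, of b]]
      by (simp add: comp_def)
  qed
  show ?thesis using measurable_compose[OF 2 1] by simp
qed

lemma prog_adapted:
  assumes "prog_measurable F a b \<phi>" "r \<in> {a..b}"
  shows "\<phi> r \<in> borel_measurable (F r)"
proof -
  have 1: "(\<lambda>(r, \<omega>). \<phi> r \<omega>) \<in> borel_measurable (restrict_space borel {a..r} \<Otimes>\<^sub>M F r)"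
    using assms unfolding prog_measurable_def by auto
  have 2: "Pair r \<in> measurable (F r) (restrict_space borel {a..r} \<Otimes>\<^sub>M F r)"
    using assms(2) by (intro measurable_Pair1') (auto simp: space_restrict_space)
  show ?thesis using measurable_compose[OF 2 1] by simp
qed

lemma prog_adapted_M: "prog_measurable F a b \<phi> \<Longrightarrow> r \<in> {a..b} \<Longrightarrow> \<phi> r \<in> borel_measurable M"
  using prog_adapted measurable_F_M by blast

lemma prog_compose2:
  assumes "prog_measurable F a b \<phi>" "prog_measurable F a b \<psi>"
    and f: "(\<lambda>(x, y). f x y) \<in> borel_measurable (borel \<Otimes>\<^sub>M borel)"
  shows "prog_measurable F a b (\<lambda>s \<omega>. f (\<phi> s \<omega>) (\<psi> s \<omega>))"
  unfolding prog_measurable_def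
proof
  fix s assume s: "s \<in> {a..b}"
  have "(\<lambda>z. (case_prod \<phi> z, case_prod \<psi> z)) \<in> measurable (restrict_space borel {a..s} \<Otimes>\<^sub>M F s) (borel \<Otimes>\<^sub>M borel)"
    using assms(1,2) s unfolding prog_measurable_def by (intro measurable_Pair) auto
  from measurable_compose[OF this f]
  show "(\<lambda>(r, \<omega>). f (\<phi> r \<omega>) (\<psi> r \<omega>)) \<in> borel_measurable (restrict_space borel {a..s} \<Otimes>\<^sub>M F s)"
    by (simp add: split_beta')
qed

lemma prog_add: "prog_measurable F a b \<phi> \<Longrightarrow> prog_measurable F a b \<psi> \<Longrightarrow>
    prog_measurable F a b (\<lambda>s \<omega>. \<phi> s \<omega> + \<psi> s \<omega>)"
  by (rule prog_compose2) measurable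

lemma prog_diff: "prog_measurable F a b \<phi> \<Longrightarrow> prog_measurable F a b \<psi> \<Longrightarrow>
    prog_measurable F a b (\<lambda>s \<omega>. \<phi> s \<omega> - \<psi> s \<omega>)"
  by (rule prog_compose2) measurable

lemma prog_linear:
  assumes "prog_measurable F a b \<phi>" "bounded_linear h"
  shows "prog_measurable F a b (\<lambda>s \<omega>. h (\<phi> s \<omega>))"
proof -
  have [measurable]: "h \<in> borel_measurable borel"
    using assms(2) by (intro borel_measurable_continuous_onI linear_continuous_on)
  then show ?thesis by (intro prog_compose2[OF assms(1) assms(1), of "\<lambda>x y. h x"]) measurable
qed

lemma prog_deterministic:
  assumes "k \<in> borel_measurable L"
  shows "prog_measurable F a b (\<lambda>s \<omega>. k s)"
  unfolding prog_measurable_def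
proof
  fix s assume s: "s \<in> {a..b}"
  have "k \<in> borel_measurable (leb_on a s)"
    by (rule measurable_leb_on_mono[OF assms]) (use s in auto)
  then have "k \<in> borel_measurable (restrict_space borel {a..s})"
    using measurable_cong_sets[OF sets_leb_on refl] by blast
  from measurable_compose[OF measurable_fst this]
  show "(\<lambda>(r, \<omega>). k r) \<in> borel_measurable (restrict_space borel {a..s} \<Otimes>\<^sub>M F s)"
    by (simp add: split_beta')
qed

text \<open>The process is the limit of its samplings along the grids of mesh \<open>1/n\<close>; each time is rounded down, so
  that on \<open>[a,s]\<close> only the past of \<open>s\<close> enters.\<close>

lemma continuous_adapted_prog:
  fixes \<phi> :: "real \<Rightarrow> 'w \<Rightarrow> 'h::euclidean_space"
  assumes ad: "\<And>s. s \<in> {a..b} \<Longrightarrow> \<phi> s \<in> borel_measurable (F s)"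
    and cont: "\<And>\<omega>. \<omega> \<in> space M \<Longrightarrow> continuous_on {a..b} (\<lambda>s. \<phi> s \<omega>)"
  shows "prog_measurable F a b \<phi>"
  unfolding prog_measurable_def
proof
  fix s assume s: "s \<in> {a..b}"
  let ?N = "restrict_space borel {a..s} \<Otimes>\<^sub>M F s"
  \<comment> \<open>for \<open>r\<close> in \<open>[a,s]\<close> the truncation changes nothing; it makes the value for every grid index \<open>F s\<close>-measurable\<close>
  define \<tau> where "\<tau> n r = max a (min s (a + \<lfloor>(r - a) * real (Suc n)\<rfloor> / real (Suc n)))" for n r
  have sp: "space ?N = {a..s} \<times> space M" by (simp add: space_pair_measure space_restrict_space)
  have \<tau>_lim: "(\<lambda>n. \<tau> n r) \<longlonglongrightarrow> r" if r: "r \<in> {a..s}" for r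
  proof (rule Lim_transform_bound[of _ "\<lambda>n. inverse (real (Suc n))", THEN Lim_null[THEN iffD2]])
    show "\<forall>\<^sub>F n in sequentially. norm (\<tau> n r - r) \<le> norm (inverse (real (Suc n)))"
    proof (rule always_eventually, rule allI)
      fix n
      let ?q = "\<lfloor>(r - a) * real (Suc n)\<rfloor> / real (Suc n)"
      have "?q \<le> r - a" by (simp add: divide_le_eq del: of_nat_Suc)
      moreover have "r - a < ?q + inverse (real (Suc n))"
      proof -
        have "(r - a) * real (Suc n) < \<lfloor>(r - a) * real (Suc n)\<rfloor> + 1" by linarith
        then have "(r - a) < (\<lfloor>(r - a) * real (Suc n)\<rfloor> + 1) / real (Suc n)"
          by (simp add: less_divide_eq del: of_nat_Suc)
        then show ?thesis by (simp add: add_divide_distrib inverse_eq_divide del: of_nat_Suc)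
      qed
      moreover have "0 \<le> ?q" using r by simp
      ultimately have "\<tau> n r \<le> r" "r - \<tau> n r < inverse (real (Suc n))" using r
        by (auto simp: \<tau>_def)
      then show "norm (\<tau> n r - r) \<le> norm (inverse (real (Suc n)))"
        by (simp del: of_nat_Suc)
    qed
    show "(\<lambda>n. inverse (real (Suc n))) \<longlonglongrightarrow> 0" by (rule LIMSEQ_inverse_real_of_nat)
  qed
  show "(\<lambda>(r, \<omega>). \<phi> r \<omega>) \<in> borel_measurable ?N"
  proof (rule borel_measurable_LIMSEQ_metric)
    fix n
    let ?f = "\<lambda>k::int. \<lambda>z::real \<times> 'w. \<phi> (max a (min s (a + k / real (Suc n)))) (snd z)"
    have "?f k \<in> borel_measurable ?N" for k
    proof -
      let ?c = "max a (min s (a + k / real (Suc n)))"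
      have "?c \<in> {a..b}" "?c \<le> s" using s by auto
      then have "\<phi> ?c \<in> borel_measurable (F s)" using ad measurable_F_mono by blast
      from measurable_compose[OF measurable_snd this] show ?thesis .
    qed
    moreover have "(\<lambda>z::real \<times> 'w. \<lfloor>(fst z - a) * real (Suc n)\<rfloor>) \<in> measurable ?N (count_space UNIV)"
    proof -
      have "fst \<in> borel_measurable ?N"
        using measurable_fst[of "restrict_space borel {a..s}" "F s"]
        by (simp add: measurable_restrict_space2_iff)
      then show ?thesis by measurable
    qed
    ultimately have "(\<lambda>z. ?f \<lfloor>(fst z - a) * real (Suc n)\<rfloor> z) \<in> borel_measurable ?N"
      by (rule measurable_compose_countable)
    then show "(\<lambda>z. \<phi> (\<tau> n (fst z)) (snd z)) \<in> borel_measurable ?N"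
      by (simp add: \<tau>_def)
  next
    fix z assume "z \<in> space ?N"
    then obtain r \<omega> where z: "z = (r, \<omega>)" "r \<in> {a..s}" "\<omega> \<in> space M" by (auto simp: sp)
    have "(\<lambda>n. \<phi> (\<tau> n r) \<omega>) \<longlonglongrightarrow> \<phi> r \<omega>"
    proof -
      have "\<forall>n. \<tau> n r \<in> {a..b}" "r \<in> {a..b}" using z(2) s by (auto simp: \<tau>_def)
      then show ?thesis
        by (intro continuous_on_tendsto_compose[OF cont[OF z(3)] \<tau>_lim[OF z(2)]]) auto
    qed
    then show "(\<lambda>n. \<phi> (\<tau> n (fst z)) (snd z)) \<longlonglongrightarrow> (case z of (r, \<omega>) \<Rightarrow> \<phi> r \<omega>)"
      by (simp add: z)
  qed
qed

end

section \<open>Square-integrable processes\<close>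

lemma norm_add_square_le: "(norm (x + y))\<^sup>2 \<le> 2 * (norm x)\<^sup>2 + 2 * (norm y)\<^sup>2"
proof -
  have "(norm (x + y))\<^sup>2 \<le> (norm x + norm y)\<^sup>2"
    by (rule power_mono[OF norm_triangle_ineq]) simp
  also have "\<dots> \<le> 2 * (norm x)\<^sup>2 + 2 * (norm y)\<^sup>2"
    using sum_squares_bound[of "norm x" "norm y"] by (simp add: power2_sum)
  finally show ?thesis .
qed

lemma norm_diff_square_le: "(norm (x - y))\<^sup>2 \<le> 2 * (norm x)\<^sup>2 + 2 * (norm y)\<^sup>2"
  using norm_add_square_le[of x "- y"] by simp

lemma ennreal_add_square_le: "(x + y)\<^sup>2 \<le> 2 * x\<^sup>2 + 2 * (y::ennreal)\<^sup>2"
proof (cases x; cases y)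
  fix r q assume r: "0 \<le> r" "x = ennreal r" and q: "0 \<le> q" "y = ennreal q"
  have "(r + q)\<^sup>2 \<le> 2 * r\<^sup>2 + 2 * q\<^sup>2" using norm_add_square_le[of r q] by simp
  then have "ennreal ((r + q)\<^sup>2) \<le> ennreal (2 * r\<^sup>2 + 2 * q\<^sup>2)" by (rule ennreal_leI)
  moreover have "(x + y)\<^sup>2 = ennreal ((r + q)\<^sup>2)"
    using r q by (simp add: ennreal_power flip: ennreal_plus)
  moreover have "2 * x\<^sup>2 + 2 * y\<^sup>2 = ennreal (2 * r\<^sup>2 + 2 * q\<^sup>2)"
    using r q by (simp add: ennreal_power ennreal_mult)
  ultimately show ?thesis by simp
qed (auto simp: ennreal_mult_eq_top_iff power2_eq_square)

lemma nn_integral_mult_finite: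
  assumes [measurable]: "f \<in> borel_measurable N" "g \<in> borel_measurable N"
    and "(\<integral>\<^sup>+x. f x ^ 2 \<partial>N) < \<infinity>" "(\<integral>\<^sup>+x. g x ^ 2 \<partial>N) < \<infinity>"
  shows "(\<integral>\<^sup>+x. f x * g x \<partial>N) < \<infinity>"
proof -
  have "(\<integral>\<^sup>+x. f x * g x \<partial>N)\<^sup>2 < \<infinity>"
    using Cauchy_Schwarz_nn_integral[of f N g] assms(3,4)
    by (auto intro!: le_less_trans[of "_\<^sup>2"] ennreal_mult_less_top[THEN iffD2])
  then show ?thesis by (auto simp: power2_eq_square less_top[symmetric])
qed

lemma integrable_mult_L2:
  fixes f g :: "'a \<Rightarrow> real"
  assumes "f \<in> borel_measurable N" "g \<in> borel_measurable N"
    and f2: "integrable N (\<lambda>x. (f x)\<^sup>2)" and g2: "integrable N (\<lambda>x. (g x)\<^sup>2)"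
  shows "integrable N (\<lambda>x. f x * g x)"
proof (rule Bochner_Integration.integrable_bound)
  show "integrable N (\<lambda>x. (f x)\<^sup>2 + (g x)\<^sup>2)" using f2 g2 by simp
  show "AE x in N. norm (f x * g x) \<le> norm ((f x)\<^sup>2 + (g x)\<^sup>2)"
  proof (rule AE_I2)
    fix x
    have "2 * (\<bar>f x\<bar> * \<bar>g x\<bar>) \<le> (f x)\<^sup>2 + (g x)\<^sup>2"
      using sum_squares_bound[of "\<bar>f x\<bar>" "\<bar>g x\<bar>"] by simp
    moreover have "0 \<le> \<bar>f x\<bar> * \<bar>g x\<bar>" by simp
    ultimately have "\<bar>f x\<bar> * \<bar>g x\<bar> \<le> (f x)\<^sup>2 + (g x)\<^sup>2" by linarith
    then show "norm (f x * g x) \<le> norm ((f x)\<^sup>2 + (g x)\<^sup>2)" by (simp add: abs_mult)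
  qed
qed (use assms in measurable)

context brownian_space
begin

lemma L2F_iff:
  "\<phi> \<in> L2F M F a b \<longleftrightarrow> prog_measurable F a b \<phi> \<and>
     integrable LM (\<lambda>(s, \<omega>). (norm (\<phi> s \<omega>))\<^sup>2)"
proof -
  interpret P: pair_sigma_finite L M by (rule pair_sf)
  have "(\<integral>\<^sup>+\<omega>. (\<integral>\<^sup>+s\<in>{a..b}. ennreal ((norm (\<phi> s \<omega>))\<^sup>2) \<partial>lborel) \<partial>M) < \<infinity>
    \<longleftrightarrow> integrable LM (\<lambda>(s, \<omega>). (norm (\<phi> s \<omega>))\<^sup>2)"
    if "prog_measurable F a b \<phi>"
  proof -
    have [measurable]: "(\<lambda>(s, \<omega>). \<phi> s \<omega>) \<in> borel_measurable LM" by (rule prog_joint[OF that])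
    have [measurable]: "(\<lambda>(s, \<omega>). (norm (\<phi> s \<omega>))\<^sup>2) \<in> borel_measurable LM"
      by (simp add: split_beta') measurable
    have "(\<integral>\<^sup>+\<omega>. (\<integral>\<^sup>+s. ennreal ((norm (\<phi> s \<omega>))\<^sup>2) \<partial>L) \<partial>M)
        = (\<integral>\<^sup>+z. ennreal ((norm (case_prod \<phi> z))\<^sup>2) \<partial>LM)"
      by (subst P.nn_integral_snd[symmetric]) simp_all
    then show ?thesis
      by (simp add: nn_set_integral_leb_on integrable_iff_bounded split_beta')
  qed
  then show ?thesis unfolding L2F_def by blast
qed

lemma L2F_prog: "\<phi> \<in> L2F M F a b \<Longrightarrow> prog_measurable F a b \<phi>"
  by (simp add: L2F_def)

lemma L2F_sq: "\<phi> \<in> L2F M F a b \<Longrightarrow> integrable LM (\<lambda>(s, \<omega>). (norm (\<phi> s \<omega>))\<^sup>2)"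
  by (simp add: L2F_iff)

lemma L2F_bound:
  assumes "\<phi> \<in> L2F M F a b" "prog_measurable F a b \<psi>"
    and "AE s in L. \<forall>\<omega>\<in>space M. norm (\<psi> s \<omega>) \<le> c * norm (\<phi> s \<omega>)"
  shows "\<psi> \<in> L2F M F a b"
  unfolding L2F_iff
proof
  interpret P: pair_sigma_finite L M by (rule pair_sf)
  have [measurable]: "(\<lambda>(s, \<omega>). \<phi> s \<omega>) \<in> borel_measurable LM"
     "(\<lambda>(s, \<omega>). \<psi> s \<omega>) \<in> borel_measurable LM"
    using assms prog_joint L2F_prog by blast+
  show "integrable LM (\<lambda>(s, \<omega>). (norm (\<psi> s \<omega>))\<^sup>2)"
  proof (rule Bochner_Integration.integrable_bound)
    show "integrable LM (\<lambda>z. c\<^sup>2 * (case z of (s, \<omega>) \<Rightarrow> (norm (\<phi> s \<omega>))\<^sup>2))"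
      using L2F_sq[OF assms(1)] by (rule integrable_mult_right)
    have "AE z in LM. norm (case_prod \<psi> z) \<le> c * norm (case_prod \<phi> z)"
    proof (rule P.AE_pair_measure)
      show "AE x in L. AE y in M. norm (case (x, y) of (x, y) \<Rightarrow> \<psi> x y) \<le> c * norm (case (x, y) of (x, y) \<Rightarrow> \<phi> x y)"
        using assms(3) by eventually_elim auto
    qed measurable
    then show "AE z in LM. norm (case z of (s, \<omega>) \<Rightarrow> (norm (\<psi> s \<omega>))\<^sup>2) \<le>
        norm (c\<^sup>2 * (case z of (s, \<omega>) \<Rightarrow> (norm (\<phi> s \<omega>))\<^sup>2))"
    proof eventually_elim
      case (elim z)
      then have "(norm (case_prod \<psi> z))\<^sup>2 \<le> (c * norm (case_prod \<phi> z))\<^sup>2" by (rule power_mono) simp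
      then show ?case by (simp add: split_beta' power_mult_distrib)
    qed
  qed (simp add: split_beta'; measurable)
qed fact

lemma L2F_add:
  assumes "\<phi> \<in> L2F M F a b" "\<psi> \<in> L2F M F a b"
  shows "(\<lambda>s \<omega>. \<phi> s \<omega> + \<psi> s \<omega>) \<in> L2F M F a b"
  unfolding L2F_iff
proof
  have [measurable]: "(\<lambda>(s, \<omega>). \<phi> s \<omega>) \<in> borel_measurable LM"
     "(\<lambda>(s, \<omega>). \<psi> s \<omega>) \<in> borel_measurable LM"
    using assms prog_joint L2F_prog by blast+
  show "integrable LM (\<lambda>(s, \<omega>). (norm (\<phi> s \<omega> + \<psi> s \<omega>))\<^sup>2)"
  proof (rule Bochner_Integration.integrable_bound)
    show "integrable LM (\<lambda>z. 2 * (case z of (s, \<omega>) \<Rightarrow> (norm (\<phi> s \<omega>))\<^sup>2)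
        + 2 * (case z of (s, \<omega>) \<Rightarrow> (norm (\<psi> s \<omega>))\<^sup>2))"
      using L2F_sq[OF assms(1)] L2F_sq[OF assms(2)] by (intro Bochner_Integration.integrable_add integrable_mult_right)
  qed (auto simp: split_beta' norm_add_square_le)
qed (use assms prog_add L2F_prog in blast)

lemma L2F_linear:
  assumes "\<phi> \<in> L2F M F a b" "bounded_linear h"
  shows "(\<lambda>s \<omega>. h (\<phi> s \<omega>)) \<in> L2F M F a b"
proof -
  obtain c where c: "\<And>x. norm (h x) \<le> c * norm x"
    using bounded_linear.bounded[OF assms(2)] by (auto simp: mult.commute)
  show ?thesis
    by (rule L2F_bound[OF assms(1) prog_linear[OF L2F_prog[OF assms(1)] assms(2)]]) (use c in auto)
qed

lemma L2F_diff:
  assumes "\<phi> \<in> L2F M F a b" "\<psi> \<in> L2F M F a b"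
  shows "(\<lambda>s \<omega>. \<phi> s \<omega> - \<psi> s \<omega>) \<in> L2F M F a b"
  using L2F_add[OF assms(1) L2F_linear[OF assms(2) bounded_linear_minus[OF bounded_linear_ident]]] by simp

lemma prog_mv:
  fixes k :: "real \<Rightarrow> real^'n::finite^'m::finite"
  assumes "k \<in> borel_measurable L" "prog_measurable F a b \<phi>"
  shows "prog_measurable F a b (\<lambda>s \<omega>. k s *v \<phi> s \<omega>)"
  by (rule prog_compose2[OF prog_deterministic[OF assms(1)] assms(2), where f="(*v)"]) measurable

lemma L2F_Linf:
  fixes k :: "real \<Rightarrow> real^'n::finite^'m::finite"
  assumes k: "k \<in> Linf a b" and \<phi>: "\<phi> \<in> L2F M F a b"
  shows "(\<lambda>s \<omega>. k s *v \<phi> s \<omega>) \<in> L2F M F a b"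
proof -
  from k obtain c where km: "k \<in> borel_measurable L" and c: "AE s in L. norm (k s) \<le> c"
    unfolding Linf_def by (auto simp: set_borel_measurable_leb_on AE_leb_on)
  from c have "AE s in L. \<forall>\<omega>\<in>space M. norm (k s *v \<phi> s \<omega>) \<le> c * norm (\<phi> s \<omega>)"
    by eventually_elim (auto intro!: order_trans[OF norm_matrix_vector_le] mult_right_mono)
  then show ?thesis by (rule L2F_bound[OF \<phi> prog_mv[OF km L2F_prog[OF \<phi>]]])
qed

subsection \<open>Continuous processes\<close>

lemma L2F_C_prog: "\<phi> \<in> L2F_C M F a b \<Longrightarrow> prog_measurable F a b \<phi>"
  unfolding L2F_C_def by (intro continuous_adapted_prog) auto

text \<open>By continuity of the paths, the supremum over the interval equals the supremum over a countable dense
  subset.  It is therefore a random variable, and it is finite because the interval is compact.  Estimates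
  for continuous processes then need the paths only through this bound.\<close>

lemma L2F_C_dominated:
  fixes \<phi> :: "real \<Rightarrow> 'w \<Rightarrow> 'h::euclidean_space"
  assumes "\<phi> \<in> L2F_C M F a b"
  obtains m where "m \<in> borel_measurable M" "integrable M (\<lambda>\<omega>. (m \<omega>)\<^sup>2)"
    "\<And>\<omega>. 0 \<le> m \<omega>" "\<And>\<omega> s. \<omega> \<in> space M \<Longrightarrow> s \<in> {a..b} \<Longrightarrow> norm (\<phi> s \<omega>) \<le> m \<omega>"
proof -
  have ad: "\<phi> s \<in> borel_measurable M" if "s \<in> {a..b}" for s
    using assms that measurable_F_M unfolding L2F_C_def by blast
  have cont: "continuous_on {a..b} (\<lambda>s. \<phi> s \<omega>)" if "\<omega> \<in> space M" for \<omega>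
    using assms that unfolding L2F_C_def by blast
  define S where "S \<omega> = (SUP s\<in>{a..b}. ennreal ((norm (\<phi> s \<omega>))\<^sup>2))" for \<omega>
  have S_fin: "(\<integral>\<^sup>+\<omega>. S \<omega> \<partial>M) < \<infinity>" using assms unfolding L2F_C_def S_def by simp
  obtain D where D: "countable D" "D \<subseteq> {a..b}" "{a..b} \<subseteq> closure D"
    by (rule separable)
  have S_D: "S \<omega> = (SUP s\<in>D. ennreal ((norm (\<phi> s \<omega>))\<^sup>2))" if "\<omega> \<in> space M" for \<omega>
  proof (rule antisym)
    show "S \<omega> \<le> (SUP s\<in>D. ennreal ((norm (\<phi> s \<omega>))\<^sup>2))"
      unfolding S_def
    proof (rule SUP_least)
      fix s assume s: "s \<in> {a..b}"
      then obtain x where x: "\<And>n. x n \<in> D" "x \<longlonglongrightarrow> s"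
        using D(3) closure_sequential by (metis subsetD)
      have "(\<lambda>n. \<phi> (x n) \<omega>) \<longlonglongrightarrow> \<phi> s \<omega>"
        by (rule continuous_on_tendsto_compose[OF cont[OF that] x(2) s])
          (intro always_eventually allI subsetD[OF D(2)] x(1))
      then have "(\<lambda>n. ennreal ((norm (\<phi> (x n) \<omega>))\<^sup>2)) \<longlonglongrightarrow> ennreal ((norm (\<phi> s \<omega>))\<^sup>2)"
        by (intro tendsto_ennrealI tendsto_intros)
      then show "ennreal ((norm (\<phi> s \<omega>))\<^sup>2) \<le> (SUP s\<in>D. ennreal ((norm (\<phi> s \<omega>))\<^sup>2))"
        by (rule LIMSEQ_le_const2) (intro exI allI impI SUP_upper x(1))
    qed
    show "(SUP s\<in>D. ennreal ((norm (\<phi> s \<omega>))\<^sup>2)) \<le> S \<omega>"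
      unfolding S_def by (rule SUP_subset_mono[OF D(2)]) simp
  qed
  have S_meas [measurable]: "S \<in> borel_measurable M"
  proof -
    have "(\<lambda>\<omega>. SUP s\<in>D. ennreal ((norm (\<phi> s \<omega>))\<^sup>2)) \<in> borel_measurable M"
      using D(1,2) ad by (intro borel_measurable_SUP) (auto intro!: measurable_compose[OF _ measurable_ennreal]
          borel_measurable_power borel_measurable_norm)
    then show ?thesis using S_D by (simp cong: measurable_cong)
  qed
  have S_top: "S \<omega> < \<infinity>" if "\<omega> \<in> space M" for \<omega>
  proof -
    have "compact ((\<lambda>s. \<phi> s \<omega>) ` {a..b})"
      by (rule compact_continuous_image[OF cont[OF that]]) simp
    then have "bounded ((\<lambda>s. \<phi> s \<omega>) ` {a..b})" by (rule compact_imp_bounded)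
    then obtain B where B: "\<And>s. s \<in> {a..b} \<Longrightarrow> norm (\<phi> s \<omega>) \<le> B"
      unfolding bounded_iff by blast
    then have "S \<omega> \<le> ennreal (B\<^sup>2)"
      unfolding S_def by (auto intro!: SUP_least ennreal_leI power_mono)
    then show ?thesis by (simp add: le_less_trans)
  qed
  define m where "m \<omega> = sqrt (enn2real (S \<omega>))" for \<omega>
  have m2: "ennreal ((m \<omega>)\<^sup>2) = S \<omega>" if "\<omega> \<in> space M" for \<omega>
    using S_top[OF that] by (simp add: m_def)
  show ?thesis
  proof (rule that[of m])
    show "m \<in> borel_measurable M" unfolding m_def by measurable
    then show "integrable M (\<lambda>\<omega>. (m \<omega>)\<^sup>2)"
      using S_fin m2 unfolding integrable_iff_bounded by (simp cong: nn_integral_cong)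
    show "0 \<le> m \<omega>" for \<omega> by (simp add: m_def)
    fix \<omega> s assume \<omega>: "\<omega> \<in> space M" and s: "s \<in> {a..b}"
    have "ennreal ((norm (\<phi> s \<omega>))\<^sup>2) \<le> S \<omega>" unfolding S_def by (rule SUP_upper[OF s])
    then have "(norm (\<phi> s \<omega>))\<^sup>2 \<le> (m \<omega>)\<^sup>2" using m2[OF \<omega>] by (metis ennreal_le_iff zero_le_power2)
    then show "norm (\<phi> s \<omega>) \<le> m \<omega>" by (rule power2_le_imp_le) (simp add: m_def)
  qed
qed

lemma L2F_C_I:
  assumes "\<And>s. s \<in> {a..b} \<Longrightarrow> \<phi> s \<in> borel_measurable (F s)"
    and "\<And>\<omega>. \<omega> \<in> space M \<Longrightarrow> continuous_on {a..b} (\<lambda>s. \<phi> s \<omega>)"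
    and m: "integrable M (\<lambda>\<omega>. (m \<omega>)\<^sup>2)" "AE \<omega> in M. \<forall>s\<in>{a..b}. norm (\<phi> s \<omega>) \<le> m \<omega>"
  shows "\<phi> \<in> L2F_C M F a b"
proof -
  have "(\<integral>\<^sup>+\<omega>. (SUP s\<in>{a..b}. ennreal ((norm (\<phi> s \<omega>))\<^sup>2)) \<partial>M) \<le> (\<integral>\<^sup>+\<omega>. ennreal ((m \<omega>)\<^sup>2) \<partial>M)"
  proof (rule nn_integral_mono_AE)
    show "AE \<omega> in M. (SUP s\<in>{a..b}. ennreal ((norm (\<phi> s \<omega>))\<^sup>2)) \<le> ennreal ((m \<omega>)\<^sup>2)"
      using m(2) by eventually_elim (auto intro!: SUP_least ennreal_leI power_mono)
  qed
  also have "\<dots> < \<infinity>" using m(1) unfolding integrable_iff_bounded by simp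
  finally show ?thesis using assms unfolding L2F_C_def by auto
qed

lemma L2F_C_adapted: "\<phi> \<in> L2F_C M F a b \<Longrightarrow> s \<in> {a..b} \<Longrightarrow> \<phi> s \<in> borel_measurable (F s)"
  and L2F_C_continuous: "\<phi> \<in> L2F_C M F a b \<Longrightarrow> \<omega> \<in> space M \<Longrightarrow> continuous_on {a..b} (\<lambda>s. \<phi> s \<omega>)"
  unfolding L2F_C_def by blast+

lemma L2F_C_diff:
  assumes "\<phi> \<in> L2F_C M F a b" "\<psi> \<in> L2F_C M F a b"
  shows "(\<lambda>s \<omega>. \<phi> s \<omega> - \<psi> s \<omega>) \<in> L2F_C M F a b"
proof -
  obtain m n where m: "m \<in> borel_measurable M" "integrable M (\<lambda>\<omega>. (m \<omega>)\<^sup>2)"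
      "\<And>\<omega>. 0 \<le> m \<omega>" "\<And>\<omega> s. \<omega> \<in> space M \<Longrightarrow> s \<in> {a..b} \<Longrightarrow> norm (\<phi> s \<omega>) \<le> m \<omega>"
    and n: "n \<in> borel_measurable M" "integrable M (\<lambda>\<omega>. (n \<omega>)\<^sup>2)"
      "\<And>\<omega>. 0 \<le> n \<omega>" "\<And>\<omega> s. \<omega> \<in> space M \<Longrightarrow> s \<in> {a..b} \<Longrightarrow> norm (\<psi> s \<omega>) \<le> n \<omega>"
    using L2F_C_dominated[OF assms(1)] L2F_C_dominated[OF assms(2)] by metis
  show ?thesis
  proof (rule L2F_C_I[where m="\<lambda>\<omega>. m \<omega> + n \<omega>"])
    show "integrable M (\<lambda>\<omega>. (m \<omega> + n \<omega>)\<^sup>2)"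
      unfolding power2_sum using m n
      by (intro Bochner_Integration.integrable_add integrable_mult_right integrable_mult_L2)
         (auto simp: mult.assoc intro!: integrable_mult_right integrable_mult_L2)
    show "AE \<omega> in M. \<forall>s\<in>{a..b}. norm (\<phi> s \<omega> - \<psi> s \<omega>) \<le> m \<omega> + n \<omega>"
      using m(4) n(4) by (auto intro!: AE_I2 order_trans[OF norm_triangle_ineq4] add_mono)
  qed (use assms L2F_C_adapted L2F_C_continuous in \<open>auto intro!: borel_measurable_diff continuous_on_diff\<close>)
qed

lemma L2F_C_linear:
  assumes \<phi>: "\<phi> \<in> L2F_C M F a b" and h: "bounded_linear h"
  shows "(\<lambda>s \<omega>. h (\<phi> s \<omega>)) \<in> L2F_C M F a b"
proof -
  obtain m where m: "m \<in> borel_measurable M" "integrable M (\<lambda>\<omega>. (m \<omega>)\<^sup>2)"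
      "\<And>\<omega>. 0 \<le> m \<omega>" "\<And>\<omega> s. \<omega> \<in> space M \<Longrightarrow> s \<in> {a..b} \<Longrightarrow> norm (\<phi> s \<omega>) \<le> m \<omega>"
    using L2F_C_dominated[OF \<phi>] by metis
  obtain c where c: "0 \<le> c" "\<And>x. norm (h x) \<le> c * norm x"
    using bounded_linear.nonneg_bounded[OF h] by (auto simp: mult.commute)
  have [measurable]: "h \<in> borel_measurable borel"
    using h by (intro borel_measurable_continuous_onI linear_continuous_on)
  show ?thesis
  proof (rule L2F_C_I[where m="\<lambda>\<omega>. c * m \<omega>"])
    show "integrable M (\<lambda>\<omega>. (c * m \<omega>)\<^sup>2)"
      using m(2) by (simp add: power_mult_distrib)
    show "AE \<omega> in M. \<forall>s\<in>{a..b}. norm (h (\<phi> s \<omega>)) \<le> c * m \<omega>"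
      using m(4) c by (auto intro!: AE_I2 order_trans[OF c(2)] mult_left_mono)
    show "(\<lambda>\<omega>. h (\<phi> s \<omega>)) \<in> borel_measurable (F s)" if "s \<in> {a..b}" for s
      using L2F_C_adapted[OF \<phi> that] by measurable
    show "continuous_on {a..b} (\<lambda>s. h (\<phi> s \<omega>))" if "\<omega> \<in> space M" for \<omega>
      by (rule bounded_linear.continuous_on[OF h L2F_C_continuous[OF \<phi> that]])
  qed
qed


subsection \<open>Processes with square-integrable total variation\<close>

lemma path_nn_integral_measurable:
  assumes "prog_measurable F a b \<alpha>"
  shows "(\<lambda>\<omega>. \<integral>\<^sup>+s. ennreal (norm (\<alpha> s \<omega>)) \<partial>L) \<in> borel_measurable M"
proof (rule sigma_finite_measure.borel_measurable_nn_integral[OF sigma_finite_leb_on])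
  have "(\<lambda>(s, \<omega>). ennreal (norm (\<alpha> s \<omega>))) \<in> borel_measurable LM"
    using prog_joint[OF assms] by (auto simp: split_beta' intro!: measurable_compose[OF _ measurable_ennreal]
        borel_measurable_norm)
  from measurable_pair_swap[OF this]
  show "(\<lambda>(\<omega>, s). ennreal (norm (\<alpha> s \<omega>))) \<in> borel_measurable (M \<Otimes>\<^sub>M L)"
    by (simp add: split_beta')
qed

lemma L2F_L1_iff:
  "\<alpha> \<in> L2F_L1 M F a b \<longleftrightarrow> prog_measurable F a b \<alpha> \<and>
     (\<integral>\<^sup>+\<omega>. (\<integral>\<^sup>+s. ennreal (norm (\<alpha> s \<omega>)) \<partial>L)\<^sup>2 \<partial>M) < \<infinity>"
  by (simp add: L2F_L1_def nn_set_integral_leb_on)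

lemma L2F_L1_prog: "\<alpha> \<in> L2F_L1 M F a b \<Longrightarrow> prog_measurable F a b \<alpha>"
  by (simp add: L2F_L1_iff)

lemma L2F_L1_bound:
  assumes "prog_measurable F a b \<alpha>" "(\<integral>\<^sup>+\<omega>. (B \<omega>)\<^sup>2 \<partial>M) < \<infinity>"
    and "AE \<omega> in M. (\<integral>\<^sup>+s. ennreal (norm (\<alpha> s \<omega>)) \<partial>L) \<le> B \<omega>"
  shows "\<alpha> \<in> L2F_L1 M F a b"
proof -
  have "(\<integral>\<^sup>+\<omega>. (\<integral>\<^sup>+s. ennreal (norm (\<alpha> s \<omega>)) \<partial>L)\<^sup>2 \<partial>M) \<le> (\<integral>\<^sup>+\<omega>. (B \<omega>)\<^sup>2 \<partial>M)"
  proof (rule nn_integral_mono_AE)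
    show "AE \<omega> in M. (\<integral>\<^sup>+s. ennreal (norm (\<alpha> s \<omega>)) \<partial>L)\<^sup>2 \<le> (B \<omega>)\<^sup>2"
      using assms(3) by eventually_elim (auto intro: power_mono)
  qed
  with assms show ?thesis by (auto simp: L2F_L1_iff)
qed

lemma prog_section_measurable:
  assumes "prog_measurable F a b \<alpha>" "\<omega> \<in> space M"
  shows "(\<lambda>s. \<alpha> s \<omega>) \<in> borel_measurable L"
  using measurable_compose[OF measurable_Pair2'[OF assms(2), of L] prog_joint[OF assms(1)]] by simp

lemma L2F_L1_add:
  assumes \<alpha>: "\<alpha> \<in> L2F_L1 M F a b" and \<beta>: "\<beta> \<in> L2F_L1 M F a b"
  shows "(\<lambda>s \<omega>. \<alpha> s \<omega> + \<beta> s \<omega>) \<in> L2F_L1 M F a b"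
proof (rule L2F_L1_bound)
  let ?A = "\<lambda>\<omega>. \<integral>\<^sup>+s. ennreal (norm (\<alpha> s \<omega>)) \<partial>L" and ?B = "\<lambda>\<omega>. \<integral>\<^sup>+s. ennreal (norm (\<beta> s \<omega>)) \<partial>L"
  note [measurable] = path_nn_integral_measurable[OF L2F_L1_prog[OF \<alpha>]] path_nn_integral_measurable[OF
      L2F_L1_prog[OF \<beta>]]
  have "(\<integral>\<^sup>+\<omega>. (?A \<omega> + ?B \<omega>)\<^sup>2 \<partial>M) \<le> (\<integral>\<^sup>+\<omega>. 2 * (?A \<omega>)\<^sup>2 + 2 * (?B \<omega>)\<^sup>2 \<partial>M)"
    by (intro nn_integral_mono ennreal_add_square_le)
  also have "\<dots> = 2 * (\<integral>\<^sup>+\<omega>. (?A \<omega>)\<^sup>2 \<partial>M) + 2 * (\<integral>\<^sup>+\<omega>. (?B \<omega>)\<^sup>2 \<partial>M)"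
    by (simp add: nn_integral_add nn_integral_cmult)
  also have "\<dots> < \<infinity>" using \<alpha> \<beta> by (auto simp: L2F_L1_iff ennreal_mult_less_top)
  finally show "(\<integral>\<^sup>+\<omega>. (?A \<omega> + ?B \<omega>)\<^sup>2 \<partial>M) < \<infinity>" .
  show "AE \<omega> in M. (\<integral>\<^sup>+s. ennreal (norm (\<alpha> s \<omega> + \<beta> s \<omega>)) \<partial>L) \<le> ?A \<omega> + ?B \<omega>"
  proof (rule AE_I2)
    fix \<omega> assume \<omega>: "\<omega> \<in> space M"
    note [measurable] = prog_section_measurable[OF L2F_L1_prog[OF \<alpha>] \<omega>] prog_section_measurable[OF L2F_L1_prog[OF \<beta>] \<omega>]
    have "(\<integral>\<^sup>+s. ennreal (norm (\<alpha> s \<omega> + \<beta> s \<omega>)) \<partial>L) \<le> (\<integral>\<^sup>+s. ennreal (norm (\<alpha> s \<omega>)) + ennreal (norm (\<beta> s \<omega>)) \<partial>L)"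
      by (intro nn_integral_mono) (simp add: norm_triangle_ineq flip: ennreal_plus)
    also have "\<dots> = ?A \<omega> + ?B \<omega>" by (rule nn_integral_add) measurable
    finally show "(\<integral>\<^sup>+s. ennreal (norm (\<alpha> s \<omega> + \<beta> s \<omega>)) \<partial>L) \<le> ?A \<omega> + ?B \<omega>" .
  qed
qed (intro prog_add L2F_L1_prog \<alpha> \<beta>)

lemma L2F_L1_scale:
  assumes \<alpha>: "\<alpha> \<in> L2F_L1 M F a b" and \<beta>: "prog_measurable F a b \<beta>" and "0 \<le> c"
    and le: "AE s in L. \<forall>\<omega>\<in>space M. norm (\<beta> s \<omega>) \<le> c * norm (\<alpha> s \<omega>)"
  shows "\<beta> \<in> L2F_L1 M F a b"
proof (rule L2F_L1_bound[OF \<beta>])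
  let ?A = "\<lambda>\<omega>. \<integral>\<^sup>+s. ennreal (norm (\<alpha> s \<omega>)) \<partial>L"
  note [measurable] = path_nn_integral_measurable[OF L2F_L1_prog[OF \<alpha>]]
  show "(\<integral>\<^sup>+\<omega>. (ennreal c * ?A \<omega>)\<^sup>2 \<partial>M) < \<infinity>"
    using \<alpha> \<open>0 \<le> c\<close>
    by (simp add: power_mult_distrib nn_integral_cmult L2F_L1_iff ennreal_mult_less_top ennreal_power)
  show "AE \<omega> in M. (\<integral>\<^sup>+s. ennreal (norm (\<beta> s \<omega>)) \<partial>L) \<le> ennreal c * ?A \<omega>"
  proof (rule AE_I2)
    fix \<omega> assume \<omega>: "\<omega> \<in> space M"
    note [measurable] = prog_section_measurable[OF L2F_L1_prog[OF \<alpha>] \<omega>]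
    have "(\<integral>\<^sup>+s. ennreal (norm (\<beta> s \<omega>)) \<partial>L) \<le> (\<integral>\<^sup>+s. ennreal c * ennreal (norm (\<alpha> s \<omega>)) \<partial>L)"
    proof (rule nn_integral_mono_AE)
      show "AE s in L. ennreal (norm (\<beta> s \<omega>)) \<le> ennreal c * ennreal (norm (\<alpha> s \<omega>))"
        using le by eventually_elim (use \<omega> \<open>0 \<le> c\<close> in \<open>simp flip: ennreal_mult\<close>)
    qed
    also have "\<dots> = ennreal c * ?A \<omega>" by (rule nn_integral_cmult) measurable
    finally show "(\<integral>\<^sup>+s. ennreal (norm (\<beta> s \<omega>)) \<partial>L) \<le> ennreal c * ?A \<omega>" .
  qed
qed

lemma L2F_L1_Linf:
  fixes k :: "real \<Rightarrow> real^'n::finite^'m::finite"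
  assumes k: "k \<in> Linf a b" and \<alpha>: "\<alpha> \<in> L2F_L1 M F a b"
  shows "(\<lambda>s \<omega>. k s *v \<alpha> s \<omega>) \<in> L2F_L1 M F a b"
proof -
  from k obtain c where km: "k \<in> borel_measurable L" and c: "AE s in L. norm (k s) \<le> c"
    unfolding Linf_def by (auto simp: set_borel_measurable_leb_on AE_leb_on)
  from c have "AE s in L. \<forall>\<omega>\<in>space M. norm (k s *v \<alpha> s \<omega>) \<le> \<bar>c\<bar> * norm (\<alpha> s \<omega>)"
    by eventually_elim (auto intro!: order_trans[OF norm_matrix_vector_le] mult_right_mono)
  then show ?thesis
    by (intro L2F_L1_scale[OF \<alpha> prog_mv[OF km L2F_L1_prog[OF \<alpha>]], of "\<bar>c\<bar>"]) auto
qed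

lemma L2F_L1_linear:
  assumes \<alpha>: "\<alpha> \<in> L2F_L1 M F a b" and h: "bounded_linear h"
  shows "(\<lambda>s \<omega>. h (\<alpha> s \<omega>)) \<in> L2F_L1 M F a b"
proof -
  obtain c where c: "0 \<le> c" "\<And>x. norm (h x) \<le> c * norm x"
    using bounded_linear.nonneg_bounded[OF h] by (auto simp: mult.commute)
  show ?thesis
    by (rule L2F_L1_scale[OF \<alpha> prog_linear[OF L2F_L1_prog[OF \<alpha>] h] c(1)]) (use c(2) in auto)
qed

lemma Lp_measurable: "k \<in> Lp p a b \<Longrightarrow> k \<in> borel_measurable L"
  and Lp_integrable: "k \<in> Lp p a b \<Longrightarrow> integrable L (\<lambda>s. norm (k s) ^ p)"
  by (simp_all add: Lp_def set_borel_measurable_leb_on set_integrable_leb_on)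

text \<open>The time integral of \<open>norm (k s *v X s \<omega>)\<close> is at most the integral of the norm of \<open>k\<close> times the
  square-integrable bound of the path.\<close>

lemma L2F_L1_Lp1:
  fixes k :: "real \<Rightarrow> real^'n::finite^'m::finite"
  assumes k: "k \<in> Lp 1 a b" and X: "X \<in> L2F_C M F a b"
  shows "(\<lambda>s \<omega>. k s *v X s \<omega>) \<in> L2F_L1 M F a b"
proof -
  obtain m where m: "m \<in> borel_measurable M" "integrable M (\<lambda>\<omega>. (m \<omega>)\<^sup>2)"
      "\<And>\<omega>. 0 \<le> m \<omega>" "\<And>\<omega> s. \<omega> \<in> space M \<Longrightarrow> s \<in> {a..b} \<Longrightarrow> norm (X s \<omega>) \<le> m \<omega>"
    using L2F_C_dominated[OF X] by metis
  note km [measurable] = Lp_measurable[OF k]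
  let ?\<kappa> = "\<integral>\<^sup>+s. ennreal (norm (k s)) \<partial>L"
  have \<kappa>: "?\<kappa> < \<infinity>" using Lp_integrable[OF k] by (simp add: integrable_iff_bounded)
  show ?thesis
  proof (rule L2F_L1_bound)
    show "prog_measurable F a b (\<lambda>s \<omega>. k s *v X s \<omega>)" by (rule prog_mv[OF km L2F_C_prog[OF X]])
    have [measurable]: "m \<in> borel_measurable M" by fact
    have "(\<integral>\<^sup>+\<omega>. (?\<kappa> * ennreal (m \<omega>))\<^sup>2 \<partial>M) = ?\<kappa>\<^sup>2 * (\<integral>\<^sup>+\<omega>. ennreal ((m \<omega>)\<^sup>2) \<partial>M)"
      using m(3) by (simp add: power_mult_distrib nn_integral_cmult ennreal_power)
    also have "\<dots> < \<infinity>" using \<kappa> m(2) by (simp add: integrable_iff_bounded ennreal_mult_less_top power2_eq_square)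
    finally show "(\<integral>\<^sup>+\<omega>. (?\<kappa> * ennreal (m \<omega>))\<^sup>2 \<partial>M) < \<infinity>" .
    show "AE \<omega> in M. (\<integral>\<^sup>+s. ennreal (norm (k s *v X s \<omega>)) \<partial>L) \<le> ?\<kappa> * ennreal (m \<omega>)"
    proof (rule AE_I2)
      fix \<omega> assume \<omega>: "\<omega> \<in> space M"
      have "(\<integral>\<^sup>+s. ennreal (norm (k s *v X s \<omega>)) \<partial>L) \<le> (\<integral>\<^sup>+s. ennreal (norm (k s)) * ennreal (m \<omega>) \<partial>L)"
        using m(3,4) \<omega> by (intro nn_integral_mono)
          (auto simp flip: ennreal_mult intro!: ennreal_leI order_trans[OF norm_matrix_vector_le] mult_left_mono)
      also have "\<dots> = ?\<kappa> * ennreal (m \<omega>)" by (rule nn_integral_multc) measurable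
      finally show "(\<integral>\<^sup>+s. ennreal (norm (k s *v X s \<omega>)) \<partial>L) \<le> ?\<kappa> * ennreal (m \<omega>)" .
    qed
  qed
qed

lemma L2F_Lp2:
  fixes k :: "real \<Rightarrow> real^'n::finite^'m::finite"
  assumes k: "k \<in> Lp 2 a b" and X: "X \<in> L2F_C M F a b"
  shows "(\<lambda>s \<omega>. k s *v X s \<omega>) \<in> L2F M F a b"
proof -
  interpret P: pair_sigma_finite L M by (rule pair_sf)
  obtain m where m: "m \<in> borel_measurable M" "integrable M (\<lambda>\<omega>. (m \<omega>)\<^sup>2)"
      "\<And>\<omega>. 0 \<le> m \<omega>" "\<And>\<omega> s. \<omega> \<in> space M \<Longrightarrow> s \<in> {a..b} \<Longrightarrow> norm (X s \<omega>) \<le> m \<omega>"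
    using L2F_C_dominated[OF X] by metis
  have pr: "prog_measurable F a b (\<lambda>s \<omega>. k s *v X s \<omega>)"
    by (rule prog_mv[OF Lp_measurable[OF k] L2F_C_prog[OF X]])
  note [measurable] = prog_joint[OF pr]
  have km2: "integrable LM (\<lambda>(s, \<omega>). (norm (k s))\<^sup>2 * (m \<omega>)\<^sup>2)"
    by (rule integrable_pair_mult[OF sigma_finite_leb_on sigma_finite_measure_axioms Lp_integrable[OF k] m(2)])
  have "integrable LM (\<lambda>(s, \<omega>). (norm (k s *v X s \<omega>))\<^sup>2)"
  proof (rule Bochner_Integration.integrable_bound[OF km2])
    show "AE z in LM. norm (case z of (s, \<omega>) \<Rightarrow> (norm (k s *v X s \<omega>))\<^sup>2) \<le>
        norm (case z of (s, \<omega>) \<Rightarrow> (norm (k s))\<^sup>2 * (m \<omega>)\<^sup>2)"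
    proof (rule AE_I2)
      fix z assume "z \<in> space LM"
      then obtain s \<omega> where z: "z = (s, \<omega>)" "s \<in> {a..b}" "\<omega> \<in> space M" by (auto simp: space_pair_measure)
      have "norm (k s *v X s \<omega>) \<le> norm (k s) * m \<omega>"
        using m(4)[OF z(3,2)] by (intro order_trans[OF norm_matrix_vector_le] mult_left_mono) auto
      then have "(norm (k s *v X s \<omega>))\<^sup>2 \<le> (norm (k s) * m \<omega>)\<^sup>2" by (rule power_mono) simp
      then show "norm (case z of (s, \<omega>) \<Rightarrow> (norm (k s *v X s \<omega>))\<^sup>2) \<le>
        norm (case z of (s, \<omega>) \<Rightarrow> (norm (k s))\<^sup>2 * (m \<omega>)\<^sup>2)" by (simp add: z power_mult_distrib)
    qed
  qed (simp add: split_beta'; measurable)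
  with pr show ?thesis by (simp add: L2F_iff)
qed

lemma L2F_path_nn_integral:
  assumes u: "u \<in> L2F M F a b"
  shows "(\<integral>\<^sup>+\<omega>. (\<integral>\<^sup>+s. (ennreal (norm (u s \<omega>)))\<^sup>2 \<partial>L) \<partial>M) < \<infinity>"
  using u unfolding L2F_def by (simp add: nn_set_integral_leb_on ennreal_power)

text \<open>Cauchy-Schwarz in the time variable.\<close>

lemma L2F_L1_Lp2:
  fixes k :: "real \<Rightarrow> real^'n::finite^'m::finite"
  assumes k: "k \<in> Lp 2 a b" and u: "u \<in> L2F M F a b"
  shows "(\<lambda>s \<omega>. k s *v u s \<omega>) \<in> L2F_L1 M F a b"
proof -
  have pr: "prog_measurable F a b (\<lambda>s \<omega>. k s *v u s \<omega>)"
    by (rule prog_mv[OF Lp_measurable[OF k] L2F_prog[OF u]])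
  let ?\<kappa> = "\<integral>\<^sup>+s. (ennreal (norm (k s)))\<^sup>2 \<partial>L"
  have \<kappa>: "?\<kappa> < \<infinity>" using Lp_integrable[OF k] by (simp add: integrable_iff_bounded ennreal_power)
  have [measurable]: "(\<lambda>\<omega>. \<integral>\<^sup>+s. (ennreal (norm (u s \<omega>)))\<^sup>2 \<partial>L) \<in> borel_measurable M"
  proof (rule sigma_finite_measure.borel_measurable_nn_integral[OF sigma_finite_leb_on])
    have "(\<lambda>(s, \<omega>). (ennreal (norm (u s \<omega>)))\<^sup>2) \<in> borel_measurable LM"
      using prog_joint[OF L2F_prog[OF u]]
      by (auto simp: split_beta' intro!: borel_measurable_power_ennreal measurable_compose[OF _
          measurable_ennreal] borel_measurable_norm)
    from measurable_pair_swap[OF this]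
    show "(\<lambda>(\<omega>, s). (ennreal (norm (u s \<omega>)))\<^sup>2) \<in> borel_measurable (M \<Otimes>\<^sub>M L)"
      by (simp add: split_beta')
  qed
  have "(\<integral>\<^sup>+\<omega>. (\<integral>\<^sup>+s. ennreal (norm (k s *v u s \<omega>)) \<partial>L)\<^sup>2 \<partial>M) \<le>
      (\<integral>\<^sup>+\<omega>. ?\<kappa> * (\<integral>\<^sup>+s. (ennreal (norm (u s \<omega>)))\<^sup>2 \<partial>L) \<partial>M)"
  proof (rule nn_integral_mono)
    fix \<omega> assume \<omega>: "\<omega> \<in> space M"
    note [measurable] = prog_section_measurable[OF L2F_prog[OF u] \<omega>] Lp_measurable[OF k]
    have "(\<integral>\<^sup>+s. ennreal (norm (k s *v u s \<omega>)) \<partial>L) \<le> (\<integral>\<^sup>+s. ennreal (norm (k s)) * ennreal (norm (u s \<omega>)) \<partial>L)"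
      by (intro nn_integral_mono) (auto simp flip: ennreal_mult intro!: ennreal_leI norm_matrix_vector_le)
    then have "(\<integral>\<^sup>+s. ennreal (norm (k s *v u s \<omega>)) \<partial>L)\<^sup>2 \<le> (\<integral>\<^sup>+s. ennreal (norm (k s)) * ennreal (norm (u s \<omega>)) \<partial>L)\<^sup>2"
      by (rule power_mono) simp
    also have "\<dots> \<le> ?\<kappa> * (\<integral>\<^sup>+s. (ennreal (norm (u s \<omega>)))\<^sup>2 \<partial>L)"
      by (rule Cauchy_Schwarz_nn_integral) measurable
    finally show "(\<integral>\<^sup>+s. ennreal (norm (k s *v u s \<omega>)) \<partial>L)\<^sup>2 \<le> ?\<kappa> * (\<integral>\<^sup>+s. (ennreal (norm (u s \<omega>)))\<^sup>2 \<partial>L)" .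
  qed
  also have "\<dots> = ?\<kappa> * (\<integral>\<^sup>+\<omega>. (\<integral>\<^sup>+s. (ennreal (norm (u s \<omega>)))\<^sup>2 \<partial>L) \<partial>M)"
    by (rule nn_integral_cmult) measurable
  also have "\<dots> < \<infinity>" using \<kappa> L2F_path_nn_integral[OF u] by (simp add: ennreal_mult_less_top)
  finally show ?thesis using pr by (simp add: L2F_L1_iff)
qed

subsection \<open>Integrability over time and chance\<close>

text \<open>Cauchy-Schwarz on the probability space: total variation and path bound are both square-integrable.\<close>

lemma integrable_L1_dominated:
  fixes f :: "real \<Rightarrow> 'w \<Rightarrow> real"
  assumes \<alpha>: "\<alpha> \<in> L2F_L1 M F a b"
    and m: "m \<in> borel_measurable M" "integrable M (\<lambda>\<omega>. (m \<omega>)\<^sup>2)" "\<And>\<omega>. 0 \<le> m \<omega>"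
    and f: "(\<lambda>(s, \<omega>). f s \<omega>) \<in> borel_measurable LM"
    and le: "AE \<omega> in M. \<forall>s\<in>{a..b}. \<bar>f s \<omega>\<bar> \<le> norm (\<alpha> s \<omega>) * m \<omega>"
  shows "integrable LM (\<lambda>(s, \<omega>). f s \<omega>)"
proof -
  interpret P: pair_sigma_finite L M by (rule pair_sf)
  let ?A = "\<lambda>\<omega>. \<integral>\<^sup>+s. ennreal (norm (\<alpha> s \<omega>)) \<partial>L"
  note [measurable] = path_nn_integral_measurable[OF L2F_L1_prog[OF \<alpha>]] m(1)
  have "(\<integral>\<^sup>+z. ennreal (norm (case_prod f z)) \<partial>LM) = (\<integral>\<^sup>+\<omega>. (\<integral>\<^sup>+s. ennreal \<bar>f s \<omega>\<bar> \<partial>L) \<partial>M)"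
    using f by (subst P.nn_integral_snd[symmetric]) (simp_all add: split_beta')
  also have "\<dots> \<le> (\<integral>\<^sup>+\<omega>. ?A \<omega> * ennreal (m \<omega>) \<partial>M)"
  proof (rule nn_integral_mono_AE)
    show "AE \<omega> in M. (\<integral>\<^sup>+s. ennreal \<bar>f s \<omega>\<bar> \<partial>L) \<le> ?A \<omega> * ennreal (m \<omega>)"
      using le AE_space
    proof eventually_elim
      case (elim \<omega>)
      note [measurable] = prog_section_measurable[OF L2F_L1_prog[OF \<alpha>] elim(2)]
      have "(\<integral>\<^sup>+s. ennreal \<bar>f s \<omega>\<bar> \<partial>L) \<le> (\<integral>\<^sup>+s. ennreal (norm (\<alpha> s \<omega>)) * ennreal (m \<omega>) \<partial>L)"
        using elim(1) m(3) by (intro nn_integral_mono) (auto simp flip: ennreal_mult intro!: ennreal_leI)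
      also have "\<dots> = ?A \<omega> * ennreal (m \<omega>)" by (rule nn_integral_multc) measurable
      finally show ?case .
    qed
  qed
  also have "\<dots> < \<infinity>"
    using \<alpha> m by (intro nn_integral_mult_finite) (auto simp: L2F_L1_iff ennreal_power integrable_iff_bounded)
  finally show ?thesis using f by (simp add: integrable_iff_bounded)
qed

lemma integrable_L2_L2:
  fixes f :: "real \<Rightarrow> 'w \<Rightarrow> real"
  assumes u: "u \<in> L2F M F a b" and v: "v \<in> L2F M F a b"
    and f: "(\<lambda>(s, \<omega>). f s \<omega>) \<in> borel_measurable LM"
    and le: "\<And>s \<omega>. \<omega> \<in> space M \<Longrightarrow> s\<in>{a..b} \<Longrightarrow> \<bar>f s \<omega>\<bar> \<le> norm (u s \<omega>) * norm (v s \<omega>)"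
  shows "integrable LM (\<lambda>(s, \<omega>). f s \<omega>)"
proof (rule Bochner_Integration.integrable_bound)
  note [measurable] = prog_joint[OF L2F_prog[OF u]] prog_joint[OF L2F_prog[OF v]]
  show "integrable LM (\<lambda>z. norm (case_prod u z) * norm (case_prod v z))"
    using L2F_sq[OF u] L2F_sq[OF v] by (intro integrable_mult_L2) (simp_all add: split_beta')
  show "AE z in LM. norm (case z of (s, \<omega>) \<Rightarrow> f s \<omega>) \<le> norm (norm (case_prod u z) * norm (case_prod v z))"
    using le by (intro AE_I2) (auto simp: space_pair_measure)
qed (rule f)

text \<open>The absolute value of \<open>k s\<close> is used because \<open>k\<close> will be the density of a Riccati component, which has no sign.\<close>

lemma integrable_time_process:
  fixes f :: "real \<Rightarrow> 'w \<Rightarrow> real"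
  assumes k: "integrable L k" and m: "integrable M m" and f: "(\<lambda>(s, \<omega>). f s \<omega>) \<in> borel_measurable LM"
    and le: "AE \<omega> in M. \<forall>s\<in>{a..b}. \<bar>f s \<omega>\<bar> \<le> \<bar>k s\<bar> * m \<omega>"
  shows "integrable LM (\<lambda>(s, \<omega>). f s \<omega>)"
proof -
  interpret P: pair_sigma_finite L M by (rule pair_sf)
  note [measurable] = f
  have [measurable]: "k \<in> borel_measurable L" "m \<in> borel_measurable M" using k m by auto
  have i: "integrable LM (\<lambda>(s, \<omega>). k s * m \<omega>)"
    by (rule integrable_pair_mult[OF sigma_finite_leb_on sigma_finite_measure_axioms k m])
  show ?thesis
  proof (rule Bochner_Integration.integrable_bound[OF i f])
    show "AE z in LM. norm (case z of (s, \<omega>) \<Rightarrow> f s \<omega>) \<le> norm (case z of (s, \<omega>) \<Rightarrow> k s * m \<omega>)"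
    proof (rule P.AE_pair_measure)
      show "AE s in L. AE \<omega> in M. norm (case (s, \<omega>) of (s, \<omega>) \<Rightarrow> f s \<omega>) \<le> norm (case (s, \<omega>) of (s, \<omega>) \<Rightarrow> k s * m \<omega>)"
      proof (rule AE_I2)
        fix s assume "s \<in> space L"
        then have s: "s \<in> {a..b}" by simp
        show "AE \<omega> in M. norm (case (s, \<omega>) of (s, \<omega>) \<Rightarrow> f s \<omega>) \<le> norm (case (s, \<omega>) of (s, \<omega>) \<Rightarrow> k s * m \<omega>)"
          using le
        proof eventually_elim
          case (elim \<omega>)
          then have "\<bar>f s \<omega>\<bar> \<le> \<bar>k s\<bar> * m \<omega>" using s by blast
          also have "\<dots> \<le> \<bar>k s\<bar> * \<bar>m \<omega>\<bar>" by (intro mult_left_mono) auto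
          finally show ?case by (simp add: abs_mult)
        qed
      qed
    qed measurable
  qed
qed

lemma time_expectation:
  fixes f :: "real \<Rightarrow> 'w \<Rightarrow> real"
  assumes f: "integrable LM (\<lambda>(s, \<omega>). f s \<omega>)"
  shows "AE s in L. integrable M (f s)"
    and "AE \<omega> in M. set_integrable lborel {a..b} (\<lambda>s. f s \<omega>)"
    and "integrable L (\<lambda>s. LINT \<omega>|M. f s \<omega>)"
    and "integrable M (\<lambda>\<omega>. LINT s:{a..b}|lborel. f s \<omega>)"
    and "(LINT \<omega>|M. (LINT s:{a..b}|lborel. f s \<omega>)) = (LINT z|LM. case_prod f z)"
    and "(LINT \<omega>|M. (LINT s:{a..b}|lborel. f s \<omega>)) = (LINT s|L. (LINT \<omega>|M. f s \<omega>))"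
proof -
  interpret P: pair_sigma_finite L M by (rule pair_sf)
  show "AE s in L. integrable M (f s)" using P.AE_integrable_fst[OF f] .
  show "AE \<omega> in M. set_integrable lborel {a..b} (\<lambda>s. f s \<omega>)"
    unfolding set_integrable_leb_on using P.AE_integrable_snd[OF f] .
  show "integrable L (\<lambda>s. LINT \<omega>|M. f s \<omega>)" by (rule P.integrable_fst[OF f])
  show "integrable M (\<lambda>\<omega>. LINT s:{a..b}|lborel. f s \<omega>)"
    unfolding set_lebesgue_integral_leb_on by (rule P.integrable_snd[OF f])
  show 1: "(LINT \<omega>|M. (LINT s:{a..b}|lborel. f s \<omega>)) = (LINT z|LM. case_prod f z)"
    unfolding set_lebesgue_integral_leb_on by (rule P.integral_snd[OF f])
  show "(LINT \<omega>|M. (LINT s:{a..b}|lborel. f s \<omega>)) = (LINT s|L. (LINT \<omega>|M. f s \<omega>))"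
    unfolding 1 by (rule P.integral_fst[OF f, symmetric])
qed

lemma time_expectation_upto:
  fixes f :: "real \<Rightarrow> 'w \<Rightarrow> real"
  assumes f: "integrable LM (\<lambda>(s, \<omega>). f s \<omega>)" and s: "s \<in> {a..b}"
  shows "integrable LM (\<lambda>(r, \<omega>). indicator {a..s} r * f r \<omega>)"
    and "integrable M (\<lambda>\<omega>. LINT r:{a..s}|lborel. f r \<omega>)"
    and "(LINT \<omega>|M. (LINT r:{a..s}|lborel. f r \<omega>)) = (LINT r:{a..s}|lborel. (LINT \<omega>|M. f r \<omega>))"
proof -
  have [measurable]: "(\<lambda>(s, \<omega>). f s \<omega>) \<in> borel_measurable LM" using f by auto
  have [measurable]: "(indicator {a..s} :: real \<Rightarrow> real) \<in> borel_measurable L"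
    unfolding leb_on_def by (rule measurable_restrict_space1) simp
  show i: "integrable LM (\<lambda>(r, \<omega>). indicator {a..s} r * f r \<omega>)"
  proof (rule Bochner_Integration.integrable_bound[OF f])
    show "(\<lambda>(r, \<omega>). indicator {a..s} r * f r \<omega>) \<in> borel_measurable LM" by measurable
  qed (auto simp: split_beta' indicator_def)
  have eq: "(LINT r:{a..b}|lborel. indicator {a..s} r * g r) = (LINT r:{a..s}|lborel. g r)" for g :: "real \<Rightarrow> real"
    using s unfolding set_lebesgue_integral_def
    by (intro Bochner_Integration.integral_cong) (auto simp: indicator_def)
  show "integrable M (\<lambda>\<omega>. LINT r:{a..s}|lborel. f r \<omega>)"
    using time_expectation(4)[OF i] by (simp add: eq)
  show "(LINT \<omega>|M. (LINT r:{a..s}|lborel. f r \<omega>)) = (LINT r:{a..s}|lborel. (LINT \<omega>|M. f r \<omega>))"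
    using time_expectation(6)[OF i] eq unfolding set_lebesgue_integral_leb_on[symmetric] by simp
qed

end

section \<open>The Ito integral\<close>

subsection \<open>Mean-square convergence\<close>

lemma Cauchy_Schwarz_integral:
  fixes f g :: "'a \<Rightarrow> real"
  assumes "f \<in> borel_measurable N" "g \<in> borel_measurable N"
    and f2: "integrable N (\<lambda>x. (f x)\<^sup>2)" and g2: "integrable N (\<lambda>x. (g x)\<^sup>2)"
  shows "\<bar>LINT x|N. f x * g x\<bar> \<le> sqrt (LINT x|N. (f x)\<^sup>2) * sqrt (LINT x|N. (g x)\<^sup>2)"
proof -
  note [measurable] = assms(1,2)
  have fg: "integrable N (\<lambda>x. f x * g x)" by (rule integrable_mult_L2[OF assms])
  have "ennreal (LINT x|N. \<bar>f x * g x\<bar>) = (\<integral>\<^sup>+x. ennreal \<bar>f x\<bar> * ennreal \<bar>g x\<bar> \<partial>N)"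
    using nn_integral_eq_integral[OF integrable_abs[OF fg]] by (simp add: abs_mult ennreal_mult)
  then have "(ennreal (LINT x|N. \<bar>f x * g x\<bar>))\<^sup>2 \<le> (\<integral>\<^sup>+x. (ennreal \<bar>f x\<bar>)\<^sup>2 \<partial>N) * (\<integral>\<^sup>+x. (ennreal \<bar>g x\<bar>)\<^sup>2 \<partial>N)"
    using Cauchy_Schwarz_nn_integral[of "\<lambda>x. ennreal \<bar>f x\<bar>" N "\<lambda>x. ennreal \<bar>g x\<bar>"] by simp
  also have "\<dots> = ennreal (LINT x|N. (f x)\<^sup>2) * ennreal (LINT x|N. (g x)\<^sup>2)"
    using f2 g2 by (simp add: ennreal_power nn_integral_eq_integral)
  finally have "(LINT x|N. \<bar>f x * g x\<bar>)\<^sup>2 \<le> (LINT x|N. (f x)\<^sup>2) * (LINT x|N. (g x)\<^sup>2)"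
    by (simp add: ennreal_power flip: ennreal_mult)
  then have "(LINT x|N. \<bar>f x * g x\<bar>) \<le> sqrt ((LINT x|N. (f x)\<^sup>2) * (LINT x|N. (g x)\<^sup>2))"
    by (rule real_le_rsqrt)
  with integral_abs_bound[of N "\<lambda>x. f x * g x"] show ?thesis
    unfolding real_sqrt_mult by (rule order_trans)
qed

text \<open>Joint continuity of the inner product in mean square; it transfers the isometry and the martingale
  property from simple integrands to their limits.\<close>

lemma tendsto_integral_mult_L2:
  fixes f g :: "'a \<Rightarrow> real" and fn gn :: "nat \<Rightarrow> 'a \<Rightarrow> real"
  assumes m: "f \<in> borel_measurable N" "g \<in> borel_measurable N"
      "\<And>n. fn n \<in> borel_measurable N" "\<And>n. gn n \<in> borel_measurable N"
    and f2: "integrable N (\<lambda>x. (f x)\<^sup>2)" and g2: "integrable N (\<lambda>x. (g x)\<^sup>2)"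
    and fn2: "\<And>n. integrable N (\<lambda>x. (fn n x)\<^sup>2)" and gn2: "\<And>n. integrable N (\<lambda>x. (gn n x)\<^sup>2)"
    and f: "(\<lambda>n. \<integral>\<^sup>+x. ennreal ((fn n x - f x)\<^sup>2) \<partial>N) \<longlonglongrightarrow> 0"
    and g: "(\<lambda>n. \<integral>\<^sup>+x. ennreal ((gn n x - g x)\<^sup>2) \<partial>N) \<longlonglongrightarrow> 0"
  shows "(\<lambda>n. LINT x|N. fn n x * gn n x) \<longlonglongrightarrow> (LINT x|N. f x * g x)"
proof -
  note [measurable] = m
  have sq_diff: "integrable N (\<lambda>x. (u x - v x)\<^sup>2)"
    if "u \<in> borel_measurable N" "v \<in> borel_measurable N"
      "integrable N (\<lambda>x. (u x)\<^sup>2)" "integrable N (\<lambda>x. (v x)\<^sup>2)" for u v :: "'a \<Rightarrow> real"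
    using that integrable_mult_L2[OF that] unfolding power2_diff
    by (auto simp: mult.assoc)
  have df: "integrable N (\<lambda>x. (fn n x - f x)\<^sup>2)" and dg: "integrable N (\<lambda>x. (gn n x - g x)\<^sup>2)" for n
    by (intro sq_diff m f2 g2 fn2 gn2)+
  define A where "A n = sqrt (LINT x|N. (fn n x - f x)\<^sup>2)" for n
  define B where "B n = sqrt (LINT x|N. (gn n x - g x)\<^sup>2)" for n
  have A: "A \<longlonglongrightarrow> 0"
  proof -
    have "(\<lambda>n. ennreal (LINT x|N. (fn n x - f x)\<^sup>2)) \<longlonglongrightarrow> ennreal 0"
      using f df by (simp add: nn_integral_eq_integral)
    then have "(\<lambda>n. LINT x|N. (fn n x - f x)\<^sup>2) \<longlonglongrightarrow> 0" by (subst (asm) tendsto_ennreal_iff) auto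
    from tendsto_real_sqrt[OF this] show ?thesis unfolding A_def by simp
  qed
  have B: "B \<longlonglongrightarrow> 0"
  proof -
    have "(\<lambda>n. ennreal (LINT x|N. (gn n x - g x)\<^sup>2)) \<longlonglongrightarrow> ennreal 0"
      using g dg by (simp add: nn_integral_eq_integral)
    then have "(\<lambda>n. LINT x|N. (gn n x - g x)\<^sup>2) \<longlonglongrightarrow> 0" by (subst (asm) tendsto_ennreal_iff) auto
    from tendsto_real_sqrt[OF this] show ?thesis unfolding B_def by simp
  qed
  let ?f = "sqrt (LINT x|N. (f x)\<^sup>2)" and ?g = "sqrt (LINT x|N. (g x)\<^sup>2)"
  have "(\<lambda>n. (LINT x|N. fn n x * gn n x) - (LINT x|N. f x * g x)) \<longlonglongrightarrow> 0"
  proof (rule Lim_null_comparison[OF always_eventually[OF allI]])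
    fix n
    have i: "integrable N (\<lambda>x. (fn n x - f x) * (gn n x - g x))"
      "integrable N (\<lambda>x. (fn n x - f x) * g x)" "integrable N (\<lambda>x. f x * (gn n x - g x))"
      "integrable N (\<lambda>x. f x * g x)" "integrable N (\<lambda>x. fn n x * gn n x)"
      by (intro integrable_mult_L2 borel_measurable_diff m df dg f2 g2 fn2 gn2)+
    have "(LINT x|N. fn n x * gn n x) - (LINT x|N. f x * g x) = (LINT x|N. fn n x * gn n x - f x * g x)"
      using i by simp
    also have "\<dots> = (LINT x|N. (fn n x - f x) * (gn n x - g x) + (fn n x - f x) * g x + f x * (gn n x - g x))"
      by (rule Bochner_Integration.integral_cong) (auto simp: algebra_simps)
    also have "\<dots> = (LINT x|N. (fn n x - f x) * (gn n x - g x)) + (LINT x|N. (fn n x - f x) * g x)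
         + (LINT x|N. f x * (gn n x - g x))"
      using i by simp
    also have "\<bar>\<dots>\<bar> \<le> A n * B n + A n * ?g + ?f * B n"
      unfolding A_def B_def
      by (intro order_trans[OF abs_triangle_ineq] add_mono Cauchy_Schwarz_integral
          borel_measurable_diff m df dg f2 g2)
    finally show "norm ((LINT x|N. fn n x * gn n x) - (LINT x|N. f x * g x)) \<le> A n * B n + A n * ?g + ?f * B n"
      by simp
    show "(\<lambda>n. A n * B n + A n * ?g + ?f * B n) \<longlonglongrightarrow> 0"
      using tendsto_add[OF tendsto_add[OF tendsto_mult[OF A B] tendsto_mult_right[OF A, of ?g]]
          tendsto_mult_left[OF B, of ?f]]
      by simp
  qed
  then show ?thesis by (rule LIM_zero_cancel)
qed

context brownian_space
begin

subsection \<open>Brownian increments\<close>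

text \<open>Independence is assumed between \<open>\<sigma>\<close>-algebras and preimages; the preimages under one random variable
  already form a \<open>\<sigma>\<close>-algebra, so this is independence of the random variables.\<close>

lemma increment_indep:
  assumes "0 \<le> r" "r < s" and Z: "Z \<in> borel_measurable (F r)"
  shows "indep_var borel Z borel (\<lambda>\<omega>. W s \<omega> - W r \<omega>)"
proof -
  let ?D = "\<lambda>\<omega>. W s \<omega> - W r \<omega>"
  have ind: "indep_set (sets (F r)) {?D -` E \<inter> space M | E. E \<in> sets borel}"
    using brownian assms unfolding brownian_motion_def by blast
  have "sigma_sets (space M) {Z -` A \<inter> space M | A. A \<in> sets borel} \<subseteq> sets (F r)"
  proof -
    have "{Z -` A \<inter> space M | A. A \<in> sets borel} \<subseteq> sets (F r)"
      using measurable_sets[OF Z, unfolded space_F] by blast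
    from sets.sigma_sets_subset[OF this] show ?thesis unfolding space_F .
  qed
  moreover have "sigma_sets (space M) {?D -` A \<inter> space M | A. A \<in> sets borel} = {?D -` E \<inter> space M | E. E \<in> sets borel}"
    using sets_vimage_algebra2[of ?D "space M" borel] by (simp add: sets_vimage_algebra)
  ultimately show ?thesis
    using ind measurable_F_M[OF Z] borel_measurable_diff[OF W_M[of s] W_M[of r]] assms
    unfolding indep_var_eq indep_sets2_eq by simp blast
qed

lemma increment_moments:
  assumes "0 \<le> r" "r < s"
  shows "integrable M (\<lambda>\<omega>. W s \<omega> - W r \<omega>)" "(LINT \<omega>|M. W s \<omega> - W r \<omega>) = 0"
    "integrable M (\<lambda>\<omega>. (W s \<omega> - W r \<omega>)\<^sup>2)" "(LINT \<omega>|M. (W s \<omega> - W r \<omega>)\<^sup>2) = s - r"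
proof -
  let ?D = "\<lambda>\<omega>. W s \<omega> - W r \<omega>" and ?d = "normal_density 0 (sqrt (s - r))"
  have D: "distributed M lborel ?D (\<lambda>x. ennreal (?d x))"
    using brownian assms unfolding brownian_motion_def by blast
  have pos: "0 < sqrt (s - r)" using assms by simp
  have int: "integrable M (\<lambda>\<omega>. (?D \<omega>) ^ k)" for k
    using integrable_normal_moment[OF pos, of 0 k] distributed_integrable[OF D, of "\<lambda>x. x ^ k"] by simp
  show 1: "integrable M ?D" using int[of 1] by simp
  show "integrable M (\<lambda>\<omega>. (?D \<omega>)\<^sup>2)" by (rule int)
  show 2: "(LINT \<omega>|M. ?D \<omega>) = 0" by (rule normal_distributed_expectation[OF pos D])
  show "(LINT \<omega>|M. (?D \<omega>)\<^sup>2) = s - r"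
    using normal_distributed_variance[OF pos D] 2 assms by simp
qed

lemma increment_orthogonal:
  assumes "0 \<le> r" "r \<le> s" and Z: "Z \<in> borel_measurable (F r)" "integrable M Z"
  shows "integrable M (\<lambda>\<omega>. Z \<omega> * (W s \<omega> - W r \<omega>))" "(LINT \<omega>|M. Z \<omega> * (W s \<omega> - W r \<omega>)) = 0"
proof -
  have "integrable M (\<lambda>\<omega>. Z \<omega> * (W s \<omega> - W r \<omega>)) \<and> (LINT \<omega>|M. Z \<omega> * (W s \<omega> - W r \<omega>)) = 0"
  proof (cases "r = s")
    case False
    then have "r < s" using assms by simp
    note i = increment_indep[OF assms(1) this Z(1)] and m = increment_moments[OF assms(1) this]
    show ?thesis
      using indep_var_integrable[OF i Z(2) m(1)] indep_var_lebesgue_integral[OF i Z(2) m(1)] m(2) by simp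
  qed simp
  then show "integrable M (\<lambda>\<omega>. Z \<omega> * (W s \<omega> - W r \<omega>))" "(LINT \<omega>|M. Z \<omega> * (W s \<omega> - W r \<omega>)) = 0"
    by auto
qed

lemma increment_square:
  assumes "0 \<le> r" "r \<le> s" and Z: "Z \<in> borel_measurable (F r)" "integrable M Z"
  shows "integrable M (\<lambda>\<omega>. Z \<omega> * (W s \<omega> - W r \<omega>)\<^sup>2)"
    "(LINT \<omega>|M. Z \<omega> * (W s \<omega> - W r \<omega>)\<^sup>2) = (LINT \<omega>|M. Z \<omega>) * (s - r)"
proof -
  have "integrable M (\<lambda>\<omega>. Z \<omega> * (W s \<omega> - W r \<omega>)\<^sup>2) \<and> 
     (LINT \<omega>|M. Z \<omega> * (W s \<omega> - W r \<omega>)\<^sup>2) = (LINT \<omega>|M. Z \<omega>) * (s - r)"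
  proof (cases "r = s")
    case False
    then have "r < s" using assms by simp
    note m = increment_moments[OF assms(1) this]
    have i: "indep_var borel Z borel (\<lambda>\<omega>. (W s \<omega> - W r \<omega>)\<^sup>2)"
      using indep_var_compose[OF increment_indep[OF assms(1) \<open>r < s\<close> Z(1)], of "\<lambda>x. x" borel "\<lambda>x. x\<^sup>2" borel]
      by (simp add: comp_def)
    show ?thesis
      using indep_var_integrable[OF i Z(2) m(3)] indep_var_lebesgue_integral[OF i Z(2) m(3)] m(4) by simp
  qed simp
  then show "integrable M (\<lambda>\<omega>. Z \<omega> * (W s \<omega> - W r \<omega>)\<^sup>2)"
    "(LINT \<omega>|M. Z \<omega> * (W s \<omega> - W r \<omega>)\<^sup>2) = (LINT \<omega>|M. Z \<omega>) * (s - r)"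
    by auto
qed

lemma integrable_increment_square:
  assumes "0 \<le> r" "r \<le> s"
  shows "integrable M (\<lambda>\<omega>. (W s \<omega> - W r \<omega>)\<^sup>2)"
  using increment_square(1)[OF assms borel_measurable_const[of 1] integrable_const[of 1]] by simp

lemma integrable_bounded_mult:
  fixes Z f :: "'w \<Rightarrow> real"
  assumes "Z \<in> borel_measurable M" "bounded (Z ` space M)" "integrable M f"
  shows "integrable M (\<lambda>\<omega>. Z \<omega> * f \<omega>)"
proof -
  from assms(2) obtain c where c: "\<And>\<omega>. \<omega> \<in> space M \<Longrightarrow> \<bar>Z \<omega>\<bar> \<le> c" unfolding bounded_iff by auto
  show ?thesis
  proof (rule Bochner_Integration.integrable_bound)
    show "integrable M (\<lambda>\<omega>. c * f \<omega>)" using assms(3) by simp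
    show "AE \<omega> in M. norm (Z \<omega> * f \<omega>) \<le> norm (c * f \<omega>)"
    proof (rule AE_I2)
      fix \<omega> assume "\<omega> \<in> space M"
      then have "\<bar>Z \<omega>\<bar> \<le> \<bar>c\<bar>" using c[of \<omega>] by linarith
      then show "norm (Z \<omega> * f \<omega>) \<le> norm (c * f \<omega>)" by (simp add: abs_mult mult_right_mono)
    qed
  qed (use assms in measurable)
qed

lemma bounded_mult_image:
  fixes Z Y :: "'w \<Rightarrow> real"
  assumes "bounded (Z ` S)" "bounded (Y ` S)"
  shows "bounded ((\<lambda>\<omega>. Z \<omega> * Y \<omega>) ` S)"
proof -
  obtain c d where c: "\<And>\<omega>. \<omega> \<in> S \<Longrightarrow> \<bar>Z \<omega>\<bar> \<le> c" and d: "\<And>\<omega>. \<omega> \<in> S \<Longrightarrow> \<bar>Y \<omega>\<bar> \<le> d"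
    using assms unfolding bounded_iff by auto
  have "\<bar>Z \<omega> * Y \<omega>\<bar> \<le> c * d" if "\<omega> \<in> S" for \<omega>
    using c[OF that] d[OF that] unfolding abs_mult by (intro mult_mono) auto
  then show ?thesis unfolding bounded_iff by (auto intro!: exI[of _ "c * d"])
qed

lemma elementary_square_integrable:
  assumes "0 \<le> c" "c \<le> d" "Z \<in> borel_measurable (F c)" "bounded (Z ` space M)"
  shows "integrable M (\<lambda>\<omega>. ((W d \<omega> - W c \<omega>) * Z \<omega>)\<^sup>2)"
proof -
  have "integrable M (\<lambda>\<omega>. (Z \<omega> * Z \<omega>) * (W d \<omega> - W c \<omega>)\<^sup>2)"
    by (intro integrable_bounded_mult integrable_increment_square bounded_mult_image
        borel_measurable_times measurable_F_M[OF assms(3)] assms)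
  then show ?thesis by (simp add: power2_eq_square mult_ac)
qed

text \<open>Only the common part of the two time intervals contributes: an increment is centred and independent of
  everything that happened before it begins.  With \<open>c \<le> e\<close>, the increment over \<open>[c,d]\<close> is cut at \<open>e\<close>, and the
  remaining two increments start together at \<open>e\<close> and share the increment up to \<open>min d f\<close>.\<close>

lemma elementary_isometry:
  assumes cd: "0 \<le> c" "c \<le> d" and ef: "0 \<le> e" "e \<le> f"
    and Z: "Z \<in> borel_measurable (F c)" "bounded (Z ` space M)"
    and Y: "Y \<in> borel_measurable (F e)" "bounded (Y ` space M)"
  shows "(LINT \<omega>|M. ((W d \<omega> - W c \<omega>) * Z \<omega>) * ((W f \<omega> - W e \<omega>) * Y \<omega>)) =
    (LINT \<omega>|M. Z \<omega> * Y \<omega>) * measure lborel ({c<..d} \<inter> {e<..f})"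
proof -
  have *: "(LINT \<omega>|M. ((W d \<omega> - W c \<omega>) * Z \<omega>) * ((W f \<omega> - W e \<omega>) * Y \<omega>)) =
      (LINT \<omega>|M. Z \<omega> * Y \<omega>) * measure lborel ({c<..d} \<inter> {e<..f})"
    if cd: "0 \<le> c" "c \<le> d" and ef: "0 \<le> e" "e \<le> f" and "c \<le> e"
      and Z: "Z \<in> borel_measurable (F c)" "bounded (Z ` space M)"
      and Y: "Y \<in> borel_measurable (F e)" "bounded (Y ` space M)"
    for c d e f Z Y
  proof -
    have We: "integrable M (\<lambda>\<omega>. W q \<omega> - W r \<omega>)" if "0 \<le> r" "r \<le> q" for q r
      using increment_orthogonal(1)[OF that borel_measurable_const[of 1] integrable_const[of 1]] by simp
    have ZY: "(\<lambda>\<omega>. Z \<omega> * Y \<omega>) \<in> borel_measurable (F e)"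
      using measurable_F_mono[OF Z(1) \<open>c \<le> e\<close>] Y(1) by (rule borel_measurable_times)
    have ZYb: "bounded ((\<lambda>\<omega>. Z \<omega> * Y \<omega>) ` space M)" by (rule bounded_mult_image[OF Z(2) Y(2)])
    have bi: "integrable M (\<lambda>\<omega>. Z \<omega> * Y \<omega> * g \<omega>)" if "integrable M g" for g
      by (rule integrable_bounded_mult[OF measurable_F_M[OF ZY] ZYb that])
    have ZYi: "integrable M (\<lambda>\<omega>. Z \<omega> * Y \<omega>)" using bi[of "\<lambda>_. 1"] by simp
    note WF = measurable_F_mono[OF W_F]
    show ?thesis
    proof (cases "d \<le> e")
      case True
      have m: "(\<lambda>\<omega>. Z \<omega> * Y \<omega> * (W d \<omega> - W c \<omega>)) \<in> borel_measurable (F e)"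
        using cd True \<open>c \<le> e\<close> by (intro borel_measurable_times borel_measurable_diff Y(1)
            measurable_F_mono[OF Z(1)] WF) auto
      have "(LINT \<omega>|M. ((W d \<omega> - W c \<omega>) * Z \<omega>) * ((W f \<omega> - W e \<omega>) * Y \<omega>)) =
          (LINT \<omega>|M. (Z \<omega> * Y \<omega> * (W d \<omega> - W c \<omega>)) * (W f \<omega> - W e \<omega>))"
        by (simp add: mult_ac)
      also have "\<dots> = 0" using ef by (rule increment_orthogonal(2)[OF _ _ m bi[OF We[OF cd]]])
      finally show ?thesis using True by (simp add: Int_greaterThanAtMost)
    next
      case False
      \<comment> \<open>the product of the increments over \<open>[e,d]\<close> and \<open>[e,f]\<close> is that over \<open>[e,g]\<close> times that over \<open>[e,h]\<close>\<close>
      define g h where "g = min d f" and "h = max d f"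
      have geh: "e \<le> g" "g \<le> h" "0 \<le> g" using False ef by (auto simp: g_def h_def)
      let ?V = "\<lambda>\<omega>. Z \<omega> * Y \<omega>"
      have m1: "(\<lambda>\<omega>. ?V \<omega> * (W e \<omega> - W c \<omega>)) \<in> borel_measurable (F e)"
        using cd ef \<open>c \<le> e\<close> by (intro borel_measurable_times[of ?V] borel_measurable_diff ZY WF) auto
      have m2: "(\<lambda>\<omega>. ?V \<omega> * (W g \<omega> - W e \<omega>)) \<in> borel_measurable (F g)"
        using geh ef by (intro borel_measurable_times[of ?V] borel_measurable_diff measurable_F_mono[OF ZY] WF) auto
      note o1 = increment_orthogonal[OF ef m1 bi[OF We[OF cd(1) \<open>c \<le> e\<close>]]]
        and o2 = increment_square[OF ef(1) geh(1) ZY ZYi]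
        and o3 = increment_orthogonal[OF geh(3,2) m2 bi[OF We[OF ef(1) geh(1)]]]
      have "((W d \<omega> - W c \<omega>) * Z \<omega>) * ((W f \<omega> - W e \<omega>) * Y \<omega>) =
         (?V \<omega> * (W e \<omega> - W c \<omega>)) * (W f \<omega> - W e \<omega>) + ?V \<omega> * (W g \<omega> - W e \<omega>)\<^sup>2
          + (?V \<omega> * (W g \<omega> - W e \<omega>)) * (W h \<omega> - W g \<omega>)" for \<omega>
        by (cases "d \<le> f") (simp_all add: g_def h_def power2_eq_square algebra_simps)
      then have "(LINT \<omega>|M. ((W d \<omega> - W c \<omega>) * Z \<omega>) * ((W f \<omega> - W e \<omega>) * Y \<omega>)) =
         (LINT \<omega>|M. (?V \<omega> * (W e \<omega> - W c \<omega>)) * (W f \<omega> - W e \<omega>) + ?V \<omega> * (W g \<omega> - W e \<omega>)\<^sup>2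
          + (?V \<omega> * (W g \<omega> - W e \<omega>)) * (W h \<omega> - W g \<omega>))" by simp
      also have "\<dots> = (LINT \<omega>|M. ?V \<omega>) * (g - e)"
        using o1 o2 o3 by simp
      also have "g - e = measure lborel ({c<..d} \<inter> {e<..f})"
        using \<open>c \<le> e\<close> geh by (simp add: Int_greaterThanAtMost g_def max_def)
      finally show ?thesis .
    qed
  qed
  show ?thesis
  proof (cases "c \<le> e")
    case True
    then show ?thesis by (intro * assms)
  next
    case False
    then have "e \<le> c" by simp
    from *[OF ef cd this Y Z] show ?thesis by (simp add: mult_ac Int_commute)
  qed
qed

end

subsection \<open>Isometry and martingale property\<close>

lemma indicator_scaleR_subset:
  "S \<subseteq> A \<Longrightarrow> indicator A r *\<^sub>R (indicator S r :: real) = indicator S r"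
  by (auto simp: indicator_def)

context brownian_space
begin

lemma simple_dataD:
  assumes "simple_data M F a b k p \<xi>"
  shows "i \<le> k \<Longrightarrow> a \<le> p i" "i \<le> k \<Longrightarrow> p i \<le> b" "i \<le> j \<Longrightarrow> j \<le> k \<Longrightarrow> p i \<le> p j"
    "i < k \<Longrightarrow> \<xi> i \<in> borel_measurable (F (p i))" "i < k \<Longrightarrow> bounded (\<xi> i ` space M)"
proof -
  have mono: "p i \<le> p j" if "i \<le> j" "j \<le> k" for i j
    using that
  proof (induction j rule: dec_induct)
    case (step n)
    then show ?case using assms unfolding simple_data_def by (meson Suc_le_lessD Suc_leD order_trans)
  qed simp
  then show "i \<le> j \<Longrightarrow> j \<le> k \<Longrightarrow> p i \<le> p j" by blast
  show "i \<le> k \<Longrightarrow> a \<le> p i" using mono[of 0 i] assms unfolding simple_data_def by auto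
  show "i \<le> k \<Longrightarrow> p i \<le> b" using mono[of i k] assms unfolding simple_data_def by auto
  show "i < k \<Longrightarrow> \<xi> i \<in> borel_measurable (F (p i))" "i < k \<Longrightarrow> bounded (\<xi> i ` space M)"
    using assms unfolding simple_data_def by blast+
qed

lemma simple_process_joint:
  assumes "simple_data M F a b k p \<xi>"
  shows "(\<lambda>(s, \<omega>). simple_process k p \<xi> s \<omega>) \<in> borel_measurable LM"
proof -
  have [measurable]: "(indicator {c<..d} :: real \<Rightarrow> real) \<in> borel_measurable L" for c d
    unfolding leb_on_def by (rule measurable_restrict_space1) simp
  have [measurable]: "\<xi> i \<in> borel_measurable M" if "i \<in> {..<k}" for i
    using simple_dataD(4)[OF assms] that measurable_F_M by blast
  show ?thesis
    unfolding simple_process_def split_beta' by measurable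
qed

lemma simple_process_bounded:
  assumes "simple_data M F a b k p \<xi>"
  obtains c where "\<And>s \<omega>. \<omega> \<in> space M \<Longrightarrow> norm (simple_process k p \<xi> s \<omega>) \<le> c"
proof -
  have "\<forall>i\<in>{..<k}. \<exists>c. \<forall>\<omega>\<in>space M. norm (\<xi> i \<omega>) \<le> c"
    using simple_dataD(5)[OF assms] unfolding bounded_iff by auto
  then obtain c where c: "\<And>i \<omega>. i < k \<Longrightarrow> \<omega> \<in> space M \<Longrightarrow> norm (\<xi> i \<omega>) \<le> c i"
    unfolding bchoice_iff by auto
  show ?thesis
  proof (rule that[of "\<Sum>i<k. c i"])
    fix s \<omega> assume \<omega>: "\<omega> \<in> space M"
    show "norm (simple_process k p \<xi> s \<omega>) \<le> (\<Sum>i<k. c i)"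
      unfolding simple_process_def
    proof (rule order_trans[OF norm_sum], rule sum_mono)
      fix i assume i: "i \<in> {..<k}"
      then have "0 \<le> c i" using c[of i \<omega>] \<omega> norm_ge_zero[of "\<xi> i \<omega>"] by (meson lessThan_iff order_trans)
      then show "norm (indicat_real {p i<..p (Suc i)} s *\<^sub>R \<xi> i \<omega>) \<le> c i"
        using c[of i \<omega>] i \<omega> by (auto simp: indicator_def)
    qed
  qed
qed

lemma prob_pair_finite: "finite_measure LM"
proof -
  interpret P: pair_sigma_finite L M by (rule pair_sf)
  interpret f: finite_measure L by (rule finite_measure_leb_on)
  have "emeasure LM (space L \<times> space M) = emeasure L (space L) * emeasure M (space M)"
    by (rule emeasure_pair_measure_Times) (rule sets.top)+
  then show ?thesis
    by (intro finite_measureI)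
      (simp add: space_pair_measure ennreal_mult_eq_top_iff f.emeasure_eq_measure emeasure_eq_measure)
qed

lemma simple_process_square:
  fixes \<xi> :: "nat \<Rightarrow> 'w \<Rightarrow> real"
  assumes "simple_data M F a b k p \<xi>"
  shows "integrable LM (\<lambda>(s, \<omega>). (simple_process k p \<xi> s \<omega>)\<^sup>2)"
proof -
  interpret f: finite_measure LM by (rule prob_pair_finite)
  note [measurable] = simple_process_joint[OF assms]
  obtain c where c: "\<And>s \<omega>. \<omega> \<in> space M \<Longrightarrow> norm (simple_process k p \<xi> s \<omega>) \<le> c"
    using simple_process_bounded[OF assms] by blast
  show ?thesis
  proof (rule f.integrable_const_bound[of _ "c\<^sup>2"])
    show "AE z in LM. norm (case z of (s, \<omega>) \<Rightarrow> (simple_process k p \<xi> s \<omega>)\<^sup>2) \<le> c\<^sup>2"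
    proof (rule AE_I2)
      fix z assume "z \<in> space LM"
      then have "norm (simple_process k p \<xi> (fst z) (snd z)) \<le> c" using c by (auto simp: space_pair_measure)
      then have "\<bar>simple_process k p \<xi> (fst z) (snd z)\<bar>\<^sup>2 \<le> c\<^sup>2" by (intro power_mono) auto
      then show "norm (case z of (s, \<omega>) \<Rightarrow> (simple_process k p \<xi> s \<omega>)\<^sup>2) \<le> c\<^sup>2"
        by (simp add: split_beta')
    qed
  qed (simp add: split_beta'; measurable)
qed

text \<open>Stopping at time \<open>s\<close> turns each summand of a simple integral into an elementary integral over
  \<open>(min s (p i), min s (p (i + 1))]\<close>.  The value has to be known at the left end point, which fails if \<open>s < p i\<close>;
  as the interval is empty in this case, the value may be replaced by zero.\<close>

definition stopped :: "(nat \<Rightarrow> real) \<Rightarrow> (nat \<Rightarrow> 'w \<Rightarrow> real) \<Rightarrow> real \<Rightarrow> nat \<Rightarrow> 'w \<Rightarrow> real" where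
  "stopped p \<xi> s i = (if p i \<le> s then \<xi> i else (\<lambda>_. 0))"

lemma stopped_facts:
  assumes d: "simple_data M F a b k p \<xi>" and s: "s \<in> {a..b}" and i: "i < k"
  shows "stopped p \<xi> s i \<in> borel_measurable (F (min s (p i)))" "bounded (stopped p \<xi> s i ` space M)"
    "0 \<le> min s (p i)" "min s (p i) \<le> min s (p (Suc i))"
proof -
  have p: "0 \<le> p i" "p i \<le> p (Suc i)"
    using i a_nonneg simple_dataD(1)[OF d, of i] simple_dataD(3)[OF d, of i "Suc i"] by auto
  then show "0 \<le> min s (p i)" "min s (p i) \<le> min s (p (Suc i))" using s a_nonneg by auto
  show "stopped p \<xi> s i \<in> borel_measurable (F (min s (p i)))" "bounded (stopped p \<xi> s i ` space M)"
    using simple_dataD(4,5)[OF d i] by (auto simp: stopped_def bounded_iff min_absorb2)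
qed

lemma simple_integral_stopped:
  assumes d: "simple_data M F a b k p \<xi>" and s: "s \<in> {a..b}"
  shows "simple_integral W k p \<xi> s \<omega> = (\<Sum>i<k. (W (min s (p (Suc i))) \<omega> - W (min s (p i)) \<omega>) * stopped p \<xi> s i \<omega>)"
  unfolding simple_integral_def
proof (rule sum.cong[OF refl])
  fix i assume "i \<in> {..<k}"
  then have "p i \<le> p (Suc i)" using simple_dataD(3)[OF d, of i "Suc i"] by auto
  then show "(W (min s (p (Suc i))) \<omega> - W (min s (p i)) \<omega>) *\<^sub>R \<xi> i \<omega> =
     (W (min s (p (Suc i))) \<omega> - W (min s (p i)) \<omega>) * stopped p \<xi> s i \<omega>"
    by (auto simp: stopped_def)
qed

lemma simple_integral_measurable:
  assumes d: "simple_data M F a b k p \<xi>" and s: "s \<in> {a..b}"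
  shows "simple_integral W k p \<xi> s \<in> borel_measurable (F s)"
proof -
  have "(\<lambda>\<omega>. (W (min s (p (Suc i))) \<omega> - W (min s (p i)) \<omega>) *\<^sub>R \<xi> i \<omega>) \<in> borel_measurable (F s)"
    if i: "i < k" for i
  proof (cases "p i \<le> s")
    case True
    have "W (min s (p (Suc i))) \<in> borel_measurable (F s)" "W (min s (p i)) \<in> borel_measurable (F s)"
      using simple_dataD(1)[OF d, of "Suc i"] simple_dataD(1)[OF d, of "i"] i s a_nonneg
      by (auto intro!: measurable_F_mono[OF W_F])
    moreover have "\<xi> i \<in> borel_measurable (F s)"
      by (rule measurable_F_mono[OF simple_dataD(4)[OF d i] True])
    ultimately show ?thesis by (intro borel_measurable_scaleR borel_measurable_diff)
  next
    case False
    moreover have "p i \<le> p (Suc i)" using i simple_dataD(3)[OF d, of i "Suc i"] by auto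
    ultimately show ?thesis by simp
  qed
  then have "(\<lambda>\<omega>. simple_integral W k p \<xi> s \<omega>) \<in> borel_measurable (F s)"
    unfolding simple_integral_def by (intro borel_measurable_sum) auto
  then show ?thesis by simp
qed

lemma integrable_sum_square:
  fixes f :: "'i \<Rightarrow> 'w \<Rightarrow> real"
  assumes "finite I" "\<And>i. i \<in> I \<Longrightarrow> f i \<in> borel_measurable M" "\<And>i. i \<in> I \<Longrightarrow> integrable M (\<lambda>\<omega>. (f i \<omega>)\<^sup>2)"
  shows "integrable M (\<lambda>\<omega>. (\<Sum>i\<in>I. f i \<omega>)\<^sup>2)"
  unfolding power2_eq_square sum_product
  by (intro Bochner_Integration.integrable_sum integrable_mult_L2) (auto intro: assms)

lemma summand_facts:
  assumes d: "simple_data M F a b k p \<xi>" and s: "s \<in> {a..b}" and i: "i < k"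
  shows "(\<lambda>\<omega>. (W (min s (p (Suc i))) \<omega> - W (min s (p i)) \<omega>) * stopped p \<xi> s i \<omega>) \<in> borel_measurable M"
    "integrable M (\<lambda>\<omega>. ((W (min s (p (Suc i))) \<omega> - W (min s (p i)) \<omega>) * stopped p \<xi> s i \<omega>)\<^sup>2)"
proof -
  note f = stopped_facts[OF assms]
  have "W (min s (p (Suc i))) \<in> borel_measurable M" "W (min s (p i)) \<in> borel_measurable M"
    using f(3,4) by (auto intro!: W_M)
  then show "(\<lambda>\<omega>. (W (min s (p (Suc i))) \<omega> - W (min s (p i)) \<omega>) * stopped p \<xi> s i \<omega>) \<in> borel_measurable M"
    using measurable_F_M[OF f(1)] by measurable
  show "integrable M (\<lambda>\<omega>. ((W (min s (p (Suc i))) \<omega> - W (min s (p i)) \<omega>) * stopped p \<xi> s i \<omega>)\<^sup>2)"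
    by (rule elementary_square_integrable[OF f(3,4,1,2)])
qed

lemma simple_integral_square:
  fixes \<xi> :: "nat \<Rightarrow> 'w \<Rightarrow> real"
  assumes d: "simple_data M F a b k p \<xi>" and s: "s \<in> {a..b}"
  shows "integrable M (\<lambda>\<omega>. (simple_integral W k p \<xi> s \<omega>)\<^sup>2)"
  unfolding simple_integral_stopped[OF assms]
  by (intro integrable_sum_square) (auto intro: summand_facts[OF assms])

text \<open>Two different grids are allowed.  Both sides expand into the same double sum, the left one by the
  isometry for pairs of elementary integrals, the right one because the integrand is a sum of products of
  indicators and random variables.\<close>

lemma simple_isometry:
  fixes \<xi> \<xi>' :: "nat \<Rightarrow> 'w \<Rightarrow> real"
  assumes d: "simple_data M F a b k p \<xi>" and d': "simple_data M F a b k' p' \<xi>'" and s: "s \<in> {a..b}"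
  shows "(LINT \<omega>|M. simple_integral W k p \<xi> s \<omega> * simple_integral W k' p' \<xi>' s \<omega>) =
     (LINT z|LM. (indicator {a..s} (fst z) * case_prod (simple_process k p \<xi>) z) * case_prod
         (simple_process k' p' \<xi>') z)"
proof -
  interpret P: pair_sigma_finite L M by (rule pair_sf)
  interpret fm: finite_measure L by (rule finite_measure_leb_on)
  let ?D = "\<lambda>p \<xi> i \<omega>. (W (min s (p (Suc i))) \<omega> - W (min s (p i)) \<omega>) * stopped p \<xi> s i \<omega>"
  let ?S = "\<lambda>i j. {min s (p i)<..min s (p (Suc i))} \<inter> {min s (p' j)<..min s (p' (Suc j))}"
  have \<xi>m: "\<xi> i \<in> borel_measurable M" "bounded (\<xi> i ` space M)" if "i < k" for i
    using simple_dataD(4,5)[OF d that] measurable_F_M by blast+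
  have \<xi>m': "\<xi>' i \<in> borel_measurable M" "bounded (\<xi>' i ` space M)" if "i < k'" for i
    using simple_dataD(4,5)[OF d' that] measurable_F_M by blast+
  have int\<xi>: "integrable M (\<lambda>\<omega>. \<xi> i \<omega> * \<xi>' j \<omega>)" if "i < k" "j < k'" for i j
    using integrable_bounded_mult[OF borel_measurable_times[OF \<xi>m(1)[OF that(1)] \<xi>m'(1)[OF that(2)]]
        bounded_mult_image[OF \<xi>m(2)[OF that(1)] \<xi>m'(2)[OF that(2)]], of "\<lambda>_. 1"] by simp
  have L: "(LINT \<omega>|M. simple_integral W k p \<xi> s \<omega> * simple_integral W k' p' \<xi>' s \<omega>) =
     (\<Sum>i<k. \<Sum>j<k'. (LINT \<omega>|M. \<xi> i \<omega> * \<xi>' j \<omega>) * measure lborel (?S i j))"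
  proof -
    have "(LINT \<omega>|M. simple_integral W k p \<xi> s \<omega> * simple_integral W k' p' \<xi>' s \<omega>) =
      (LINT \<omega>|M. (\<Sum>i<k. \<Sum>j<k'. ?D p \<xi> i \<omega> * ?D p' \<xi>' j \<omega>))"
      unfolding simple_integral_stopped[OF d s] simple_integral_stopped[OF d' s] sum_product ..
    also have "\<dots> = (\<Sum>i<k. \<Sum>j<k'. (LINT \<omega>|M. ?D p \<xi> i \<omega> * ?D p' \<xi>' j \<omega>))"
      by (subst Bochner_Integration.integral_sum, intro Bochner_Integration.integrable_sum integrable_mult_L2;
          (rule summand_facts[OF d s] summand_facts[OF d' s]; simp)?)
         (intro sum.cong refl Bochner_Integration.integral_sum integrable_mult_L2;
          (rule summand_facts[OF d s] summand_facts[OF d' s]; simp))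
    also have "\<dots> = (\<Sum>i<k. \<Sum>j<k'. (LINT \<omega>|M. \<xi> i \<omega> * \<xi>' j \<omega>) * measure lborel (?S i j))"
    proof (intro sum.cong refl)
      fix i j assume "i \<in> {..<k}" "j \<in> {..<k'}"
      then have ij: "i < k" "j < k'" by auto
      note f = stopped_facts[OF d s ij(1)] and f' = stopped_facts[OF d' s ij(2)]
      have "(LINT \<omega>|M. ?D p \<xi> i \<omega> * ?D p' \<xi>' j \<omega>) =
          (LINT \<omega>|M. stopped p \<xi> s i \<omega> * stopped p' \<xi>' s j \<omega>) * measure lborel (?S i j)"
        by (rule elementary_isometry[OF f(3,4) f'(3,4) f(1,2) f'(1,2)])
      also have "\<dots> = (LINT \<omega>|M. \<xi> i \<omega> * \<xi>' j \<omega>) * measure lborel (?S i j)"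
      proof (cases "p i \<le> s \<and> p' j \<le> s")
        case False
        moreover have "p i \<le> p (Suc i)" "p' j \<le> p' (Suc j)"
          using simple_dataD(3)[OF d, of i "Suc i"] simple_dataD(3)[OF d', of j "Suc j"] ij by auto
        ultimately have "?S i j = {}" by auto
        then have "measure lborel (?S i j) = 0" by (simp only: measure_empty)
        then show ?thesis by (simp only: mult_zero_right)
      qed (simp add: stopped_def)
      finally show "(LINT \<omega>|M. ?D p \<xi> i \<omega> * ?D p' \<xi>' j \<omega>) = (LINT \<omega>|M. \<xi> i \<omega> * \<xi>' j \<omega>) * measure lborel (?S i j)" .
    qed
    finally show ?thesis .
  qed
  let ?g = "\<lambda>i j z. indicator (?S i j) (fst z) * (\<xi> i (snd z) * \<xi>' j (snd z))"
  have iS: "integrable L (indicator (?S i j) :: real \<Rightarrow> real)" 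
    and mS: "(LINT r|L. indicator (?S i j) r) = measure lborel (?S i j)" if ij: "i < k" "j < k'" for i j
  proof -
    have sub: "?S i j \<subseteq> {a..b}"
      using simple_dataD(1)[OF d, of i] ij s by auto
    have m: "(indicator (?S i j) :: real \<Rightarrow> real) \<in> borel_measurable L"
      unfolding leb_on_def by (rule measurable_restrict_space1) simp
    show "integrable L (indicator (?S i j) :: real \<Rightarrow> real)"
      by (rule fm.integrable_const_bound[of _ 1]) (use m in \<open>auto simp: indicator_def\<close>)
    have "(LINT r|L. indicator (?S i j) r) = (LINT r|lborel. indicator {a..b} r *\<^sub>R (indicator (?S i j) r :: real))"
      unfolding leb_on_def by (rule integral_restrict_space) simp
    also have "\<dots> = (LINT r|lborel. indicator (?S i j) r)"
      by (rule Bochner_Integration.integral_cong[OF refl]) (rule indicator_scaleR_subset[OF sub])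
    also have "\<dots> = measure lborel (?S i j)" by simp
    finally show "(LINT r|L. indicator (?S i j) r) = measure lborel (?S i j)" .
  qed
  have gi: "integrable LM (?g i j)" if "i < k" "j < k'" for i j
    using integrable_pair_mult[OF sigma_finite_leb_on sigma_finite_measure_axioms iS[OF that] int\<xi>[OF that]]
    by (simp add: split_beta')
  have R: "(LINT z|LM. ?g i j z) = (LINT \<omega>|M. \<xi> i \<omega> * \<xi>' j \<omega>) * measure lborel (?S i j)" if "i < k" "j < k'" for i j
  proof -
    have "(LINT z|LM. ?g i j z) = (LINT r|L. (LINT \<omega>|M. ?g i j (r, \<omega>)))"
      by (rule P.integral_fst'[OF gi[OF that], symmetric])
    also have "\<dots> = (LINT r|L. indicator (?S i j) r) * (LINT \<omega>|M. \<xi> i \<omega> * \<xi>' j \<omega>)" by simp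
    finally show ?thesis by (simp only: mS[OF that] mult.commute)
  qed
  have "(LINT z|LM. (indicator {a..s} (fst z) * case_prod (simple_process k p \<xi>) z) * case_prod
      (simple_process k' p' \<xi>') z)
    = (LINT z|LM. (\<Sum>i<k. \<Sum>j<k'. ?g i j z))"
  proof (rule Bochner_Integration.integral_cong[OF refl])
    fix z assume "z \<in> space LM"
    then obtain r \<omega> where z: "z = (r, \<omega>)" "r \<in> {a..b}" by (auto simp: space_pair_measure)
    have "(indicator {a..s} r * simple_process k p \<xi> r \<omega>) * simple_process k' p' \<xi>' r \<omega> =
      (\<Sum>i<k. \<Sum>j<k'. indicator {a..s} r * indicator {p i<..p (Suc i)} r * indicator {p' j<..p' (Suc j)} r *
          (\<xi> i \<omega> * \<xi>' j \<omega>))"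
      unfolding simple_process_def sum_distrib_left sum_distrib_right
      by (subst sum.swap) (auto simp: mult_ac intro!: sum.cong)
    also have "\<dots> = (\<Sum>i<k. \<Sum>j<k'. ?g i j z)"
    proof (intro sum.cong refl)
      fix i j assume "i \<in> {..<k}" "j \<in> {..<k'}"
      have "indicator {a..s} r * indicator {p i<..p (Suc i)} r * indicator {p' j<..p' (Suc j)} r =
          (indicator (?S i j) r :: real)"
        using z(2) by (auto simp: indicator_def)
      then show "indicator {a..s} r * indicator {p i<..p (Suc i)} r * indicator {p' j<..p' (Suc j)} r *
          (\<xi> i \<omega> * \<xi>' j \<omega>) = ?g i j z"
        by (simp only: z fst_conv snd_conv)
    qed
    finally show "(indicator {a..s} (fst z) * case_prod (simple_process k p \<xi>) z) * case_prod
        (simple_process k' p' \<xi>') z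
       = (\<Sum>i<k. \<Sum>j<k'. ?g i j z)" by (simp add: z)
  qed
  also have "\<dots> = (\<Sum>i<k. (LINT z|LM. (\<Sum>j<k'. ?g i j z)))"
    by (rule Bochner_Integration.integral_sum) (rule Bochner_Integration.integrable_sum, rule gi; blast)
  also have "\<dots> = (\<Sum>i<k. \<Sum>j<k'. (LINT z|LM. ?g i j z))"
    by (rule sum.cong[OF refl], rule Bochner_Integration.integral_sum, rule gi; blast)
  also have "\<dots> = (\<Sum>i<k. \<Sum>j<k'. (LINT \<omega>|M. \<xi> i \<omega> * \<xi>' j \<omega>) * measure lborel (?S i j))"
    by (intro sum.cong refl R) auto
  finally show ?thesis using L by simp
qed

text \<open>Between \<open>r\<close> and \<open>s\<close> a simple integral only collects the increments over
  \<open>[max r (min s (p i)), max r (min s (p (i + 1)))]\<close>, each of which begins after \<open>Z\<close> and the value of the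
      integrand are known.\<close>

lemma simple_martingale:
  fixes \<xi> :: "nat \<Rightarrow> 'w \<Rightarrow> real"
  assumes d: "simple_data M F a b k p \<xi>" and rs: "a \<le> r" "r \<le> s" "s \<le> b"
    and Z: "Z \<in> borel_measurable (F r)" "bounded (Z ` space M)"
  shows "(LINT \<omega>|M. Z \<omega> * (simple_integral W k p \<xi> s \<omega> - simple_integral W k p \<xi> r \<omega>)) = 0"
proof -
  define c where "c i = max r (min s (p i))" for i
  let ?\<xi> = "stopped p \<xi> s"
  have cc: "0 \<le> c i" "c i \<le> c (Suc i)" if "i < k" for i
    using rs a_nonneg simple_dataD(3)[OF d, of i "Suc i"] that by (auto simp: c_def)
  have \<xi>: "?\<xi> i \<in> borel_measurable (F (c i))" "bounded (?\<xi> i ` space M)" if "i < k" for i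
    using measurable_F_mono[OF stopped_facts(1)[OF d _ that, of s], of "c i"] stopped_facts(2)[OF d _ that, of s] rs
    by (auto simp: c_def)
  have V: "(\<lambda>\<omega>. Z \<omega> * ?\<xi> i \<omega>) \<in> borel_measurable (F (c i))" "integrable M (\<lambda>\<omega>. Z \<omega> * ?\<xi> i \<omega>)" if "i < k" for i
  proof -
    show m: "(\<lambda>\<omega>. Z \<omega> * ?\<xi> i \<omega>) \<in> borel_measurable (F (c i))"
      by (intro borel_measurable_times \<xi>(1)[OF that] measurable_F_mono[OF Z(1)]) (simp add: c_def)
    show "integrable M (\<lambda>\<omega>. Z \<omega> * ?\<xi> i \<omega>)"
      using integrable_bounded_mult[OF measurable_F_M[OF m] bounded_mult_image[OF Z(2) \<xi>(2)[OF that]], of "\<lambda>_.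
          1"] by simp
  qed
  note o = increment_orthogonal[OF cc V]
  have "simple_integral W k p \<xi> s \<omega> - simple_integral W k p \<xi> r \<omega> =
      (\<Sum>i<k. ?\<xi> i \<omega> * (W (c (Suc i)) \<omega> - W (c i) \<omega>))" for \<omega>
    unfolding simple_integral_def sum_subtractf[symmetric]
  proof (intro sum.cong refl)
    fix i assume "i \<in> {..<k}"
    then have "p i \<le> p (Suc i)" using simple_dataD(3)[OF d, of i "Suc i"] by auto
    then show "(W (min s (p (Suc i))) \<omega> - W (min s (p i)) \<omega>) *\<^sub>R \<xi> i \<omega> - (W (min r (p (Suc i))) \<omega> - W
        (min r (p i)) \<omega>) *\<^sub>R \<xi> i \<omega>
       = ?\<xi> i \<omega> * (W (c (Suc i)) \<omega> - W (c i) \<omega>)"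
      using rs by (auto simp: stopped_def c_def min_def max_def algebra_simps)
  qed
  then have "(LINT \<omega>|M. Z \<omega> * (simple_integral W k p \<xi> s \<omega> - simple_integral W k p \<xi> r \<omega>)) =
     (LINT \<omega>|M. (\<Sum>i<k. Z \<omega> * ?\<xi> i \<omega> * (W (c (Suc i)) \<omega> - W (c i) \<omega>)))"
    by (simp add: sum_distrib_left mult.assoc)
  also have "\<dots> = (\<Sum>i<k. (LINT \<omega>|M. Z \<omega> * ?\<xi> i \<omega> * (W (c (Suc i)) \<omega> - W (c i) \<omega>)))"
    using o by (intro Bochner_Integration.integral_sum) auto
  also have "\<dots> = 0" using o by (intro sum.neutral) auto
  finally show ?thesis .
qed


lemma ito_L2F: "is_ito_integral M F W a b \<phi> I \<Longrightarrow> \<phi> \<in> L2F M F a b"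
  and ito_adapted: "is_ito_integral M F W a b \<phi> I \<Longrightarrow> s \<in> {a..b} \<Longrightarrow> I s \<in> borel_measurable (F s)"
  and ito_continuous: "is_ito_integral M F W a b \<phi> I \<Longrightarrow> \<omega> \<in> space M \<Longrightarrow> continuous_on {a..b} (\<lambda>s. I s \<omega>)"
  unfolding is_ito_integral_def by blast+

lemma ito_prog: "is_ito_integral M F W a b \<phi> I \<Longrightarrow> prog_measurable F a b I"
  using ito_adapted ito_continuous by (intro continuous_adapted_prog) auto

text \<open>The approximating simple integrands, with the iterated integral over time and chance written as one
  integral for the product measure.\<close>

definition ito_approximation ::
  "(real \<Rightarrow> 'w \<Rightarrow> 'h::euclidean_space) \<Rightarrow> (real \<Rightarrow> 'w \<Rightarrow> 'h) \<Rightarrow>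
   (nat \<Rightarrow> nat) \<Rightarrow> (nat \<Rightarrow> nat \<Rightarrow> real) \<Rightarrow> (nat \<Rightarrow> nat \<Rightarrow> 'w \<Rightarrow> 'h) \<Rightarrow> bool" where
  "ito_approximation \<phi> I k p \<xi> \<longleftrightarrow> (\<forall>n. simple_data M F a b (k n) (p n) (\<xi> n)) \<and>
     (\<lambda>n. \<integral>\<^sup>+z. ennreal ((norm (case_prod (simple_process (k n) (p n) (\<xi> n)) z - case_prod \<phi> z))\<^sup>2) \<partial>LM) \<longlonglongrightarrow> 0 \<and>
     (\<forall>s\<in>{a..b}. (\<lambda>n. \<integral>\<^sup>+\<omega>. ennreal ((norm (simple_integral W (k n) (p n) (\<xi> n) s \<omega> - I s \<omega>))\<^sup>2) \<partial>M) \<longlonglongrightarrow> 0)"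

lemma ito_approximationD:
  assumes "ito_approximation \<phi> I k p \<xi>"
  shows "simple_data M F a b (k n) (p n) (\<xi> n)"
    "(\<lambda>n. \<integral>\<^sup>+z. ennreal ((norm (case_prod (simple_process (k n) (p n) (\<xi> n)) z - case_prod \<phi> z))\<^sup>2) \<partial>LM) \<longlonglongrightarrow> 0"
    "s \<in> {a..b} \<Longrightarrow> (\<lambda>n. \<integral>\<^sup>+\<omega>. ennreal ((norm (simple_integral W (k n) (p n) (\<xi> n) s \<omega> - I s \<omega>))\<^sup>2) \<partial>M) \<longlonglongrightarrow> 0"
  using assms unfolding ito_approximation_def by blast+

lemma is_ito_integral_iff:
  fixes \<phi> :: "real \<Rightarrow> 'w \<Rightarrow> 'h::euclidean_space"
  shows "is_ito_integral M F W a b \<phi> I \<longleftrightarrow> \<phi> \<in> L2F M F a b \<and> (\<forall>s\<in>{a..b}. I s \<in> borel_measurable (F s)) \<and>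
    (\<forall>\<omega>\<in>space M. continuous_on {a..b} (\<lambda>s. I s \<omega>)) \<and> (\<exists>k p \<xi>. ito_approximation \<phi> I k p \<xi>)"
proof -
  interpret P: pair_sigma_finite L M by (rule pair_sf)
  have "(\<integral>\<^sup>+\<omega>. (\<integral>\<^sup>+s\<in>{a..b}. ennreal ((norm (simple_process k p \<xi> s \<omega> - \<phi> s \<omega>))\<^sup>2) \<partial>lborel) \<partial>M) =
     (\<integral>\<^sup>+z. ennreal ((norm (case_prod (simple_process k p \<xi>) z - case_prod \<phi> z))\<^sup>2) \<partial>LM)"
    if "simple_data M F a b k p \<xi>" "\<phi> \<in> L2F M F a b" for k p and \<xi> :: "nat \<Rightarrow> 'w \<Rightarrow> 'h"
  proof -
    note [measurable] = simple_process_joint[OF that(1)] prog_joint[OF L2F_prog[OF that(2)]]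
    show ?thesis
      by (subst P.nn_integral_snd[symmetric]) (simp_all add: nn_set_integral_leb_on)
  qed
  then show ?thesis unfolding is_ito_integral_def ito_approximation_def by (auto cong: conj_cong)
qed

lemma ito_approx:
  assumes "is_ito_integral M F W a b \<phi> I"
  obtains k p \<xi> where "ito_approximation \<phi> I k p \<xi>"
  using assms unfolding is_ito_integral_iff by blast

text \<open>A single approximating simple integral at finite distance already gives integrability.\<close>

lemma ito_square:
  fixes \<phi> :: "real \<Rightarrow> 'w \<Rightarrow> real"
  assumes I: "is_ito_integral M F W a b \<phi> I" and s: "s \<in> {a..b}"
  shows "integrable M (\<lambda>\<omega>. (I s \<omega>)\<^sup>2)"
proof -
  obtain k p \<xi> where ap: "ito_approximation \<phi> I k p \<xi>"
    by (rule ito_approx[OF I])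
  note d = ito_approximationD(1)[OF ap] and l = ito_approximationD(3)[OF ap]
  have "\<forall>\<^sub>F n in sequentially. (\<integral>\<^sup>+\<omega>. ennreal ((norm (simple_integral W (k n) (p n) (\<xi> n) s \<omega> - I s \<omega>))\<^sup>2) \<partial>M) < 1"
    using l[OF s] by (rule order_tendstoD) simp
  then obtain n where n: "(\<integral>\<^sup>+\<omega>. ennreal ((norm (simple_integral W (k n) (p n) (\<xi> n) s \<omega> - I s \<omega>))\<^sup>2) \<partial>M) < 1"
    by (auto simp: eventually_sequentially)
  let ?S = "simple_integral W (k n) (p n) (\<xi> n) s"
  have [measurable]: "?S \<in> borel_measurable M" "I s \<in> borel_measurable M"
    by (rule measurable_F_M[OF simple_integral_measurable[OF d s]], rule measurable_F_M[OF ito_adapted[OF I s]])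
  have i1: "integrable M (\<lambda>\<omega>. (?S \<omega> - I s \<omega>)\<^sup>2)"
    unfolding integrable_iff_bounded using less_trans[OF n ennreal_one_less_top] by simp
  show ?thesis
  proof (rule Bochner_Integration.integrable_bound)
    show "integrable M (\<lambda>\<omega>. 2 * (?S \<omega>)\<^sup>2 + 2 * (?S \<omega> - I s \<omega>)\<^sup>2)"
      using simple_integral_square[OF d s] i1 by simp
    show "AE \<omega> in M. norm ((I s \<omega>)\<^sup>2) \<le> norm (2 * (?S \<omega>)\<^sup>2 + 2 * (?S \<omega> - I s \<omega>)\<^sup>2)"
    proof (rule AE_I2)
      fix \<omega>
      show "norm ((I s \<omega>)\<^sup>2) \<le> norm (2 * (?S \<omega>)\<^sup>2 + 2 * (?S \<omega> - I s \<omega>)\<^sup>2)"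
        using norm_diff_square_le[of "?S \<omega>" "?S \<omega> - I s \<omega>"] by simp
    qed
  qed measurable
qed

lemma ito_isometry:
  fixes \<phi> \<psi> :: "real \<Rightarrow> 'w \<Rightarrow> real"
  assumes I: "is_ito_integral M F W a b \<phi> I" and K: "is_ito_integral M F W a b \<psi> K" and s: "s \<in> {a..b}"
  shows "(LINT \<omega>|M. I s \<omega> * K s \<omega>) = (LINT r:{a..s}|lborel. (LINT \<omega>|M. \<phi> r \<omega> * \<psi> r \<omega>))"
proof -
  obtain k p \<xi> where ap: "ito_approximation \<phi> I k p \<xi>"
    by (rule ito_approx[OF I])
  note d = ito_approximationD(1)[OF ap] and l = ito_approximationD(2)[OF ap] and i = ito_approximationD(3)[OF ap]
  obtain k' p' \<xi>' where ap1: "ito_approximation \<psi> K k' p' \<xi>'"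
    by (rule ito_approx[OF K])
  note d' = ito_approximationD(1)[OF ap1] and l' = ito_approximationD(2)[OF ap1] and i' = ito_approximationD(3)[OF ap1]
  let ?S = "\<lambda>n. simple_integral W (k n) (p n) (\<xi> n) s" and ?S' = "\<lambda>n. simple_integral W (k' n) (p' n) (\<xi>' n) s"
  let ?\<sigma> = "\<lambda>n. simple_process (k n) (p n) (\<xi> n)" and ?\<sigma>' = "\<lambda>n. simple_process (k' n) (p' n) (\<xi>' n)"
  have L1: "(\<lambda>n. LINT \<omega>|M. ?S n \<omega> * ?S' n \<omega>) \<longlonglongrightarrow> (LINT \<omega>|M. I s \<omega> * K s \<omega>)"
  proof (rule tendsto_integral_mult_L2)
    show "I s \<in> borel_measurable M" "K s \<in> borel_measurable M" "\<And>n. ?S n \<in> borel_measurable M" "\<And>n. ?S' n \<in>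
        borel_measurable M"
      by (rule measurable_F_M[OF ito_adapted[OF I s]] measurable_F_M[OF ito_adapted[OF K s]]
        measurable_F_M[OF simple_integral_measurable[OF d s]] measurable_F_M[OF simple_integral_measurable[OF d' s]])+
    show "(\<lambda>n. \<integral>\<^sup>+\<omega>. ennreal ((?S n \<omega> - I s \<omega>)\<^sup>2) \<partial>M) \<longlonglongrightarrow> 0"
      "(\<lambda>n. \<integral>\<^sup>+\<omega>. ennreal ((?S' n \<omega> - K s \<omega>)\<^sup>2) \<partial>M) \<longlonglongrightarrow> 0" using i[OF s] i'[OF s] by simp_all
  qed (intro ito_square[OF I s] ito_square[OF K s] simple_integral_square[OF d s] simple_integral_square[OF d' s])+
  note [measurable] = prog_joint[OF L2F_prog[OF ito_L2F[OF I]]] prog_joint[OF L2F_prog[OF ito_L2F[OF K]]]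
    simple_process_joint[OF d] simple_process_joint[OF d']
  have [measurable]: "(indicator {a..s} :: real \<Rightarrow> real) \<in> borel_measurable L"
    unfolding leb_on_def by (rule measurable_restrict_space1) simp
  let ?i = "\<lambda>z::real \<times> 'w. indicator {a..s} (fst z) :: real"
  have ile: "(?i z * x)\<^sup>2 \<le> x\<^sup>2" for z x by (simp add: indicator_def)
  have sq: "integrable LM (\<lambda>z. (?i z * g z)\<^sup>2)"
    if m[measurable]: "g \<in> borel_measurable LM" and "integrable LM (\<lambda>z. (g z)\<^sup>2)" for g
  proof (rule Bochner_Integration.integrable_bound[OF that(2)])
    show "AE z in LM. norm ((?i z * g z)\<^sup>2) \<le> norm ((g z)\<^sup>2)" using ile by simp
  qed measurable
  have L2: "(\<lambda>n. LINT z|LM. (?i z * case_prod (?\<sigma> n) z) * case_prod (?\<sigma>' n) z) \<longlonglongrightarrow>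
     (LINT z|LM. (?i z * case_prod \<phi> z) * case_prod \<psi> z)"
  proof (rule tendsto_integral_mult_L2)
    show "integrable LM (\<lambda>z. (?i z * case_prod (?\<sigma> n) z)\<^sup>2)" for n
      using simple_process_square[OF d] by (intro sq) (auto simp: split_beta')
    show "integrable LM (\<lambda>z. (?i z * case_prod \<phi> z)\<^sup>2)"
      using L2F_sq[OF ito_L2F[OF I]] by (intro sq) (auto simp: split_beta')
    show "integrable LM (\<lambda>z. (case_prod (?\<sigma>' n) z)\<^sup>2)" for n
      using simple_process_square[OF d'] by (simp add: split_beta')
    show "integrable LM (\<lambda>z. (case_prod \<psi> z)\<^sup>2)"
      using L2F_sq[OF ito_L2F[OF K]] by (simp add: split_beta')
    show "(\<lambda>n. \<integral>\<^sup>+z. ennreal ((?i z * case_prod (?\<sigma> n) z - ?i z * case_prod \<phi> z)\<^sup>2) \<partial>LM) \<longlonglongrightarrow> 0"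
    proof (rule tendsto_sandwich[OF always_eventually always_eventually tendsto_const l])
      show "\<forall>n. (\<integral>\<^sup>+z. ennreal ((?i z * case_prod (?\<sigma> n) z - ?i z * case_prod \<phi> z)\<^sup>2) \<partial>LM) \<le>
          (\<integral>\<^sup>+z. ennreal ((norm (case_prod (?\<sigma> n) z - case_prod \<phi> z))\<^sup>2) \<partial>LM)"
        unfolding right_diff_distrib[symmetric] using ile by (auto intro!: nn_integral_mono ennreal_leI)
    qed simp
    show "(\<lambda>n. \<integral>\<^sup>+z. ennreal ((case_prod (?\<sigma>' n) z - case_prod \<psi> z)\<^sup>2) \<partial>LM) \<longlonglongrightarrow> 0"
      using l' by simp
  qed measurable
  have "(LINT \<omega>|M. ?S n \<omega> * ?S' n \<omega>) = (LINT z|LM. (?i z * case_prod (?\<sigma> n) z) * case_prod (?\<sigma>' n) z)" for n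
    by (rule simple_isometry[OF d d' s])
  with L1 L2 have eq: "(LINT \<omega>|M. I s \<omega> * K s \<omega>) = (LINT z|LM. (?i z * case_prod \<phi> z) * case_prod \<psi> z)"
    using LIMSEQ_unique by simp
  have int: "integrable LM (\<lambda>(s, \<omega>). \<phi> s \<omega> * \<psi> s \<omega>)"
    by (rule integrable_L2_L2[OF ito_L2F[OF I] ito_L2F[OF K]]) (measurable, simp add: abs_mult)
  note up = time_expectation_upto[OF int s]
  have "(LINT z|LM. (?i z * case_prod \<phi> z) * case_prod \<psi> z) = (LINT z|LM. case_prod (\<lambda>r \<omega>. indicator {a..s} r *
      (\<phi> r \<omega> * \<psi> r \<omega>)) z)"
    by (simp add: split_beta' mult.assoc)
  also have "\<dots> = (LINT r|L. (LINT \<omega>|M. indicator {a..s} r * (\<phi> r \<omega> * \<psi> r \<omega>)))"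
    using time_expectation(5,6)[OF up(1)] by simp
  also have "\<dots> = (LINT r:{a..b}|lborel. (LINT \<omega>|M. indicator {a..s} r * (\<phi> r \<omega> * \<psi> r \<omega>)))"
    by (simp only: set_lebesgue_integral_leb_on)
  also have "\<dots> = (LINT r:{a..s}|lborel. (LINT \<omega>|M. \<phi> r \<omega> * \<psi> r \<omega>))"
    using s unfolding set_lebesgue_integral_def
    by (intro Bochner_Integration.integral_cong) (auto simp: indicator_def)
  finally show ?thesis using eq by simp
qed

lemma ito_martingale_bounded:
  fixes \<phi> :: "real \<Rightarrow> 'w \<Rightarrow> real"
  assumes I: "is_ito_integral M F W a b \<phi> I" and rs: "a \<le> r" "r \<le> s" "s \<le> b"
    and Z: "Z \<in> borel_measurable (F r)" "bounded (Z ` space M)"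
  shows "(LINT \<omega>|M. Z \<omega> * (I s \<omega> - I r \<omega>)) = 0"
proof -
  obtain k p \<xi> where ap: "ito_approximation \<phi> I k p \<xi>"
    by (rule ito_approx[OF I])
  note d = ito_approximationD(1)[OF ap] and i = ito_approximationD(3)[OF ap]
  have r: "r \<in> {a..b}" and s: "s \<in> {a..b}" using rs by auto
  let ?S = "\<lambda>n t. simple_integral W (k n) (p n) (\<xi> n) t"
  have Zsq: "integrable M (\<lambda>\<omega>. (Z \<omega>)\<^sup>2)"
    using integrable_bounded_mult[OF measurable_F_M[OF borel_measurable_times[OF Z(1) Z(1)]]
        bounded_mult_image[OF Z(2) Z(2)], of "\<lambda>_. 1"]
    by (simp add: power2_eq_square)
  have *: "(\<lambda>n. LINT \<omega>|M. Z \<omega> * ?S n t \<omega>) \<longlonglongrightarrow> (LINT \<omega>|M. Z \<omega> * I t \<omega>)"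
    and int: "integrable M (\<lambda>\<omega>. Z \<omega> * I t \<omega>)" "\<And>n. integrable M (\<lambda>\<omega>. Z \<omega> * ?S n t \<omega>)" if t: "t \<in> {a..b}" for t
  proof -
    have m: "I t \<in> borel_measurable M" "Z \<in> borel_measurable M" "\<And>n. ?S n t \<in> borel_measurable M"
      by (rule measurable_F_M[OF ito_adapted[OF I t]] measurable_F_M[OF Z(1)]
        measurable_F_M[OF simple_integral_measurable[OF d t]])+
    show "(\<lambda>n. LINT \<omega>|M. Z \<omega> * ?S n t \<omega>) \<longlonglongrightarrow> (LINT \<omega>|M. Z \<omega> * I t \<omega>)"
    proof (rule tendsto_integral_mult_L2)
      show "(\<lambda>n. \<integral>\<^sup>+\<omega>. ennreal ((?S n t \<omega> - I t \<omega>)\<^sup>2) \<partial>M) \<longlonglongrightarrow> 0" using i[OF t] by simp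
    qed (use Zsq in \<open>auto intro: m ito_square[OF I t] simple_integral_square[OF d t]\<close>)
    show "integrable M (\<lambda>\<omega>. Z \<omega> * I t \<omega>)" "\<And>n. integrable M (\<lambda>\<omega>. Z \<omega> * ?S n t \<omega>)"
      by (intro integrable_mult_L2 m Zsq ito_square[OF I t] simple_integral_square[OF d t])+
  qed
  have "(\<lambda>n. (LINT \<omega>|M. Z \<omega> * ?S n s \<omega>) - (LINT \<omega>|M. Z \<omega> * ?S n r \<omega>)) \<longlonglongrightarrow> (LINT \<omega>|M. Z \<omega> * I s \<omega>) -
      (LINT \<omega>|M. Z \<omega> * I r \<omega>)"
    by (intro tendsto_diff * r s)
  moreover have "(LINT \<omega>|M. Z \<omega> * ?S n s \<omega>) - (LINT \<omega>|M. Z \<omega> * ?S n r \<omega>) = 0" for n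
    using simple_martingale[OF d[of n] rs Z] int(2)[OF r, of n] int(2)[OF s, of n]
    by (simp add: right_diff_distrib)
  ultimately have "(LINT \<omega>|M. Z \<omega> * I s \<omega>) - (LINT \<omega>|M. Z \<omega> * I r \<omega>) = 0"
    by (simp add: LIMSEQ_const_iff)
  then show ?thesis using int(1)[OF r] int(1)[OF s] by (simp add: right_diff_distrib)
qed

text \<open>Truncation removes the boundedness of the test variable.  The drift of a state equation is integrable at
  almost every time, but in general neither bounded nor square-integrable.\<close>

lemma ito_martingale:
  fixes \<phi> :: "real \<Rightarrow> 'w \<Rightarrow> real"
  assumes I: "is_ito_integral M F W a b \<phi> I" and rs: "a \<le> r" "r \<le> s" "s \<le> b"
    and Z: "Z \<in> borel_measurable (F r)" and int: "integrable M (\<lambda>\<omega>. Z \<omega> * (I s \<omega> - I r \<omega>))"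
  shows "(LINT \<omega>|M. Z \<omega> * (I s \<omega> - I r \<omega>)) = 0"
proof -
  \<comment> \<open>\<open>Z\<close> cut off at \<open>n\<close> and \<open>- n\<close>\<close>
  define Zn where "Zn n \<omega> = max (- real n) (min (real n) (Z \<omega>))" for n :: nat and \<omega>
  have Znm: "Zn n \<in> borel_measurable (F r)" for n
    unfolding Zn_def using Z by measurable
  have Znb: "bounded (Zn n ` space M)" for n
    unfolding bounded_iff Zn_def by (auto intro!: exI[of _ "real n"])
  have m: "I s \<in> borel_measurable M" "I r \<in> borel_measurable M" "Z \<in> borel_measurable M" "\<And>n. Zn n \<in> borel_measurable M"
    by (rule measurable_F_M[OF ito_adapted[OF I, of s]] measurable_F_M[OF ito_adapted[OF I, of r]]
        measurable_F_M[OF Z] measurable_F_M[OF Znm]; (use rs in simp)?)+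
  note [measurable] = m
  have "(\<lambda>n. LINT \<omega>|M. Zn n \<omega> * (I s \<omega> - I r \<omega>)) \<longlonglongrightarrow> (LINT \<omega>|M. Z \<omega> * (I s \<omega> - I r \<omega>))"
  proof (rule integral_dominated_convergence)
    show "integrable M (\<lambda>\<omega>. \<bar>Z \<omega> * (I s \<omega> - I r \<omega>)\<bar>)" using int by (rule integrable_abs)
    show "AE \<omega> in M. (\<lambda>n. Zn n \<omega> * (I s \<omega> - I r \<omega>)) \<longlonglongrightarrow> Z \<omega> * (I s \<omega> - I r \<omega>)"
    proof (rule AE_I2)
      fix \<omega>
      obtain N where N: "\<bar>Z \<omega>\<bar> \<le> real N" using real_arch_simple by blast
      have "\<forall>\<^sub>F n in sequentially. Z \<omega> = Zn n \<omega>"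
        unfolding eventually_sequentially
      proof (intro exI[of _ N] allI impI)
        fix n assume "N \<le> n"
        then have "\<bar>Z \<omega>\<bar> \<le> real n" using N by linarith
        then show "Z \<omega> = Zn n \<omega>" unfolding Zn_def by auto
      qed
      then have "(\<lambda>n. Zn n \<omega>) \<longlonglongrightarrow> Z \<omega>"
        by (rule Lim_transform_eventually[OF tendsto_const])
      then show "(\<lambda>n. Zn n \<omega> * (I s \<omega> - I r \<omega>)) \<longlonglongrightarrow> Z \<omega> * (I s \<omega> - I r \<omega>)"
        by (rule tendsto_mult_right)
    qed
    show "AE \<omega> in M. norm (Zn n \<omega> * (I s \<omega> - I r \<omega>)) \<le> \<bar>Z \<omega> * (I s \<omega> - I r \<omega>)\<bar>" for n
      by (intro AE_I2) (auto simp: abs_mult Zn_def intro!: mult_right_mono)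
  qed measurable
  moreover have "(LINT \<omega>|M. Zn n \<omega> * (I s \<omega> - I r \<omega>)) = 0" for n
    by (rule ito_martingale_bounded[OF I rs Znm Znb])
  ultimately show ?thesis by (simp add: LIMSEQ_const_iff)
qed

subsection \<open>Linear operations\<close>

lemma nn_integral_linear_square_tendsto:
  fixes f :: "'a \<Rightarrow> 'h::euclidean_space"
  assumes h: "bounded_linear h" and m: "f \<in> borel_measurable N" "\<And>n. fn n \<in> borel_measurable N"
    and f: "(\<lambda>n. \<integral>\<^sup>+x. ennreal ((norm (fn n x - f x))\<^sup>2) \<partial>N) \<longlonglongrightarrow> 0"
  shows "(\<lambda>n. \<integral>\<^sup>+x. ennreal ((norm (h (fn n x) - h (f x)))\<^sup>2) \<partial>N) \<longlonglongrightarrow> 0"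
proof -
  note [measurable] = m
  obtain c where c: "0 \<le> c" "\<And>x. norm (h x) \<le> c * norm x"
    using bounded_linear.nonneg_bounded[OF h] by (auto simp: mult.commute)
  have sq: "ennreal ((norm (h x - h y))\<^sup>2) \<le> ennreal (c\<^sup>2) * ennreal ((norm (x - y))\<^sup>2)" for x y
  proof -
    have "(norm (h (x - y)))\<^sup>2 \<le> (c * norm (x - y))\<^sup>2" using c by (intro power_mono) auto
    then show ?thesis by (simp add: linear_diff[OF bounded_linear.linear[OF h]] power_mult_distrib flip: ennreal_mult)
  qed
  have le: "(\<integral>\<^sup>+x. ennreal ((norm (h (fn n x) - h (f x)))\<^sup>2) \<partial>N) \<le> ennreal (c\<^sup>2) *
      (\<integral>\<^sup>+x. ennreal ((norm (fn n x - f x))\<^sup>2) \<partial>N)" for n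
    by (subst nn_integral_cmult[symmetric]) (auto intro!: nn_integral_mono sq)
  have "(\<lambda>n. ennreal (c\<^sup>2) * (\<integral>\<^sup>+x. ennreal ((norm (fn n x - f x))\<^sup>2) \<partial>N)) \<longlonglongrightarrow> 0"
    using ennreal_tendsto_cmult[OF _ f, of "ennreal (c\<^sup>2)"] by simp
  then show ?thesis
    by (rule tendsto_sandwich[OF always_eventually always_eventually tendsto_const, rotated -1]) (use le in auto)
qed

lemma ito_linear:
  fixes \<phi> :: "real \<Rightarrow> 'w \<Rightarrow> 'h::euclidean_space" and h :: "'h \<Rightarrow> 'g::euclidean_space"
  assumes I: "is_ito_integral M F W a b \<phi> I" and h: "bounded_linear h"
  shows "is_ito_integral M F W a b (\<lambda>s \<omega>. h (\<phi> s \<omega>)) (\<lambda>s \<omega>. h (I s \<omega>))"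
proof -
  interpret h: bounded_linear h by fact
  have [measurable]: "h \<in> borel_measurable borel"
    using h by (intro borel_measurable_continuous_onI linear_continuous_on)
  obtain k p \<xi> where ap: "ito_approximation \<phi> I k p \<xi>"
    by (rule ito_approx[OF I])
  note d = ito_approximationD(1)[OF ap]
  let ?\<xi> = "\<lambda>n i \<omega>. h (\<xi> n i \<omega>)"
  have sp: "simple_process (k n) (p n) (?\<xi> n) = (\<lambda>s \<omega>. h (simple_process (k n) (p n) (\<xi> n) s \<omega>))" for n
    by (simp add: simple_process_def h.sum h.scaleR fun_eq_iff)
  have si: "simple_integral W (k n) (p n) (?\<xi> n) s \<omega> = h (simple_integral W (k n) (p n) (\<xi> n) s \<omega>)" for n s \<omega>
    by (simp add: simple_integral_def h.sum h.scaleR)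
  have "simple_data M F a b (k n) (p n) (?\<xi> n)" for n
  proof -
    have "?\<xi> n i \<in> borel_measurable (F (p n i))" "bounded (?\<xi> n i ` space M)" if "i < k n" for i
      using measurable_compose[OF simple_dataD(4)[OF d that], of h borel]
        bounded_linear_image[OF simple_dataD(5)[OF d that] h] by (simp_all add: image_image)
    then show ?thesis using d[of n] unfolding simple_data_def by blast
  qed
  moreover have "(\<lambda>n. \<integral>\<^sup>+z. ennreal ((norm (case_prod (simple_process (k n) (p n) (?\<xi> n)) z - case_prod
      (\<lambda>s \<omega>. h (\<phi> s \<omega>)) z))\<^sup>2) \<partial>LM) \<longlonglongrightarrow> 0"
    using nn_integral_linear_square_tendsto[OF h prog_joint[OF L2F_prog[OF ito_L2F[OF I]]]
        simple_process_joint[OF d] ito_approximationD(2)[OF ap]]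
    by (simp add: sp split_beta')
  moreover have "(\<lambda>n. \<integral>\<^sup>+\<omega>. ennreal ((norm (simple_integral W (k n) (p n) (?\<xi> n) s \<omega> - h (I s \<omega>)))\<^sup>2) \<partial>M) \<longlonglongrightarrow> 0"
    if s: "s \<in> {a..b}" for s
    unfolding si
    by (rule nn_integral_linear_square_tendsto[OF h measurable_F_M[OF ito_adapted[OF I s]]
          measurable_F_M[OF simple_integral_measurable[OF d s]] ito_approximationD(3)[OF ap s]])
  ultimately have "ito_approximation (\<lambda>s \<omega>. h (\<phi> s \<omega>)) (\<lambda>s \<omega>. h (I s \<omega>)) k p ?\<xi>"
    unfolding ito_approximation_def by blast
  moreover have "(\<lambda>\<omega>. h (I s \<omega>)) \<in> borel_measurable (F s)" if "s \<in> {a..b}" for s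
    using ito_adapted[OF I that] by measurable
  moreover have "continuous_on {a..b} (\<lambda>s. h (I s \<omega>))" if "\<omega> \<in> space M" for \<omega>
    by (rule bounded_linear.continuous_on[OF h ito_continuous[OF I that]])
  ultimately show ?thesis
    unfolding is_ito_integral_iff using L2F_linear[OF ito_L2F[OF I] h] by blast
qed


text \<open>The difference of two Ito integrals requires simple integrands over different grids to be brought to a
  common grid.  Over a finer grid, the values of a simple process at the right end points describe the same
  process, and summing the increments inside one coarse interval telescopes.\<close>

lemma telescope_refinement:
  fixes w :: "real \<Rightarrow> 'b::ab_group_add" and r :: "nat \<Rightarrow> real"
  assumes sm: "strict_mono_on {..m} r" and uv: "u \<le> v" "v \<le> m"
  shows "(\<Sum>j<m. if r (Suc j) \<in> {r u<..r v} then w (r (Suc j)) - w (r j) else 0) = w (r v) - (w (r u) :: 'b)"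
proof -
  have r: "r i < r j" if "i < j" "j \<le> m" for i j
    using strict_mono_onD[OF sm, of i j] that by simp
  have mono: "r i \<le> r j" if "i \<le> j" "j \<le> m" for i j
    using r[of i j] that by (cases "i = j") auto
  have iff: "r (Suc j) \<in> {r u<..r v} \<longleftrightarrow> j \<in> {u..<v}" if "j < m" for j
  proof -
    have "r u < r (Suc j) \<longleftrightarrow> u < Suc j" using r[of u "Suc j"] mono[of "Suc j" u] uv that by
        (meson Suc_leI le_trans not_le)
    moreover have "r (Suc j) \<le> r v \<longleftrightarrow> Suc j \<le> v" using r[of v "Suc j"] mono[of "Suc j" v] uv that by
        (meson Suc_leI not_le)
    ultimately show ?thesis by auto
  qed
  have "(\<Sum>j<m. if r (Suc j) \<in> {r u<..r v} then w (r (Suc j)) - w (r j) else 0) = (\<Sum>j<m. if j \<in> {u..<v} then w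
      (r (Suc j)) - w (r j) else 0)"
    by (intro sum.cong refl) (simp only: iff lessThan_iff)
  also have "\<dots> = (\<Sum>j\<in>{u..<v}. w (r (Suc j)) - w (r j))"
    using uv by (subst sum.inter_restrict[symmetric]) (auto intro!: sum.cong)
  also have "\<dots> = w (r v) - w (r u)" by (rule sum_Suc_diff'[OF uv(1)])
  finally show ?thesis .
qed

text \<open>The process and its integral are both sums \<open>\<Sum>i. (w (p (i + 1)) - w (p i)) *\<^sub>R \<xi> i \<omega>\<close>, for \<open>w\<close> the indicator
  \<open>x \<mapsto> [s \<le> x]\<close> and for the stopped path \<open>x \<mapsto> W (min s x)\<close>; refinement preserves such sums for any \<open>w\<close>.\<close>

lemma simple_refine:
  fixes \<xi> :: "nat \<Rightarrow> 'w \<Rightarrow> 'h::euclidean_space" and r :: "nat \<Rightarrow> real"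
  assumes d: "simple_data M F a b k p \<xi>" and sm: "strict_mono_on {..m} r"
    and sub: "p ` {..k} \<subseteq> r ` {..m}" and ab: "r ` {..m} \<subseteq> {a..b}"
  defines "\<xi>' \<equiv> \<lambda>j. simple_process k p \<xi> (r (Suc j))"
  shows "simple_data M F a b m r \<xi>'" "simple_process m r \<xi>' s \<omega> = simple_process k p \<xi> s \<omega>"
    "simple_integral W m r \<xi>' s \<omega> = simple_integral W k p \<xi> s \<omega>"
proof -
  have idx: "\<exists>u\<le>m. p i = r u" if "i \<le> k" for i using sub that by (auto simp: image_subset_iff)
  have r: "r i < r j" if "i < j" "j \<le> m" for i j
    using strict_mono_onD[OF sm, of i j] that by simp
  have mono: "r i \<le> r j" if "i \<le> j" "j \<le> m" for i j
    using r[of i j] that by (cases "i = j") auto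
  have key: "(\<Sum>j<m. if r (Suc j) \<in> {p i<..p (Suc i)} then w (r (Suc j)) - w (r j) else 0) = w (p (Suc i)) - w (p i)"
    if i: "i < k" for i and w :: "real \<Rightarrow> real"
  proof -
    obtain u v where uv: "u \<le> m" "p i = r u" "v \<le> m" "p (Suc i) = r v" using idx[of i] idx[of "Suc i"] i by auto
    have "p i \<le> p (Suc i)" using simple_dataD(3)[OF d, of i "Suc i"] i by simp
    show ?thesis
    proof (cases "u \<le> v")
      case True
      then show ?thesis unfolding uv by (rule telescope_refinement[OF sm _ uv(3)])
    next
      case False
      then show ?thesis using \<open>p i \<le> p (Suc i)\<close> r[of v u] uv by auto
    qed
  qed
  have sw: "(\<Sum>j<m. (w (r (Suc j)) - w (r j)) *\<^sub>R \<xi>' j \<omega>) = (\<Sum>i<k. (w (p (Suc i)) - w (p i)) *\<^sub>R \<xi> i \<omega>)" for w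
      :: "real \<Rightarrow> real"
  proof -
    have "(\<Sum>j<m. (w (r (Suc j)) - w (r j)) *\<^sub>R \<xi>' j \<omega>) =
      (\<Sum>j<m. \<Sum>i<k. (if r (Suc j) \<in> {p i<..p (Suc i)} then w (r (Suc j)) - w (r j) else 0) *\<^sub>R \<xi> i \<omega>)"
      unfolding \<xi>'_def simple_process_def scaleR_sum_right
      by (intro sum.cong refl) (auto simp: indicator_def)
    also have "\<dots> = (\<Sum>i<k. (\<Sum>j<m. (if r (Suc j) \<in> {p i<..p (Suc i)} then w (r (Suc j)) - w (r j) else 0)) *\<^sub>R \<xi> i \<omega>)"
      by (subst sum.swap) (simp only: scaleR_sum_left)
    also have "\<dots> = (\<Sum>i<k. (w (p (Suc i)) - w (p i)) *\<^sub>R \<xi> i \<omega>)"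
      by (intro sum.cong refl) (simp only: key lessThan_iff)
    finally show ?thesis .
  qed
  show "simple_integral W m r \<xi>' s \<omega> = simple_integral W k p \<xi> s \<omega>"
    using sw[of "\<lambda>x. W (min s x) \<omega>"] unfolding simple_integral_def .
  have ind: "indicator {x<..y} s = of_bool (s \<le> y) - (of_bool (s \<le> x) :: real)" if "x \<le> y" for x y
    using that by (auto simp: indicator_def)
  have "simple_process m r \<xi>' s \<omega> = (\<Sum>j<m. (of_bool (s \<le> r (Suc j)) - of_bool (s \<le> r j)) *\<^sub>R \<xi>' j \<omega>)"
    unfolding simple_process_def by (intro sum.cong refl) (simp add: ind mono)
  also have "\<dots> = (\<Sum>i<k. (of_bool (s \<le> p (Suc i)) - of_bool (s \<le> p i)) *\<^sub>R \<xi> i \<omega>)" by (rule sw)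
  also have "\<dots> = simple_process k p \<xi> s \<omega>"
    unfolding simple_process_def by (intro sum.cong refl) (simp add: ind simple_dataD(3)[OF d])
  finally show "simple_process m r \<xi>' s \<omega> = simple_process k p \<xi> s \<omega>" .
  have "\<xi>' j \<in> borel_measurable (F (r j))" "bounded (\<xi>' j ` space M)" if j: "j < m" for j
  proof -
    have "(\<lambda>\<omega>. indicat_real {p i<..p (Suc i)} (r (Suc j)) *\<^sub>R \<xi> i \<omega>) \<in> borel_measurable (F (r j))" if i: "i < k" for i
    proof (cases "p i < r (Suc j)")
      case True
      obtain u where u: "u \<le> m" "p i = r u" using idx[of i] i by auto
      have "u \<le> j" using True mono[of "Suc j" u] u by (metis leI not_less_eq_eq order.strict_trans2 order_less_irrefl)
      then have "p i \<le> r j" using u mono[of u j] j by simp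
      from measurable_F_mono[OF simple_dataD(4)[OF d i] this] show ?thesis by measurable
    qed simp
    then show "\<xi>' j \<in> borel_measurable (F (r j))"
      unfolding \<xi>'_def simple_process_def by (intro borel_measurable_sum) auto
    show "bounded (\<xi>' j ` space M)"
      using simple_process_bounded[OF d] unfolding \<xi>'_def bounded_iff by (metis (no_types, lifting) imageE)
  qed
  moreover have "a \<le> r 0" "r m \<le> b" using ab by auto
  ultimately show "simple_data M F a b m r \<xi>'" unfolding simple_data_def using mono by auto
qed

lemma common_grid:
  assumes d: "simple_data M F a b k p \<xi>" and d': "simple_data M F a b k' p' \<xi>'"
  obtains m and r :: "nat \<Rightarrow> real" where "strict_mono_on {..m} r"
    "p ` {..k} \<subseteq> r ` {..m}" "p' ` {..k'} \<subseteq> r ` {..m}" "r ` {..m} \<subseteq> {a..b}"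
proof -
  let ?S = "p ` {..k} \<union> p' ` {..k'}"
  let ?l = "sorted_list_of_set ?S"
  have fin: "finite ?S" by simp
  have len: "length ?l = card ?S" by simp
  have ne: "card ?S \<noteq> 0" by auto
  define m where "m = card ?S - 1"
  have im: "(!) ?l ` {..m} = ?S"
  proof -
    have "Suc m = card ?S" using ne unfolding m_def by linarith
    then have "{..m} = {0..<length ?l}"
      unfolding len by (metis atLeast0LessThan lessThan_Suc_atMost)
    then have "(!) ?l ` {..m} = set ?l" by (auto simp: set_conv_nth)
    then show ?thesis using fin by simp
  qed
  show ?thesis
  proof (rule that[of m "(!) ?l"])
    have "j < card ?S" if "j \<le> m" for j using that ne unfolding m_def by linarith
    then show "strict_mono_on {..m} ((!) ?l)"
      by (intro strict_mono_onI sorted_wrt_nth_less[OF strict_sorted_list_of_set]) (simp_all add: len)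
    show "(!) ?l ` {..m} \<subseteq> {a..b}"
      unfolding im using simple_dataD(1,2)[OF d] simple_dataD(1,2)[OF d'] by auto
  qed (use im in auto)
qed

lemma simple_diff:
  fixes \<xi> \<xi>' :: "nat \<Rightarrow> 'w \<Rightarrow> 'h::euclidean_space"
  assumes d: "simple_data M F a b k p \<xi>" and d': "simple_data M F a b k' p' \<xi>'"
  obtains m r \<theta> where "simple_data M F a b m r \<theta>"
    "\<And>s \<omega>. simple_process m r \<theta> s \<omega> = simple_process k p \<xi> s \<omega> - simple_process k' p' \<xi>' s \<omega>"
    "\<And>s \<omega>. simple_integral W m r \<theta> s \<omega> = simple_integral W k p \<xi> s \<omega> - simple_integral W k' p' \<xi>' s \<omega>"
proof -
  obtain m and r :: "nat \<Rightarrow> real" where g: "strict_mono_on {..m} r"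
    "p ` {..k} \<subseteq> r ` {..m}" "p' ` {..k'} \<subseteq> r ` {..m}" "r ` {..m} \<subseteq> {a..b}"
    by (rule common_grid[OF d d']) blast
  note 1 = simple_refine[OF d g(1,2,4)] and 2 = simple_refine[OF d' g(1,3,4)]
  let ?\<xi> = "\<lambda>j. simple_process k p \<xi> (r (Suc j))" and ?\<xi>' = "\<lambda>j. simple_process k' p' \<xi>' (r (Suc j))"
  show ?thesis
  proof (rule that[of m r "\<lambda>j \<omega>. ?\<xi> j \<omega> - ?\<xi>' j \<omega>"])
    have "(\<lambda>\<omega>. ?\<xi> j \<omega> - ?\<xi>' j \<omega>) \<in> borel_measurable (F (r j))"
      "bounded ((\<lambda>\<omega>. ?\<xi> j \<omega> - ?\<xi>' j \<omega>) ` space M)" if "j < m" for j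
      using simple_dataD(4,5)[OF 1(1) that] simple_dataD(4,5)[OF 2(1) that]
      by (auto intro!: borel_measurable_diff bounded_minus_comp)
    then show "simple_data M F a b m r (\<lambda>j \<omega>. ?\<xi> j \<omega> - ?\<xi>' j \<omega>)"
      using 1(1) unfolding simple_data_def by blast
    show "simple_process m r (\<lambda>j \<omega>. ?\<xi> j \<omega> - ?\<xi>' j \<omega>) s \<omega> = simple_process k p \<xi> s \<omega> - simple_process k' p' \<xi>'
        s \<omega>" for s \<omega>
    proof -
      have "simple_process m r (\<lambda>j \<omega>. ?\<xi> j \<omega> - ?\<xi>' j \<omega>) s \<omega> = simple_process m r ?\<xi> s \<omega> - simple_process m r ?\<xi>' s \<omega>"
        unfolding simple_process_def[of m] scaleR_diff_right sum_subtractf ..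
      then show ?thesis by (simp only: 1(2) 2(2))
    qed
    show "simple_integral W m r (\<lambda>j \<omega>. ?\<xi> j \<omega> - ?\<xi>' j \<omega>) s \<omega> = simple_integral W k p \<xi> s \<omega> - simple_integral W
        k' p' \<xi>' s \<omega>" for s \<omega>
    proof -
      have "simple_integral W m r (\<lambda>j \<omega>. ?\<xi> j \<omega> - ?\<xi>' j \<omega>) s \<omega> = simple_integral W m r ?\<xi> s \<omega> - simple_integral
          W m r ?\<xi>' s \<omega>"
        unfolding simple_integral_def[of _ m] scaleR_diff_right sum_subtractf ..
      then show ?thesis by (simp only: 1(3) 2(3))
    qed
  qed
qed

lemma nn_integral_diff_square_tendsto:
  fixes f g :: "'a \<Rightarrow> 'h::euclidean_space"
  assumes m: "f \<in> borel_measurable N" "g \<in> borel_measurable N"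
      "\<And>n. fn n \<in> borel_measurable N" "\<And>n. gn n \<in> borel_measurable N"
    and f: "(\<lambda>n. \<integral>\<^sup>+x. ennreal ((norm (fn n x - f x))\<^sup>2) \<partial>N) \<longlonglongrightarrow> 0"
    and g: "(\<lambda>n. \<integral>\<^sup>+x. ennreal ((norm (gn n x - g x))\<^sup>2) \<partial>N) \<longlonglongrightarrow> 0"
  shows "(\<lambda>n. \<integral>\<^sup>+x. ennreal ((norm ((fn n x - gn n x) - (f x - g x)))\<^sup>2) \<partial>N) \<longlonglongrightarrow> 0"
proof (rule tendsto_sandwich[OF always_eventually always_eventually tendsto_const])
  note [measurable] = m
  let ?a = "\<lambda>n. \<integral>\<^sup>+x. ennreal ((norm (fn n x - f x))\<^sup>2) \<partial>N"
  let ?b = "\<lambda>n. \<integral>\<^sup>+x. ennreal ((norm (gn n x - g x))\<^sup>2) \<partial>N"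
  show "(\<lambda>n. 2 * ?a n + 2 * ?b n) \<longlonglongrightarrow> 0"
    using tendsto_add[OF ennreal_tendsto_cmult[OF _ f, of 2] ennreal_tendsto_cmult[OF _ g, of 2]] by simp
  show "\<forall>n. (\<integral>\<^sup>+x. ennreal ((norm ((fn n x - gn n x) - (f x - g x)))\<^sup>2) \<partial>N) \<le> 2 * ?a n + 2 * ?b n"
  proof
    fix n
    have "(\<integral>\<^sup>+x. ennreal ((norm ((fn n x - gn n x) - (f x - g x)))\<^sup>2) \<partial>N) \<le>
      (\<integral>\<^sup>+x. 2 * ennreal ((norm (fn n x - f x))\<^sup>2) + 2 * ennreal ((norm (gn n x - g x))\<^sup>2) \<partial>N)"
    proof (rule nn_integral_mono)
      fix x
      have "(norm ((fn n x - gn n x) - (f x - g x)))\<^sup>2 \<le> 2 * (norm (fn n x - f x))\<^sup>2 + 2 * (norm (gn n x - g x))\<^sup>2"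
        using norm_diff_square_le[of "fn n x - f x" "gn n x - g x"] by (simp add: algebra_simps)
      then have "ennreal ((norm ((fn n x - gn n x) - (f x - g x)))\<^sup>2) \<le> ennreal (2 * (norm (fn n x - f x))\<^sup>2 +
          2 * (norm (gn n x - g x))\<^sup>2)"
        by (rule ennreal_leI)
      then show "ennreal ((norm ((fn n x - gn n x) - (f x - g x)))\<^sup>2) \<le> 2 * ennreal ((norm (fn n x - f x))\<^sup>2) +
          2 * ennreal ((norm (gn n x - g x))\<^sup>2)"
        by (simp add: ennreal_mult)
    qed
    also have "\<dots> = 2 * ?a n + 2 * ?b n" by (simp add: nn_integral_add nn_integral_cmult)
    finally show "(\<integral>\<^sup>+x. ennreal ((norm ((fn n x - gn n x) - (f x - g x)))\<^sup>2) \<partial>N) \<le> 2 * ?a n + 2 * ?b n" .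
  qed
qed simp

lemma ito_diff:
  fixes \<phi> \<psi> :: "real \<Rightarrow> 'w \<Rightarrow> 'h::euclidean_space"
  assumes I: "is_ito_integral M F W a b \<phi> I" and K: "is_ito_integral M F W a b \<psi> K"
  shows "is_ito_integral M F W a b (\<lambda>s \<omega>. \<phi> s \<omega> - \<psi> s \<omega>) (\<lambda>s \<omega>. I s \<omega> - K s \<omega>)"
proof -
  obtain k p \<xi> where ap: "ito_approximation \<phi> I k p \<xi>"
    by (rule ito_approx[OF I])
  obtain k' p' \<xi>' where ap': "ito_approximation \<psi> K k' p' \<xi>'"
    by (rule ito_approx[OF K])
  note d = ito_approximationD(1)[OF ap] and d' = ito_approximationD(1)[OF ap']
  have "\<exists>m r \<theta>. simple_data M F a b m r \<theta> \<and>
    (\<forall>s \<omega>. simple_process m r \<theta> s \<omega> = simple_process (k n) (p n) (\<xi> n) s \<omega> - simple_process (k' n) (p' n) (\<xi>' n) s \<omega>) \<and>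
    (\<forall>s \<omega>. simple_integral W m r \<theta> s \<omega> = simple_integral W (k n) (p n) (\<xi> n) s \<omega> - simple_integral W (k' n)
        (p' n) (\<xi>' n) s \<omega>)" for n
    by (rule simple_diff[OF d[of n] d'[of n]]) blast
  then obtain m r \<theta> where c: "\<And>n. simple_data M F a b (m n) (r n) (\<theta> n)"
    and sp: "\<And>n s \<omega>. simple_process (m n) (r n) (\<theta> n) s \<omega> = simple_process (k n) (p n) (\<xi> n) s \<omega> -
        simple_process (k' n) (p' n) (\<xi>' n) s \<omega>"
    and si: "\<And>n s \<omega>. simple_integral W (m n) (r n) (\<theta> n) s \<omega> = simple_integral W (k n) (p n) (\<xi> n) s \<omega> -
        simple_integral W (k' n) (p' n) (\<xi>' n) s \<omega>"
    by metis
  have "(\<lambda>n. \<integral>\<^sup>+z. ennreal ((norm (case_prod (simple_process (m n) (r n) (\<theta> n)) z - case_prod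
      (\<lambda>s \<omega>. \<phi> s \<omega> - \<psi> s \<omega>) z))\<^sup>2) \<partial>LM) \<longlonglongrightarrow> 0"
    using nn_integral_diff_square_tendsto[OF prog_joint[OF L2F_prog[OF ito_L2F[OF I]]]
        prog_joint[OF L2F_prog[OF ito_L2F[OF K]]]
        simple_process_joint[OF d] simple_process_joint[OF d'] ito_approximationD(2)[OF ap]
            ito_approximationD(2)[OF ap']]
    by (simp add: sp split_beta')
  moreover have "(\<lambda>n. \<integral>\<^sup>+\<omega>. ennreal ((norm (simple_integral W (m n) (r n) (\<theta> n) s \<omega> - (I s \<omega> - K s \<omega>)))\<^sup>2) \<partial>M) \<longlonglongrightarrow> 0"
    if s: "s \<in> {a..b}" for s
    unfolding si
    by (rule nn_integral_diff_square_tendsto[OF measurable_F_M[OF ito_adapted[OF I s]]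
        measurable_F_M[OF ito_adapted[OF K s]]
        measurable_F_M[OF simple_integral_measurable[OF d s]] measurable_F_M[OF simple_integral_measurable[OF d' s]]
        ito_approximationD(3)[OF ap s] ito_approximationD(3)[OF ap' s]])
  ultimately have "ito_approximation (\<lambda>s \<omega>. \<phi> s \<omega> - \<psi> s \<omega>) (\<lambda>s \<omega>. I s \<omega> - K s \<omega>) m r \<theta>"
    unfolding ito_approximation_def using c by blast
  moreover have "(\<lambda>\<omega>. I s \<omega> - K s \<omega>) \<in> borel_measurable (F s)" if "s \<in> {a..b}" for s
    by (intro borel_measurable_diff ito_adapted[OF I that] ito_adapted[OF K that])
  moreover have "continuous_on {a..b} (\<lambda>s. I s \<omega> - K s \<omega>)" if "\<omega> \<in> space M" for \<omega>
    by (intro continuous_on_diff ito_continuous[OF I that] ito_continuous[OF K that])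
  ultimately show ?thesis
    unfolding is_ito_integral_iff using L2F_diff[OF ito_L2F[OF I] ito_L2F[OF K]] by blast
qed

section \<open>The product rule in expectation\<close>

definition ito_process :: "(real \<Rightarrow> 'w \<Rightarrow> 'h::euclidean_space) \<Rightarrow> (real \<Rightarrow> 'w \<Rightarrow> 'h) \<Rightarrow> (real \<Rightarrow> 'w \<Rightarrow> 'h) \<Rightarrow> bool" where
  "ito_process X \<alpha> \<beta> \<longleftrightarrow> X \<in> L2F_C M F a b \<and> \<alpha> \<in> L2F_L1 M F a b \<and> has_ito_differential M F W a b X \<alpha> \<beta>"

lemma has_ito_differential_linear:
  fixes h :: "'h::euclidean_space \<Rightarrow> 'g::euclidean_space"
  assumes X: "has_ito_differential M F W a b X \<alpha> \<beta>" and h: "bounded_linear h"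
  shows "has_ito_differential M F W a b (\<lambda>s \<omega>. h (X s \<omega>)) (\<lambda>s \<omega>. h (\<alpha> s \<omega>)) (\<lambda>s \<omega>. h (\<beta> s \<omega>))"
proof -
  interpret h: bounded_linear h by fact
  from X obtain I where I: "is_ito_integral M F W a b \<beta> I"
    and int: "AE \<omega> in M. set_integrable lborel {a..b} (\<lambda>s. \<alpha> s \<omega>)"
    and eq: "AE \<omega> in M. \<forall>s\<in>{a..b}. X s \<omega> = X a \<omega> + (LINT r:{a..s}|lborel. \<alpha> r \<omega>) + I s \<omega>"
    unfolding has_ito_differential_def by blast
  have lin: "set_integrable lborel A (\<lambda>s. h (f s)) \<and> (LINT r:A|lborel. h (f r)) = h (LINT r:A|lborel. f r)"
    if "set_integrable lborel A f" for A and f :: "real \<Rightarrow> 'h"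
    using integrable_bounded_linear[OF h that[unfolded set_integrable_def]]
      integral_bounded_linear[OF h that[unfolded set_integrable_def]]
    by (simp add: set_integrable_def set_lebesgue_integral_def h.scaleR)
  have "AE \<omega> in M. set_integrable lborel {a..b} (\<lambda>s. h (\<alpha> s \<omega>))"
    using int by eventually_elim (use lin in blast)
  moreover have "AE \<omega> in M. \<forall>s\<in>{a..b}. h (X s \<omega>) = h (X a \<omega>) + (LINT r:{a..s}|lborel. h (\<alpha> r \<omega>)) + h (I s \<omega>)"
    using int eq
  proof eventually_elim
    case (elim \<omega>)
    show ?case
    proof
      fix s assume s: "s \<in> {a..b}"
      have "set_integrable lborel {a..s} (\<lambda>r. \<alpha> r \<omega>)"
        by (rule set_integrable_subset[OF elim(1)]) (use s in auto)
      from conjunct2[OF lin[OF this]] elim(2) s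
      show "h (X s \<omega>) = h (X a \<omega>) + (LINT r:{a..s}|lborel. h (\<alpha> r \<omega>)) + h (I s \<omega>)"
        by (metis h.add)
    qed
  qed
  ultimately show ?thesis
    using ito_linear[OF I h] unfolding has_ito_differential_def by blast
qed

lemma has_ito_differential_diff:
  assumes X: "has_ito_differential M F W a b X \<alpha> \<beta>" and Y: "has_ito_differential M F W a b Y \<gamma> \<delta>"
  shows "has_ito_differential M F W a b (\<lambda>s \<omega>. X s \<omega> - Y s \<omega>) (\<lambda>s \<omega>. \<alpha> s \<omega> - \<gamma> s \<omega>) (\<lambda>s \<omega>. \<beta> s \<omega> - \<delta> s \<omega>)"
proof -
  from X obtain I where I: "is_ito_integral M F W a b \<beta> I"
    and int: "AE \<omega> in M. set_integrable lborel {a..b} (\<lambda>s. \<alpha> s \<omega>)"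
    and eq: "AE \<omega> in M. \<forall>s\<in>{a..b}. X s \<omega> = X a \<omega> + (LINT r:{a..s}|lborel. \<alpha> r \<omega>) + I s \<omega>"
    unfolding has_ito_differential_def by blast
  from Y obtain K where K: "is_ito_integral M F W a b \<delta> K"
    and int': "AE \<omega> in M. set_integrable lborel {a..b} (\<lambda>s. \<gamma> s \<omega>)"
    and eq': "AE \<omega> in M. \<forall>s\<in>{a..b}. Y s \<omega> = Y a \<omega> + (LINT r:{a..s}|lborel. \<gamma> r \<omega>) + K s \<omega>"
    unfolding has_ito_differential_def by blast
  have "AE \<omega> in M. set_integrable lborel {a..b} (\<lambda>s. \<alpha> s \<omega> - \<gamma> s \<omega>)"
    using int int' by eventually_elim (rule set_integral_diff(1))
  moreover have "AE \<omega> in M. \<forall>s\<in>{a..b}. X s \<omega> - Y s \<omega> = X a \<omega> - Y a \<omega> + (LINT r:{a..s}|lborel. \<alpha> r \<omega> - \<gamma> r \<omega>) +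
      (I s \<omega> - K s \<omega>)"
    using int int' eq eq'
  proof eventually_elim
    case (elim \<omega>)
    show ?case
    proof
      fix s assume s: "s \<in> {a..b}"
      have "set_integrable lborel {a..s} (\<lambda>r. \<alpha> r \<omega>)" "set_integrable lborel {a..s} (\<lambda>r. \<gamma> r \<omega>)"
        using s by (auto intro!: set_integrable_subset[OF elim(1)] set_integrable_subset[OF elim(2)])
      from set_integral_diff(2)[OF this] bspec[OF elim(3) s] bspec[OF elim(4) s]
      show "X s \<omega> - Y s \<omega> = X a \<omega> - Y a \<omega> + (LINT r:{a..s}|lborel. \<alpha> r \<omega> - \<gamma> r \<omega>) + (I s \<omega> - K s \<omega>)"
        by (simp add: algebra_simps)
    qed
  qed
  ultimately show ?thesis
    using ito_diff[OF I K] unfolding has_ito_differential_def by blast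
qed

lemma ito_process_linear:
  assumes "ito_process X \<alpha> \<beta>" "bounded_linear h"
  shows "ito_process (\<lambda>s \<omega>. h (X s \<omega>)) (\<lambda>s \<omega>. h (\<alpha> s \<omega>)) (\<lambda>s \<omega>. h (\<beta> s \<omega>))"
  using assms L2F_C_linear L2F_L1_linear has_ito_differential_linear unfolding ito_process_def by blast

text \<open>The bound is the total variation of the drift, which is finite almost surely.\<close>

lemma drift_dominated:
  fixes \<alpha> :: "real \<Rightarrow> 'w \<Rightarrow> real"
  assumes \<alpha>: "\<alpha> \<in> L2F_L1 M F a b"
  obtains n where "n \<in> borel_measurable M" "integrable M (\<lambda>\<omega>. (n \<omega>)\<^sup>2)" "\<And>\<omega>. 0 \<le> n \<omega>"
    "AE \<omega> in M. \<forall>s\<in>{a..b}. \<bar>LINT r:{a..s}|lborel. \<alpha> r \<omega>\<bar> \<le> n \<omega>"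
proof -
  let ?A = "\<lambda>\<omega>. \<integral>\<^sup>+s. ennreal (norm (\<alpha> s \<omega>)) \<partial>L"
  note [measurable] = path_nn_integral_measurable[OF L2F_L1_prog[OF \<alpha>]]
  have A2: "(\<integral>\<^sup>+\<omega>. (?A \<omega>)\<^sup>2 \<partial>M) < \<infinity>" using \<alpha> by (simp add: L2F_L1_iff)
  have fin: "AE \<omega> in M. ?A \<omega> < \<infinity>"
  proof -
    have "AE \<omega> in M. (?A \<omega>)\<^sup>2 \<noteq> \<infinity>"
    proof (rule nn_integral_PInf_AE)
      show "(\<lambda>\<omega>. (?A \<omega>)\<^sup>2) \<in> borel_measurable M" by measurable
      show "(\<integral>\<^sup>+\<omega>. (?A \<omega>)\<^sup>2 \<partial>M) \<noteq> \<infinity>" using A2 by simp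
    qed
    then show ?thesis by eventually_elim (auto simp: power2_eq_square less_top[symmetric])
  qed
  show ?thesis
  proof (rule that[of "\<lambda>\<omega>. enn2real (?A \<omega>)"])
    show "(\<lambda>\<omega>. enn2real (?A \<omega>)) \<in> borel_measurable M" by measurable
    have "(\<integral>\<^sup>+\<omega>. ennreal ((enn2real (?A \<omega>))\<^sup>2) \<partial>M) = (\<integral>\<^sup>+\<omega>. (?A \<omega>)\<^sup>2 \<partial>M)"
    proof (rule nn_integral_cong_AE)
      show "AE \<omega> in M. ennreal ((enn2real (?A \<omega>))\<^sup>2) = (?A \<omega>)\<^sup>2"
        using fin by eventually_elim (simp flip: ennreal_power)
    qed
    moreover have "(\<lambda>\<omega>. (enn2real (?A \<omega>))\<^sup>2) \<in> borel_measurable M" by measurable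
    ultimately show "integrable M (\<lambda>\<omega>. (enn2real (?A \<omega>))\<^sup>2)" using A2 by (simp add: integrable_iff_bounded)
    show "AE \<omega> in M. \<forall>s\<in>{a..b}. \<bar>LINT r:{a..s}|lborel. \<alpha> r \<omega>\<bar> \<le> enn2real (?A \<omega>)"
      using fin AE_space
    proof eventually_elim
      case (elim \<omega>)
      note [measurable] = prog_section_measurable[OF L2F_L1_prog[OF \<alpha>] elim(2)]
      have int: "integrable L (\<lambda>s. \<alpha> s \<omega>)" using elim(1) by (simp add: integrable_iff_bounded)
      show ?case
      proof
        fix s assume s: "s \<in> {a..b}"
        have "ennreal (norm (LINT r:{a..s}|lborel. \<alpha> r \<omega>)) \<le> (\<integral>\<^sup>+r. ennreal (norm (\<alpha> r \<omega>)) \<partial>leb_on a s)"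
          unfolding set_lebesgue_integral_leb_on
        proof (rule integral_norm_bound_ennreal)
          have "set_integrable lborel {a..s} (\<lambda>s. \<alpha> s \<omega>)"
            by (rule set_integrable_subset[OF int[folded set_integrable_leb_on]]) (use s in auto)
          then show "integrable (leb_on a s) (\<lambda>r. \<alpha> r \<omega>)" by (simp add: set_integrable_leb_on)
        qed
        also have "\<dots> \<le> ?A \<omega>"
          unfolding nn_set_integral_leb_on[symmetric]
          by (intro nn_set_integral_set_mono) (use s in auto)
        finally have "ennreal (norm (LINT r:{a..s}|lborel. \<alpha> r \<omega>)) \<le> ?A \<omega>" .
        then show "\<bar>LINT r:{a..s}|lborel. \<alpha> r \<omega>\<bar> \<le> enn2real (?A \<omega>)"
          using elim(1) enn2real_mono by fastforce
      qed
    qed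
  qed simp
qed

lemma time_expectation_product:
  fixes f :: "real \<Rightarrow> 'w \<Rightarrow> real"
  assumes f: "integrable LM (\<lambda>(s, \<omega>). f s \<omega>)" and s: "s \<in> {a..b}"
  shows "(LINT r:{a..s}|lborel. (LINT \<omega>|M. f r \<omega>)) = (LINT z|LM. indicator {a..s} (fst z) * case_prod f z)"
    and "integrable LM (\<lambda>z. indicator {a..s} (fst z) * case_prod f z)"
proof -
  note up = time_expectation_upto(1)[OF f s]
  have "(LINT z|LM. case_prod (\<lambda>r \<omega>. indicator {a..s} r * f r \<omega>) z) =
      (LINT r|L. (LINT \<omega>|M. indicator {a..s} r * f r \<omega>))"
    using time_expectation(5,6)[OF up] by simp
  also have "\<dots> = (LINT r:{a..b}|lborel. (LINT \<omega>|M. indicator {a..s} r * f r \<omega>))"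
    by (simp only: set_lebesgue_integral_leb_on)
  also have "\<dots> = (LINT r:{a..s}|lborel. (LINT \<omega>|M. f r \<omega>))"
    using s unfolding set_lebesgue_integral_def
    by (intro Bochner_Integration.integral_cong) (auto simp: indicator_def)
  finally show "(LINT r:{a..s}|lborel. (LINT \<omega>|M. f r \<omega>)) = (LINT z|LM. indicator {a..s} (fst z) * case_prod f z)"
    by (simp add: split_beta')
  show "integrable LM (\<lambda>z. indicator {a..s} (fst z) * case_prod f z)"
    using up by (simp add: split_beta')
qed

text \<open>Since \<open>\<alpha> r\<close> is known at time \<open>r\<close>, the Ito integral may be evaluated at \<open>r\<close> instead of \<open>s\<close>: its
  increment from \<open>r\<close> to \<open>s\<close> is orthogonal to \<open>\<alpha> r\<close>.\<close>

lemma drift_times_ito: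
  fixes \<alpha> \<delta> :: "real \<Rightarrow> 'w \<Rightarrow> real"
  assumes \<alpha>: "\<alpha> \<in> L2F_L1 M F a b" and K: "is_ito_integral M F W a b \<delta> K"
    and m: "m \<in> borel_measurable M" "integrable M (\<lambda>\<omega>. (m \<omega>)\<^sup>2)" "\<And>\<omega>. 0 \<le> m \<omega>"
    and Km: "AE \<omega> in M. \<forall>s\<in>{a..b}. \<bar>K s \<omega>\<bar> \<le> m \<omega>" and s: "s \<in> {a..b}"
  shows "(LINT \<omega>|M. (LINT r:{a..s}|lborel. \<alpha> r \<omega>) * K s \<omega>) = (LINT r:{a..s}|lborel. (LINT \<omega>|M. \<alpha> r \<omega> * K r \<omega>))"
    and "integrable LM (\<lambda>(r, \<omega>). \<alpha> r \<omega> * K r \<omega>)"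
proof -
  note [measurable] = prog_joint[OF L2F_L1_prog[OF \<alpha>]] prog_joint[OF ito_prog[OF K]]
  have Ks [measurable]: "K s \<in> borel_measurable M" by (rule measurable_F_M[OF ito_adapted[OF K s]])
  have i1: "integrable LM (\<lambda>(r, \<omega>). \<alpha> r \<omega> * K s \<omega>)"
  proof (rule integrable_L1_dominated[OF \<alpha> m])
    show "AE \<omega> in M. \<forall>r\<in>{a..b}. \<bar>\<alpha> r \<omega> * K s \<omega>\<bar> \<le> norm (\<alpha> r \<omega>) * m \<omega>"
      using Km by eventually_elim (use s in \<open>auto simp: abs_mult intro!: mult_left_mono\<close>)
  qed measurable
  show i2: "integrable LM (\<lambda>(r, \<omega>). \<alpha> r \<omega> * K r \<omega>)"
  proof (rule integrable_L1_dominated[OF \<alpha> m])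
    show "AE \<omega> in M. \<forall>r\<in>{a..b}. \<bar>\<alpha> r \<omega> * K r \<omega>\<bar> \<le> norm (\<alpha> r \<omega>) * m \<omega>"
      using Km by eventually_elim (auto simp: abs_mult intro!: mult_left_mono)
  qed measurable
  have sub: "{a..s} \<subseteq> {a..b}" using s by auto
  have "(LINT \<omega>|M. (LINT r:{a..s}|lborel. \<alpha> r \<omega>) * K s \<omega>) = (LINT \<omega>|M. (LINT r:{a..s}|lborel. \<alpha> r \<omega> * K s \<omega>))"
    by simp
  also have "\<dots> = (LINT r:{a..s}|lborel. (LINT \<omega>|M. \<alpha> r \<omega> * K s \<omega>))"
    by (rule time_expectation_upto(3)[OF i1 s])
  also have "\<dots> = (LINT r:{a..s}|lborel. (LINT \<omega>|M. \<alpha> r \<omega> * K r \<omega>))"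
    unfolding set_lebesgue_integral_leb_on
  proof (rule integral_cong_AE)
    show "(\<lambda>r. LINT \<omega>|M. \<alpha> r \<omega> * K s \<omega>) \<in> borel_measurable (leb_on a s)"
      "(\<lambda>r. LINT \<omega>|M. \<alpha> r \<omega> * K r \<omega>) \<in> borel_measurable (leb_on a s)"
      using time_expectation(3)[OF i1] time_expectation(3)[OF i2]
      by (auto intro!: measurable_leb_on_mono[OF _ sub])
    have "AE r in leb_on a s. integrable M (\<lambda>\<omega>. \<alpha> r \<omega> * K s \<omega>)" "AE r in leb_on a s. integrable M (\<lambda>\<omega>. \<alpha> r \<omega> * K r \<omega>)"
      using time_expectation(1)[OF i1] time_expectation(1)[OF i2] unfolding AE_leb_on
      by (eventually_elim, use sub in auto)+
    then show "AE r in leb_on a s. (LINT \<omega>|M. \<alpha> r \<omega> * K s \<omega>) = (LINT \<omega>|M. \<alpha> r \<omega> * K r \<omega>)"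
      using AE_space
    proof eventually_elim
      case (elim r)
      then have r: "a \<le> r" "r \<le> s" "s \<le> b" using s by auto
      have "(LINT \<omega>|M. \<alpha> r \<omega> * (K s \<omega> - K r \<omega>)) = 0"
        by (rule ito_martingale[OF K r prog_adapted[OF L2F_L1_prog[OF \<alpha>]]])
          (use r elim in \<open>auto simp: right_diff_distrib\<close>)
      then show ?case using elim by (simp add: right_diff_distrib)
    qed
  qed
  finally show "(LINT \<omega>|M. (LINT r:{a..s}|lborel. \<alpha> r \<omega>) * K s \<omega>) = (LINT r:{a..s}|lborel. (LINT \<omega>|M. \<alpha> r \<omega> * K r \<omega>))" .
qed


lemma integrable_square_add:
  fixes f g :: "'w \<Rightarrow> real"
  assumes "f \<in> borel_measurable M" "g \<in> borel_measurable M"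
    and "integrable M (\<lambda>\<omega>. (f \<omega>)\<^sup>2)" "integrable M (\<lambda>\<omega>. (g \<omega>)\<^sup>2)"
  shows "integrable M (\<lambda>\<omega>. (f \<omega> + g \<omega>)\<^sup>2)"
  using assms integrable_mult_L2[OF assms] unfolding power2_sum by (auto simp: mult.assoc)

text \<open>One square-integrable random variable bounds the process, its martingale part and its drift part.  The
  path bound for the process is part of its definition, and the martingale part inherits one from the process
  and the drift.\<close>

lemma ito_process_dominated:
  fixes x \<alpha> \<beta> :: "real \<Rightarrow> 'w \<Rightarrow> real"
  assumes x: "ito_process x \<alpha> \<beta>"
  obtains I m where "is_ito_integral M F W a b \<beta> I" "m \<in> borel_measurable M" "integrable M (\<lambda>\<omega>. (m \<omega>)\<^sup>2)"
    "\<And>\<omega>. 0 \<le> m \<omega>"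
    "AE \<omega> in M. (\<forall>s\<in>{a..b}. \<bar>x s \<omega>\<bar> \<le> m \<omega> \<and> \<bar>I s \<omega>\<bar> \<le> m \<omega> \<and> \<bar>x s \<omega> - I s \<omega>\<bar> \<le> m \<omega>)"
    "AE \<omega> in M. I a \<omega> = 0 \<and> primitive_on a b (\<lambda>s. x s \<omega> - I s \<omega>) (\<lambda>s. \<alpha> s \<omega>)"
proof -
  from x have xC: "x \<in> L2F_C M F a b" and \<alpha>: "\<alpha> \<in> L2F_L1 M F a b" unfolding ito_process_def by auto
  from x obtain I where I: "is_ito_integral M F W a b \<beta> I"
    and int: "AE \<omega> in M. set_integrable lborel {a..b} (\<lambda>s. \<alpha> s \<omega>)"
    and eq: "AE \<omega> in M. \<forall>s\<in>{a..b}. x s \<omega> = x a \<omega> + (LINT r:{a..s}|lborel. \<alpha> r \<omega>) + I s \<omega>"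
    unfolding ito_process_def has_ito_differential_def by blast
  obtain mx where mx: "mx \<in> borel_measurable M" "integrable M (\<lambda>\<omega>. (mx \<omega>)\<^sup>2)"
      "\<And>\<omega>. 0 \<le> mx \<omega>" "\<And>\<omega> s. \<omega> \<in> space M \<Longrightarrow> s \<in> {a..b} \<Longrightarrow> norm (x s \<omega>) \<le> mx \<omega>"
    by (rule L2F_C_dominated[OF xC]) blast
  obtain n where n: "n \<in> borel_measurable M" "integrable M (\<lambda>\<omega>. (n \<omega>)\<^sup>2)" "\<And>\<omega>. 0 \<le> n \<omega>"
    "AE \<omega> in M. \<forall>s\<in>{a..b}. \<bar>LINT r:{a..s}|lborel. \<alpha> r \<omega>\<bar> \<le> n \<omega>"
    by (rule drift_dominated[OF \<alpha>]) blast
  note [measurable] = mx(1) n(1)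
  show ?thesis
  proof (rule that[OF I, of "\<lambda>\<omega>. 2 * mx \<omega> + n \<omega>"])
    show "integrable M (\<lambda>\<omega>. (2 * mx \<omega> + n \<omega>)\<^sup>2)"
      using mx(2) n(2) by (intro integrable_square_add) (auto simp: power_mult_distrib)
    show "0 \<le> 2 * mx \<omega> + n \<omega>" for \<omega> using mx(3) n(3) by simp
    show "AE \<omega> in M. (\<forall>s\<in>{a..b}. \<bar>x s \<omega>\<bar> \<le> 2 * mx \<omega> + n \<omega> \<and> \<bar>I s \<omega>\<bar> \<le> 2 * mx \<omega> + n \<omega> \<and> \<bar>x s \<omega> - I s \<omega>\<bar> \<le> 2 * mx
        \<omega> + n \<omega>)"
      using eq n(4) AE_space
    proof eventually_elim
      case (elim \<omega>)
      show ?case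
      proof
        fix s assume s: "s \<in> {a..b}"
        have a: "a \<in> {a..b}" using a_le_b by simp
        have "\<bar>x s \<omega>\<bar> \<le> mx \<omega>" "\<bar>x a \<omega>\<bar> \<le> mx \<omega>" "\<bar>LINT r:{a..s}|lborel. \<alpha> r \<omega>\<bar> \<le> n \<omega>"
          "x s \<omega> = x a \<omega> + (LINT r:{a..s}|lborel. \<alpha> r \<omega>) + I s \<omega>"
          using mx(4)[OF elim(3) s] mx(4)[OF elim(3) a] bspec[OF elim(1) s] bspec[OF elim(2) s] by simp_all
        then show "\<bar>x s \<omega>\<bar> \<le> 2 * mx \<omega> + n \<omega> \<and> \<bar>I s \<omega>\<bar> \<le> 2 * mx \<omega> + n \<omega> \<and> \<bar>x s \<omega> - I s \<omega>\<bar> \<le> 2 * mx \<omega> + n \<omega>"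
          using mx(3)[of \<omega>] n(3)[of \<omega>] by (intro conjI; linarith)
      qed
    qed
    show "AE \<omega> in M. I a \<omega> = 0 \<and> primitive_on a b (\<lambda>s. x s \<omega> - I s \<omega>) (\<lambda>s. \<alpha> s \<omega>)"
      using eq int
    proof eventually_elim
      case (elim \<omega>)
      have aa: "set_integrable lborel {a..a} (\<lambda>s. \<alpha> s \<omega>)"
        by (rule set_integrable_subset[OF elim(2)]) (use a_le_b in auto)
      have "(LINT r:{a..a}|lborel. \<alpha> r \<omega>) = 0"
        using set_integral_at_point[of lborel a "\<lambda>s. \<alpha> s \<omega>"] aa by simp
      moreover have "x a \<omega> = x a \<omega> + (LINT r:{a..a}|lborel. \<alpha> r \<omega>) + I a \<omega>"
        by (rule bspec[OF elim(1)]) (use a_le_b in simp)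
      ultimately have I0: "I a \<omega> = 0" by simp
      moreover have "x s \<omega> - I s \<omega> = x a \<omega> - I a \<omega> + (LINT r:{a..s}|lborel. \<alpha> r \<omega>)" if "s \<in> {a..b}" for s
        using bspec[OF elim(1) that] I0 by simp
      ultimately show ?case using elim(2) unfolding primitive_on_def by blast
    qed
  qed measurable
qed

text \<open>Both processes are split into drift part and Ito integral, \<open>x = V + I\<close> and \<open>y = U + K\<close>.  Integration by
  parts along the paths gives \<open>V U\<close>, the Ito isometry gives \<open>I K\<close>, and the two mixed products are those of a
  drift with an Ito integral; the four contributions add up because \<open>\<alpha> U + \<alpha> K = \<alpha> y\<close> and \<open>V \<gamma> + I \<gamma> = x \<gamma>\<close>.\<close>

lemma product_expectation:
  fixes x y \<alpha> \<beta> \<gamma> \<delta> :: "real \<Rightarrow> 'w \<Rightarrow> real"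
  assumes x: "ito_process x \<alpha> \<beta>" and y: "ito_process y \<gamma> \<delta>"
  shows "integrable LM (\<lambda>(r, \<omega>). \<alpha> r \<omega> * y r \<omega> + x r \<omega> * \<gamma> r \<omega> + \<beta> r \<omega> * \<delta> r \<omega>)"
    and "s \<in> {a..b} \<Longrightarrow> integrable M (\<lambda>\<omega>. x s \<omega> * y s \<omega>)"
    and "s \<in> {a..b} \<Longrightarrow> (LINT \<omega>|M. x s \<omega> * y s \<omega>) = (LINT \<omega>|M. x a \<omega> * y a \<omega>) +
        (LINT r:{a..s}|lborel. (LINT \<omega>|M. \<alpha> r \<omega> * y r \<omega> + x r \<omega> * \<gamma> r \<omega> + \<beta> r \<omega> * \<delta> r \<omega>))"
proof -
  from x have xC: "x \<in> L2F_C M F a b" and \<alpha>: "\<alpha> \<in> L2F_L1 M F a b" unfolding ito_process_def by auto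
  from y have yC: "y \<in> L2F_C M F a b" and \<gamma>: "\<gamma> \<in> L2F_L1 M F a b" unfolding ito_process_def by auto
  obtain I m1 where I: "is_ito_integral M F W a b \<beta> I" and m1: "m1 \<in> borel_measurable M" "integrable M (\<lambda>\<omega>. (m1 \<omega>)\<^sup>2)"
      "\<And>\<omega>. 0 \<le> m1 \<omega>"
    and d1: "AE \<omega> in M. (\<forall>s\<in>{a..b}. \<bar>x s \<omega>\<bar> \<le> m1 \<omega> \<and> \<bar>I s \<omega>\<bar> \<le> m1 \<omega> \<and> \<bar>x s \<omega> - I s \<omega>\<bar> \<le> m1 \<omega>)"
    and p1: "AE \<omega> in M. I a \<omega> = 0 \<and> primitive_on a b (\<lambda>s. x s \<omega> - I s \<omega>) (\<lambda>s. \<alpha> s \<omega>)"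
    by (rule ito_process_dominated[OF x]) blast
  obtain K m2 where K: "is_ito_integral M F W a b \<delta> K" and m2: "m2 \<in> borel_measurable M" "integrable M (\<lambda>\<omega>. (m2 \<omega>)\<^sup>2)"
      "\<And>\<omega>. 0 \<le> m2 \<omega>"
    and d2: "AE \<omega> in M. (\<forall>s\<in>{a..b}. \<bar>y s \<omega>\<bar> \<le> m2 \<omega> \<and> \<bar>K s \<omega>\<bar> \<le> m2 \<omega> \<and> \<bar>y s \<omega> - K s \<omega>\<bar> \<le> m2 \<omega>)"
    and p2: "AE \<omega> in M. K a \<omega> = 0 \<and> primitive_on a b (\<lambda>s. y s \<omega> - K s \<omega>) (\<lambda>s. \<gamma> s \<omega>)"
    by (rule ito_process_dominated[OF y]) blast
  define V where "V s \<omega> = x s \<omega> - I s \<omega>" for s \<omega>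
  define U where "U s \<omega> = y s \<omega> - K s \<omega>" for s \<omega>
  note prx = L2F_C_prog[OF xC] and pry = L2F_C_prog[OF yC] and prI = ito_prog[OF I] and prK = ito_prog[OF K]
  have prV: "prog_measurable F a b V" and prU: "prog_measurable F a b U"
    unfolding V_def U_def by (intro prog_diff prx pry prI prK)+
  note pr\<alpha> = L2F_L1_prog[OF \<alpha>] and pr\<gamma> = L2F_L1_prog[OF \<gamma>]
  note pr\<beta> = L2F_prog[OF ito_L2F[OF I]] and pr\<delta> = L2F_prog[OF ito_L2F[OF K]]
  note [measurable] = prog_joint[OF prx] prog_joint[OF pry] prog_joint[OF prI] prog_joint[OF prK]
      prog_joint[OF prV] prog_joint[OF prU]
    prog_joint[OF pr\<alpha>] prog_joint[OF pr\<gamma>] prog_joint[OF pr\<beta>] prog_joint[OF pr\<delta>]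
  have i\<alpha>: "integrable LM (\<lambda>(r, \<omega>). \<alpha> r \<omega> * f r \<omega>)"
    if [measurable]: "(\<lambda>(s, \<omega>). f s \<omega>) \<in> borel_measurable LM" and "AE \<omega> in M. \<forall>s\<in>{a..b}. \<bar>f s \<omega>\<bar> \<le> m2 \<omega>" for f
  proof (rule integrable_L1_dominated[OF \<alpha> m2])
    show "AE \<omega> in M. \<forall>r\<in>{a..b}. \<bar>\<alpha> r \<omega> * f r \<omega>\<bar> \<le> norm (\<alpha> r \<omega>) * m2 \<omega>"
      using that(2) by eventually_elim (auto simp: abs_mult intro!: mult_left_mono)
  qed measurable
  have i\<gamma>: "integrable LM (\<lambda>(r, \<omega>). f r \<omega> * \<gamma> r \<omega>)"
    if [measurable]: "(\<lambda>(s, \<omega>). f s \<omega>) \<in> borel_measurable LM" and "AE \<omega> in M. \<forall>s\<in>{a..b}. \<bar>f s \<omega>\<bar> \<le> m1 \<omega>" for f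
  proof (rule integrable_L1_dominated[OF \<gamma> m1])
    show "AE \<omega> in M. \<forall>r\<in>{a..b}. \<bar>f r \<omega> * \<gamma> r \<omega>\<bar> \<le> norm (\<gamma> r \<omega>) * m1 \<omega>"
      using that(2) by eventually_elim (subst (2) mult.commute, auto simp: abs_mult intro!: mult_right_mono)
  qed measurable
  have dx: "AE \<omega> in M. \<forall>s\<in>{a..b}. \<bar>x s \<omega>\<bar> \<le> m1 \<omega>" and dI: "AE \<omega> in M. \<forall>s\<in>{a..b}. \<bar>I s \<omega>\<bar> \<le> m1 \<omega>"
    and dV: "AE \<omega> in M. \<forall>s\<in>{a..b}. \<bar>V s \<omega>\<bar> \<le> m1 \<omega>"
    unfolding V_def using d1 by (eventually_elim, blast)+
  have dy: "AE \<omega> in M. \<forall>s\<in>{a..b}. \<bar>y s \<omega>\<bar> \<le> m2 \<omega>" and dK: "AE \<omega> in M. \<forall>s\<in>{a..b}. \<bar>K s \<omega>\<bar> \<le> m2 \<omega>"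
    and dU: "AE \<omega> in M. \<forall>s\<in>{a..b}. \<bar>U s \<omega>\<bar> \<le> m2 \<omega>"
    unfolding U_def using d2 by (eventually_elim, blast)+
  have iay: "integrable LM (\<lambda>(r, \<omega>). \<alpha> r \<omega> * y r \<omega>)" by (rule i\<alpha>[OF _ dy]) measurable
  have iaU: "integrable LM (\<lambda>(r, \<omega>). \<alpha> r \<omega> * U r \<omega>)" by (rule i\<alpha>[OF _ dU]) measurable
  have ixg: "integrable LM (\<lambda>(r, \<omega>). x r \<omega> * \<gamma> r \<omega>)" by (rule i\<gamma>[OF _ dx]) measurable
  have iVg: "integrable LM (\<lambda>(r, \<omega>). V r \<omega> * \<gamma> r \<omega>)" by (rule i\<gamma>[OF _ dV]) measurable
  have ibd: "integrable LM (\<lambda>(r, \<omega>). \<beta> r \<omega> * \<delta> r \<omega>)"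
    by (rule integrable_L2_L2[OF ito_L2F[OF I] ito_L2F[OF K]]) (measurable, simp add: abs_mult)
  have iUV: "integrable LM (\<lambda>(r, \<omega>). \<alpha> r \<omega> * U r \<omega> + V r \<omega> * \<gamma> r \<omega>)"
    using Bochner_Integration.integrable_add[OF iaU iVg] by (simp add: split_beta')
  show iall: "integrable LM (\<lambda>(r, \<omega>). \<alpha> r \<omega> * y r \<omega> + x r \<omega> * \<gamma> r \<omega> + \<beta> r \<omega> * \<delta> r \<omega>)"
    using Bochner_Integration.integrable_add[OF Bochner_Integration.integrable_add[OF iay ixg] ibd] by
        (simp add: split_beta')
  have prod: "integrable M (\<lambda>\<omega>. f \<omega> * g \<omega>)"
    if [measurable]: "f \<in> borel_measurable M" "g \<in> borel_measurable M" and f: "AE \<omega> in M. \<bar>f \<omega>\<bar> \<le> m1 \<omega>" and g: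
        "AE \<omega> in M. \<bar>g \<omega>\<bar> \<le> m2 \<omega>" for f g
  proof (rule Bochner_Integration.integrable_bound[OF integrable_mult_L2[OF m1(1) m2(1) m1(2) m2(2)]])
    show "AE \<omega> in M. norm (f \<omega> * g \<omega>) \<le> norm (m1 \<omega> * m2 \<omega>)"
      using f g by eventually_elim (use m1(3) m2(3) in \<open>auto simp: abs_mult intro!: mult_mono\<close>)
  qed measurable
  {
    fix s assume s: "s \<in> {a..b}"
    have a: "a \<in> {a..b}" using a_le_b by simp
    have meas: "x r \<in> borel_measurable M" "y r \<in> borel_measurable M" "I r \<in> borel_measurable M" "K r \<in>
        borel_measurable M"
       "V r \<in> borel_measurable M" "U r \<in> borel_measurable M" if "r \<in> {a..b}" for r
      by (rule prog_adapted_M[OF prx that] prog_adapted_M[OF pry that] prog_adapted_M[OF prI that]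
          prog_adapted_M[OF prK that] prog_adapted_M[OF prV that] prog_adapted_M[OF prU that])+
    have b1: "AE \<omega> in M. \<bar>f s \<omega>\<bar> \<le> m1 \<omega>" if "AE \<omega> in M. \<forall>s\<in>{a..b}. \<bar>f s \<omega>\<bar> \<le> m1 \<omega>" "s \<in> {a..b}" for f :: "real
        \<Rightarrow> 'w \<Rightarrow> real" and s
      using that(1) by eventually_elim (use that(2) in blast)
    have b2: "AE \<omega> in M. \<bar>f s \<omega>\<bar> \<le> m2 \<omega>" if "AE \<omega> in M. \<forall>s\<in>{a..b}. \<bar>f s \<omega>\<bar> \<le> m2 \<omega>" "s \<in> {a..b}" for f :: "real
        \<Rightarrow> 'w \<Rightarrow> real" and s
      using that(1) by eventually_elim (use that(2) in blast)
    show xy: "integrable M (\<lambda>\<omega>. x s \<omega> * y s \<omega>)" by (rule prod[OF meas(1)[OF s] meas(2)[OF s] b1[OF dx s] b2[OF dy s]])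
    have VU: "integrable M (\<lambda>\<omega>. V r \<omega> * U r \<omega>)" if "r \<in> {a..b}" for r by
        (rule prod[OF meas(5)[OF that] meas(6)[OF that] b1[OF dV that] b2[OF dU that]])
    have VK: "integrable M (\<lambda>\<omega>. V r \<omega> * K s \<omega>)" if "r \<in> {a..b}" for r by
        (rule prod[OF meas(5)[OF that] meas(4)[OF s] b1[OF dV that] b2[OF dK s]])
    have IU: "integrable M (\<lambda>\<omega>. I s \<omega> * U r \<omega>)" if "r \<in> {a..b}" for r by
        (rule prod[OF meas(3)[OF s] meas(6)[OF that] b1[OF dI s] b2[OF dU that]])
    have IK: "integrable M (\<lambda>\<omega>. I s \<omega> * K s \<omega>)" by (rule prod[OF meas(3)[OF s] meas(4)[OF s] b1[OF dI s] b2[OF dK s]])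
    have EVU: "(LINT \<omega>|M. V s \<omega> * U s \<omega>) = (LINT \<omega>|M. x a \<omega> * y a \<omega>) +
        (LINT r:{a..s}|lborel. (LINT \<omega>|M. \<alpha> r \<omega> * U r \<omega> + V r \<omega> * \<gamma> r \<omega>))"
    proof -
      have "(LINT \<omega>|M. V s \<omega> * U s \<omega>) = (LINT \<omega>|M. V a \<omega> * U a \<omega> + (LINT r:{a..s}|lborel. \<alpha> r \<omega> * U r \<omega> + V r \<omega>
          * \<gamma> r \<omega>))"
      proof (rule integral_cong_AE)
        show "AE \<omega> in M. V s \<omega> * U s \<omega> = V a \<omega> * U a \<omega> + (LINT r:{a..s}|lborel. \<alpha> r \<omega> * U r \<omega> + V r \<omega> * \<gamma> r \<omega>)"
          using p1 p2
        proof eventually_elim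
          case (elim \<omega>)
          show ?case using primitive_onD(2)[OF primitive_on_mult[OF a_le_b conjunct2[OF elim(1)]
              conjunct2[OF elim(2)]] s]
            unfolding V_def U_def .
        qed
        show "(\<lambda>\<omega>. V s \<omega> * U s \<omega>) \<in> borel_measurable M" using VU[OF s] by auto
        show "(\<lambda>\<omega>. V a \<omega> * U a \<omega> + (LINT r:{a..s}|lborel. \<alpha> r \<omega> * U r \<omega> + V r \<omega> * \<gamma> r \<omega>)) \<in> borel_measurable M"
          using VU[OF a] time_expectation_upto(2)[OF iUV s] by auto
      qed
      also have "\<dots> = (LINT \<omega>|M. V a \<omega> * U a \<omega>) + (LINT \<omega>|M. (LINT r:{a..s}|lborel. \<alpha> r \<omega> * U r \<omega> + V r \<omega> * \<gamma> r \<omega>))"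
        by (rule Bochner_Integration.integral_add[OF VU[OF a] time_expectation_upto(2)[OF iUV s]])
      also have "(LINT \<omega>|M. V a \<omega> * U a \<omega>) = (LINT \<omega>|M. x a \<omega> * y a \<omega>)"
      proof (rule integral_cong_AE)
        show "AE \<omega> in M. V a \<omega> * U a \<omega> = x a \<omega> * y a \<omega>" using p1 p2 by eventually_elim (simp add: V_def U_def)
      qed (intro borel_measurable_times meas a)+
      also have "(LINT \<omega>|M. (LINT r:{a..s}|lborel. \<alpha> r \<omega> * U r \<omega> + V r \<omega> * \<gamma> r \<omega>)) =
          (LINT r:{a..s}|lborel. (LINT \<omega>|M. \<alpha> r \<omega> * U r \<omega> + V r \<omega> * \<gamma> r \<omega>))"
        by (rule time_expectation_upto(3)[OF iUV s])
      finally show ?thesis .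
    qed
    \<comment> \<open>drift with Ito integral, used once for each order of the two factors\<close>
    have cross: "(LINT \<omega>|M. A s \<omega> * Q s \<omega>) = (LINT r:{a..s}|lborel. (LINT \<omega>|M. \<kappa> r \<omega> * Q r \<omega>))"
       and icross: "integrable LM (\<lambda>(r, \<omega>). \<kappa> r \<omega> * Q r \<omega>)"
      if \<kappa>: "\<kappa> \<in> L2F_L1 M F a b" and Q: "is_ito_integral M F W a b \<epsilon> Q" and pA: "prog_measurable F a b A"
        and m: "m \<in> borel_measurable M" "integrable M (\<lambda>\<omega>. (m \<omega>)\<^sup>2)" "\<And>\<omega>. 0 \<le> m \<omega>"
        and Qm: "AE \<omega> in M. \<forall>s\<in>{a..b}. \<bar>Q s \<omega>\<bar> \<le> m \<omega>" and Q0: "AE \<omega> in M. Q a \<omega> = 0"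
        and prim: "AE \<omega> in M. primitive_on a b (\<lambda>s. A s \<omega>) (\<lambda>s. \<kappa> s \<omega>)"
        and int: "integrable M (\<lambda>\<omega>. A s \<omega> * Q s \<omega>)" "integrable M (\<lambda>\<omega>. A a \<omega> * Q s \<omega>)"
      for \<kappa> \<epsilon> Q A :: "real \<Rightarrow> 'w \<Rightarrow> real" and m
    proof -
      note dr = drift_times_ito[OF \<kappa> Q m Qm s]
      show "integrable LM (\<lambda>(r, \<omega>). \<kappa> r \<omega> * Q r \<omega>)" by (rule dr(2))
      note mA = prog_adapted_M[OF pA s] prog_adapted_M[OF pA a] and mQ = prog_adapted_M[OF ito_prog[OF Q] s]
          prog_adapted_M[OF ito_prog[OF Q] a]
      note [measurable] = mA mQ
      have "(LINT \<omega>|M. A s \<omega> * Q s \<omega>) - (LINT \<omega>|M. A a \<omega> * Q s \<omega>) = (LINT \<omega>|M. A s \<omega> * Q s \<omega> - A a \<omega> * Q s \<omega>)"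
        using int by simp
      also have "\<dots> = (LINT \<omega>|M. (LINT r:{a..s}|lborel. \<kappa> r \<omega> * Q s \<omega>))"
      proof (rule integral_cong_AE)
        have "integrable LM (\<lambda>(r, \<omega>). \<kappa> r \<omega> * Q s \<omega>)"
        proof (rule integrable_L1_dominated[OF \<kappa> m])
          note [measurable] = prog_joint[OF L2F_L1_prog[OF \<kappa>]]
          show "(\<lambda>(r, \<omega>). \<kappa> r \<omega> * Q s \<omega>) \<in> borel_measurable LM" by measurable
          show "AE \<omega> in M. \<forall>r\<in>{a..b}. \<bar>\<kappa> r \<omega> * Q s \<omega>\<bar> \<le> norm (\<kappa> r \<omega>) * m \<omega>"
            using Qm by eventually_elim (use s in \<open>auto simp: abs_mult intro!: mult_left_mono\<close>)
        qed
        from time_expectation_upto(2)[OF this s]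
        show "(\<lambda>\<omega>. LINT r:{a..s}|lborel. \<kappa> r \<omega> * Q s \<omega>) \<in> borel_measurable M" by auto
        show "AE \<omega> in M. A s \<omega> * Q s \<omega> - A a \<omega> * Q s \<omega> = (LINT r:{a..s}|lborel. \<kappa> r \<omega> * Q s \<omega>)"
          using prim
        proof eventually_elim
          case (elim \<omega>)
          have "A s \<omega> - A a \<omega> = (LINT r:{a..s}|lborel. \<kappa> r \<omega>)" using primitive_onD(2)[OF elim s] by simp
          then show ?case by (simp flip: left_diff_distrib)
        qed
      qed measurable
      also have "\<dots> = (LINT r:{a..s}|lborel. (LINT \<omega>|M. \<kappa> r \<omega> * Q r \<omega>))" using dr(1) by simp
      finally have 1: "(LINT \<omega>|M. A s \<omega> * Q s \<omega>) - (LINT \<omega>|M. A a \<omega> * Q s \<omega>) =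
          (LINT r:{a..s}|lborel. (LINT \<omega>|M. \<kappa> r \<omega> * Q r \<omega>))" .
      have eq: "AE \<omega> in M. A a \<omega> * (Q s \<omega> - Q a \<omega>) = A a \<omega> * Q s \<omega>" using Q0 by eventually_elim simp
      have "integrable M (\<lambda>\<omega>. A a \<omega> * (Q s \<omega> - Q a \<omega>)) \<longleftrightarrow> integrable M (\<lambda>\<omega>. A a \<omega> * Q s \<omega>)"
        by (rule integrable_cong_AE) (measurable, rule eq)
      then have "(LINT \<omega>|M. A a \<omega> * (Q s \<omega> - Q a \<omega>)) = 0"
        using ito_martingale[OF Q order_refl _ _ prog_adapted[OF pA a], of s] s int(2) by simp
      moreover have "(LINT \<omega>|M. A a \<omega> * (Q s \<omega> - Q a \<omega>)) = (LINT \<omega>|M. A a \<omega> * Q s \<omega>)"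
        by (rule integral_cong_AE) (measurable, rule eq)
      ultimately show "(LINT \<omega>|M. A s \<omega> * Q s \<omega>) = (LINT r:{a..s}|lborel. (LINT \<omega>|M. \<kappa> r \<omega> * Q r \<omega>))"
        using 1 by simp
    qed
    have pV: "AE \<omega> in M. primitive_on a b (\<lambda>s. V s \<omega>) (\<lambda>s. \<alpha> s \<omega>)" "AE \<omega> in M. I a \<omega> = 0"
      unfolding V_def using p1 by (eventually_elim, blast)+
    have pU: "AE \<omega> in M. primitive_on a b (\<lambda>s. U s \<omega>) (\<lambda>s. \<gamma> s \<omega>)" "AE \<omega> in M. K a \<omega> = 0"
      unfolding U_def using p2 by (eventually_elim, blast)+
    note EVK = cross[OF \<alpha> K prV m2 dK pU(2) pV(1) VK[OF s] VK[OF a]]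
    note iaK = icross[OF \<alpha> K prV m2 dK pU(2) pV(1) VK[OF s] VK[OF a]]
    have UI: "integrable M (\<lambda>\<omega>. U r \<omega> * I s \<omega>)" if "r \<in> {a..b}" for r using IU[OF that] by (simp add: mult.commute)
    note EUI = cross[OF \<gamma> I prU m1 dI pV(2) pU(1) UI[OF s] UI[OF a]]
    note igI = icross[OF \<gamma> I prU m1 dI pV(2) pU(1) UI[OF s] UI[OF a]]
    note EIK = ito_isometry[OF I K s]
    let ?i = "\<lambda>z::real \<times> 'w. indicator {a..s} (fst z) :: real"
    note P = time_expectation_product[OF _ s]
    have "(LINT \<omega>|M. x s \<omega> * y s \<omega>) = (LINT \<omega>|M. V s \<omega> * U s \<omega> + V s \<omega> * K s \<omega> + U s \<omega> * I s \<omega> + I s \<omega> * K s \<omega>)"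
      by (rule Bochner_Integration.integral_cong) (auto simp: V_def U_def algebra_simps)
    also have "\<dots> = (LINT \<omega>|M. V s \<omega> * U s \<omega>) + (LINT \<omega>|M. V s \<omega> * K s \<omega>) + (LINT \<omega>|M. U s \<omega> * I s \<omega>) +
        (LINT \<omega>|M. I s \<omega> * K s \<omega>)"
      using VU[OF s] VK[OF s] UI[OF s] IK by simp
    also have "\<dots> = (LINT \<omega>|M. x a \<omega> * y a \<omega>) + ((LINT z|LM. ?i z * (case z of (r, \<omega>) \<Rightarrow> \<alpha> r \<omega> * U r \<omega> + V r \<omega> * \<gamma> r \<omega>))
       + (LINT z|LM. ?i z * (case z of (r, \<omega>) \<Rightarrow> \<alpha> r \<omega> * K r \<omega>)) + (LINT z|LM. ?i z * (case z of (r, \<omega>) \<Rightarrow> \<gamma> r \<omega> * I r \<omega>))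
       + (LINT z|LM. ?i z * (case z of (r, \<omega>) \<Rightarrow> \<beta> r \<omega> * \<delta> r \<omega>)))"
      unfolding EVU EVK EUI EIK P(1)[OF iUV] P(1)[OF iaK] P(1)[OF igI] P(1)[OF ibd] by simp
    also have "((LINT z|LM. ?i z * (case z of (r, \<omega>) \<Rightarrow> \<alpha> r \<omega> * U r \<omega> + V r \<omega> * \<gamma> r \<omega>))
       + (LINT z|LM. ?i z * (case z of (r, \<omega>) \<Rightarrow> \<alpha> r \<omega> * K r \<omega>)) + (LINT z|LM. ?i z * (case z of (r, \<omega>) \<Rightarrow> \<gamma> r \<omega> * I r \<omega>))
       + (LINT z|LM. ?i z * (case z of (r, \<omega>) \<Rightarrow> \<beta> r \<omega> * \<delta> r \<omega>)))
      = (LINT z|LM. ?i z * (case z of (r, \<omega>) \<Rightarrow> \<alpha> r \<omega> * U r \<omega> + V r \<omega> * \<gamma> r \<omega>)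
         + ?i z * (case z of (r, \<omega>) \<Rightarrow> \<alpha> r \<omega> * K r \<omega>) + ?i z * (case z of (r, \<omega>) \<Rightarrow> \<gamma> r \<omega> * I r \<omega>)
         + ?i z * (case z of (r, \<omega>) \<Rightarrow> \<beta> r \<omega> * \<delta> r \<omega>))"
      using P(2)[OF iUV] P(2)[OF iaK] P(2)[OF igI] P(2)[OF ibd] by simp
    also have "\<dots> = (LINT z|LM. ?i z * (case z of (r, \<omega>) \<Rightarrow> \<alpha> r \<omega> * y r \<omega> + x r \<omega> * \<gamma> r \<omega> + \<beta> r \<omega> * \<delta> r \<omega>))"
      by (rule Bochner_Integration.integral_cong) (auto simp: V_def U_def algebra_simps)
    also have "\<dots> = (LINT r:{a..s}|lborel. (LINT \<omega>|M. \<alpha> r \<omega> * y r \<omega> + x r \<omega> * \<gamma> r \<omega> + \<beta> r \<omega> * \<delta> r \<omega>))"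
      by (rule P(1)[OF iall, symmetric])
    finally show "(LINT \<omega>|M. x s \<omega> * y s \<omega>) = (LINT \<omega>|M. x a \<omega> * y a \<omega>) +
        (LINT r:{a..s}|lborel. (LINT \<omega>|M. \<alpha> r \<omega> * y r \<omega> + x r \<omega> * \<gamma> r \<omega> + \<beta> r \<omega> * \<delta> r \<omega>))" .
  }
qed


text \<open>By the product rule, \<open>s \<mapsto> E[x(s) y(s)]\<close> is an absolutely continuous function of time, so a deterministic
  weight is brought in by ordinary integration by parts.\<close>

lemma product_expectation_weighted:
  fixes x y \<alpha> \<beta> \<gamma> \<delta> :: "real \<Rightarrow> 'w \<Rightarrow> real"
  assumes x: "ito_process x \<alpha> \<beta>" and y: "ito_process y \<gamma> \<delta>"
    and p: "primitive_on a b p p'" and cont: "continuous_on {a..b} p"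
  defines "h \<equiv> \<lambda>r \<omega>. \<alpha> r \<omega> * y r \<omega> + x r \<omega> * \<gamma> r \<omega> + \<beta> r \<omega> * \<delta> r \<omega>"
  shows "integrable LM (\<lambda>(r, \<omega>). p' r * (x r \<omega> * y r \<omega>) + p r * h r \<omega>)"
    and "p b * (LINT \<omega>|M. x b \<omega> * y b \<omega>) = p a * (LINT \<omega>|M. x a \<omega> * y a \<omega>) +
        (LINT z|LM. (case z of (r, \<omega>) \<Rightarrow> p' r * (x r \<omega> * y r \<omega>) + p r * h r \<omega>))"
proof -
  note pe = product_expectation[OF x y, folded h_def]
  have xC: "x \<in> L2F_C M F a b" and yC: "y \<in> L2F_C M F a b" using x y unfolding ito_process_def by auto
  obtain m1 where m1: "m1 \<in> borel_measurable M" "integrable M (\<lambda>\<omega>. (m1 \<omega>)\<^sup>2)"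
      "\<And>\<omega>. 0 \<le> m1 \<omega>" "\<And>\<omega> s. \<omega> \<in> space M \<Longrightarrow> s \<in> {a..b} \<Longrightarrow> norm (x s \<omega>) \<le> m1 \<omega>"
    by (rule L2F_C_dominated[OF xC]) blast
  obtain m2 where m2: "m2 \<in> borel_measurable M" "integrable M (\<lambda>\<omega>. (m2 \<omega>)\<^sup>2)"
      "\<And>\<omega>. 0 \<le> m2 \<omega>" "\<And>\<omega> s. \<omega> \<in> space M \<Longrightarrow> s \<in> {a..b} \<Longrightarrow> norm (y s \<omega>) \<le> m2 \<omega>"
    by (rule L2F_C_dominated[OF yC]) blast
  have p'i: "integrable L p'" using primitive_onD(1)[OF p] by (simp add: set_integrable_leb_on)
  have [measurable]: "p' \<in> borel_measurable L" using p'i by auto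
  have [measurable]: "p \<in> borel_measurable L"
    using borel_measurable_continuous_on_restrict[OF cont] measurable_cong_sets[OF sets_leb_on refl] by blast
  note [measurable] = prog_joint[OF L2F_C_prog[OF xC]] prog_joint[OF L2F_C_prog[OF yC]]
  have hm [measurable]: "(\<lambda>(r, \<omega>). h r \<omega>) \<in> borel_measurable LM" using pe(1) by auto
  have i1: "integrable LM (\<lambda>(r, \<omega>). p' r * (x r \<omega> * y r \<omega>))"
  proof (rule integrable_time_process[OF p'i integrable_mult_L2[OF m1(1) m2(1) m1(2) m2(2)]])
    show "AE \<omega> in M. \<forall>s\<in>{a..b}. \<bar>p' s * (x s \<omega> * y s \<omega>)\<bar> \<le> \<bar>p' s\<bar> * (m1 \<omega> * m2 \<omega>)"
      using m1(3,4) m2(3,4) by (intro AE_I2 ballI) (simp add: abs_mult mult_left_mono mult_mono)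
  qed measurable
  have "bounded (p ` {a..b})" by (rule compact_imp_bounded[OF compact_continuous_image[OF cont]]) simp
  then obtain c where c: "\<And>s. s \<in> {a..b} \<Longrightarrow> \<bar>p s\<bar> \<le> c"
    unfolding bounded_iff by fastforce
  have i2: "integrable LM (\<lambda>(r, \<omega>). p r * h r \<omega>)"
  proof (rule Bochner_Integration.integrable_bound)
    show "integrable LM (\<lambda>z. c * case_prod h z)" using pe(1) by simp
    show "AE z in LM. norm (case z of (r, \<omega>) \<Rightarrow> p r * h r \<omega>) \<le> norm (c * case_prod h z)"
    proof (rule AE_I2)
      fix z assume "z \<in> space LM"
      then obtain r \<omega> where z: "z = (r, \<omega>)" "r \<in> {a..b}" by (auto simp: space_pair_measure)
      have "\<bar>p r\<bar> \<le> \<bar>c\<bar>" using c[OF z(2)] by simp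
      then show "norm (case z of (r, \<omega>) \<Rightarrow> p r * h r \<omega>) \<le> norm (c * case_prod h z)"
        by (simp add: z abs_mult mult_right_mono)
    qed
  qed measurable
  show isum: "integrable LM (\<lambda>(r, \<omega>). p' r * (x r \<omega> * y r \<omega>) + p r * h r \<omega>)"
    using Bochner_Integration.integrable_add[OF i1 i2] by (simp add: split_beta')
  define f where "f s = (LINT \<omega>|M. x s \<omega> * y s \<omega>)" for s
  define g where "g r = (LINT \<omega>|M. h r \<omega>)" for r
  have pf: "primitive_on a b f g"
    unfolding primitive_on_def f_def g_def set_integrable_leb_on
    by (intro conjI ballI time_expectation(3)[OF pe(1)]) (simp only: h_def product_expectation(3)[OF x y])
  have "p b * f b = p a * f a + (LINT r:{a..b}|lborel. p' r * f r + p r * g r)"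
    using a_le_b by (intro primitive_onD(2)[OF primitive_on_mult[OF a_le_b p pf]]) auto
  also have "(LINT r:{a..b}|lborel. p' r * f r + p r * g r) = (LINT r|L. (LINT \<omega>|M. p' r * (x r \<omega> * y r \<omega>) + p
      r * h r \<omega>))"
    unfolding set_lebesgue_integral_leb_on
  proof (rule integral_cong_AE)
    show "(\<lambda>r. p' r * f r + p r * g r) \<in> borel_measurable L"
      using primitive_onD(1)[OF primitive_on_mult[OF a_le_b p pf]] by (auto simp: set_integrable_leb_on)
    show "(\<lambda>r. LINT \<omega>|M. p' r * (x r \<omega> * y r \<omega>) + p r * h r \<omega>) \<in> borel_measurable L"
      using time_expectation(3)[OF isum] by auto
    show "AE r in L. p' r * f r + p r * g r = (LINT \<omega>|M. p' r * (x r \<omega> * y r \<omega>) + p r * h r \<omega>)"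
      using time_expectation(1)[OF pe(1)] AE_space
    proof eventually_elim
      case (elim r)
      then show ?case using pe(2)[of r] by (simp add: f_def g_def)
    qed
  qed
  also have "\<dots> = (LINT z|LM. (case z of (r, \<omega>) \<Rightarrow> p' r * (x r \<omega> * y r \<omega>) + p r * h r \<omega>))"
    using time_expectation(5,6)[OF isum] by simp
  finally show "p b * (LINT \<omega>|M. x b \<omega> * y b \<omega>) = p a * (LINT \<omega>|M. x a \<omega> * y a \<omega>) +
        (LINT z|LM. (case z of (r, \<omega>) \<Rightarrow> p' r * (x r \<omega> * y r \<omega>) + p r * h r \<omega>))"
    by (simp add: f_def)
qed

lemma inner_matrix_vector_sum:
  fixes A :: "real^'n::finite^'m::finite"
  shows "(A *v x) \<bullet> y = (\<Sum>i\<in>UNIV. \<Sum>j\<in>UNIV. A $ i $ j * (x $ j * y $ i))"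
  by (simp add: inner_vec_def matrix_vector_mult_def sum_distrib_left sum_distrib_right mult_ac)

text \<open>The rule that is applied to \<open>\<langle>\<Pi> X, N\<rangle>\<close>, summed over the components of the matrix.\<close>

lemma bilinear_expectation:
  fixes X \<alpha> \<beta> :: "real \<Rightarrow> 'w \<Rightarrow> real^'n::finite" and Y \<gamma> \<delta> :: "real \<Rightarrow> 'w \<Rightarrow> real^'m::finite"
    and P P' :: "real \<Rightarrow> real^'n^'m"
  assumes X: "ito_process X \<alpha> \<beta>" and Y: "ito_process Y \<gamma> \<delta>"
    and P: "\<And>i j. primitive_on a b (\<lambda>s. P s $ i $ j) (\<lambda>s. P' s $ i $ j)" and cont: "continuous_on {a..b} P"
  defines "h \<equiv> \<lambda>(r, \<omega>). (P' r *v X r \<omega>) \<bullet> Y r \<omega> + (P r *v \<alpha> r \<omega>) \<bullet> Y r \<omega> + (P r *v X r \<omega>) \<bullet> \<gamma> r \<omega> +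
      (P r *v \<beta> r \<omega>) \<bullet> \<delta> r \<omega>"
  shows "integrable LM h"
    and "(LINT \<omega>|M. (P b *v X b \<omega>) \<bullet> Y b \<omega>) = (LINT \<omega>|M. (P a *v X a \<omega>) \<bullet> Y a \<omega>) + (LINT z|LM. h z)"
proof -
  have Xj: "ito_process (\<lambda>s \<omega>. X s \<omega> $ j) (\<lambda>s \<omega>. \<alpha> s \<omega> $ j) (\<lambda>s \<omega>. \<beta> s \<omega> $ j)" for j
    by (rule ito_process_linear[OF X bounded_linear_vec_nth])
  have Yi: "ito_process (\<lambda>s \<omega>. Y s \<omega> $ i) (\<lambda>s \<omega>. \<gamma> s \<omega> $ i) (\<lambda>s \<omega>. \<delta> s \<omega> $ i)" for i
    by (rule ito_process_linear[OF Y bounded_linear_vec_nth])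
  have cij: "continuous_on {a..b} (\<lambda>s. P s $ i $ j)" for i j
    using cont by (intro continuous_intros)
  let ?h = "\<lambda>i j r \<omega>. P' r $ i $ j * (X r \<omega> $ j * Y r \<omega> $ i) +
     P r $ i $ j * (\<alpha> r \<omega> $ j * Y r \<omega> $ i + X r \<omega> $ j * \<gamma> r \<omega> $ i + \<beta> r \<omega> $ j * \<delta> r \<omega> $ i)"
  note w = product_expectation_weighted[OF Xj Yi P cij]
  have heq: "h z = (\<Sum>i\<in>UNIV. \<Sum>j\<in>UNIV. case_prod (?h i j) z)" for z
    unfolding h_def inner_matrix_vector_sum
    by (cases z) (simp add: sum.distrib[symmetric] algebra_simps)
  show "integrable LM h"
    unfolding heq[abs_def] by (intro Bochner_Integration.integrable_sum w(1))
  have E: "(LINT \<omega>|M. (P s *v X s \<omega>) \<bullet> Y s \<omega>) = (\<Sum>i\<in>UNIV. \<Sum>j\<in>UNIV. P s $ i $ j * (LINT \<omega>|M. X s \<omega> $ j * Y s \<omega> $ i))"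
    if s: "s \<in> {a..b}" for s
    unfolding inner_matrix_vector_sum
    using product_expectation(2)[OF Xj Yi s] by simp
  have ab: "a \<in> {a..b}" "b \<in> {a..b}" using a_le_b by auto
  have "(LINT z|LM. h z) = (\<Sum>i\<in>UNIV. \<Sum>j\<in>UNIV. (LINT z|LM. case_prod (?h i j) z))"
    unfolding heq using w(1) by simp
  then show "(LINT \<omega>|M. (P b *v X b \<omega>) \<bullet> Y b \<omega>) = (LINT \<omega>|M. (P a *v X a \<omega>) \<bullet> Y a \<omega>) + (LINT z|LM. h z)"
    unfolding E[OF ab(1)] E[OF ab(2)] w(2) sum.distrib by simp
qed

lemma inner_expectation:
  fixes X \<alpha> \<beta> Y \<gamma> \<delta> :: "real \<Rightarrow> 'w \<Rightarrow> real^'n::finite"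
  assumes X: "ito_process X \<alpha> \<beta>" and Y: "ito_process Y \<gamma> \<delta>"
  defines "h \<equiv> \<lambda>r \<omega>. \<alpha> r \<omega> \<bullet> Y r \<omega> + X r \<omega> \<bullet> \<gamma> r \<omega> + \<beta> r \<omega> \<bullet> \<delta> r \<omega>"
  shows "integrable LM (\<lambda>(r, \<omega>). h r \<omega>)"
    and "s \<in> {a..b} \<Longrightarrow> integrable M (\<lambda>\<omega>. X s \<omega> \<bullet> Y s \<omega>)"
    and "s \<in> {a..b} \<Longrightarrow> (LINT \<omega>|M. X s \<omega> \<bullet> Y s \<omega>) = (LINT \<omega>|M. X a \<omega> \<bullet> Y a \<omega>) + (LINT r:{a..s}|lborel. (LINT \<omega>|M. h r \<omega>))"
proof -
  have Xj: "ito_process (\<lambda>s \<omega>. X s \<omega> $ j) (\<lambda>s \<omega>. \<alpha> s \<omega> $ j) (\<lambda>s \<omega>. \<beta> s \<omega> $ j)" for j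
    by (rule ito_process_linear[OF X bounded_linear_vec_nth])
  have Yj: "ito_process (\<lambda>s \<omega>. Y s \<omega> $ i) (\<lambda>s \<omega>. \<gamma> s \<omega> $ i) (\<lambda>s \<omega>. \<delta> s \<omega> $ i)" for i
    by (rule ito_process_linear[OF Y bounded_linear_vec_nth])
  note w = product_expectation[OF Xj Yj]
  let ?h = "\<lambda>j r \<omega>. \<alpha> r \<omega> $ j * Y r \<omega> $ j + X r \<omega> $ j * \<gamma> r \<omega> $ j + \<beta> r \<omega> $ j * \<delta> r \<omega> $ j"
  have heq: "h r \<omega> = (\<Sum>j\<in>UNIV. ?h j r \<omega>)" for r \<omega>
    unfolding h_def inner_vec_def by (simp add: sum.distrib)
  have "integrable LM (\<lambda>z. \<Sum>j\<in>UNIV. case_prod (?h j) z)"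
    by (intro Bochner_Integration.integrable_sum w(1))
  then show hi: "integrable LM (\<lambda>(r, \<omega>). h r \<omega>)" unfolding heq split_beta' .
  show i: "integrable M (\<lambda>\<omega>. X s \<omega> \<bullet> Y s \<omega>)" if "s \<in> {a..b}" for s
    unfolding inner_vec_def using w(2)[OF that] by simp
  have E: "(LINT \<omega>|M. X s \<omega> \<bullet> Y s \<omega>) = (\<Sum>j\<in>UNIV. (LINT \<omega>|M. X s \<omega> $ j * Y s \<omega> $ j))" if "s \<in> {a..b}" for s
    unfolding inner_vec_def using w(2)[OF that] by simp
  show "(LINT \<omega>|M. X s \<omega> \<bullet> Y s \<omega>) = (LINT \<omega>|M. X a \<omega> \<bullet> Y a \<omega>) + (LINT r:{a..s}|lborel. (LINT \<omega>|M. h r \<omega>))"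
    if s: "s \<in> {a..b}"
  proof -
    have a: "a \<in> {a..b}" using a_le_b by simp
    note T = time_expectation_product[OF w(1) s]
    have "(LINT r:{a..s}|lborel. (LINT \<omega>|M. h r \<omega>)) = (LINT z|LM. (\<Sum>j\<in>UNIV. indicator {a..s} (fst z) *
        case_prod (?h j) z))"
      unfolding time_expectation_product(1)[OF hi s]
      by (intro Bochner_Integration.integral_cong refl) (simp add: heq split_beta' sum_distrib_left)
    also have "\<dots> = (\<Sum>j\<in>UNIV. (LINT r:{a..s}|lborel. (LINT \<omega>|M. ?h j r \<omega>)))"
      unfolding T(1) by (rule Bochner_Integration.integral_sum) (rule T(2))
    finally show ?thesis
      unfolding E[OF s] E[OF a] w(3)[OF s] sum.distrib by simp
  qed
qed

section \<open>Uniqueness for linear equations\<close>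

text \<open>The exceptional null set may depend on the time; continuity reduces the claim to countably many times.\<close>

lemma AE_zero_paths:
  fixes N :: "real \<Rightarrow> 'w \<Rightarrow> 'h::euclidean_space"
  assumes cont: "\<And>\<omega>. \<omega> \<in> space M \<Longrightarrow> continuous_on {a..b} (\<lambda>s. N s \<omega>)"
    and z: "\<And>s. s \<in> {a..b} \<Longrightarrow> AE \<omega> in M. N s \<omega> = 0"
  shows "AE \<omega> in M. \<forall>s\<in>{a..b}. N s \<omega> = 0"
proof -
  obtain D where D: "countable D" "D \<subseteq> {a..b}" "{a..b} \<subseteq> closure D"
    by (rule separable)
  have "AE \<omega> in M. \<forall>s\<in>D. N s \<omega> = 0"
    using D(1,2) z by (subst AE_ball_countable) auto
  then show ?thesis using AE_space
  proof eventually_elim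
    case (elim \<omega>)
    show ?case
    proof
      fix s assume s: "s \<in> {a..b}"
      then obtain x where x: "\<And>n. x n \<in> D" "x \<longlonglongrightarrow> s"
        using D(3) closure_sequential by (metis subsetD)
      have "(\<lambda>n. N (x n) \<omega>) \<longlonglongrightarrow> N s \<omega>"
        by (rule continuous_on_tendsto_compose[OF cont[OF elim(2)] x(2) s])
          (intro always_eventually allI subsetD[OF D(2)] x(1))
      moreover have "N (x n) \<omega> = 0" for n using elim(1) x(1) by blast
      ultimately show "N s \<omega> = 0" by (simp add: LIMSEQ_const_iff)
    qed
  qed
qed

text \<open>By the product rule, the second moment \<open>\<phi>\<close> satisfies \<open>\<phi>(s) \<le> \<integral> (2 |A| + |C|\<^sup>2) \<phi>\<close> with an integrable kernel.\<close>

lemma linear_sde_unique: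
  fixes N :: "real \<Rightarrow> 'w \<Rightarrow> real^'n::finite" and A C :: "real \<Rightarrow> real^'n^'n"
  assumes N: "N \<in> L2F_C M F a b" and A: "A \<in> Lp 1 a b" and C: "C \<in> Lp 2 a b"
    and N0: "AE \<omega> in M. N a \<omega> = 0"
    and sde: "has_ito_differential M F W a b N (\<lambda>s \<omega>. A s *v N s \<omega>) (\<lambda>s \<omega>. C s *v N s \<omega>)"
  shows "AE \<omega> in M. \<forall>s\<in>{a..b}. N s \<omega> = 0"
proof -
  have ip: "ito_process N (\<lambda>s \<omega>. A s *v N s \<omega>) (\<lambda>s \<omega>. C s *v N s \<omega>)"
    unfolding ito_process_def using N sde L2F_L1_Lp1[OF A N] by blast
  note ie = inner_expectation[OF ip ip]
  let ?h = "\<lambda>r \<omega>. (A r *v N r \<omega>) \<bullet> N r \<omega> + N r \<omega> \<bullet> (A r *v N r \<omega>) + (C r *v N r \<omega>) \<bullet> (C r *v N r \<omega>)"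
  obtain m where m: "m \<in> borel_measurable M" "integrable M (\<lambda>\<omega>. (m \<omega>)\<^sup>2)"
      "\<And>\<omega>. 0 \<le> m \<omega>" "\<And>\<omega> s. \<omega> \<in> space M \<Longrightarrow> s \<in> {a..b} \<Longrightarrow> norm (N s \<omega>) \<le> m \<omega>"
    by (rule L2F_C_dominated[OF N]) blast
  note [measurable] = prog_joint[OF L2F_C_prog[OF N]]
  define k where "k r = 2 * norm (A r) + (norm (C r))\<^sup>2" for r
  have k: "integrable L k" unfolding k_def using Lp_integrable[OF A] Lp_integrable[OF C] by simp
  then have [measurable]: "k \<in> borel_measurable L" by auto
  have k0: "0 \<le> k r" for r by (simp add: k_def)
  have sqm: "(norm (N s \<omega>))\<^sup>2 \<le> (m \<omega>)\<^sup>2" if "s \<in> {a..b}" "\<omega> \<in> space M" for s \<omega>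
    using m(4)[OF that(2,1)] by (intro power_mono) auto
  define \<phi> where "\<phi> s = (LINT \<omega>|M. N s \<omega> \<bullet> N s \<omega>)" for s
  have ik: "integrable LM (\<lambda>(r, \<omega>). k r * (N r \<omega> \<bullet> N r \<omega>))"
  proof (rule integrable_time_process[OF k m(2)])
    show "AE \<omega> in M. \<forall>s\<in>{a..b}. \<bar>k s * (N s \<omega> \<bullet> N s \<omega>)\<bar> \<le> \<bar>k s\<bar> * (m \<omega>)\<^sup>2"
      using sqm by (intro AE_I2 ballI) (simp add: abs_mult mult_left_mono power2_norm_eq_inner)
  qed measurable
  have i1: "integrable LM (\<lambda>(r, \<omega>). N r \<omega> \<bullet> N r \<omega>)"
  proof (rule integrable_time_process[OF _ m(2), of "\<lambda>_. 1"])
    show "integrable L (\<lambda>_. 1 :: real)" using finite_measure.integrable_const[OF finite_measure_leb_on] .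
    show "AE \<omega> in M. \<forall>s\<in>{a..b}. \<bar>N s \<omega> \<bullet> N s \<omega>\<bar> \<le> \<bar>1\<bar> * (m \<omega>)\<^sup>2"
      using sqm by (intro AE_I2 ballI) (simp add: power2_norm_eq_inner)
  qed measurable
  have "\<phi> s = 0" if s: "s \<in> {a..b}" for s
  proof (rule gronwall_zero[of a b k \<phi> "LINT \<omega>|M. (m \<omega>)\<^sup>2"])
    show "set_integrable lborel {a..b} k" using k by (simp add: set_integrable_leb_on)
    show "set_borel_measurable lborel {a..b} \<phi>"
      using time_expectation(3)[OF i1] unfolding set_borel_measurable_leb_on \<phi>_def by auto
    show "\<phi> s \<le> (LINT \<omega>|M. (m \<omega>)\<^sup>2)" if "s \<in> {a..b}" for s
      unfolding \<phi>_def using sqm[OF that] by (intro integral_mono ie(2) m(2) that) (simp add: power2_norm_eq_inner)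
    show "0 \<le> \<phi> s" for s unfolding \<phi>_def by simp
    show "0 \<le> k s" for s by (rule k0)
    fix s assume s: "s \<in> {a..b}"
    have "AE \<omega> in M. N a \<omega> \<bullet> N a \<omega> = 0" using N0 by eventually_elim simp
    then have "(LINT \<omega>|M. N a \<omega> \<bullet> N a \<omega>) = 0" by (rule integral_eq_zero_AE)
    then have "\<phi> s = (LINT r:{a..s}|lborel. (LINT \<omega>|M. ?h r \<omega>))"
      unfolding \<phi>_def using ie(3)[OF s] by simp
    also have "\<dots> \<le> (LINT r:{a..s}|lborel. k r * \<phi> r)"
    proof (rule set_integral_mono)
      have sub: "{a..s} \<subseteq> {a..b}" using s by auto
      show "set_integrable lborel {a..s} (\<lambda>r. LINT \<omega>|M. ?h r \<omega>)"
        by (rule set_integrable_subset[OF _ _ sub]) (use time_expectation(3)[OF ie(1)] in \<open>auto simp: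
            set_integrable_leb_on\<close>)
      show "set_integrable lborel {a..s} (\<lambda>r. k r * \<phi> r)"
        by (rule set_integrable_subset[OF _ _ sub]) (use time_expectation(3)[OF ik] in \<open>auto simp:
            set_integrable_leb_on \<phi>_def\<close>)
      fix r assume "r \<in> {a..s}"
      then have r: "r \<in> {a..b}" using s by auto
      have le: "?h r \<omega> \<le> k r * (N r \<omega> \<bullet> N r \<omega>)" for \<omega>
      proof -
        have "(A r *v N r \<omega>) \<bullet> N r \<omega> \<le> norm (A r *v N r \<omega>) * norm (N r \<omega>)" by (rule norm_cauchy_schwarz)
        also have "\<dots> \<le> (norm (A r) * norm (N r \<omega>)) * norm (N r \<omega>)"
          by (intro mult_right_mono norm_matrix_vector_le) simp
        finally have 1: "(A r *v N r \<omega>) \<bullet> N r \<omega> \<le> norm (A r) * (norm (N r \<omega>))\<^sup>2" by (simp add: power2_eq_square)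
        have "(norm (C r *v N r \<omega>))\<^sup>2 \<le> (norm (C r) * norm (N r \<omega>))\<^sup>2"
          by (intro power_mono norm_matrix_vector_le) simp
        then have 2: "(C r *v N r \<omega>) \<bullet> (C r *v N r \<omega>) \<le> (norm (C r))\<^sup>2 * (norm (N r \<omega>))\<^sup>2"
          by (simp add: power2_norm_eq_inner power_mult_distrib)
        show ?thesis
          using 1 2 by (simp add: k_def power2_norm_eq_inner[symmetric] algebra_simps inner_commute[of "N r \<omega>"])
      qed
      show "(LINT \<omega>|M. ?h r \<omega>) \<le> k r * \<phi> r"
      proof (cases "integrable M (?h r)")
        case True
        have "(LINT \<omega>|M. ?h r \<omega>) \<le> (LINT \<omega>|M. k r * (N r \<omega> \<bullet> N r \<omega>))"
          by (rule integral_mono[OF True _ le]) (simp add: ie(2)[OF r])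
        then show ?thesis by (simp add: \<phi>_def)
      next
        case False
        then have "(LINT \<omega>|M. ?h r \<omega>) = 0" by (rule not_integrable_integral_eq)
        then show ?thesis using k0[of r] by (simp add: \<phi>_def)
      qed
    qed
    finally show "\<phi> s \<le> (LINT r:{a..s}|lborel. k r * \<phi> r)" .
  qed (rule s)
  then have "AE \<omega> in M. N s \<omega> = 0" if "s \<in> {a..b}" for s
    using that integral_nonneg_eq_0_iff_AE[OF ie(2)[OF that]] unfolding \<phi>_def by simp
  then show ?thesis by (intro AE_zero_paths L2F_C_continuous[OF N])
qed

end

section \<open>One player: variation of the cost\<close>

lemma inner_transpose_left: "(transpose A *v x) \<bullet> y = x \<bullet> (A *v (y :: real^'n::finite))"
  by (simp add: transpose_matrix_vector dot_lmul_matrix)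

lemma symmetric_inner:
  assumes "transpose A = (A :: real^'n::finite^'n)"
  shows "(A *v x) \<bullet> y = (A *v y) \<bullet> x"
  using inner_transpose_left[of A x y] assms by (simp add: inner_commute)

text \<open>The algebra behind the choice of the Riccati and the backward equation, at one point of time and chance.
  The first two lines are the integrand of \<open>d\<langle>P X, N\<rangle>\<close>, the third that of \<open>d\<langle>\<eta>, N\<rangle>\<close>, the fourth the integrand of the
  first-order variation of the cost; all terms containing \<open>N\<close> cancel and the stationarity residual remains.\<close>

lemma adjoint_identity:
  fixes A C Q P P' :: "real^'n::finite^'n" and B D Lf :: "real^'m::finite^'n" and S \<Theta> :: "real^'n^'m" and R ::
      "real^'m^'m"
    and X N \<eta> \<zeta> bb \<sigma> q :: "real^'n" and v w \<rho> :: "real^'m"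
  assumes Lf: "Lf = P ** B + transpose C ** P ** D + transpose S"
    and P': "P' = - (P ** A + transpose A ** P + transpose C ** P ** C + Q + Lf ** \<Theta>)"
    and u: "u = \<Theta> *v X + v"
    and drv: "drv = transpose A *v \<eta> + transpose C *v \<zeta> + transpose C *v (P *v \<sigma>) + P *v bb + q + Lf *v v"
  shows "(P' *v X) \<bullet> N + (P *v (A *v X + B *v u + bb)) \<bullet> N + (P *v X) \<bullet> (A *v N + B *v w)
      + (P *v (C *v X + D *v u + \<sigma>)) \<bullet> (C *v N + D *v w)
      + ((- drv) \<bullet> N + \<eta> \<bullet> (A *v N + B *v w) + \<zeta> \<bullet> (C *v N + D *v w))
      + ((Q *v X) \<bullet> N + q \<bullet> N + (S *v X) \<bullet> w + (S *v N) \<bullet> u + (R *v u) \<bullet> w + \<rho> \<bullet> w)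
    = (transpose B *v (P *v X + \<eta>) + transpose D *v (P *v (C *v X + D *v u + \<sigma>) + \<zeta>) + S *v X + R *v u + \<rho>) \<bullet> w"
proof -
  have "Lf *v u = Lf *v (\<Theta> *v X) + Lf *v v" unfolding u by (simp add: matrix_vector_right_distrib)
  moreover have "Lf *v u = P *v (B *v u) + transpose C *v (P *v (D *v u)) + transpose S *v u"
    unfolding Lf by (simp add: matrix_vector_mult_add_rdistrib matrix_vector_mul_assoc matrix_mul_assoc)
  ultimately have L: "Lf *v (\<Theta> *v X) = P *v (B *v u) + transpose C *v (P *v (D *v u)) + transpose S *v u - Lf *v v"
    by (simp add: algebra_simps)
  have P'X: "P' *v X = - (P *v (A *v X) + transpose A *v (P *v X) + transpose C *v (P *v (C *v X)) + Q *v X +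
      Lf *v (\<Theta> *v X))"
    unfolding P' by (simp add: matrix_vector_mult_add_rdistrib matrix_vector_mul_assoc matrix_mul_assoc
        bounded_bilinear.minus_left[OF bounded_bilinear_matrix_vector]
        bounded_bilinear.diff_left[OF bounded_bilinear_matrix_vector])
  show ?thesis
    unfolding P'X L drv
    by (simp add: matrix_vector_right_distrib inner_left_distrib inner_right_distrib inner_diff_left
        inner_minus_left inner_transpose_left
        dot_lmul_matrix inner_commute[of u "S *v N"] algebra_simps)
qed

definition running_cost ::
  "(real \<Rightarrow> real^'n::finite^'n) \<Rightarrow> (real \<Rightarrow> real^'n^'m::finite) \<Rightarrow> (real \<Rightarrow> real^'m^'m) \<Rightarrow>
   (real \<Rightarrow> 'w \<Rightarrow> real^'n) \<Rightarrow> (real \<Rightarrow> 'w \<Rightarrow> real^'m) \<Rightarrow> (real \<Rightarrow> 'w \<Rightarrow> real^'m) \<Rightarrow> (real \<Rightarrow> 'w \<Rightarrow> real^'n) \<Rightarrow> real \<Rightarrow> 'w \<Rightarrow>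
       real" where
  "running_cost Q S R q \<rho> u X s \<omega> = (Q s *v X s \<omega>) \<bullet> X s \<omega> + 2 * ((S s *v X s \<omega>) \<bullet> u s \<omega>) + (R s *v u s \<omega>) \<bullet> u s \<omega>
     + 2 * (q s \<omega> \<bullet> X s \<omega>) + 2 * (\<rho> s \<omega> \<bullet> u s \<omega>)"

definition terminal_cost :: "real^'n::finite^'n \<Rightarrow> ('w \<Rightarrow> real^'n) \<Rightarrow> ('w \<Rightarrow> real^'n) \<Rightarrow> 'w \<Rightarrow> real" where
  "terminal_cost G g Z \<omega> = (G *v Z \<omega>) \<bullet> Z \<omega> + 2 * (g \<omega> \<bullet> Z \<omega>)"

lemma running_cost_expansion:
  fixes Q :: "real^'n::finite^'n" and R :: "real^'m::finite^'m" and S :: "real^'n^'m"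
  assumes "transpose Q = Q" "transpose R = R"
  shows "(Q *v (X + N)) \<bullet> (X + N) + 2 * ((S *v (X + N)) \<bullet> (u + w)) + (R *v (u + w)) \<bullet> (u + w) + 2 *
      (q \<bullet> (X + N)) + 2 * (\<rho> \<bullet> (u + w))
   = ((Q *v X) \<bullet> X + 2 * ((S *v X) \<bullet> u) + (R *v u) \<bullet> u + 2 * (q \<bullet> X) + 2 * (\<rho> \<bullet> u))
   + ((Q *v N) \<bullet> N + 2 * ((S *v N) \<bullet> w) + (R *v w) \<bullet> w)
   + 2 * ((Q *v X) \<bullet> N + q \<bullet> N + (S *v X) \<bullet> w + (S *v N) \<bullet> u + (R *v u) \<bullet> w + \<rho> \<bullet> w)"
  using symmetric_inner[OF assms(1), of N X] symmetric_inner[OF assms(2), of w u]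
  by (simp add: matrix_vector_right_distrib inner_left_distrib inner_right_distrib algebra_simps)

lemma terminal_cost_expansion:
  fixes G :: "real^'n::finite^'n"
  assumes "transpose G = G"
  shows "(G *v (X + N)) \<bullet> (X + N) + 2 * (g \<bullet> (X + N)) = ((G *v X) \<bullet> X + 2 * (g \<bullet> X)) + (G *v N) \<bullet> N + 2 *
      ((G *v X) \<bullet> N + g \<bullet> N)"
  using symmetric_inner[OF assms, of N X]
  by (simp add: matrix_vector_right_distrib inner_left_distrib inner_right_distrib algebra_simps)

lemma Lp_transpose:
  fixes k :: "real \<Rightarrow> real^'n::finite^'m::finite"
  assumes "k \<in> Lp p a b"
  shows "(\<lambda>s. transpose (k s)) \<in> Lp p a b"
  using assms unfolding Lp_def by (auto simp: set_borel_measurable_leb_on norm_transpose intro: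
      borel_measurable_transpose)

lemma continuous_Linf:
  fixes P :: "real \<Rightarrow> real^'n::finite^'m::finite"
  assumes "continuous_on {a..b} P"
  shows "P \<in> Linf a b"
proof -
  have "bounded (P ` {a..b})" by (rule compact_imp_bounded[OF compact_continuous_image[OF assms]]) simp
  then obtain c where "\<forall>s\<in>{a..b}. norm (P s) \<le> c" unfolding bounded_iff by blast
  moreover have "P \<in> borel_measurable (leb_on a b)"
    using borel_measurable_continuous_on_restrict[OF assms] measurable_cong_sets[OF sets_leb_on refl] by blast
  ultimately show ?thesis
    unfolding Linf_def by (auto simp: set_borel_measurable_leb_on intro!: exI[of _ c] AE_I2)
qed

context brownian_space
begin

lemma integrable_inner_L1_C:
  fixes \<alpha> Z :: "real \<Rightarrow> 'w \<Rightarrow> 'h::euclidean_space"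
  assumes \<alpha>: "\<alpha> \<in> L2F_L1 M F a b" and Z: "Z \<in> L2F_C M F a b"
  shows "integrable LM (\<lambda>(s, \<omega>). \<alpha> s \<omega> \<bullet> Z s \<omega>)"
proof -
  obtain m where m: "m \<in> borel_measurable M" "integrable M (\<lambda>\<omega>. (m \<omega>)\<^sup>2)"
      "\<And>\<omega>. 0 \<le> m \<omega>" "\<And>\<omega> s. \<omega> \<in> space M \<Longrightarrow> s \<in> {a..b} \<Longrightarrow> norm (Z s \<omega>) \<le> m \<omega>"
    by (rule L2F_C_dominated[OF Z]) blast
  note [measurable] = prog_joint[OF L2F_L1_prog[OF \<alpha>]] prog_joint[OF L2F_C_prog[OF Z]]
  show ?thesis
  proof (rule integrable_L1_dominated[OF \<alpha> m(1-3)])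
    show "AE \<omega> in M. \<forall>s\<in>{a..b}. \<bar>\<alpha> s \<omega> \<bullet> Z s \<omega>\<bar> \<le> norm (\<alpha> s \<omega>) * m \<omega>"
      using m(4) by (intro AE_I2 ballI order_trans[OF Cauchy_Schwarz_ineq2]) (simp add: mult_left_mono)
  qed measurable
qed

lemma integrable_inner_L2:
  fixes \<alpha> Z :: "real \<Rightarrow> 'w \<Rightarrow> 'h::euclidean_space"
  assumes \<alpha>: "\<alpha> \<in> L2F M F a b" and Z: "Z \<in> L2F M F a b"
  shows "integrable LM (\<lambda>(s, \<omega>). \<alpha> s \<omega> \<bullet> Z s \<omega>)"
proof -
  note [measurable] = prog_joint[OF L2F_prog[OF \<alpha>]] prog_joint[OF L2F_prog[OF Z]]
  show ?thesis by (rule integrable_L2_L2[OF \<alpha> Z]) (measurable, rule Cauchy_Schwarz_ineq2)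
qed

lemma L2F_C_square:
  fixes X :: "real \<Rightarrow> 'w \<Rightarrow> 'h::euclidean_space"
  assumes X: "X \<in> L2F_C M F a b" and s: "s \<in> {a..b}"
  shows "X s \<in> borel_measurable M" "integrable M (\<lambda>\<omega>. (norm (X s \<omega>))\<^sup>2)"
proof -
  obtain m where m: "m \<in> borel_measurable M" "integrable M (\<lambda>\<omega>. (m \<omega>)\<^sup>2)"
      "\<And>\<omega>. 0 \<le> m \<omega>" "\<And>\<omega> s. \<omega> \<in> space M \<Longrightarrow> s \<in> {a..b} \<Longrightarrow> norm (X s \<omega>) \<le> m \<omega>"
    by (rule L2F_C_dominated[OF X]) blast
  show Xm [measurable]: "X s \<in> borel_measurable M" by (rule prog_adapted_M[OF L2F_C_prog[OF X] s])
  show "integrable M (\<lambda>\<omega>. (norm (X s \<omega>))\<^sup>2)"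
  proof (rule Bochner_Integration.integrable_bound[OF m(2)])
    show "AE \<omega> in M. norm ((norm (X s \<omega>))\<^sup>2) \<le> norm ((m \<omega>)\<^sup>2)"
      using m(4)[OF _ s] by (intro AE_I2) (simp add: power_mono)
  qed measurable
qed

lemma integrable_inner:
  fixes f g :: "'w \<Rightarrow> 'h::euclidean_space"
  assumes "f \<in> borel_measurable M" "integrable M (\<lambda>\<omega>. (norm (f \<omega>))\<^sup>2)"
    and "g \<in> borel_measurable M" "integrable M (\<lambda>\<omega>. (norm (g \<omega>))\<^sup>2)"
  shows "integrable M (\<lambda>\<omega>. f \<omega> \<bullet> g \<omega>)"
proof (rule Bochner_Integration.integrable_bound)
  show "integrable M (\<lambda>\<omega>. norm (f \<omega>) * norm (g \<omega>))"
    using assms by (intro integrable_mult_L2) auto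
  show "AE \<omega> in M. norm (f \<omega> \<bullet> g \<omega>) \<le> norm (norm (f \<omega>) * norm (g \<omega>))"
    by (intro AE_I2) (simp add: Cauchy_Schwarz_ineq2)
qed (use assms in measurable)

text \<open>The first order of summation is that of the cost, the second that of the convexity condition.\<close>

lemma integral_path_plus:
  fixes f :: "real \<Rightarrow> 'w \<Rightarrow> real"
  assumes "integrable LM (\<lambda>(s, \<omega>). f s \<omega>)" "integrable M g"
  shows "(LINT \<omega>|M. g \<omega> + (LINT s:{a..b}|lborel. f s \<omega>)) = (LINT \<omega>|M. g \<omega>) + (LINT z|LM. case_prod f z)"
    and "(LINT \<omega>|M. (LINT s:{a..b}|lborel. f s \<omega>) + g \<omega>) = (LINT \<omega>|M. g \<omega>) + (LINT z|LM. case_prod f z)"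
  using time_expectation(4,5)[OF assms(1)] assms(2) by simp_all

lemma AE_pair_time:
  assumes "AE s in L. Q s"
  shows "AE z in LM. Q (fst z)"
proof -
  interpret P: pair_sigma_finite L M by (rule pair_sf)
  from assms obtain N where N: "{s \<in> space L. \<not> Q s} \<subseteq> N" "N \<in> null_sets L" by (rule AE_E3) (auto simp: null_sets_def)
  have "AE z in LM. fst z \<notin> N"
  proof (rule P.AE_pair_measure)
    have [measurable]: "N \<in> sets L" using N(2) by auto
    show "{z \<in> space LM. fst z \<notin> N} \<in> sets LM" by measurable
    show "AE s in L. AE \<omega> in M. fst (s, \<omega>) \<notin> N" using AE_not_in[OF N(2)] by eventually_elim simp
  qed
  then show ?thesis using AE_space
    by eventually_elim (use N(1) in \<open>auto simp: space_pair_measure\<close>)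
qed

definition player_cost ::
  "real^'n::finite^'n \<Rightarrow> ('w \<Rightarrow> real^'n) \<Rightarrow> (real \<Rightarrow> real^'n^'n) \<Rightarrow> (real \<Rightarrow> real^'n^'m::finite) \<Rightarrow> (real \<Rightarrow> real^'m^'m) \<Rightarrow>
   (real \<Rightarrow> 'w \<Rightarrow> real^'n) \<Rightarrow> (real \<Rightarrow> 'w \<Rightarrow> real^'m) \<Rightarrow> (real \<Rightarrow> 'w \<Rightarrow> real^'m) \<Rightarrow> (real \<Rightarrow> 'w \<Rightarrow> real^'n) \<Rightarrow> real" where
  "player_cost G g Q S R q \<rho> u X =
     (LINT \<omega>|M. terminal_cost G g (X b) \<omega> + (LINT s:{a..b}|lborel. running_cost Q S R q \<rho> u X s \<omega>))"

lemma player_cost_integrable: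
  fixes Q :: "real \<Rightarrow> real^'n::finite^'n" and S :: "real \<Rightarrow> real^'n^'m::finite" and R :: "real \<Rightarrow> real^'m^'m"
  assumes Q: "Q \<in> Lp 1 a b" and S: "S \<in> Lp 2 a b" and R: "R \<in> Linf a b"
    and q: "q \<in> L2F_L1 M F a b" and \<rho>: "\<rho> \<in> L2F M F a b"
    and g: "g \<in> borel_measurable M" "integrable M (\<lambda>\<omega>. (norm (g \<omega>))\<^sup>2)"
    and X: "X \<in> L2F_C M F a b" and u: "u \<in> L2F M F a b"
  shows "integrable LM (\<lambda>(s, \<omega>). running_cost Q S R q \<rho> u X s \<omega>)"
    and "integrable M (terminal_cost G g (X b))"
proof -
  have b: "b \<in> {a..b}" using a_le_b by simp
  have "integrable LM (\<lambda>z. (Q (fst z) *v X (fst z) (snd z)) \<bullet> X (fst z) (snd z))"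
    using integrable_inner_L1_C[OF L2F_L1_Lp1[OF Q X] X] by (simp add: split_beta')
  moreover have "integrable LM (\<lambda>z. (S (fst z) *v X (fst z) (snd z)) \<bullet> u (fst z) (snd z))"
    using integrable_inner_L2[OF L2F_Lp2[OF S X] u] by (simp add: split_beta')
  moreover have "integrable LM (\<lambda>z. (R (fst z) *v u (fst z) (snd z)) \<bullet> u (fst z) (snd z))"
    using integrable_inner_L2[OF L2F_Linf[OF R u] u] by (simp add: split_beta')
  moreover have "integrable LM (\<lambda>z. q (fst z) (snd z) \<bullet> X (fst z) (snd z))"
    using integrable_inner_L1_C[OF q X] by (simp add: split_beta')
  moreover have "integrable LM (\<lambda>z. \<rho> (fst z) (snd z) \<bullet> u (fst z) (snd z))"
    using integrable_inner_L2[OF \<rho> u] by (simp add: split_beta')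
  ultimately show "integrable LM (\<lambda>(s, \<omega>). running_cost Q S R q \<rho> u X s \<omega>)"
    unfolding running_cost_def split_beta' by (intro Bochner_Integration.integrable_add integrable_mult_right)
  have GX: "(\<lambda>s \<omega>. G *v X s \<omega>) \<in> L2F_C M F a b"
    by (rule L2F_C_linear[OF X matrix_vector_mul_bounded_linear])
  show "integrable M (terminal_cost G g (X b))"
    unfolding terminal_cost_def[abs_def]
    by (intro Bochner_Integration.integrable_add integrable_mult_right integrable_inner L2F_C_square[OF GX b]
        L2F_C_square[OF X b] g)
qed

lemma player_cost_cong:
  fixes Q :: "real \<Rightarrow> real^'n::finite^'n" and S :: "real \<Rightarrow> real^'n^'m::finite" and R :: "real \<Rightarrow> real^'m^'m"
  assumes Q: "Q \<in> Lp 1 a b" and S: "S \<in> Lp 2 a b" and R: "R \<in> Linf a b"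
    and q: "q \<in> L2F_L1 M F a b" and \<rho>: "\<rho> \<in> L2F M F a b"
    and g: "g \<in> borel_measurable M" "integrable M (\<lambda>\<omega>. (norm (g \<omega>))\<^sup>2)"
    and X: "X \<in> L2F_C M F a b" and X': "X' \<in> L2F_C M F a b" and u: "u \<in> L2F M F a b"
    and eq: "AE \<omega> in M. \<forall>s\<in>{a..b}. X' s \<omega> = X s \<omega>"
  shows "player_cost G g Q S R q \<rho> u X' = player_cost G g Q S R q \<rho> u X"
  unfolding player_cost_def
proof (rule integral_cong_AE)
  have "integrable M (\<lambda>\<omega>. terminal_cost G g (Z b) \<omega> + (LINT s:{a..b}|lborel. running_cost Q S R q \<rho> u Z s \<omega>))"
    if "Z \<in> L2F_C M F a b" for Z
    by (intro Bochner_Integration.integrable_add player_cost_integrable(2)[OF Q S R q \<rho> g that u]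
        time_expectation(4)[OF player_cost_integrable(1)[OF Q S R q \<rho> g that u]])
  from this[OF X] this[OF X']
  show "(\<lambda>\<omega>. terminal_cost G g (X b) \<omega> + (LINT s:{a..b}|lborel. running_cost Q S R q \<rho> u X s \<omega>)) \<in> borel_measurable M"
    "(\<lambda>\<omega>. terminal_cost G g (X' b) \<omega> + (LINT s:{a..b}|lborel. running_cost Q S R q \<rho> u X' s \<omega>)) \<in> borel_measurable M"
    by blast+
  show "AE \<omega> in M. terminal_cost G g (X' b) \<omega> + (LINT s:{a..b}|lborel. running_cost Q S R q \<rho> u X' s \<omega>) =
     terminal_cost G g (X b) \<omega> + (LINT s:{a..b}|lborel. running_cost Q S R q \<rho> u X s \<omega>)"
    using eq
  proof eventually_elim
    case (elim \<omega>)
    then have "X' b \<omega> = X b \<omega>" using a_le_b by simp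
    then show ?case using elim
      by (auto simp: set_lebesgue_integral_def terminal_cost_def running_cost_def
          intro!: Bochner_Integration.integral_cong split: split_indicator)
  qed
qed

text \<open>One player's problem, with the control vector of both players and the player's own blocks of the Riccati
  and the backward solution.  The second-order part of the variation of the cost is nonnegative by
  convexity.  The first-order part is computed by the product rule, applied to \<open>P X\<close> and \<open>\<eta>\<close> against the state
  variation, and reduces to the pairing of the control variation with the stationarity residual.\<close>

lemma player_optimality:
  fixes A C Q P P' :: "real \<Rightarrow> real^'n::finite^'n" and B D Lf :: "real \<Rightarrow> real^'m::finite^'n"
    and S \<Theta> :: "real \<Rightarrow> real^'n^'m" and R :: "real \<Rightarrow> real^'m^'m" and G :: "real^'n^'n"
    and X Y \<eta> \<zeta> bb \<sigma> q drv :: "real \<Rightarrow> 'w \<Rightarrow> real^'n" and u u' v \<rho> :: "real \<Rightarrow> 'w \<Rightarrow> real^'m" and g :: "'w \<Rightarrow> real^'n"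
  assumes A: "A \<in> Lp 1 a b" and B: "B \<in> Lp 2 a b" and bb: "bb \<in> L2F_L1 M F a b"
    and C: "C \<in> Lp 2 a b" and D: "D \<in> Linf a b" and \<sigma>: "\<sigma> \<in> L2F M F a b"
    and Q: "Q \<in> Lp 1 a b" "AE s in L. transpose (Q s) = Q s" and S: "S \<in> Lp 2 a b"
    and R: "R \<in> Linf a b" "AE s in L. transpose (R s) = R s"
    and q: "q \<in> L2F_L1 M F a b" and \<rho>: "\<rho> \<in> L2F M F a b"
    and g: "g \<in> borel_measurable M" "integrable M (\<lambda>\<omega>. (norm (g \<omega>))\<^sup>2)" and G: "transpose G = G"
    and P: "\<And>i j. primitive_on a b (\<lambda>s. P s $ i $ j) (\<lambda>s. P' s $ i $ j)" "continuous_on {a..b} P" "P b = G"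
    and Lf: "\<And>s. Lf s = P s ** B s + transpose (C s) ** P s ** D s + transpose (S s)"
    and P': "\<And>s. P' s = - (P s ** A s + transpose (A s) ** P s + transpose (C s) ** P s ** C s + Q s + Lf s ** \<Theta> s)"
    and \<eta>: "\<eta> \<in> L2F_C M F a b" "AE \<omega> in M. \<eta> b \<omega> = g \<omega>" and \<zeta>: "\<zeta> \<in> L2F M F a b"
    and v: "v \<in> L2F M F a b"
    and drv: "\<And>s \<omega>. drv s \<omega> = transpose (A s) *v \<eta> s \<omega> + transpose (C s) *v \<zeta> s \<omega>
        + transpose (C s) *v (P s *v \<sigma> s \<omega>) + P s *v bb s \<omega> + q s \<omega> + Lf s *v v s \<omega>"
    and bsde: "has_ito_differential M F W a b \<eta> (\<lambda>s \<omega>. - drv s \<omega>) \<zeta>"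
    and u: "u \<in> L2F M F a b" "\<And>s \<omega>. u s \<omega> = \<Theta> s *v X s \<omega> + v s \<omega>" and u': "u' \<in> L2F M F a b"
    and X: "X \<in> L2F_C M F a b" "has_ito_differential M F W a b X
        (\<lambda>s \<omega>. A s *v X s \<omega> + B s *v u s \<omega> + bb s \<omega>) (\<lambda>s \<omega>. C s *v X s \<omega> + D s *v u s \<omega> + \<sigma> s \<omega>)"
    and Y: "Y \<in> L2F_C M F a b" "has_ito_differential M F W a b Y
        (\<lambda>s \<omega>. A s *v Y s \<omega> + B s *v u' s \<omega> + bb s \<omega>) (\<lambda>s \<omega>. C s *v Y s \<omega> + D s *v u' s \<omega> + \<sigma> s \<omega>)"
    and start: "AE \<omega> in M. Y a \<omega> = X a \<omega>"
    and stationary: "AE s in L. \<forall>\<omega>\<in>space M. (transpose (B s) *v (P s *v X s \<omega> + \<eta> s \<omega>)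
        + transpose (D s) *v (P s *v (C s *v X s \<omega> + D s *v u s \<omega> + \<sigma> s \<omega>) + \<zeta> s \<omega>)
        + S s *v X s \<omega> + R s *v u s \<omega> + \<rho> s \<omega>) \<bullet> (u' s \<omega> - u s \<omega>) = 0"
    and convex: "\<And>N. N \<in> L2F_C M F a b \<Longrightarrow> AE \<omega> in M. N a \<omega> = 0 \<Longrightarrow>
        has_ito_differential M F W a b N (\<lambda>s \<omega>. A s *v N s \<omega> + B s *v (u' s \<omega> - u s \<omega>)) (\<lambda>s \<omega>. C s *v N s \<omega> + D
            s *v (u' s \<omega> - u s \<omega>)) \<Longrightarrow>
        0 \<le> (LINT \<omega>|M. (LINT s:{a..b}|lborel. (Q s *v N s \<omega>) \<bullet> N s \<omega> + 2 * ((S s *v N s \<omega>) \<bullet> (u' s \<omega> - u s \<omega>))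
             + (R s *v (u' s \<omega> - u s \<omega>)) \<bullet> (u' s \<omega> - u s \<omega>)) + (G *v N b \<omega>) \<bullet> N b \<omega>)"
  shows "player_cost G g Q S R q \<rho> u X \<le> player_cost G g Q S R q \<rho> u' Y"
proof -
  define N where "N s \<omega> = Y s \<omega> - X s \<omega>" for s \<omega>
  define w where "w s \<omega> = u' s \<omega> - u s \<omega>" for s \<omega>
  have ab: "a \<in> {a..b}" "b \<in> {a..b}" using a_le_b by auto
  have w: "w \<in> L2F M F a b" unfolding w_def using u' u(1) by (rule L2F_diff)
  have NC: "N \<in> L2F_C M F a b" unfolding N_def using Y(1) X(1) by (rule L2F_C_diff)
  have N0: "AE \<omega> in M. N a \<omega> = 0" using start by eventually_elim (simp add: N_def)
  have Nd: "has_ito_differential M F W a b N (\<lambda>s \<omega>. A s *v N s \<omega> + B s *v w s \<omega>) (\<lambda>s \<omega>. C s *v N s \<omega> + D s *v w s \<omega>)"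
  proof -
    have "A s *v Y s \<omega> + B s *v u' s \<omega> + bb s \<omega> - (A s *v X s \<omega> + B s *v u s \<omega> + bb s \<omega>) = A s *v N s \<omega> + B s *v w s \<omega>"
      "C s *v Y s \<omega> + D s *v u' s \<omega> + \<sigma> s \<omega> - (C s *v X s \<omega> + D s *v u s \<omega> + \<sigma> s \<omega>) = C s *v N s \<omega> + D s *v w s
          \<omega>" for s \<omega>
      unfolding N_def w_def by (simp_all add: matrix_vector_mult_diff_distrib)
    with has_ito_differential_diff[OF Y(2) X(2)] show ?thesis by (simp add: N_def[abs_def])
  qed
  have Xp: "ito_process X (\<lambda>s \<omega>. A s *v X s \<omega> + B s *v u s \<omega> + bb s \<omega>) (\<lambda>s \<omega>. C s *v X s \<omega> + D s *v u s \<omega> + \<sigma> s \<omega>)"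
    unfolding ito_process_def by (intro conjI X L2F_L1_add L2F_L1_Lp1[OF A] L2F_L1_Lp2[OF B] u(1) bb)
  have Np: "ito_process N (\<lambda>s \<omega>. A s *v N s \<omega> + B s *v w s \<omega>) (\<lambda>s \<omega>. C s *v N s \<omega> + D s *v w s \<omega>)"
    unfolding ito_process_def by (intro conjI NC Nd L2F_L1_add L2F_L1_Lp1[OF A] L2F_L1_Lp2[OF B] w)
  have drvL: "drv \<in> L2F_L1 M F a b"
  proof -
    note PL = continuous_Linf[OF P(2)]
    have "Lf s *v v s \<omega> = P s *v (B s *v v s \<omega>) + transpose (C s) *v (P s *v (D s *v v s \<omega>)) + transpose (S s)
        *v v s \<omega>" for s \<omega>
      unfolding Lf by (simp add: matrix_vector_mult_add_rdistrib matrix_vector_mul_assoc matrix_mul_assoc)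
    then have "drv = (\<lambda>s \<omega>. transpose (A s) *v \<eta> s \<omega> + transpose (C s) *v \<zeta> s \<omega>
        + transpose (C s) *v (P s *v \<sigma> s \<omega>) + P s *v bb s \<omega> + q s \<omega>
        + (P s *v (B s *v v s \<omega>) + transpose (C s) *v (P s *v (D s *v v s \<omega>)) + transpose (S s) *v v s \<omega>))"
      by (simp add: drv fun_eq_iff)
    also have "\<dots> \<in> L2F_L1 M F a b"
      by (intro L2F_L1_add L2F_L1_Lp1[OF Lp_transpose[OF A]] L2F_L1_Lp2[OF Lp_transpose[OF C]]
          L2F_L1_Lp2[OF Lp_transpose[OF S]]
          L2F_L1_Linf[OF PL] L2F_Linf[OF PL] L2F_Linf[OF D] L2F_L1_Lp2[OF B] \<eta>(1) \<zeta> \<sigma> bb q v)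
    finally show ?thesis .
  qed
  have \<eta>p: "ito_process \<eta> (\<lambda>s \<omega>. - drv s \<omega>) \<zeta>"
    unfolding ito_process_def
    by (intro conjI \<eta>(1) bsde L2F_L1_linear[OF drvL bounded_linear_minus[OF bounded_linear_ident]])
  note be = bilinear_expectation[OF Xp Np P(1,2)] and ie = inner_expectation[OF \<eta>p Np]
  let ?h1 = "\<lambda>s \<omega>. (P' s *v X s \<omega>) \<bullet> N s \<omega> + (P s *v (A s *v X s \<omega> + B s *v u s \<omega> + bb s \<omega>)) \<bullet> N s \<omega>
      + (P s *v X s \<omega>) \<bullet> (A s *v N s \<omega> + B s *v w s \<omega>) + (P s *v (C s *v X s \<omega> + D s *v u s \<omega> + \<sigma> s \<omega>)) \<bullet>
          (C s *v N s \<omega> + D s *v w s \<omega>)"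
  let ?h2 = "\<lambda>s \<omega>. (- drv s \<omega>) \<bullet> N s \<omega> + \<eta> s \<omega> \<bullet> (A s *v N s \<omega> + B s *v w s \<omega>) + \<zeta> s \<omega> \<bullet> (C s *v N s \<omega> + D s *v w s \<omega>)"
  define c where "c = running_cost Q S R q \<rho> u X"
  define c' where "c' = running_cost Q S R q \<rho> u' Y"
  define cq where "cq s \<omega> = (Q s *v N s \<omega>) \<bullet> N s \<omega> + 2 * ((S s *v N s \<omega>) \<bullet> w s \<omega>) + (R s *v w s \<omega>) \<bullet> w s \<omega>" for s \<omega>
  define cl where "cl s \<omega> = (Q s *v X s \<omega>) \<bullet> N s \<omega> + q s \<omega> \<bullet> N s \<omega> + (S s *v X s \<omega>) \<bullet> w s \<omega> + (S s *v N s \<omega>) \<bullet> u s \<omega>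
      + (R s *v u s \<omega>) \<bullet> w s \<omega> + \<rho> s \<omega> \<bullet> w s \<omega>" for s \<omega>
  have iQ: "integrable LM (\<lambda>z. (Q (fst z) *v U (fst z) (snd z)) \<bullet> V (fst z) (snd z))"
    if "U \<in> L2F_C M F a b" "V \<in> L2F_C M F a b" for U V :: "real \<Rightarrow> 'w \<Rightarrow> real^'n"
    using integrable_inner_L1_C[OF L2F_L1_Lp1[OF Q(1) that(1)] that(2)] by (simp add: split_beta')
  have iS: "integrable LM (\<lambda>z. (S (fst z) *v U (fst z) (snd z)) \<bullet> V (fst z) (snd z))"
    if "U \<in> L2F_C M F a b" "V \<in> L2F M F a b" for U and V :: "real \<Rightarrow> 'w \<Rightarrow> real^'m"
    using integrable_inner_L2[OF L2F_Lp2[OF S that(1)] that(2)] by (simp add: split_beta')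
  have iR: "integrable LM (\<lambda>z. (R (fst z) *v U (fst z) (snd z)) \<bullet> V (fst z) (snd z))"
    if "U \<in> L2F M F a b" "V \<in> L2F M F a b" for U V :: "real \<Rightarrow> 'w \<Rightarrow> real^'m"
    using integrable_inner_L2[OF L2F_Linf[OF R(1) that(1)] that(2)] by (simp add: split_beta')
  have iq: "integrable LM (\<lambda>z. q (fst z) (snd z) \<bullet> V (fst z) (snd z))" if "V \<in> L2F_C M F a b" for V
    using integrable_inner_L1_C[OF q that] by (simp add: split_beta')
  have ir: "integrable LM (\<lambda>z. \<rho> (fst z) (snd z) \<bullet> V (fst z) (snd z))" if "V \<in> L2F M F a b" for V
    using integrable_inner_L2[OF \<rho> that] by (simp add: split_beta')
  note ints = Bochner_Integration.integrable_add integrable_mult_right iQ iS iR iq ir X(1) Y(1) NC u(1) u' w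
  have ic: "integrable LM (case_prod c)" and ic': "integrable LM (case_prod c')"
    unfolding c_def c'_def by (rule player_cost_integrable(1)[OF Q(1) S R(1) q \<rho> g] X(1) u(1) Y(1) u')+
  have icq: "integrable LM (case_prod cq)" and icl: "integrable LM (case_prod cl)"
    unfolding cq_def cl_def split_beta' by (intro ints)+
  note sq = L2F_C_square[OF _ ab(2)]
  have iG: "integrable M (\<lambda>\<omega>. (G *v U b \<omega>) \<bullet> V b \<omega>)" if U: "U \<in> L2F_C M F a b" and V: "V \<in> L2F_C M F a b" for U V
  proof -
    have GU: "(\<lambda>s \<omega>. G *v U s \<omega>) \<in> L2F_C M F a b"
      by (rule L2F_C_linear[OF U matrix_vector_mul_bounded_linear])
    show ?thesis by (intro integrable_inner sq[OF GU] sq[OF V])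
  qed
  have ig: "integrable M (\<lambda>\<omega>. g \<omega> \<bullet> V b \<omega>)" if V: "V \<in> L2F_C M F a b" for V
    by (intro integrable_inner sq[OF V] g)
  let ?t = "\<lambda>X. terminal_cost G g (X b)"
  have it: "integrable M (?t V)" if V: "V \<in> L2F_C M F a b" for V
    by (rule player_cost_integrable(2)[OF Q(1) S R(1) q \<rho> g V u(1)])
  have costX: "player_cost G g Q S R q \<rho> u X = (LINT \<omega>|M. ?t X \<omega>) + (LINT z|LM. case_prod c z)"
    unfolding player_cost_def c_def[symmetric] using ic by (intro integral_path_plus(1) it[OF X(1)])
  have costY: "player_cost G g Q S R q \<rho> u' Y = (LINT \<omega>|M. ?t Y \<omega>) + (LINT z|LM. case_prod c' z)"
    unfolding player_cost_def c'_def[symmetric] using ic' by (intro integral_path_plus(1) it[OF Y(1)])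
  have conv: "0 \<le> (LINT \<omega>|M. (G *v N b \<omega>) \<bullet> N b \<omega>) + (LINT z|LM. case_prod cq z)"
    using convex[OF NC N0, folded w_def, OF Nd, folded cq_def] integral_path_plus(2)[OF _ iG[OF NC NC], of cq]
        icq by simp
  have run: "(LINT z|LM. case_prod c' z) = (LINT z|LM. case_prod c z) + (LINT z|LM. case_prod cq z)
       + 2 * (LINT z|LM. case_prod cl z)"
  proof -
    have "(LINT z|LM. case_prod c' z) = (LINT z|LM. case_prod c z + case_prod cq z + 2 * case_prod cl z)"
    proof (rule integral_cong_AE)
      have "AE s in L. transpose (Q s) = Q s \<and> transpose (R s) = R s" using Q(2) R(2) by eventually_elim simp
      from AE_pair_time[OF this]
      show "AE z in LM. case_prod c' z = case_prod c z + case_prod cq z + 2 * case_prod cl z"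
      proof eventually_elim
        case (elim z)
        then show ?case
          using running_cost_expansion[of "Q (fst z)" "R (fst z)" "X (fst z) (snd z)" "N (fst z) (snd z)" "S
              (fst z)" "u (fst z) (snd z)" "w (fst z) (snd z)"
            "q (fst z) (snd z)" "\<rho> (fst z) (snd z)"]
          by (simp add: split_beta' c_def c'_def running_cost_def cq_def cl_def N_def w_def)
      qed
    qed (use ic ic' icq icl in auto)
    then show ?thesis using ic icq icl by simp
  qed
  have ter: "(LINT \<omega>|M. ?t Y \<omega>) = (LINT \<omega>|M. ?t X \<omega>) + (LINT \<omega>|M. (G *v N b \<omega>) \<bullet> N b \<omega>) + 2 *
      (LINT \<omega>|M. (G *v X b \<omega>) \<bullet> N b \<omega> + g \<omega> \<bullet> N b \<omega>)"
  proof -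
    have "?t Y \<omega> = ?t X \<omega> + (G *v N b \<omega>) \<bullet> N b \<omega> + 2 * ((G *v X b \<omega>) \<bullet> N b \<omega> + g \<omega> \<bullet> N b \<omega>)" for \<omega>
      using terminal_cost_expansion[OF G, of "X b \<omega>" "N b \<omega>" "g \<omega>"] by (simp add: N_def terminal_cost_def)
    then have "(LINT \<omega>|M. ?t Y \<omega>) = (LINT \<omega>|M. ?t X \<omega> + (G *v N b \<omega>) \<bullet> N b \<omega> + 2 * ((G *v X b \<omega>) \<bullet> N b \<omega> + g \<omega>
        \<bullet> N b \<omega>))"
      by presburger
    also have "\<dots> = (LINT \<omega>|M. ?t X \<omega>) + (LINT \<omega>|M. (G *v N b \<omega>) \<bullet> N b \<omega>) +
        (LINT \<omega>|M. 2 * ((G *v X b \<omega>) \<bullet> N b \<omega> + g \<omega> \<bullet> N b \<omega>))"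
      by (subst Bochner_Integration.integral_add Bochner_Integration.integral_add;
          (intro Bochner_Integration.integrable_add integrable_mult_right it[OF X(1)] iG ig X(1) NC)?)+ (rule refl)
    finally show ?thesis by (simp only: integral_mult_right_zero)
  qed
  have lin: "(LINT \<omega>|M. (G *v X b \<omega>) \<bullet> N b \<omega> + g \<omega> \<bullet> N b \<omega>) + (LINT z|LM. case_prod cl z) = 0"
  proof -
    have 1: "(LINT \<omega>|M. (G *v X b \<omega>) \<bullet> N b \<omega>) = (LINT z|LM. case_prod ?h1 z)"
    proof -
      have "(LINT \<omega>|M. (P a *v X a \<omega>) \<bullet> N a \<omega>) = 0"
        by (rule integral_eq_zero_AE) (use N0 in eventually_elim, simp)
      then show ?thesis using be(2) unfolding P(3) by simp
    qed
    have 2: "(LINT \<omega>|M. g \<omega> \<bullet> N b \<omega>) = (LINT z|LM. case_prod ?h2 z)"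
    proof -
      have "(LINT \<omega>|M. \<eta> a \<omega> \<bullet> N a \<omega>) = 0"
        by (rule integral_eq_zero_AE) (use N0 in eventually_elim, simp)
      moreover have "(LINT \<omega>|M. g \<omega> \<bullet> N b \<omega>) = (LINT \<omega>|M. \<eta> b \<omega> \<bullet> N b \<omega>)"
      proof (rule integral_cong_AE)
        show "AE \<omega> in M. g \<omega> \<bullet> N b \<omega> = \<eta> b \<omega> \<bullet> N b \<omega>" using \<eta>(2) by eventually_elim simp
      qed (use g(1) sq(1)[OF NC] sq(1)[OF \<eta>(1)] in measurable)
      moreover have "(LINT r:{a..b}|lborel. (LINT \<omega>|M. ?h2 r \<omega>)) = (LINT z|LM. case_prod ?h2 z)"
        using time_expectation(5,6)[OF ie(1)] by (simp add: set_lebesgue_integral_leb_on)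
      ultimately show ?thesis using ie(3)[OF ab(2)] by simp
    qed
    have "(LINT \<omega>|M. (G *v X b \<omega>) \<bullet> N b \<omega> + g \<omega> \<bullet> N b \<omega>) + (LINT z|LM. case_prod cl z)
       = (LINT z|LM. case_prod ?h1 z + case_prod ?h2 z + case_prod cl z)"
      using 1 2 be(1) ie(1) icl iG[OF X(1) NC] ig[OF NC] by simp
    also have "\<dots> = 0"
    proof (rule integral_eq_zero_AE)
      show "AE z in LM. case_prod ?h1 z + case_prod ?h2 z + case_prod cl z = 0"
        using AE_pair_time[OF stationary] AE_space
      proof eventually_elim
        case (elim z)
        obtain s \<omega> where z: "z = (s, \<omega>)" "\<omega> \<in> space M" using elim(2) by (cases z) (auto simp: space_pair_measure)
        have "?h1 s \<omega> + ?h2 s \<omega> + cl s \<omega> = (transpose (B s) *v (P s *v X s \<omega> + \<eta> s \<omega>)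
          + transpose (D s) *v (P s *v (C s *v X s \<omega> + D s *v u s \<omega> + \<sigma> s \<omega>) + \<zeta> s \<omega>)
          + S s *v X s \<omega> + R s *v u s \<omega> + \<rho> s \<omega>) \<bullet> w s \<omega>"
          unfolding cl_def by (rule adjoint_identity[OF Lf P' u(2) drv])
        also have "\<dots> = 0" using elim(1) z by (simp add: w_def)
        finally show ?case by (simp add: z)
      qed
    qed
    finally show ?thesis .
  qed
  show ?thesis unfolding costX costY run ter using conv lin by linarith
qed

end

section \<open>Block matrices\<close>

lemma sum_UNIV_Plus:
  "(\<Sum>i\<in>(UNIV :: ('p::finite + 'q::finite) set). f i) = (\<Sum>i\<in>UNIV. f (Inl i)) + (\<Sum>i\<in>UNIV. f (Inr i))"
  unfolding UNIV_Plus_UNIV[symmetric] by (subst sum.Plus) simp_all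

lemma upper_vstack [simp]: "upper (vstack x y) = x" and lower_vstack [simp]: "lower (vstack x y) = y"
  by (simp_all add: upper_def lower_def vstack_def vec_eq_iff)

lemma vstack_upper_lower [simp]: "vstack (upper x) (lower x) = x"
  by (auto simp: upper_def lower_def vstack_def vec_eq_iff split: sum.split)

lemma upper_component [simp]: "upper x $ i = x $ Inl i" and lower_component [simp]: "lower x $ j = x $ Inr j"
  by (simp_all add: upper_def lower_def)

lemma upper_add: "upper (x + y) = upper x + upper y" and lower_add: "lower (x + y) = lower x + lower y"
  and upper_minus: "upper (- x) = - upper x" and lower_minus: "lower (- x) = - lower x"
  for x y :: "('e::ab_group_add)^('p::finite + 'q::finite)"
  by (simp_all add: vec_eq_iff)

lemma upper_mult_vector: "upper (A *v x) = upper A *v x" and lower_mult_vector: "lower (A *v x) = lower A *v x"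
  and upper_mult_matrix: "upper (A ** B) = upper A ** B" and lower_mult_matrix: "lower (A ** B) = lower A ** B"
  for A :: "real^'n::finite^('p::finite + 'q::finite)" and B :: "real^'k::finite^'n"
  by (simp_all add: vec_eq_iff matrix_vector_mult_def matrix_matrix_mult_def)

lemma block_diag_component:
  "block_diag A B $ Inl i $ Inl j = A $ i $ j" "block_diag A B $ Inl i $ Inr l = 0"
  "block_diag A B $ Inr k $ Inl j = 0" "block_diag A B $ Inr k $ Inr l = B $ k $ l"
  by (simp_all add: block_diag_def vstack_def)

lemma transpose_block_diag: "transpose (block_diag A B) = block_diag (transpose A) (transpose B)"
proof -
  have "transpose (block_diag A B) $ i $ j = block_diag (transpose A) (transpose B) $ i $ j" for i j
    by (cases i; cases j) (simp_all add: transpose_def block_diag_component)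
  then show ?thesis by (simp add: vec_eq_iff)
qed

lemma upper_block_diag_vector: "upper (block_diag A B) *v x = A *v upper x"
  and lower_block_diag_vector: "lower (block_diag A B) *v x = B *v lower x"
  by (simp_all add: vec_eq_iff matrix_vector_mult_def sum_UNIV_Plus block_diag_component)

lemma upper_block_diag_matrix: "upper (block_diag A B) ** X = A ** upper X"
  and lower_block_diag_matrix: "lower (block_diag A B) ** X = B ** lower X"
  by (simp_all add: vec_eq_iff matrix_matrix_mult_def sum_UNIV_Plus block_diag_component)

lemma upper_II [simp]: "upper II = mat 1" and lower_II [simp]: "lower II = mat 1"
  by (simp_all add: II_def)

lemma upper_block_diag: "upper (block_diag A B ** II) = A" and lower_block_diag: "lower (block_diag A B ** II) = B"
  by (simp_all add: upper_mult_matrix lower_mult_matrix upper_block_diag_matrix lower_block_diag_matrix)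

text \<open>\<open>J\<^sup>T\<close> selects from the residuals of both players the components that belong to the respective own control.\<close>

lemma transpose_JJ_vector:
  fixes h :: "real^(('m1::finite + 'm2::finite) + ('m1 + 'm2))"
  shows "transpose JJ *v h = vstack (upper (upper h)) (lower (lower h))"
proof -
  have J: "(JJ :: real^('m1 + 'm2)^_) $ Inl (Inl i) $ Inl j = (if i = j then 1 else 0)"
    "JJ $ Inl (Inl i) $ Inr l = 0" "JJ $ Inl (Inr k) $ c = 0"
    "JJ $ Inr (Inl i) $ c = 0" "JJ $ Inr (Inr k) $ Inl j = 0" "JJ $ Inr (Inr k) $ Inr l = (if k = l then 1 else 0)"
    for i j :: 'm1 and k l :: 'm2 and c
    by (cases c; simp add: JJ_def vstack_def block_diag_def mat_def)+
  have "(transpose JJ *v h) $ i = vstack (upper (upper h)) (lower (lower h)) $ i" for i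
    by (cases i)
      (simp_all add: matrix_vector_mult_def transpose_def sum_UNIV_Plus J vstack_def if_distrib[of "\<lambda>x. x * _"]
          cong: if_cong)
  then show ?thesis by (simp add: vec_eq_iff)
qed

lemma inner_vstack: "(x :: real^('p::finite + 'q::finite)) \<bullet> vstack y z = upper x \<bullet> y + lower x \<bullet> z"
  by (simp add: inner_vec_def sum_UNIV_Plus vstack_def)

lemma left_cols_vector: "left_cols A *v y = A *v vstack y 0"
  and right_cols_vector: "right_cols A *v z = A *v vstack 0 z"
  for A :: "real^('p::finite + 'q::finite)^'r::finite"
  by (simp_all add: vec_eq_iff matrix_vector_mult_def left_cols_def right_cols_def sum_UNIV_Plus vstack_def)

lemma bounded_linear_upper: "bounded_linear (upper :: ('e::euclidean_space)^('p::finite + 'q::finite) \<Rightarrow> _)"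
  and bounded_linear_lower: "bounded_linear (lower :: 'e^('p + 'q) \<Rightarrow> _)"
  and bounded_linear_vstack_left: "bounded_linear (\<lambda>x :: real^'p. vstack x (0 :: real^'q))"
  and bounded_linear_vstack_right: "bounded_linear (\<lambda>y :: real^'q. vstack (0 :: real^'p) y)"
  unfolding linear_conv_bounded_linear[symmetric]
  by (auto simp: linear_iff vec_eq_iff vstack_def split: sum.split)

lemma vstack_split: "vstack x y = vstack x 0 + vstack 0 (y :: real^'q::finite)" for x :: "real^'p::finite"
  by (auto simp: vec_eq_iff vstack_def split: sum.split)

section \<open>The stationarity condition\<close>

text \<open>In this form the driver contains the inverse weight only through \<open>v\<close>, whose square-integrability is known;
  hence the driver inherits its integrability from the coefficients.\<close>

lemma bsde_driver_eq:
  "bsde_driver \<G> P \<eta> \<zeta> s \<omega> = transpose (AA \<G> s) *v \<eta> s \<omega> + transpose (CC \<G> s) *v \<zeta> s \<omega>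
     + transpose (CC \<G> s) *v (P s *v sigc \<G> s \<omega>) + P s *v bc \<G> s \<omega> + qq \<G> s \<omega> + left_factor \<G> P s *v vff \<G> P \<eta> \<zeta> s \<omega>"
proof -
  have "left_factor \<G> P s *v vff \<G> P \<eta> \<zeta> s \<omega> = - ((KK \<G> P s ** transpose JJ) *v
     (transpose (BB \<G> s) *v \<eta> s \<omega> + transpose (DD \<G> s) *v \<zeta> s \<omega>
      + transpose (DD \<G> s) *v (P s *v sigc \<G> s \<omega>) + rr \<G> s \<omega>))"
    by (simp add: vff_def KK_def matrix_vector_mul_assoc[symmetric]
        bounded_bilinear.minus_right[OF bounded_bilinear_matrix_vector])
  then show ?thesis
    by (simp add: bsde_driver_def Let_def bounded_bilinear.diff_left[OF bounded_bilinear_matrix_vector]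
        matrix_vector_right_distrib matrix_vector_mul_assoc[symmetric])
qed

lemma matrix_mult_minus_right: "A ** (- B) = - (A ** B)" for A :: "real^'a::finite^'b::finite" and B ::
    "real^'c::finite^'a"
  by (simp add: vec_eq_iff matrix_matrix_mult_def sum_negf)

text \<open>Applied to \<open>X\<close>, the quadratic term of the Riccati equation is the left factor times \<open>\<Theta> X\<close>; together with
  the corresponding term of the driver it becomes the left factor times the control \<open>u = \<Theta> X + v\<close>.\<close>

lemma riccati_rhs_eq:
  "riccati_rhs \<G> P s = P s ** Ac \<G> s + transpose (AA \<G> s) ** P s + transpose (CC \<G> s) ** P s ** Cc \<G> s + QQ \<G> s ** II
     + left_factor \<G> P s ** Theta \<G> P s"
  by (simp add: riccati_rhs_def Theta_def matrix_mul_assoc matrix_mult_minus_right)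

text \<open>The weight matrix collects all terms of \<open>J\<^sup>T H\<close> in which \<open>u\<close> occurs, so \<open>J\<^sup>T H = 0\<close> is a linear equation
  for \<open>u\<close> with this matrix, and the feedback is its solution.\<close>

lemma stationarity:
  assumes inv: "invertible (weight \<G> P s)"
    and u: "u = Theta \<G> P s *v X + vff \<G> P \<eta> \<zeta> s \<omega>"
  shows "transpose JJ *v (transpose (BB \<G> s) *v (P s *v X + \<eta> s \<omega>)
     + transpose (DD \<G> s) *v (P s *v (Cc \<G> s *v X + Dc \<G> s *v u + sigc \<G> s \<omega>) + \<zeta> s \<omega>)
     + SS \<G> s *v (II *v X) + RR \<G> s *v (II *v u) + rr \<G> s \<omega>) = 0"
proof -
  let ?W = "weight \<G> P s"
  let ?y = "transpose JJ *v (transpose (BB \<G> s) *v \<eta> s \<omega> + transpose (DD \<G> s) *v \<zeta> s \<omega>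
      + transpose (DD \<G> s) *v (P s *v sigc \<G> s \<omega>) + rr \<G> s \<omega>)"
  have Wi: "?W *v (matrix_inv ?W *v z) = z" for z
    using someI_ex[OF inv[unfolded invertible_def]] by (simp add: matrix_inv_def matrix_vector_mul_assoc)
  have "u = - (matrix_inv ?W *v (right_factor \<G> P s *v X + ?y))"
    unfolding u Theta_def vff_def
    by (simp add: bounded_bilinear.minus_left[OF bounded_bilinear_matrix_vector] matrix_vector_right_distrib
        matrix_vector_mul_assoc)
  then have "?W *v u = - (right_factor \<G> P s *v X + ?y)"
    using Wi by (simp add: bounded_bilinear.minus_right[OF bounded_bilinear_matrix_vector])
  then have "right_factor \<G> P s *v X + ?y + ?W *v u = 0" by simp
  moreover have "right_factor \<G> P s *v X = transpose JJ *v (transpose (BB \<G> s) *v (P s *v X) + transpose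
      (DD \<G> s) *v (P s *v (Cc \<G> s *v X)) + SS \<G> s *v (II *v X))"
    unfolding right_factor_def
    by (simp add: matrix_vector_mul_assoc[symmetric] matrix_vector_mult_add_rdistrib)
  moreover have "?W *v u = transpose JJ *v (RR \<G> s *v (II *v u) + transpose (DD \<G> s) *v (P s *v (Dc \<G> s *v u)))"
    unfolding weight_def
    by (simp add: matrix_vector_mul_assoc[symmetric] matrix_vector_mult_add_rdistrib)
  ultimately show ?thesis by (simp add: matrix_vector_right_distrib algebra_simps)
qed

section \<open>Restriction to a later starting time\<close>

lemma Lp_later: "k \<in> Lp p a b \<Longrightarrow> a \<le> t \<Longrightarrow> k \<in> Lp p t b"
  unfolding Lp_def
  by (auto simp: set_borel_measurable_leb_on intro: measurable_leb_on_mono set_integrable_subset[of lborel "{a..b}"])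

lemma Linf_later: "k \<in> Linf a b \<Longrightarrow> a \<le> t \<Longrightarrow> k \<in> Linf t b"
  unfolding Linf_def
  by (auto simp: set_borel_measurable_leb_on intro: measurable_leb_on_mono elim!: eventually_mono)

lemma prog_measurable_later:
  assumes "prog_measurable F a b \<phi>" "a \<le> t"
  shows "prog_measurable F t b \<phi>"
  unfolding prog_measurable_def
proof
  fix s assume s: "s \<in> {t..b}"
  have 1: "(\<lambda>(r, \<omega>). \<phi> r \<omega>) \<in> borel_measurable (restrict_space borel {a..s} \<Otimes>\<^sub>M F s)"
    using assms s unfolding prog_measurable_def by auto
  have 2: "(\<lambda>z. z) \<in> measurable (restrict_space borel {t..s} \<Otimes>\<^sub>M F s) (restrict_space borel {a..s} \<Otimes>\<^sub>M F s)"
  proof (rule measurable_pair)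
    have "(\<lambda>x. x) \<in> measurable (restrict_space borel {t..s}) (restrict_space borel {a..s})"
      using assms(2) by (intro measurable_restrict_space3) auto
    from measurable_compose[OF measurable_fst this]
    show "fst \<circ> (\<lambda>z. z) \<in> measurable (restrict_space borel {t..s} \<Otimes>\<^sub>M F s) (restrict_space borel {a..s})"
      by (simp add: comp_def)
  qed (simp add: comp_def)
  show "(\<lambda>(r, \<omega>). \<phi> r \<omega>) \<in> borel_measurable (restrict_space borel {t..s} \<Otimes>\<^sub>M F s)"
    using measurable_compose[OF 2 1] by simp
qed

lemma L2F_later:
  assumes "\<phi> \<in> L2F M F a b" "a \<le> t"
  shows "\<phi> \<in> L2F M F t b"
proof -
  have "(\<integral>\<^sup>+\<omega>. (\<integral>\<^sup>+s\<in>{t..b}. ennreal ((norm (\<phi> s \<omega>))\<^sup>2) \<partial>lborel) \<partial>M) \<le>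
      (\<integral>\<^sup>+\<omega>. (\<integral>\<^sup>+s\<in>{a..b}. ennreal ((norm (\<phi> s \<omega>))\<^sup>2) \<partial>lborel) \<partial>M)"
    by (intro nn_integral_mono nn_set_integral_set_mono) (use assms(2) in auto)
  with assms show ?thesis unfolding L2F_def using prog_measurable_later by (auto intro: le_less_trans)
qed

lemma L2F_L1_later:
  assumes "\<phi> \<in> L2F_L1 M F a b" "a \<le> t"
  shows "\<phi> \<in> L2F_L1 M F t b"
proof -
  have "(\<integral>\<^sup>+\<omega>. (\<integral>\<^sup>+s\<in>{t..b}. ennreal (norm (\<phi> s \<omega>)) \<partial>lborel)\<^sup>2 \<partial>M) \<le>
      (\<integral>\<^sup>+\<omega>. (\<integral>\<^sup>+s\<in>{a..b}. ennreal (norm (\<phi> s \<omega>)) \<partial>lborel)\<^sup>2 \<partial>M)"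
    by (intro nn_integral_mono power_mono nn_set_integral_set_mono) (use assms(2) in auto)
  with assms show ?thesis unfolding L2F_L1_def using prog_measurable_later by (auto intro: le_less_trans)
qed

text \<open>The Riccati equation is integrated backwards from its terminal value.\<close>

lemma primitive_on_backward:
  fixes f R :: "real \<Rightarrow> real"
  assumes "a \<le> b" and R: "set_integrable lborel {a..b} R" and f: "\<And>s. s \<in> {a..b} \<Longrightarrow> f s = c +
      (LINT r:{s..b}|lborel. R r)"
  shows "primitive_on a b f (\<lambda>s. - R s)" "f b = c"
proof -
  have split: "(LINT r:{a..b}|lborel. R r) = (LINT r:{a..s}|lborel. R r) + (LINT r:{s..b}|lborel. R r)" if s:
      "s \<in> {a..b}" for s
  proof -
    have "AE r in lborel. \<not> (r \<in> {a..s} \<and> r \<in> {s..b})"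
      using AE_lborel_singleton[of s] by eventually_elim auto
    moreover have "{a..b} = {a..s} \<union> {s..b}" using s by auto
    moreover have "set_integrable lborel {a..s} R" "set_integrable lborel {s..b} R"
      by (rule set_integrable_subset[OF R]; use s in auto)+
    ultimately show ?thesis by (simp add: set_integral_Un_AE)
  qed
  show "primitive_on a b f (\<lambda>s. - R s)"
    unfolding primitive_on_def
  proof (intro conjI ballI)
    show "set_integrable lborel {a..b} (\<lambda>s. - R s)" using R by (simp add: set_integrable_def)
    fix s assume s: "s \<in> {a..b}"
    have "(LINT r:{a..s}|lborel. - R r) = - (LINT r:{a..s}|lborel. R r)" by (simp add: set_lebesgue_integral_def)
    then show "f s = f a + (LINT r:{a..s}|lborel. - R r)"
      using f[OF s] f[of a] split[OF s] \<open>a \<le> b\<close> by simp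
  qed
  have "set_integrable lborel {b} R" by (rule set_integrable_subset[OF R]) (use \<open>a \<le> b\<close> in auto)
  from set_integral_at_point[OF this] show "f b = c" using f[of b] \<open>a \<le> b\<close> by simp
qed

section \<open>The equilibrium\<close>

theorem theorem7p1:
  fixes M :: "'w measure"
    and F :: "real \<Rightarrow> 'w measure"
    and W :: "real \<Rightarrow> 'w \<Rightarrow> real"
    and T t :: real
    and \<G> :: "('w, 'n::finite, 'm1::finite, 'm2::finite) game"
    and P :: "real \<Rightarrow> real^'n^('n + 'n)"
    and \<eta> \<zeta> :: "real \<Rightarrow> 'w \<Rightarrow> real^('n + 'n)"
    and \<Theta> :: "real \<Rightarrow> real^'n^('m1 + 'm2)"
    and v u :: "real \<Rightarrow> 'w \<Rightarrow> real^('m1 + 'm2)"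
    and X :: "real \<Rightarrow> 'w \<Rightarrow> real^'n"
    and x :: "real^'n"
  assumes "prob_space M" and "complete_measure M"
    and "F = aug_filtration M W" and "brownian_motion M F W"
    and "0 < T" and "0 \<le> t" and "t < T"
    and "game_integrability M F T \<G>"
    and convex1: "convexity_condition M F W t T
          (Ac \<G>) (\<lambda>s. left_cols (Bc \<G> s)) (Cc \<G>) (\<lambda>s. left_cols (Dc \<G> s))
          (Qc \<G> P1) (\<lambda>s. upper (Sc \<G> P1 s)) (\<lambda>s. left_cols (upper (Rc \<G> P1 s))) (Gc \<G> P1)"
    and convex2: "convexity_condition M F W t T
          (Ac \<G>) (\<lambda>s. right_cols (Bc \<G> s)) (Cc \<G>) (\<lambda>s. right_cols (Dc \<G> s))
          (Qc \<G> P2) (\<lambda>s. lower (Sc \<G> P2 s)) (\<lambda>s. right_cols (lower (Rc \<G> P2 s))) (Gc \<G> P2)"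
    and "riccati_solution \<G> t T P"
    and "bsde_solution M F W t T \<G> P \<eta> \<zeta>"
    and "\<Theta> = Theta \<G> P" and "\<Theta> \<in> Lp 2 t T"
    and "v = vff \<G> P \<eta> \<zeta>" and "v \<in> L2F M F t T"
    and "X \<in> L2F_C M F t T" and "AE \<omega> in M. X t \<omega> = x"
    and "has_ito_differential M F W t T X
          (\<lambda>s \<omega>. (Ac \<G> s + Bc \<G> s ** \<Theta> s) *v X s \<omega> + Bc \<G> s *v v s \<omega> + bc \<G> s \<omega>)
          (\<lambda>s \<omega>. (Cc \<G> s + Dc \<G> s ** \<Theta> s) *v X s \<omega> + Dc \<G> s *v v s \<omega> + sigc \<G> s \<omega>)"
    and "u = (\<lambda>s \<omega>. \<Theta> s *v X s \<omega> + v s \<omega>)"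
  shows "open_loop_nash M F W T \<G> t x (\<lambda>s \<omega>. upper (u s \<omega>)) (\<lambda>s \<omega>. lower (u s \<omega>))"
proof -
  let ?u1 = "\<lambda>s \<omega>. upper (u s \<omega>)" and ?u2 = "\<lambda>s \<omega>. lower (u s \<omega>)"
  interpret prob_space M by fact
  interpret brownian_space M F W t T
    using assms(3,4,6,7) by unfold_locales auto
  note gi = \<open>game_integrability M F T \<G>\<close>[unfolded game_integrability_def]
  have A: "Ac \<G> \<in> Lp 1 t T" and B: "Bc \<G> \<in> Lp 2 t T" and C: "Cc \<G> \<in> Lp 2 t T" and Q: "\<And>i. Qc \<G> i \<in> Lp 1 t T"
      and S: "\<And>i. Sc \<G> i \<in> Lp 2 t T"
    using gi \<open>0 \<le> t\<close> by (auto intro: Lp_later)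
  have D: "Dc \<G> \<in> Linf t T" and R: "\<And>i. Rc \<G> i \<in> Linf t T"
    using gi \<open>0 \<le> t\<close> by (auto intro: Linf_later)
  have bb: "bc \<G> \<in> L2F_L1 M F t T" and q: "\<And>i. qc \<G> i \<in> L2F_L1 M F t T"
    using gi \<open>0 \<le> t\<close> by (auto intro: L2F_L1_later)
  have \<sigma>: "sigc \<G> \<in> L2F M F t T" and \<rho>: "\<And>i. rhoc \<G> i \<in> L2F M F t T"
    using gi \<open>0 \<le> t\<close> by (auto intro: L2F_later)
  have Qs: "AE s in L. transpose (Qc \<G> i s) = Qc \<G> i s" and Rs: "AE s in L. transpose (Rc \<G> i s) = Rc \<G> i s" for i
  proof -
    have "AE s in lborel. s \<in> {0..T} \<longrightarrow> transpose (Qc \<G> i s) = Qc \<G> i s" "AE s in lborel. s \<in> {0..T} \<longrightarrow> transpose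
        (Rc \<G> i s) = Rc \<G> i s"
      using gi by blast+
    then show "AE s in L. transpose (Qc \<G> i s) = Qc \<G> i s" "AE s in L. transpose (Rc \<G> i s) = Rc \<G> i s"
      unfolding AE_leb_on using \<open>0 \<le> t\<close> by (eventually_elim, auto)+
  qed
  have g: "gc \<G> i \<in> borel_measurable M" "integrable M (\<lambda>\<omega>. (norm (gc \<G> i \<omega>))\<^sup>2)" and G: "transpose (Gc \<G> i) =
      Gc \<G> i" for i
  proof -
    have "gc \<G> i \<in> L2_FT M (F T)" "transpose (Gc \<G> i) = Gc \<G> i" using gi by blast+
    then show "gc \<G> i \<in> borel_measurable M" "integrable M (\<lambda>\<omega>. (norm (gc \<G> i \<omega>))\<^sup>2)" "transpose (Gc \<G> i) = Gc \<G> i"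
      unfolding L2_FT_def by (auto intro: measurable_F_M)
  qed
  note ric = \<open>riccati_solution \<G> t T P\<close>[unfolded riccati_solution_def]
  have Pcont: "continuous_on {t..T} P" using ric by blast
  have inv: "AE s in L. invertible (weight \<G> P s)" using ric unfolding AE_leb_on by blast
  have Pprim: "primitive_on t T (\<lambda>s. P s $ i $ j) (\<lambda>s. - (riccati_rhs \<G> P s $ i $ j))"
    and PT_ij: "P T $ i $ j = (GG \<G> ** II) $ i $ j" for i j
  proof -
    have bl: "bounded_linear (\<lambda>Z :: real^'n^('n + 'n). Z $ i $ j)"
      by (rule bounded_linear_compose[OF bounded_linear_vec_nth bounded_linear_vec_nth])
    have lin: "set_integrable lborel E (\<lambda>s. f s $ i $ j) \<and> (LINT r:E|lborel. f r $ i $ j) =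
        (LINT r:E|lborel. f r) $ i $ j"
      if "set_integrable lborel E f" for E and f :: "real \<Rightarrow> real^'n^('n + 'n)"
      using integrable_bounded_linear[OF bl that[unfolded set_integrable_def]]
        integral_bounded_linear[OF bl that[unfolded set_integrable_def]]
      by (simp add: set_integrable_def set_lebesgue_integral_def)
    have rhs: "set_integrable lborel {t..T} (riccati_rhs \<G> P)" using ric by blast
    have rhs': "set_integrable lborel {t..T} (\<lambda>s. riccati_rhs \<G> P s $ i $ j)" using lin[OF rhs] by blast
    have eq: "P s $ i $ j = (GG \<G> ** II) $ i $ j + (LINT r:{s..T}|lborel. riccati_rhs \<G> P r $ i $ j)" if s: "s
        \<in> {t..T}" for s
    proof -
      have "set_integrable lborel {s..T} (riccati_rhs \<G> P)" by (rule set_integrable_subset[OF rhs]) (use s in auto)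
      moreover have "P s = GG \<G> ** II + (LINT r:{s..T}|lborel. riccati_rhs \<G> P r)" using ric s by blast
      ultimately show ?thesis using lin[of "{s..T}" "riccati_rhs \<G> P"] by simp
    qed
    from primitive_on_backward[OF a_le_b rhs' eq]
    show "primitive_on t T (\<lambda>s. P s $ i $ j) (\<lambda>s. - (riccati_rhs \<G> P s $ i $ j))" "P T $ i $ j = (GG \<G> ** II) $ i $ j"
      by auto
  qed
  have PT: "P T = GG \<G> ** II" by (simp add: vec_eq_iff PT_ij)
  note bs = \<open>bsde_solution M F W t T \<G> P \<eta> \<zeta>\<close>[unfolded bsde_solution_def]
  have \<eta>: "\<eta> \<in> L2F_C M F t T" and \<zeta>: "\<zeta> \<in> L2F M F t T" and \<eta>T: "AE \<omega> in M. \<eta> T \<omega> = gg \<G> \<omega>"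
    and bsde: "has_ito_differential M F W t T \<eta> (\<lambda>s \<omega>. - bsde_driver \<G> P \<eta> \<zeta> s \<omega>) \<zeta>"
    using bs by blast+
  have XC: "X \<in> L2F_C M F t T" and v: "v \<in> L2F M F t T" by fact+
  have ueq: "u s \<omega> = \<Theta> s *v X s \<omega> + v s \<omega>" for s \<omega> using assms by simp
  have u: "u \<in> L2F M F t T"
    unfolding \<open>u = _\<close> by (intro L2F_add L2F_Lp2 XC v) fact
  have Xd: "has_ito_differential M F W t T X (\<lambda>s \<omega>. Ac \<G> s *v X s \<omega> + Bc \<G> s *v u s \<omega> + bc \<G> s \<omega>)
      (\<lambda>s \<omega>. Cc \<G> s *v X s \<omega> + Dc \<G> s *v u s \<omega> + sigc \<G> s \<omega>)"
  proof -
    have "(E + K ** \<Theta> s) *v X s \<omega> + K *v v s \<omega> = E *v X s \<omega> + K *v u s \<omega>" for E :: "real^'n^'n" and K s \<omega>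
      by (simp add: ueq matrix_vector_right_distrib matrix_vector_mult_add_rdistrib matrix_vector_mul_assoc)
    with assms(19) show ?thesis by simp
  qed
  have uL: "?u1 \<in> L2F M F t T" and lL: "?u2 \<in> L2F M F t T"
    by (rule L2F_linear[OF u bounded_linear_upper], rule L2F_linear[OF u bounded_linear_lower])
  have ju: "joint ?u1 ?u2 = u" by (simp add: joint_def)
  have jointL: "joint u1 u2 \<in> L2F M F t T"
    if "u1 \<in> L2F M F t T" "u2 \<in> L2F M F t T" for u1 :: "real \<Rightarrow> 'w \<Rightarrow> real^'m1" and u2 :: "real \<Rightarrow> 'w \<Rightarrow> real^'m2"
    unfolding joint_def by (subst vstack_split)
      (intro L2F_add L2F_linear[OF that(1) bounded_linear_vstack_left]
          L2F_linear[OF that(2) bounded_linear_vstack_right])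
  have Xstate: "is_state M F W T \<G> t x u X"
    unfolding is_state_def using XC \<open>AE \<omega> in M. X t \<omega> = x\<close> Xd by blast
  let ?J = "\<lambda>i. player_cost (Gc \<G> i) (gc \<G> i) (Qc \<G> i) (Sc \<G> i) (Rc \<G> i) (qc \<G> i) (rhoc \<G> i)"
  have cost_eq: "cost M T \<G> i t = ?J i" for i
    by (simp add: fun_eq_iff cost_def player_cost_def terminal_cost_def running_cost_def)
  \<comment> \<open>the equilibrium condition concerns every version of the state process\<close>
  have version: "cost M T \<G> i t u X' = cost M T \<G> i t u X" if X': "is_state M F W T \<G> t x u X'" for X' i
  proof -
    have X'C: "X' \<in> L2F_C M F t T" and X'x: "AE \<omega> in M. X' t \<omega> = x"
      and X'd: "has_ito_differential M F W t T X' (\<lambda>s \<omega>. Ac \<G> s *v X' s \<omega> + Bc \<G> s *v u s \<omega> + bc \<G> s \<omega>)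
      (\<lambda>s \<omega>. Cc \<G> s *v X' s \<omega> + Dc \<G> s *v u s \<omega> + sigc \<G> s \<omega>)"
      using X' unfolding is_state_def by blast+
    have "AE \<omega> in M. \<forall>s\<in>{t..T}. X' s \<omega> - X s \<omega> = 0"
    proof (rule linear_sde_unique[OF L2F_C_diff[OF X'C XC] A C])
      show "AE \<omega> in M. X' t \<omega> - X t \<omega> = 0" using X'x \<open>AE \<omega> in M. X t \<omega> = x\<close> by eventually_elim simp
      show "has_ito_differential M F W t T (\<lambda>s \<omega>. X' s \<omega> - X s \<omega>) (\<lambda>s \<omega>. Ac \<G> s *v (X' s \<omega> - X s \<omega>))
          (\<lambda>s \<omega>. Cc \<G> s *v (X' s \<omega> - X s \<omega>))"
        using has_ito_differential_diff[OF X'd Xd] by (simp add: matrix_vector_mult_diff_distrib)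
    qed
    then have "AE \<omega> in M. \<forall>s\<in>{t..T}. X' s \<omega> = X s \<omega>" by eventually_elim simp
    then show ?thesis unfolding cost_eq by (rule player_cost_cong[OF Q S R q \<rho> g XC X'C u])
  qed
  define H where "H s \<omega> = transpose (BB \<G> s) *v (P s *v X s \<omega> + \<eta> s \<omega>)
     + transpose (DD \<G> s) *v (P s *v (Cc \<G> s *v X s \<omega> + Dc \<G> s *v u s \<omega> + sigc \<G> s \<omega>) + \<zeta> s \<omega>)
     + SS \<G> s *v (II *v X s \<omega>) + RR \<G> s *v (II *v u s \<omega>) + rr \<G> s \<omega>" for s \<omega>
  have Hzero: "AE s in L. \<forall>\<omega>. upper (upper (H s \<omega>)) = 0 \<and> lower (lower (H s \<omega>)) = 0"
    using inv
  proof eventually_elim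
    case (elim s)
    have "vstack (upper (upper (H s \<omega>))) (lower (lower (H s \<omega>))) = 0" for \<omega>
      unfolding transpose_JJ_vector[symmetric] H_def
      by (rule stationarity[OF elim]) (use ueq assms(13,15) in simp)
    from arg_cong[OF this, of upper] arg_cong[OF this, of lower] show ?case
      by (simp add: vec_eq_iff)
  qed
  note blocks = AA_def BB_def CC_def DD_def QQ_def SS_def RR_def transpose_block_diag
  have H1: "upper (H s \<omega>) = transpose (Bc \<G> s) *v (upper (P s) *v X s \<omega> + upper (\<eta> s \<omega>))
        + transpose (Dc \<G> s) *v (upper (P s) *v (Cc \<G> s *v X s \<omega> + Dc \<G> s *v u s \<omega> + sigc \<G> s \<omega>) + upper (\<zeta> s \<omega>))
        + Sc \<G> P1 s *v X s \<omega> + Rc \<G> P1 s *v u s \<omega> + rhoc \<G> P1 s \<omega>"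
    and H2: "lower (H s \<omega>) = transpose (Bc \<G> s) *v (lower (P s) *v X s \<omega> + lower (\<eta> s \<omega>))
        + transpose (Dc \<G> s) *v (lower (P s) *v (Cc \<G> s *v X s \<omega> + Dc \<G> s *v u s \<omega> + sigc \<G> s \<omega>) + lower (\<zeta> s \<omega>))
        + Sc \<G> P2 s *v X s \<omega> + Rc \<G> P2 s *v u s \<omega> + rhoc \<G> P2 s \<omega>" for s \<omega>
    unfolding H_def blocks rr_def
    by (simp_all only: upper_add lower_add upper_block_diag_vector lower_block_diag_vector upper_mult_vector
        lower_mult_vector upper_II lower_II matrix_vector_mul_lid
        upper_vstack lower_vstack)
  have opt1: "?J P1 u X
     \<le> ?J P1 (joint v1 ?u2) Y"
    if v1: "v1 \<in> L2F M F t T" and Y: "is_state M F W T \<G> t x (joint v1 ?u2) Y" for v1 Y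
  proof -
    define w where "w s \<omega> = v1 s \<omega> - upper (u s \<omega>)" for s \<omega>
    have wL: "w \<in> L2F M F t T" unfolding w_def by (rule L2F_diff[OF v1 uL])
    \<comment> \<open>the deviation of player 1 changes the upper control block only\<close>
    have weq: "joint v1 ?u2 s \<omega> - u s \<omega> = vstack (w s \<omega>) 0" for s \<omega>
      by (auto simp: joint_def w_def vec_eq_iff vstack_def upper_def lower_def split: sum.split)
    have YC: "Y \<in> L2F_C M F t T" and Yx: "AE \<omega> in M. Y t \<omega> = x"
      and Yd: "has_ito_differential M F W t T Y (\<lambda>s \<omega>. Ac \<G> s *v Y s \<omega> + Bc \<G> s *v joint v1 ?u2 s \<omega> + bc \<G> s \<omega>)
        (\<lambda>s \<omega>. Cc \<G> s *v Y s \<omega> + Dc \<G> s *v joint v1 ?u2 s \<omega> + sigc \<G> s \<omega>)"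
      using Y unfolding is_state_def by blast+
    show ?thesis
    proof (rule player_optimality[OF A B bb C D \<sigma> Q Qs S R Rs q \<rho> g G, where P = "\<lambda>s. upper (P s)" and P' =
        "\<lambda>s. - upper (riccati_rhs \<G> P s)"
          and Lf = "\<lambda>s. upper (left_factor \<G> P s)" and \<Theta> = \<Theta> and \<eta> = "\<lambda>s \<omega>. upper (\<eta> s \<omega>)" and \<zeta> = "\<lambda>s \<omega>. upper (\<zeta> s \<omega>)"
          and v = v and drv = "\<lambda>s \<omega>. upper (bsde_driver \<G> P \<eta> \<zeta> s \<omega>)"])
      show "primitive_on t T (\<lambda>s. upper (P s) $ i $ j) (\<lambda>s. (- upper (riccati_rhs \<G> P s)) $ i $ j)" for i j
        using Pprim[of "Inl i" j] by simp
      show "continuous_on {t..T} (\<lambda>s. upper (P s))"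
        by (rule bounded_linear.continuous_on[OF bounded_linear_upper Pcont])
      show "upper (P T) = Gc \<G> P1" by (simp add: PT GG_def upper_block_diag)
      show "upper (left_factor \<G> P s) = upper (P s) ** Bc \<G> s + transpose (Cc \<G> s) ** upper (P s) ** Dc \<G> s +
          transpose (Sc \<G> P1 s)" for s
        unfolding left_factor_def blocks
        by (simp add: upper_add upper_mult_matrix upper_block_diag_matrix upper_block_diag)
      show "- upper (riccati_rhs \<G> P s) = - (upper (P s) ** Ac \<G> s + transpose (Ac \<G> s) ** upper (P s)
          + transpose (Cc \<G> s) ** upper (P s) ** Cc \<G> s + Qc \<G> P1 s + upper (left_factor \<G> P s) ** \<Theta> s)" for s
        unfolding riccati_rhs_eq blocks \<open>\<Theta> = _\<close>
        by (simp add: upper_add upper_mult_matrix upper_block_diag_matrix upper_block_diag)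
      show "(\<lambda>s \<omega>. upper (\<eta> s \<omega>)) \<in> L2F_C M F t T" by (rule L2F_C_linear[OF \<eta> bounded_linear_upper])
      show "AE \<omega> in M. upper (\<eta> T \<omega>) = gc \<G> P1 \<omega>" using \<eta>T by eventually_elim (simp add: gg_def)
      show "(\<lambda>s \<omega>. upper (\<zeta> s \<omega>)) \<in> L2F M F t T" by (rule L2F_linear[OF \<zeta> bounded_linear_upper])
      show "upper (bsde_driver \<G> P \<eta> \<zeta> s \<omega>) = transpose (Ac \<G> s) *v upper (\<eta> s \<omega>) + transpose (Cc \<G> s) *v upper (\<zeta> s \<omega>)
        + transpose (Cc \<G> s) *v (upper (P s) *v sigc \<G> s \<omega>) + upper (P s) *v bc \<G> s \<omega> + qc \<G> P1 s \<omega> + upper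
            (left_factor \<G> P s) *v v s \<omega>" for s \<omega>
        unfolding bsde_driver_eq blocks qq_def \<open>v = _\<close>
        by (simp add: upper_add upper_mult_vector upper_block_diag_vector)
      show "has_ito_differential M F W t T (\<lambda>s \<omega>. upper (\<eta> s \<omega>)) (\<lambda>s \<omega>. - upper (bsde_driver \<G> P \<eta> \<zeta> s \<omega>))
          (\<lambda>s \<omega>. upper (\<zeta> s \<omega>))"
        using has_ito_differential_linear[OF bsde bounded_linear_upper] by (simp add: upper_minus)
      show "AE \<omega> in M. Y t \<omega> = X t \<omega>" using Yx \<open>AE \<omega> in M. X t \<omega> = x\<close> by eventually_elim simp
      show "AE s in L. \<forall>\<omega>\<in>space M. (transpose (Bc \<G> s) *v (upper (P s) *v X s \<omega> + upper (\<eta> s \<omega>))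
        + transpose (Dc \<G> s) *v (upper (P s) *v (Cc \<G> s *v X s \<omega> + Dc \<G> s *v u s \<omega> + sigc \<G> s \<omega>) + upper (\<zeta> s \<omega>))
        + Sc \<G> P1 s *v X s \<omega> + Rc \<G> P1 s *v u s \<omega> + rhoc \<G> P1 s \<omega>) \<bullet> (joint v1 ?u2 s \<omega> - u s \<omega>) = 0"
        using Hzero unfolding H1[symmetric] weq inner_vstack by eventually_elim simp
      show "0 \<le> (LINT \<omega>|M. (LINT s:{t..T}|lborel. (Qc \<G> P1 s *v N s \<omega>) \<bullet> N s \<omega> + 2 * ((Sc \<G> P1 s *v N s \<omega>) \<bullet>
          (joint v1 ?u2 s \<omega> - u s \<omega>))
             + (Rc \<G> P1 s *v (joint v1 ?u2 s \<omega> - u s \<omega>)) \<bullet> (joint v1 ?u2 s \<omega> - u s \<omega>)) + (Gc \<G> P1 *v N T \<omega>) \<bullet> N T \<omega>)"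
        if "N \<in> L2F_C M F t T" "AE \<omega> in M. N t \<omega> = 0"
          "has_ito_differential M F W t T N (\<lambda>s \<omega>. Ac \<G> s *v N s \<omega> + Bc \<G> s *v (joint v1 ?u2 s \<omega> - u s \<omega>))
              (\<lambda>s \<omega>. Cc \<G> s *v N s \<omega> + Dc \<G> s *v (joint v1 ?u2 s \<omega> - u s \<omega>))" for N
        using convex1[unfolded convexity_condition_def, rule_format, OF wL that(1)] that(2,3)
        unfolding weq left_cols_vector inner_vstack
        by (simp add: upper_mult_vector)
    qed (rule XC Xd YC Yd u v ueq jointL[OF v1 lL])+
  qed
  have opt2: "?J P2 u X
     \<le> ?J P2 (joint ?u1 v2) Y"
    if v2: "v2 \<in> L2F M F t T" and Y: "is_state M F W T \<G> t x (joint ?u1 v2) Y" for v2 Y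
  proof -
    define w where "w s \<omega> = v2 s \<omega> - lower (u s \<omega>)" for s \<omega>
    have wL: "w \<in> L2F M F t T" unfolding w_def by (rule L2F_diff[OF v2 lL])
    \<comment> \<open>the deviation of player 2 changes the lower control block only\<close>
    have weq: "joint ?u1 v2 s \<omega> - u s \<omega> = vstack 0 (w s \<omega>)" for s \<omega>
      by (auto simp: joint_def w_def vec_eq_iff vstack_def lower_def upper_def split: sum.split)
    have YC: "Y \<in> L2F_C M F t T" and Yx: "AE \<omega> in M. Y t \<omega> = x"
      and Yd: "has_ito_differential M F W t T Y (\<lambda>s \<omega>. Ac \<G> s *v Y s \<omega> + Bc \<G> s *v joint ?u1 v2 s \<omega> + bc \<G> s \<omega>)
        (\<lambda>s \<omega>. Cc \<G> s *v Y s \<omega> + Dc \<G> s *v joint ?u1 v2 s \<omega> + sigc \<G> s \<omega>)"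
      using Y unfolding is_state_def by blast+
    show ?thesis
    proof (rule player_optimality[OF A B bb C D \<sigma> Q Qs S R Rs q \<rho> g G, where P = "\<lambda>s. lower (P s)" and P' =
        "\<lambda>s. - lower (riccati_rhs \<G> P s)"
          and Lf = "\<lambda>s. lower (left_factor \<G> P s)" and \<Theta> = \<Theta> and \<eta> = "\<lambda>s \<omega>. lower (\<eta> s \<omega>)" and \<zeta> = "\<lambda>s \<omega>. lower (\<zeta> s \<omega>)"
          and v = v and drv = "\<lambda>s \<omega>. lower (bsde_driver \<G> P \<eta> \<zeta> s \<omega>)"])
      show "primitive_on t T (\<lambda>s. lower (P s) $ i $ j) (\<lambda>s. (- lower (riccati_rhs \<G> P s)) $ i $ j)" for i j
        using Pprim[of "Inr i" j] by simp
      show "continuous_on {t..T} (\<lambda>s. lower (P s))"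
        by (rule bounded_linear.continuous_on[OF bounded_linear_lower Pcont])
      show "lower (P T) = Gc \<G> P2" by (simp add: PT GG_def lower_block_diag)
      show "lower (left_factor \<G> P s) = lower (P s) ** Bc \<G> s + transpose (Cc \<G> s) ** lower (P s) ** Dc \<G> s +
          transpose (Sc \<G> P2 s)" for s
        unfolding left_factor_def blocks
        by (simp add: lower_add lower_mult_matrix lower_block_diag_matrix lower_block_diag)
      show "- lower (riccati_rhs \<G> P s) = - (lower (P s) ** Ac \<G> s + transpose (Ac \<G> s) ** lower (P s)
          + transpose (Cc \<G> s) ** lower (P s) ** Cc \<G> s + Qc \<G> P2 s + lower (left_factor \<G> P s) ** \<Theta> s)" for s
        unfolding riccati_rhs_eq blocks \<open>\<Theta> = _\<close>
        by (simp add: lower_add lower_mult_matrix lower_block_diag_matrix lower_block_diag)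
      show "(\<lambda>s \<omega>. lower (\<eta> s \<omega>)) \<in> L2F_C M F t T" by (rule L2F_C_linear[OF \<eta> bounded_linear_lower])
      show "AE \<omega> in M. lower (\<eta> T \<omega>) = gc \<G> P2 \<omega>" using \<eta>T by eventually_elim (simp add: gg_def)
      show "(\<lambda>s \<omega>. lower (\<zeta> s \<omega>)) \<in> L2F M F t T" by (rule L2F_linear[OF \<zeta> bounded_linear_lower])
      show "lower (bsde_driver \<G> P \<eta> \<zeta> s \<omega>) = transpose (Ac \<G> s) *v lower (\<eta> s \<omega>) + transpose (Cc \<G> s) *v lower (\<zeta> s \<omega>)
        + transpose (Cc \<G> s) *v (lower (P s) *v sigc \<G> s \<omega>) + lower (P s) *v bc \<G> s \<omega> + qc \<G> P2 s \<omega> + lower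
            (left_factor \<G> P s) *v v s \<omega>" for s \<omega>
        unfolding bsde_driver_eq blocks qq_def \<open>v = _\<close>
        by (simp add: lower_add lower_mult_vector lower_block_diag_vector)
      show "has_ito_differential M F W t T (\<lambda>s \<omega>. lower (\<eta> s \<omega>)) (\<lambda>s \<omega>. - lower (bsde_driver \<G> P \<eta> \<zeta> s \<omega>))
          (\<lambda>s \<omega>. lower (\<zeta> s \<omega>))"
        using has_ito_differential_linear[OF bsde bounded_linear_lower] by (simp add: lower_minus)
      show "AE \<omega> in M. Y t \<omega> = X t \<omega>" using Yx \<open>AE \<omega> in M. X t \<omega> = x\<close> by eventually_elim simp
      show "AE s in L. \<forall>\<omega>\<in>space M. (transpose (Bc \<G> s) *v (lower (P s) *v X s \<omega> + lower (\<eta> s \<omega>))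
        + transpose (Dc \<G> s) *v (lower (P s) *v (Cc \<G> s *v X s \<omega> + Dc \<G> s *v u s \<omega> + sigc \<G> s \<omega>) + lower (\<zeta> s \<omega>))
        + Sc \<G> P2 s *v X s \<omega> + Rc \<G> P2 s *v u s \<omega> + rhoc \<G> P2 s \<omega>) \<bullet> (joint ?u1 v2 s \<omega> - u s \<omega>) = 0"
        using Hzero unfolding H2[symmetric] weq inner_vstack by eventually_elim simp
      show "0 \<le> (LINT \<omega>|M. (LINT s:{t..T}|lborel. (Qc \<G> P2 s *v N s \<omega>) \<bullet> N s \<omega> + 2 * ((Sc \<G> P2 s *v N s \<omega>) \<bullet>
          (joint ?u1 v2 s \<omega> - u s \<omega>))
             + (Rc \<G> P2 s *v (joint ?u1 v2 s \<omega> - u s \<omega>)) \<bullet> (joint ?u1 v2 s \<omega> - u s \<omega>)) + (Gc \<G> P2 *v N T \<omega>) \<bullet> N T \<omega>)"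
        if "N \<in> L2F_C M F t T" "AE \<omega> in M. N t \<omega> = 0"
          "has_ito_differential M F W t T N (\<lambda>s \<omega>. Ac \<G> s *v N s \<omega> + Bc \<G> s *v (joint ?u1 v2 s \<omega> - u s \<omega>))
              (\<lambda>s \<omega>. Cc \<G> s *v N s \<omega> + Dc \<G> s *v (joint ?u1 v2 s \<omega> - u s \<omega>))" for N
        using convex2[unfolded convexity_condition_def, rule_format, OF wL that(1)] that(2,3)
        unfolding weq right_cols_vector inner_vstack
        by (simp add: lower_mult_vector)
    qed (rule XC Xd YC Yd u v ueq jointL[OF uL v2])+
  qed

  show ?thesis
    unfolding open_loop_nash_def ju
  proof (intro conjI uL lL exI[of _ X] Xstate allI impI ballI)
    fix X' v1 Y assume "is_state M F W T \<G> t x u X'" "v1 \<in> L2F M F t T" "is_state M F W T \<G> t x (joint v1 ?u2) Y"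
    then show "cost M T \<G> P1 t u X' \<le> cost M T \<G> P1 t (joint v1 ?u2) Y"
      using opt1 version unfolding cost_eq by metis
  next
    fix X' v2 Y assume "is_state M F W T \<G> t x u X'" "v2 \<in> L2F M F t T" "is_state M F W T \<G> t x (joint ?u1 v2) Y"
    then show "cost M T \<G> P2 t u X' \<le> cost M T \<G> P2 t (joint ?u1 v2) Y"
      using opt2 version unfolding cost_eq by metis
  qed
qed

end
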